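(* There is an equality of selfadjoint unbounded operators $$W\,\Gamma\,(D_V\times_\nabla D_{Q_0^2})\,\Gamma\,W^*=D_{\mathbb{S}^4}$$ on $L^2(\mathcal{E}_{\mathbb{S}^4})\cong L^2(\mathbb{S}^4_0)\otimes\mathbb{C}^4$.
   Context: **Sphere and torus action.** Parametrize the round sphere $\mathbb{S}^4\subset\mathbb{C}^2\times\mathbb{R}$ by $a=e^{i\theta_1}\cos\varphi\cos\psi$, $b=e^{i\theta_2}\sin\varphi\cos\psi$, $x=\sin\psi$ ($0\le\theta_1,\theta_2<2\pi$, $0\le\varphi\le\pi/2$, $-\pi/2\le\psi\le\pi/2$), with metric $\cos^2\varphi\cos^2\psi\,d\theta_1^2+\sin^2\varphi\cos^2\psi\,d\theta_2^2+\cos^2\psi\,d\varphi^2+d\psi^2$. $\mathbb{T}^2$ acts by $(t_1,t_2)\cdot(a,b,x)=(t_1a,t_2b,x)$. Put $\mathbb{S}^4_0=\{a\ne0,b\ne0\}$; its quotient by $\mathbb{T}^2$ is the open quadrant $Q_0^2=\{(\cos\varphi\cos\psi,\sin\varphi\cos\psi,\sin\psi):0<\varphi<\pi/2,-\pi/2<\psi<\pi/2\}$ of $\mathbb{S}^2$ with metric $\cos^2\psi\,d\varphi^2+d\psi^2$. Let $q:\mathbb{S}^4_0\to Q_0^2$ be the quotient map. **The Dirac operator on $\mathbb{S}^4$.** $D_{\mathbb{S}^4}$ is the closed (selfadjoint) Dirac operator on the Hilbert space $L^2(\mathcal{E}_{\mathbb{S}^4})$ of $L^2$-spinors. As the paper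 does, the spinor bundle restricted to $\mathbb{S}^4_0$ is identified with the trivial bundle $\mathbb{S}^4_0\times\mathbb{C}^4$, so $L^2(\mathcal{E}_{\mathbb{S}^4})\cong L^2(\mathbb{S}^4_0)\otimes\mathbb{C}^4$ ($\mathbb{S}^4\setminus\mathbb{S}^4_0$ has measure zero; $L^2$ with respect to the Riemannian volume); under this identification the lift of the torus action to spinors is translation of functions tensored with the identity on $\mathbb{C}^4$, and on $C_c^\infty(\mathbb{S}^4_0)\otimes\mathbb{C}^4$ (a core for $D_{\mathbb{S}^4}$) $$D_{\mathbb{S}^4}=\tfrac{i}{\cos\varphi\cos\psi}\gamma^1\tfrac{\partial}{\partial\theta_1}+\tfrac{i}{\sin\varphi\cos\psi}\gamma^2\tfrac{\partial}{\partial\theta_2}+\tfrac{i}{\cos\psi}\gamma^3\big(\tfrac{\partial}{\partial\varphi}+\tfrac12\cot\varphi-\tfrac12\tan\varphi\big)+i\gamma^4\big(\tfrac{\partial}{\partial\psi}-\tfrac32\tan\psi\big),$$ where $\gamma^1=\begin{pmatrix}0&1&0&0\\1&0&0&0\\0&0&0&-1\\0&0&-1&0\end{pmatrix}$, $\gamma^2=\begin{pmatrix}0&-i&0&0\\i&0&0&0\\0&0&0&i\\0&0&-i&0\end{pmatrix}$, $\gamma^3=\begin{pmatrix}0&0&1&0\\0&0&0&1\\1&0&0&0\\0&1&0&0\end{pmatrix}$, $\gamma^4=\begin{pmatrix}0&0&-i&0\\0&0&0&-i\\i&0&0&0\\0&i&0&0\end{pmatrix}$. **Vertical data.** $\mathcal{X}=C_c^\infty(\mathbb{S}^4_0)\otimes\mathbb{C}^2$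 is a right $C_c^\infty(Q_0^2)$-module via $q^*$; $X$ is its completion to a Hilbert $C^*$-module over $C_0(Q_0^2)$ for $$\langle\xi,\eta\rangle_X(\cos\varphi\cos\psi,\sin\varphi\cos\psi,\sin\psi)=\int_{\mathbb{T}^2}(\xi^*\eta)\big(t_1^{-1}\cos\varphi\cos\psi,t_2^{-1}\sin\varphi\cos\psi,\sin\psi\big)dt\cdot\sin\varphi\cos\varphi\cos^2\psi,$$ with $dt=d\theta_1d\theta_2$. Grading: $\gamma_X=\mathrm{diag}(1,-1)$. With Pauli matrices $\sigma^1=\begin{pmatrix}0&1\\1&0\end{pmatrix}$, $\sigma^2=\begin{pmatrix}0&-i\\i&0\end{pmatrix}$, $D_V$ is the closure of $\mathcal{D}_V=\frac{i}{\cos\varphi\cos\psi}\sigma^1\frac{\partial}{\partial\theta_1}+\frac{i}{\sin\varphi\cos\psi}\sigma^2\frac{\partial}{\partial\theta_2}:\mathcal{X}\to X$. **Horizontal data.** $\mathcal{D}_{Q_0^2}=\frac{i}{\cos\psi}\sigma^1\frac{\partial}{\partial\varphi}+i\sigma^2\big(\frac{\partial}{\partial\psi}-\frac12\tan\psi\big):C_c^\infty(Q_0^2)\otimes\mathbb{C}^2\to L^2(Q_0^2)\otimes\mathbb{C}^2$ (Riemannian measure $\cos\psi\,d\varphi\,d\psi$), with closure $D_{Q_0^2}$ and grading $\gamma_{Q_0^2}=\mathrm{diag}(1,-1)$. **Tensor sum.** The connection is $\nabla_{\partial/\partial\varphi}=\frac{\partial}{\partial\varphi}+\frac12\cot\varphi-\frac12\tan\varphi$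 and $\nabla_{\partial/\partial\psi}=\frac{\partial}{\partial\psi}-\tan\psi$, as maps $\mathcal{X}\to X$. On $\mathcal{X}\otimes_{C_c^\infty(Q_0^2)}(C_c^\infty(Q_0^2)\otimes\mathbb{C}^2)$ put $(\mathcal{D}_V\otimes1)(\xi\otimes\eta)=\mathcal{D}_V(\xi)\otimes\eta$ and $$(1\otimes_\nabla\mathcal{D}_{Q_0^2})(\xi\otimes\eta)=\xi\otimes\mathcal{D}_{Q_0^2}(\eta)+\nabla_{\partial/\partial\varphi}(\xi)\cdot\tfrac{1}{\cos\psi}\otimes i\sigma^1\eta+\nabla_{\partial/\partial\psi}(\xi)\otimes i\sigma^2\eta.$$ $D_V\times_\nabla D_{Q_0^2}$ is the closure, on $X\hat\otimes_{C_0(Q_0^2)}(L^2(Q_0^2)\otimes\mathbb{C}^2)$, of the symmetric operator $\mathcal{D}_V\otimes1+(\gamma_X\otimes1)(1\otimes_\nabla\mathcal{D}_{Q_0^2})$. **The unitaries.** $W:X\hat\otimes_{C_0(Q_0^2)}(L^2(Q_0^2)\otimes\mathbb{C}^2)\to L^2(\mathbb{S}^4_0)\otimes\mathbb{C}^4$ is the unitary extending $(f\otimes\lambda)\otimes(h\otimes\mu)\mapsto f\cdot(h\circ q)\otimes\begin{pmatrix}\lambda\mu_1\\\lambda\mu_2\end{pmatrix}$, for $f\in C_c^\infty(\mathbb{S}^4_0)$, $h\in C_c^\infty(Q_0^2)$, $\lambda\in\mathbb{C}^2$, $\mu=(\mu_1,\mu_2)\in\mathbb{C}^2$. With $\gamma=\gamma_X\hat\otimes\gamma_{Q_0^2}$,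 $\Gamma$ is the even selfadjoint unitary $\Gamma=(\gamma_X\hat\otimes1)\frac{1+\gamma}{2}+\frac{1-\gamma}{2}$ on $X\hat\otimes_{C_0(Q_0^2)}(L^2(Q_0^2)\otimes\mathbb{C}^2)$.
   Formalization: Proved as equality of closed unbounded operators, domains included; "selfadjoint" is not asserted: on periodic functions the closure from the stated core is symmetric but not selfadjoint (nonzero boundary terms at φ=0 and φ=π/2 on the torus-invariant part). *)

theory Defs
  imports "HOL-Analysis.Analysis" "HOL-Library.Poly_Mapping"
begin

text \<open>
  A semi-inner product space over the complex numbers, given by explicit operations.  The inner
  product, linear in its second argument, takes values in \<open>'b\<close>: \<open>'b = complex\<close> for (pre-)Hilbert
  spaces, and \<open>'b\<close> a type of functions for (pre-)Hilbert modules over an algebra of functions.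
  In either case the seminorm is part of the structure.
\<close>

record ('v, 'b) ip_space =
  carr :: "'v set"
  add :: "'v \<Rightarrow> 'v \<Rightarrow> 'v"
  smult :: "complex \<Rightarrow> 'v \<Rightarrow> 'v"
  ip :: "'v \<Rightarrow> 'v \<Rightarrow> 'b"
  nrm :: "'v \<Rightarrow> real"

definition diff :: "('v, 'b) ip_space \<Rightarrow> 'v \<Rightarrow> 'v \<Rightarrow> 'v" where
  "diff V x y = add V x (smult V (-1) y)"

definition null_rel :: "('v, 'b) ip_space \<Rightarrow> ('v \<times> 'v) set" where
  "null_rel V = {(x, y). x \<in> carr V \<and> y \<in> carr V \<and> nrm V (diff V x y) = 0}"

definition cls :: "('v, 'b) ip_space \<Rightarrow> 'v \<Rightarrow> 'v set" where
  "cls V x = null_rel V `` {x}"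

definition hausdorff :: "('v, 'b) ip_space \<Rightarrow> ('v set, 'b) ip_space" where
  "hausdorff V =
    \<lparr>carr = carr V // null_rel V,
     add = (\<lambda>A B. \<Union>x\<in>A. \<Union>y\<in>B. cls V (add V x y)),
     smult = (\<lambda>c A. \<Union>x\<in>A. cls V (smult V c x)),
     ip = (\<lambda>A B. the_elem (\<Union>x\<in>A. \<Union>y\<in>B. {ip V x y})),
     nrm = (\<lambda>A. the_elem (nrm V ` A))\<rparr>"

definition lift_map :: "('v, 'b) ip_space \<Rightarrow> ('v \<Rightarrow> 'v) \<Rightarrow> 'v set \<Rightarrow> 'v set" where
  "lift_map V f A = (\<Union>x\<in>A. cls V (f x))"

text \<open>
  For function-valued inner products the limit below is a pointwise one (the topology on functions
  is the product topology); for Cauchy sequences in a Hilbert module over \<open>C\<^sub>0(Q)\<close> the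
  inner products converge uniformly, so that this is the limit in \<open>C\<^sub>0(Q)\<close>.
\<close>

definition cauchy_seqs ::
    "('v, 'b::topological_space) ip_space \<Rightarrow> (nat \<Rightarrow> 'v, 'b) ip_space" where
  "cauchy_seqs V =
    \<lparr>carr = {s. (\<forall>n. s n \<in> carr V) \<and>
                (\<forall>e>0. \<exists>N. \<forall>m\<ge>N. \<forall>n\<ge>N. nrm V (diff V (s m) (s n)) < e)},
     add = (\<lambda>s t n. add V (s n) (t n)),
     smult = (\<lambda>c s n. smult V c (s n)),
     ip = (\<lambda>s t. THE z. (\<lambda>n. ip V (s n) (t n)) \<longlonglongrightarrow> z),
     nrm = (\<lambda>s. lim (\<lambda>n. nrm V (s n)))\<rparr>"

definition completion ::
    "('v, 'b::topological_space) ip_space \<Rightarrow> ((nat \<Rightarrow> 'v) set, 'b) ip_space" where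
  "completion V = hausdorff (cauchy_seqs V)"

definition embed :: "('v, 'b::topological_space) ip_space \<Rightarrow> 'v \<Rightarrow> (nat \<Rightarrow> 'v) set" where
  "embed V x = cls (cauchy_seqs V) (\<lambda>_. x)"

text \<open>
  \<open>X\<close> is a Hilbert module over an algebra of functions which acts on the Hilbert space \<open>H\<close> by
  \<open>act\<close>.  The interior tensor product is the separated completion of the vector space
  freely generated by the pairs in \<open>X \<times> H\<close>, for the semi-inner product with
  \<open>\<langle>\<xi> \<otimes> \<eta>, \<xi>' \<otimes> \<eta>'\<rangle> = \<langle>\<eta>, \<langle>\<xi>, \<xi>'\<rangle> \<eta>'\<rangle>\<close>.  Bilinearity and balancedness of
  the tensor product need not be imposed separately: the corresponding differences are null vectors.
\<close>

definition free_tensor ::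
    "('x, 'b) ip_space \<Rightarrow> ('h, complex) ip_space \<Rightarrow> ('b \<Rightarrow> 'h \<Rightarrow> 'h)
      \<Rightarrow> (('x \<times> 'h) \<Rightarrow>\<^sub>0 complex, complex) ip_space" where
  "free_tensor X H act =
    (let form = (\<lambda>z w. \<Sum>(x, h)\<in>Poly_Mapping.keys z. \<Sum>(x', h')\<in>Poly_Mapping.keys w.
           cnj (Poly_Mapping.lookup z (x, h)) * Poly_Mapping.lookup w (x', h') * ip H h (act (ip X x x') h'))
     in \<lparr>carr = {z. Poly_Mapping.keys z \<subseteq> carr X \<times> carr H},
         add = (+),
         smult = (\<lambda>c. Poly_Mapping.map ((*) c)),
         ip = form,
         nrm = (\<lambda>z. sqrt (Re (form z z)))\<rparr>)"

definition interior_tensor where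
  "interior_tensor X H act = completion (free_tensor X H act)"

definition elem_tensor where
  "elem_tensor X H act x h = embed (free_tensor X H act) (Poly_Mapping.single (x, h) 1)"

text \<open>A (possibly unbounded) operator from \<open>V\<close> to \<open>W\<close> is represented by its graph.\<close>

inductive_set lin_span ::
    "('v, 'b) ip_space \<Rightarrow> ('w, 'c) ip_space \<Rightarrow> ('v \<times> 'w) set \<Rightarrow> ('v \<times> 'w) set"
  for V W G where
  base: "p \<in> G \<Longrightarrow> p \<in> lin_span V W G"
| add: "(x, y) \<in> lin_span V W G \<Longrightarrow> (x', y') \<in> lin_span V W G
          \<Longrightarrow> (add V x x', add W y y') \<in> lin_span V W G"
| smult: "(x, y) \<in> lin_span V W G \<Longrightarrow> (smult V c x, smult W c y) \<in> lin_span V W G"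

definition op_closure ::
    "('v, 'b) ip_space \<Rightarrow> ('w, 'c) ip_space \<Rightarrow> ('v \<times> 'w) set \<Rightarrow> ('v \<times> 'w) set" where
  "op_closure V W S = {(x, y). x \<in> carr V \<and> y \<in> carr W \<and>
     (\<exists>u v. (\<forall>n. (u n, v n) \<in> S) \<and>
            (\<lambda>n. nrm V (diff V (u n) x)) \<longlonglongrightarrow> 0 \<and>
            (\<lambda>n. nrm W (diff W (v n) y)) \<longlonglongrightarrow> 0)}"

definition op_add ::
    "('w, 'c) ip_space \<Rightarrow> ('v \<times> 'w) set \<Rightarrow> ('v \<times> 'w) set \<Rightarrow> ('v \<times> 'w) set" where
  "op_add W S T = {(x, add W y z) | x y z. (x, y) \<in> S \<and> (x, z) \<in> T}"

definition op_scale ::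
    "('w, 'c) ip_space \<Rightarrow> complex \<Rightarrow> ('v \<times> 'w) set \<Rightarrow> ('v \<times> 'w) set" where
  "op_scale W c S = {(x, smult W c y) | x y. (x, y) \<in> S}"

text \<open>Composition in the order of operators: \<open>S \<circ>\<^sub>g T\<close> applies \<open>T\<close> first.\<close>

definition op_comp ::
    "('v \<times> 'w) set \<Rightarrow> ('u \<times> 'v) set \<Rightarrow> ('u \<times> 'w) set" (infixr \<open>\<circ>\<^sub>g\<close> 75) where
  "S \<circ>\<^sub>g T = T O S"

definition op_adjoint ::
    "('v, complex) ip_space \<Rightarrow> ('w, complex) ip_space \<Rightarrow> ('v \<times> 'w) set \<Rightarrow> ('w \<times> 'v) set" where
  "op_adjoint V W S = {(y, x). y \<in> carr W \<and> x \<in> carr V \<and>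
     (\<forall>(u, v)\<in>S. ip W v y = ip V u x)}"

definition is_unitary ::
    "('v, complex) ip_space \<Rightarrow> ('w, complex) ip_space \<Rightarrow> ('v \<times> 'w) set \<Rightarrow> bool" where
  "is_unitary V W U \<longleftrightarrow>
     single_valued U \<and> Domain U = carr V \<and> Range U = carr W \<and> lin_span V W U = U \<and>
     (\<forall>(x, y)\<in>U. \<forall>(x', y')\<in>U. ip W y y' = ip V x x')"

text \<open>
  The interior tensor product \<open>A \<otimes> B\<close> of everywhere defined maps, extended by linearity and
  continuity.
\<close>

definition tensor_op where
  "tensor_op X H act A B =
    (let T = interior_tensor X H act; t = elem_tensor X H act
     in op_closure T T (lin_span T T {(t x h, t (A x) (B h)) | x h. x \<in> carr X \<and> h \<in> carr H}))"

definition cip :: "complex^'n \<Rightarrow> complex^'n \<Rightarrow> complex" where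
  "cip u v = (\<Sum>i\<in>UNIV. cnj (u $ i) * v $ i)"

definition sq_int :: "'a measure \<Rightarrow> ('a \<Rightarrow> complex^'n, complex) ip_space" where
  "sq_int M =
    \<lparr>carr = {f \<in> borel_measurable M. integrable M (\<lambda>x. (norm (f x))\<^sup>2)},
     add = (\<lambda>f g x. f x + g x),
     smult = (\<lambda>c f x. c *s f x),
     ip = (\<lambda>f g. LINT x|M. cip (f x) (g x)),
     nrm = (\<lambda>f. sqrt (LINT x|M. (norm (f x))\<^sup>2))\<rparr>"

definition L2 :: "'a measure \<Rightarrow> (('a \<Rightarrow> complex^'n) set, complex) ip_space" where
  "L2 M = hausdorff (sq_int M)"

definition L2_mult ::
    "'a measure \<Rightarrow> ('a \<Rightarrow> complex) \<Rightarrow> ('a \<Rightarrow> complex^'n) set \<Rightarrow> ('a \<Rightarrow> complex^'n) set" where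
  "L2_mult M a = lift_map (sq_int M) (\<lambda>f x. a x *s f x)"

type_synonym pt4 = "complex \<times> complex \<times> real"
type_synonym pt2 = "real \<times> real \<times> real"

definition rect :: "(real \<times> real) set" where
  "rect = {0<..<pi/2} \<times> {-pi/2<..<pi/2}"

definition S4_0 :: "pt4 set" where
  "S4_0 = {(a, b, x). (norm a)\<^sup>2 + (norm b)\<^sup>2 + x\<^sup>2 = 1 \<and> a \<noteq> 0 \<and> b \<noteq> 0}"

definition sph4 :: "real \<times> real \<times> real \<times> real \<Rightarrow> pt4" where
  "sph4 = (\<lambda>(t1, t2, ph, ps). (cis t1 * of_real (cos ph * cos ps),
                              cis t2 * of_real (sin ph * cos ps), sin ps))"

definition chart4 :: "pt4 \<Rightarrow> real \<times> real \<times> real \<times> real" where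
  "chart4 = the_inv_into ({0..<2*pi} \<times> {0..<2*pi} \<times> rect) sph4"

definition sph2 :: "real \<times> real \<Rightarrow> pt2" where
  "sph2 = (\<lambda>(ph, ps). (cos ph * cos ps, sin ph * cos ps, sin ps))"

definition Q2_0 :: "pt2 set" where
  "Q2_0 = sph2 ` rect"

definition chart2 :: "pt2 \<Rightarrow> real \<times> real" where
  "chart2 = the_inv_into rect sph2"

text \<open>The orbit of \<open>(a, b, x)\<close> is identified with the point of the quadrant it contains.\<close>

definition quot :: "pt4 \<Rightarrow> pt2" where
  "quot = (\<lambda>(a, b, x). (norm a, norm b, x))"

text \<open>
  The Riemannian measures.  The metrics are diagonal in the coordinates, so the densities are the
  products of the lengths of the coordinate vector fields.
\<close>

definition vol4 :: "pt4 measure" where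
  "vol4 = distr (density (restrict_space lborel ({0..<2*pi} \<times> {0..<2*pi} \<times> rect))
             (\<lambda>(t1, t2, ph, ps). ennreal ((cos ph * cos ps) * (sin ph * cos ps) * cos ps)))
           (restrict_space borel S4_0) sph4"

definition vol2 :: "pt2 measure" where
  "vol2 = distr (density (restrict_space lborel rect) (\<lambda>(ph, ps). ennreal (cos ps)))
           (restrict_space borel Q2_0) sph2"

primrec Ck_on :: "nat \<Rightarrow> 'a::real_normed_vector set \<Rightarrow> ('a \<Rightarrow> 'b::real_normed_vector) \<Rightarrow> bool" where
  "Ck_on 0 U f \<longleftrightarrow> continuous_on U f"
| "Ck_on (Suc k) U f \<longleftrightarrow> (\<forall>x\<in>U. f differentiable (at x)) \<and>
     (\<forall>v. Ck_on k U (\<lambda>x. frechet_derivative f (at x) v))"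

definition smooth_on :: "'a::real_normed_vector set \<Rightarrow> ('a \<Rightarrow> 'b::real_normed_vector) \<Rightarrow> bool" where
  "smooth_on U f \<longleftrightarrow> (\<forall>k. Ck_on k U f)"

text \<open>
  Compactly supported smooth functions are extended by zero to the ambient space.  The map
  \<open>sph4\<close> restricts to a smooth covering of \<open>S4_0\<close> by \<open>\<real> \<times> \<real> \<times> rect\<close>, so smoothness can be
  tested after pulling back along it.
\<close>

definition Cc4 :: "(pt4 \<Rightarrow> 'b::real_normed_vector) set" where
  "Cc4 = {f. smooth_on (UNIV \<times> UNIV \<times> rect) (f \<circ> sph4) \<and>
             (\<exists>K. compact K \<and> K \<subseteq> S4_0 \<and> (\<forall>p. p \<notin> K \<longrightarrow> f p = 0))}"

definition Cc2 :: "(pt2 \<Rightarrow> 'b::real_normed_vector) set" where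
  "Cc2 = {f. smooth_on rect (f \<circ> sph2) \<and>
             (\<exists>K. compact K \<and> K \<subseteq> Q2_0 \<and> (\<forall>p. p \<notin> K \<longrightarrow> f p = 0))}"

definition d_t1 :: "(pt4 \<Rightarrow> complex^'n) \<Rightarrow> pt4 \<Rightarrow> complex^'n" where
  "d_t1 f p = (if p \<in> S4_0 then let (t1, t2, ph, ps) = chart4 p in
     vector_derivative (\<lambda>s. f (sph4 (s, t2, ph, ps))) (at t1) else 0)"

definition d_t2 :: "(pt4 \<Rightarrow> complex^'n) \<Rightarrow> pt4 \<Rightarrow> complex^'n" where
  "d_t2 f p = (if p \<in> S4_0 then let (t1, t2, ph, ps) = chart4 p in
     vector_derivative (\<lambda>s. f (sph4 (t1, s, ph, ps))) (at t2) else 0)"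

definition d_ph :: "(pt4 \<Rightarrow> complex^'n) \<Rightarrow> pt4 \<Rightarrow> complex^'n" where
  "d_ph f p = (if p \<in> S4_0 then let (t1, t2, ph, ps) = chart4 p in
     vector_derivative (\<lambda>s. f (sph4 (t1, t2, s, ps))) (at ph) else 0)"

definition d_ps :: "(pt4 \<Rightarrow> complex^'n) \<Rightarrow> pt4 \<Rightarrow> complex^'n" where
  "d_ps f p = (if p \<in> S4_0 then let (t1, t2, ph, ps) = chart4 p in
     vector_derivative (\<lambda>s. f (sph4 (t1, t2, ph, s))) (at ps) else 0)"

definition q_ph :: "(pt2 \<Rightarrow> complex^'n) \<Rightarrow> pt2 \<Rightarrow> complex^'n" where
  "q_ph h y = (if y \<in> Q2_0 then let (ph, ps) = chart2 y in
     vector_derivative (\<lambda>s. h (sph2 (s, ps))) (at ph) else 0)"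

definition q_ps :: "(pt2 \<Rightarrow> complex^'n) \<Rightarrow> pt2 \<Rightarrow> complex^'n" where
  "q_ps h y = (if y \<in> Q2_0 then let (ph, ps) = chart2 y in
     vector_derivative (\<lambda>s. h (sph2 (ph, s))) (at ps) else 0)"

definition gamma1 :: "complex^4^4" where
  "gamma1 = vector [vector [0, 1, 0, 0], vector [1, 0, 0, 0],
                    vector [0, 0, 0, -1], vector [0, 0, -1, 0]]"

definition gamma2 :: "complex^4^4" where
  "gamma2 = vector [vector [0, -\<i>, 0, 0], vector [\<i>, 0, 0, 0],
                    vector [0, 0, 0, \<i>], vector [0, 0, -\<i>, 0]]"

definition gamma3 :: "complex^4^4" where
  "gamma3 = vector [vector [0, 0, 1, 0], vector [0, 0, 0, 1],
                    vector [1, 0, 0, 0], vector [0, 1, 0, 0]]"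

definition gamma4 :: "complex^4^4" where
  "gamma4 = vector [vector [0, 0, -\<i>, 0], vector [0, 0, 0, -\<i>],
                    vector [\<i>, 0, 0, 0], vector [0, \<i>, 0, 0]]"

definition Dirac4_symb :: "(pt4 \<Rightarrow> complex^4) \<Rightarrow> pt4 \<Rightarrow> complex^4" where
  "Dirac4_symb f p = (let (t1, t2, ph, ps) = chart4 p in
     (\<i> / of_real (cos ph * cos ps)) *s (gamma1 *v d_t1 f p) +
     (\<i> / of_real (sin ph * cos ps)) *s (gamma2 *v d_t2 f p) +
     (\<i> / of_real (cos ps)) *s
       (gamma3 *v (d_ph f p + of_real (cot ph / 2 - tan ph / 2) *s f p)) +
     \<i> *s (gamma4 *v (d_ps f p - of_real (3 / 2 * tan ps) *s f p)))"

definition L2_S4 :: "((pt4 \<Rightarrow> complex^4) set, complex) ip_space" where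
  "L2_S4 = L2 vol4"

text \<open>
  The compactly supported smooth sections over \<open>S4_0\<close>, in the given trivialization of the spinor
  bundle, are a core: the operator is the closure of its restriction to them.
  Their coefficients are genuine functions on \<open>S4_0\<close>, i.e. \<open>2\<pi>\<close>-periodic in both angles.
  Selfadjointness is not built into this definition.
\<close>

definition Dirac_S4 :: "((pt4 \<Rightarrow> complex^4) set \<times> (pt4 \<Rightarrow> complex^4) set) set" where
  "Dirac_S4 = op_closure L2_S4 L2_S4
     {(cls (sq_int vol4) f, cls (sq_int vol4) (Dirac4_symb f)) | f. f \<in> Cc4}"

definition sigma1 :: "complex^2^2" where
  "sigma1 = vector [vector [0, 1], vector [1, 0]]"

definition sigma2 :: "complex^2^2" where
  "sigma2 = vector [vector [0, -\<i>], vector [\<i>, 0]]"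

definition grading2 :: "complex^2^2" where
  "grading2 = vector [vector [1, 0], vector [0, -1]]"

definition X_ip :: "(pt4 \<Rightarrow> complex^2) \<Rightarrow> (pt4 \<Rightarrow> complex^2) \<Rightarrow> pt2 \<Rightarrow> complex" where
  "X_ip \<xi> \<eta> y = (if y \<in> Q2_0 then let (ph, ps) = chart2 y in
     (LINT t:{0..2*pi} \<times> {0..2*pi}|lborel.
        let p = (inverse (cis (fst t)) * of_real (cos ph * cos ps),
                 inverse (cis (snd t)) * of_real (sin ph * cos ps), sin ps)
        in cip (\<xi> p) (\<eta> p)) * of_real (sin ph * cos ph * (cos ps)\<^sup>2) else 0)"

definition X_pre :: "(pt4 \<Rightarrow> complex^2, pt2 \<Rightarrow> complex) ip_space" where
  "X_pre =
    \<lparr>carr = Cc4,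
     add = (\<lambda>f g p. f p + g p),
     smult = (\<lambda>c f p. c *s f p),
     ip = X_ip,
     nrm = (\<lambda>f. sqrt (SUP y\<in>Q2_0. cmod (X_ip f f y)))\<rparr>"

type_synonym X_elem = "(nat \<Rightarrow> pt4 \<Rightarrow> complex^2) set"

definition X_mod :: "(X_elem, pt2 \<Rightarrow> complex) ip_space" where
  "X_mod = completion X_pre"

definition X_grading :: "X_elem \<Rightarrow> X_elem" where
  "X_grading = lift_map (cauchy_seqs X_pre) (\<lambda>s n p. grading2 *v s n p)"

definition D_V0 :: "(pt4 \<Rightarrow> complex^2) \<Rightarrow> pt4 \<Rightarrow> complex^2" where
  "D_V0 \<xi> p = (let (t1, t2, ph, ps) = chart4 p in
     (\<i> / of_real (cos ph * cos ps)) *s (sigma1 *v d_t1 \<xi> p) +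
     (\<i> / of_real (sin ph * cos ps)) *s (sigma2 *v d_t2 \<xi> p))"

definition X_act :: "(pt4 \<Rightarrow> complex^2) \<Rightarrow> (pt2 \<Rightarrow> complex) \<Rightarrow> pt4 \<Rightarrow> complex^2" where
  "X_act \<xi> a p = a (quot p) *s \<xi> p"

definition nabla_ph :: "(pt4 \<Rightarrow> complex^2) \<Rightarrow> pt4 \<Rightarrow> complex^2" where
  "nabla_ph \<xi> p = (let (t1, t2, ph, ps) = chart4 p in
     d_ph \<xi> p + of_real (cot ph / 2 - tan ph / 2) *s \<xi> p)"

definition nabla_ps :: "(pt4 \<Rightarrow> complex^2) \<Rightarrow> pt4 \<Rightarrow> complex^2" where
  "nabla_ps \<xi> p = (let (t1, t2, ph, ps) = chart4 p in
     d_ps \<xi> p - of_real (tan ps) *s \<xi> p)"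

type_synonym H_elem = "(pt2 \<Rightarrow> complex^2) set"

definition H_Q :: "(H_elem, complex) ip_space" where
  "H_Q = L2 vol2"

definition H_grading :: "H_elem \<Rightarrow> H_elem" where
  "H_grading = lift_map (sq_int vol2) (\<lambda>h y. grading2 *v h y)"

definition D_Q0 :: "(pt2 \<Rightarrow> complex^2) \<Rightarrow> pt2 \<Rightarrow> complex^2" where
  "D_Q0 h y = (let (ph, ps) = chart2 y in
     (\<i> / of_real (cos ps)) *s (sigma1 *v q_ph h y) +
     \<i> *s (sigma2 *v (q_ps h y - of_real (tan ps / 2) *s h y)))"

type_synonym T_elem = "(nat \<Rightarrow> (X_elem \<times> H_elem) \<Rightarrow>\<^sub>0 complex) set"

definition XH :: "(T_elem, complex) ip_space" where
  "XH = interior_tensor X_mod H_Q (L2_mult vol2)"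

text \<open>
  The elementary tensor of smooth compactly supported functions.  These span (the image in the
  Hilbert space of) the algebraic balanced tensor product on which the operators are defined.
\<close>

definition tens :: "(pt4 \<Rightarrow> complex^2) \<Rightarrow> (pt2 \<Rightarrow> complex^2) \<Rightarrow> T_elem" where
  "tens \<xi> \<eta> = elem_tensor X_mod H_Q (L2_mult vol2) (embed X_pre \<xi>) (cls (sq_int vol2) \<eta>)"

definition D_V_tensor_1 :: "(T_elem \<times> T_elem) set" where
  "D_V_tensor_1 = lin_span XH XH
     {(tens \<xi> \<eta>, tens (D_V0 \<xi>) \<eta>) | \<xi> \<eta>. \<xi> \<in> Cc4 \<and> \<eta> \<in> Cc2}"

definition one_tensor_nabla_D_Q :: "(T_elem \<times> T_elem) set" where
  "one_tensor_nabla_D_Q = lin_span XH XH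
     {(tens \<xi> \<eta>,
       add XH (tens \<xi> (D_Q0 \<eta>))
         (add XH
           (tens (X_act (nabla_ph \<xi>) (\<lambda>y. let (ph, ps) = chart2 y in 1 / of_real (cos ps)))
                 (\<lambda>y. \<i> *s (sigma1 *v \<eta> y)))
           (tens (nabla_ps \<xi>) (\<lambda>y. \<i> *s (sigma2 *v \<eta> y)))))
      | \<xi> \<eta>. \<xi> \<in> Cc4 \<and> \<eta> \<in> Cc2}"

definition gamma_X_tensor_1 :: "(T_elem \<times> T_elem) set" where
  "gamma_X_tensor_1 = tensor_op X_mod H_Q (L2_mult vol2) X_grading id"

definition D_V_times_D_Q :: "(T_elem \<times> T_elem) set" where
  "D_V_times_D_Q = op_closure XH XH
     (op_add XH D_V_tensor_1 (gamma_X_tensor_1 \<circ>\<^sub>g one_tensor_nabla_D_Q))"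

definition gamma_XH :: "(T_elem \<times> T_elem) set" where
  "gamma_XH = tensor_op X_mod H_Q (L2_mult vol2) X_grading H_grading"

definition Gamma_XH :: "(T_elem \<times> T_elem) set" where
  "Gamma_XH = op_add XH
     (gamma_X_tensor_1 \<circ>\<^sub>g op_scale XH (1/2) (op_add XH (Id_on (carr XH)) gamma_XH))
     (op_scale XH (1/2) (op_add XH (Id_on (carr XH)) (op_scale XH (-1) gamma_XH)))"

definition W_prop :: "(T_elem \<times> (pt4 \<Rightarrow> complex^4) set) set \<Rightarrow> bool" where
  "W_prop U \<longleftrightarrow> is_unitary XH L2_S4 U \<and>
     (\<forall>f \<in> Cc4. \<forall>h \<in> Cc2. \<forall>l m :: complex^2.
        (tens (\<lambda>p. f p *s l) (\<lambda>y. h y *s m),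
         cls (sq_int vol4) (\<lambda>p. (f p * h (quot p)) *s
            vector [l$1 * m$1, l$2 * m$1, l$1 * m$2, l$2 * m$2])) \<in> U)"

definition W_unitary :: "(T_elem \<times> (pt4 \<Rightarrow> complex^4) set) set" where
  "W_unitary = (THE U. W_prop U)"

end

theory Submission
  imports Defs
begin

text \<open>
  Everything is carried to one Hilbert space, \<open>L2_S4\<close>, where the two operators become closures of
  first-order differential operators with the same domain, the compactly supported smooth functions,
  and can be compared pointwise.

  The map \<open>W\<close> sends \<open>\<xi> \<otimes> \<eta>\<close> to the function \<open>p \<mapsto> \<xi> p \<otimes> \<eta> (q p)\<close>.  It is isometric because the
  volume of the sphere disintegrates over the quadrant (\<open>vol4_disintegration\<close>): integrating first
  along the torus orbits produces exactly the module inner product of the two left factors, the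
  factor \<open>sin \<phi> cos \<phi> cos\<^sup>2 \<psi>\<close> being the density of the orbits.  Hence \<open>W\<close> extends to the module
  completed in its supremum norm, to finite sums, and to the completion of these.  It is onto
  because its range contains all smooth functions with compact support, which are dense
  (\<open>smooth_spinors_dense\<close>), and because \<open>L2_S4\<close> is complete (\<open>sq_int_complete\<close>).  Density also shows
  that a unitary is determined by its values on elementary tensors (\<open>W_prop_unique\<close>), so the
  \<open>W_unitary\<close> of the statement is this \<open>W\<close>.

  Along \<open>W\<close> the gradings become constant matrices, since bounded operators that agree on a dense
  subspace agree.  The two summands of the tensor sum become differential operators
  (\<open>vertical_spinor_tensor\<close>, \<open>horizontal_spinor_tensor\<close>): functions on the quadrant do not depend on
  the angles, and along the quadrant the product rule turns the connection on the left factor and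
  the Dirac operator on the right factor into one derivative, the potential \<open>-(3/2) tan \<psi>\<close> of the
  sphere arising as \<open>-tan \<psi> - (1/2) tan \<psi>\<close>.  Their domain is all of \<open>Cc4\<close>, since a cutoff function
  of the quadrant which is one on the support of a given function splits it into elementary tensors
  (\<open>smooth_spinor_split\<close>).  Finally \<open>\<Gamma>\<close> becomes the constant matrix \<open>diag(1, 1, 1, -1)\<close>.  Conjugation by
  it commutes with all derivatives and maps the matrices of the tensor sum to
  \<open>\<gamma>\<^sup>1, \<dots>, \<gamma>\<^sup>4\<close> (\<open>Gamma_conjugates_to_Dirac\<close>), and being a homeomorphism of the graph space it
  commutes with closures.
\<close>

section \<open>Separated quotients and completions of seminormed spaces\<close>

text \<open>
  Separated quotients and completions are governed by the seminorm alone.  Applied to differences it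
  makes the null relation an equivalence and the induced operations independent of representatives.
  The axioms are the part of the vector space laws which this uses; functions and formal sums of pairs
  satisfy them alike, and they pass to Cauchy sequences, so that one development serves all the
  quotients below.
\<close>

locale seminormed =
  fixes V :: "('v, 'b::topological_space) ip_space"
  assumes add_carr: "x \<in> carr V \<Longrightarrow> y \<in> carr V \<Longrightarrow> add V x y \<in> carr V"
    and smult_carr: "x \<in> carr V \<Longrightarrow> smult V c x \<in> carr V"
    and assoc: "x \<in> carr V \<Longrightarrow> y \<in> carr V \<Longrightarrow> z \<in> carr V \<Longrightarrow>
                  add V (add V x y) z = add V x (add V y z)"
    and comm: "x \<in> carr V \<Longrightarrow> y \<in> carr V \<Longrightarrow> add V x y = add V y x"
    and smult_add: "x \<in> carr V \<Longrightarrow> y \<in> carr V \<Longrightarrow>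
                  smult V c (add V x y) = add V (smult V c x) (smult V c y)"
    and smult_smult: "x \<in> carr V \<Longrightarrow> smult V c (smult V d x) = smult V (c * d) x"
    and smult_one: "x \<in> carr V \<Longrightarrow> smult V 1 x = x"
    and add_cancel: "x \<in> carr V \<Longrightarrow> y \<in> carr V \<Longrightarrow> add V (add V x y) (smult V (-1) y) = x"
    and sub_self: "x \<in> carr V \<Longrightarrow> add V x (smult V (-1) x) = smult V 0 x"
    and nrm_add: "x \<in> carr V \<Longrightarrow> y \<in> carr V \<Longrightarrow> nrm V (add V x y) \<le> nrm V x + nrm V y"
    and nrm_smult: "x \<in> carr V \<Longrightarrow> nrm V (smult V c x) = cmod c * nrm V x"
begin

lemma diff_carr: "x \<in> carr V \<Longrightarrow> y \<in> carr V \<Longrightarrow> diff V x y \<in> carr V"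
  by (simp add: diff_def add_carr smult_carr)

lemma nrm_diff_self: "x \<in> carr V \<Longrightarrow> nrm V (diff V x x) = 0"
  by (simp add: diff_def sub_self nrm_smult)

lemma nrm_nonneg: "x \<in> carr V \<Longrightarrow> 0 \<le> nrm V x"
  using nrm_add[of x "smult V (-1) x"] nrm_diff_self[of x] nrm_smult[of x "-1"]
  by (simp add: diff_def smult_carr)

lemma diff_tri_eq:
  assumes "x \<in> carr V" "y \<in> carr V" "z \<in> carr V"
  shows "add V (diff V x y) (diff V y z) = diff V x z"
proof -
  have "add V (diff V x y) y = x"
    using add_cancel[of x "smult V (-1) y"] assms
    by (simp add: diff_def smult_carr smult_smult smult_one)
  then show ?thesis
    using assoc[of "diff V x y" y "smult V (-1) z"] assms
    by (simp add: diff_def smult_carr add_carr)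
qed

lemma diff_tri:
  assumes "x \<in> carr V" "y \<in> carr V" "z \<in> carr V"
  shows "nrm V (diff V x z) \<le> nrm V (diff V x y) + nrm V (diff V y z)"
  using nrm_add[of "diff V x y" "diff V y z"] diff_tri_eq assms by (simp add: diff_carr)

lemma diff_sym:
  assumes "x \<in> carr V" "y \<in> carr V"
  shows "nrm V (diff V x y) = nrm V (diff V y x)"
proof -
  have "diff V y x = smult V (-1) (diff V x y)"
    using assms by (simp add: diff_def smult_add smult_smult smult_one smult_carr comm)
  then show ?thesis using assms by (simp add: nrm_smult diff_carr)
qed

lemma nrm_le_diff:
  assumes "x \<in> carr V" "y \<in> carr V"
  shows "nrm V x \<le> nrm V (diff V x y) + nrm V y"
proof -
  have "add V (diff V x y) y = x"
    using add_cancel[of x "smult V (-1) y"] assms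
    by (simp add: diff_def smult_carr smult_smult smult_one)
  then show ?thesis using nrm_add[of "diff V x y" y] assms by (simp add: diff_carr)
qed

lemma abs_nrm_diff:
  assumes "x \<in> carr V" "y \<in> carr V"
  shows "\<bar>nrm V x - nrm V y\<bar> \<le> nrm V (diff V x y)"
  using nrm_le_diff[of x y] nrm_le_diff[of y x] diff_sym[of x y] assms by linarith

lemma diff_add_eq:
  assumes "x \<in> carr V" "y \<in> carr V" "x' \<in> carr V" "y' \<in> carr V"
  shows "diff V (add V x y) (add V x' y') = add V (diff V x x') (diff V y y')"
proof -
  let ?m = "smult V (-1)"
  have "add V (add V x y) (add V (?m x') (?m y')) = add V x (add V y (add V (?m x') (?m y')))"
    using assms by (simp add: assoc add_carr smult_carr)
  also have "add V y (add V (?m x') (?m y')) = add V (?m x') (add V y (?m y'))"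
    using assms assoc[of y "?m x'" "?m y'"] assoc[of "?m x'" y "?m y'"]
    by (simp add: smult_carr comm[of y "?m x'"])
  also have "add V x (add V (?m x') (add V y (?m y'))) = add V (add V x (?m x')) (add V y (?m y'))"
    using assms by (simp add: assoc add_carr smult_carr)
  finally show ?thesis using assms by (simp add: diff_def smult_add)
qed

lemma diff_smult_eq:
  assumes "x \<in> carr V" "y \<in> carr V"
  shows "diff V (smult V c x) (smult V c y) = smult V c (diff V x y)"
  using assms by (simp add: diff_def smult_add smult_smult smult_carr)

lemma nrm_diff_add:
  assumes "x \<in> carr V" "y \<in> carr V" "x' \<in> carr V" "y' \<in> carr V"
  shows "nrm V (diff V (add V x y) (add V x' y')) \<le> nrm V (diff V x x') + nrm V (diff V y y')"
  using nrm_add[of "diff V x x'" "diff V y y'"] assms by (simp add: diff_add_eq diff_carr)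

lemma nrm_diff_smult:
  assumes "x \<in> carr V" "y \<in> carr V"
  shows "nrm V (diff V (smult V c x) (smult V c y)) = cmod c * nrm V (diff V x y)"
  using assms by (simp add: diff_smult_eq nrm_smult diff_carr)

subsection \<open>The separated quotient\<close>

lemma null_rel_iff: "(x, y) \<in> null_rel V \<longleftrightarrow> x \<in> carr V \<and> y \<in> carr V \<and> nrm V (diff V x y) = 0"
  by (simp add: null_rel_def)

lemma equiv_null_rel: "equiv (carr V) (null_rel V)"
proof (rule equivI)
  show "null_rel V \<subseteq> carr V \<times> carr V" by (auto simp: null_rel_def)
  show "refl_on (carr V) (null_rel V)" by (auto simp: refl_on_def null_rel_def nrm_diff_self)
  show "sym (null_rel V)" by (auto simp: sym_def null_rel_def diff_sym)
  show "trans (null_rel V)"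
  proof (rule transI)
    fix x y z assume "(x, y) \<in> null_rel V" "(y, z) \<in> null_rel V"
    then show "(x, z) \<in> null_rel V"
      using diff_tri[of x y z] nrm_nonneg[of "diff V x z"] by (auto simp: null_rel_def diff_carr)
  qed
qed

lemma mem_cls: "y \<in> cls V x \<longleftrightarrow> (x, y) \<in> null_rel V"
  by (simp add: cls_def)

lemma cls_self: "x \<in> carr V \<Longrightarrow> x \<in> cls V x"
  by (simp add: mem_cls null_rel_iff nrm_diff_self)

lemma cls_eq_iff: "x \<in> carr V \<Longrightarrow> y \<in> carr V \<Longrightarrow> cls V x = cls V y \<longleftrightarrow> (x, y) \<in> null_rel V"
  unfolding cls_def by (rule eq_equiv_class_iff[OF equiv_null_rel])

lemma carr_hausdorff: "carr (hausdorff V) = cls V ` carr V"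
  by (auto simp: hausdorff_def quotient_def cls_def)

lemma UN_cls_eq:
  assumes "x \<in> carr V" "\<And>y. (x, y) \<in> null_rel V \<Longrightarrow> F y = F x"
  shows "(\<Union>y\<in>cls V x. F y) = F x"
proof -
  have "(\<Union>y\<in>cls V x. F y) = (\<Union>y\<in>cls V x. F x)"
    by (rule SUP_cong) (auto simp: mem_cls assms)
  then show ?thesis using cls_self[OF assms(1)] by auto
qed

lemma UN_UN_const:
  assumes "a \<in> A" "b \<in> B" "\<And>x y. x \<in> A \<Longrightarrow> y \<in> B \<Longrightarrow> F x y = C"
  shows "(\<Union>x\<in>A. \<Union>y\<in>B. F x y) = C"
proof -
  have "(\<Union>x\<in>A. \<Union>y\<in>B. F x y) = (\<Union>x\<in>A. \<Union>y\<in>B. C)"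
    by (intro SUP_cong refl assms(3))
  then show ?thesis using assms(1,2) by auto
qed

lemma add_hausdorff:
  assumes "x \<in> carr V" "y \<in> carr V"
  shows "add (hausdorff V) (cls V x) (cls V y) = cls V (add V x y)"
proof -
  have *: "cls V (add V x' y') = cls V (add V x y)"
    if "(x, x') \<in> null_rel V" "(y, y') \<in> null_rel V" for x' y'
  proof -
    have "nrm V (diff V (add V x y) (add V x' y')) \<le> 0"
      using nrm_diff_add[of x y x' y'] that assms by (auto simp: null_rel_iff)
    then have "nrm V (diff V (add V x y) (add V x' y')) = 0"
      using that assms nrm_nonneg[of "diff V (add V x y) (add V x' y')"]
      by (auto simp: null_rel_iff add_carr diff_carr)
    then show ?thesis
      using that assms cls_eq_iff[of "add V x y" "add V x' y'"] by (auto simp: null_rel_iff add_carr)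
  qed
  have "(\<Union>x'\<in>cls V x. \<Union>y'\<in>cls V y. cls V (add V x' y')) = cls V (add V x y)"
    by (rule UN_UN_const[OF cls_self[OF assms(1)] cls_self[OF assms(2)]]) (simp add: mem_cls *)
  then show ?thesis by (simp add: hausdorff_def)
qed

lemma smult_hausdorff:
  assumes "x \<in> carr V"
  shows "smult (hausdorff V) c (cls V x) = cls V (smult V c x)"
proof -
  have "cls V (smult V c x') = cls V (smult V c x)" if "(x, x') \<in> null_rel V" for x'
    using that assms cls_eq_iff[of "smult V c x" "smult V c x'"]
    by (auto simp: null_rel_iff smult_carr nrm_diff_smult)
  then show ?thesis by (simp add: hausdorff_def UN_cls_eq assms)
qed

lemma nrm_hausdorff:
  assumes "x \<in> carr V"
  shows "nrm (hausdorff V) (cls V x) = nrm V x"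
proof -
  have "nrm V x' = nrm V x" if "(x, x') \<in> null_rel V" for x'
    using abs_nrm_diff[of x x'] that by (simp add: null_rel_iff)
  then have "nrm V ` cls V x \<subseteq> {nrm V x}" by (simp add: mem_cls image_subset_iff)
  then have "nrm V ` cls V x = {nrm V x}" using cls_self[OF assms] by blast
  then show ?thesis by (simp add: hausdorff_def)
qed

lemma ip_hausdorff:
  assumes "x \<in> carr V" "y \<in> carr V"
    and "\<And>x' y'. (x, x') \<in> null_rel V \<Longrightarrow> (y, y') \<in> null_rel V \<Longrightarrow> ip V x' y' = ip V x y"
  shows "ip (hausdorff V) (cls V x) (cls V y) = ip V x y"
proof -
  have "(\<Union>x'\<in>cls V x. \<Union>y'\<in>cls V y. {ip V x' y'}) = {ip V x y}"
    by (rule UN_UN_const[OF cls_self[OF assms(1)] cls_self[OF assms(2)]]) (simp add: mem_cls assms(3))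
  then show ?thesis by (simp add: hausdorff_def)
qed

lemma diff_hausdorff:
  assumes "x \<in> carr V" "y \<in> carr V"
  shows "diff (hausdorff V) (cls V x) (cls V y) = cls V (diff V x y)"
  using assms by (simp add: diff_def add_hausdorff smult_hausdorff smult_carr)

text \<open>
  A map which respects null vectors descends to the quotient; this is how the gradings and the
  multiplication operators act on classes.
\<close>

lemma lift_map_cls:
  assumes "x \<in> carr V" "\<And>y. y \<in> carr V \<Longrightarrow> f y \<in> carr V"
    and "\<And>y z. y \<in> carr V \<Longrightarrow> z \<in> carr V \<Longrightarrow> nrm V (diff V y z) = 0 \<Longrightarrow> nrm V (diff V (f y) (f z)) = 0"
  shows "lift_map V f (cls V x) = cls V (f x)"
  unfolding lift_map_def
proof (rule UN_cls_eq[OF assms(1)])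
  fix y assume "(x, y) \<in> null_rel V"
  then have "x \<in> carr V" "y \<in> carr V" "nrm V (diff V y x) = 0"
    using diff_sym[of x y] by (auto simp: null_rel_iff)
  then show "cls V (f y) = cls V (f x)"
    by (simp add: cls_eq_iff assms null_rel_iff)
qed

end

subsection \<open>Cauchy sequences\<close>

context seminormed
begin

lemma cauchy_iff:
  "s \<in> carr (cauchy_seqs V) \<longleftrightarrow> (\<forall>n. s n \<in> carr V) \<and>
      (\<forall>e>0. \<exists>N. \<forall>m\<ge>N. \<forall>n\<ge>N. nrm V (diff V (s m) (s n)) < e)"
  by (simp add: cauchy_seqs_def)

lemma cauchy_const: "x \<in> carr V \<Longrightarrow> (\<lambda>_. x) \<in> carr (cauchy_seqs V)"
  by (auto simp: cauchy_iff nrm_diff_self)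

lemma cauchy_nrm_convergent:
  assumes "s \<in> carr (cauchy_seqs V)"
  shows "convergent (\<lambda>n. nrm V (s n))"
proof -
  have "Cauchy (\<lambda>n. nrm V (s n))"
    unfolding Cauchy_def dist_real_def
    using assms abs_nrm_diff unfolding cauchy_iff by (meson order_le_less_trans)
  then show ?thesis by (simp add: Cauchy_convergent_iff)
qed

lemma nrm_cauchy_tendsto:
  assumes "s \<in> carr (cauchy_seqs V)"
  shows "(\<lambda>n. nrm V (s n)) \<longlonglongrightarrow> nrm (cauchy_seqs V) s"
  using cauchy_nrm_convergent[OF assms] by (simp add: cauchy_seqs_def convergent_LIMSEQ_iff)

lemma cauchy_add:
  assumes "s \<in> carr (cauchy_seqs V)" "t \<in> carr (cauchy_seqs V)"
  shows "add (cauchy_seqs V) s t \<in> carr (cauchy_seqs V)"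
proof -
  have c: "\<And>n. s n \<in> carr V" "\<And>n. t n \<in> carr V" using assms by (auto simp: cauchy_iff)
  have "\<exists>N. \<forall>m\<ge>N. \<forall>n\<ge>N. nrm V (diff V (add V (s m) (t m)) (add V (s n) (t n))) < e" if "e > 0" for e
  proof -
    obtain N1 N2 where N: "\<And>m n. m \<ge> N1 \<Longrightarrow> n \<ge> N1 \<Longrightarrow> nrm V (diff V (s m) (s n)) < e/2"
      "\<And>m n. m \<ge> N2 \<Longrightarrow> n \<ge> N2 \<Longrightarrow> nrm V (diff V (t m) (t n)) < e/2"
      using assms \<open>e > 0\<close> unfolding cauchy_iff by (meson half_gt_zero)
    have "nrm V (diff V (add V (s m) (t m)) (add V (s n) (t n))) < e"
      if "m \<ge> max N1 N2" "n \<ge> max N1 N2" for m n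
      using nrm_diff_add[OF c(1) c(2) c(1) c(2), of m m n n] N(1)[of m n] N(2)[of m n] that by auto
    then show ?thesis by blast
  qed
  then show ?thesis using c by (simp add: cauchy_iff) (simp add: cauchy_seqs_def add_carr)
qed

lemma cauchy_smult:
  assumes "s \<in> carr (cauchy_seqs V)"
  shows "smult (cauchy_seqs V) c s \<in> carr (cauchy_seqs V)"
proof -
  have c: "\<And>n. s n \<in> carr V" using assms by (auto simp: cauchy_iff)
  have "\<exists>N. \<forall>m\<ge>N. \<forall>n\<ge>N. nrm V (diff V (smult V c (s m)) (smult V c (s n))) < e" if "e > 0" for e
  proof -
    obtain N where N: "\<And>m n. m \<ge> N \<Longrightarrow> n \<ge> N \<Longrightarrow> nrm V (diff V (s m) (s n)) < e / (cmod c + 1)"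
      using assms \<open>e > 0\<close> unfolding cauchy_iff
      by (meson divide_pos_pos norm_ge_zero add_nonneg_pos zero_less_one)
    have "nrm V (diff V (smult V c (s m)) (smult V c (s n))) < e" if "m \<ge> N" "n \<ge> N" for m n
    proof -
      have "cmod c * nrm V (diff V (s m) (s n)) \<le> (cmod c + 1) * nrm V (diff V (s m) (s n))"
        by (simp add: mult_right_mono nrm_nonneg diff_carr c)
      also have "\<dots> < e"
        using N[OF that] by (simp add: pos_less_divide_eq mult.commute add_nonneg_pos)
      finally show ?thesis by (simp add: nrm_diff_smult c)
    qed
    then show ?thesis by blast
  qed
  then show ?thesis using c by (simp add: cauchy_iff) (simp add: cauchy_seqs_def smult_carr)
qed

lemma seminormed_cauchy: "seminormed (cauchy_seqs V)"
proof (unfold_locales, goal_cases)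
  case 1 then show ?case by (rule cauchy_add)
next
  case 2 then show ?case by (rule cauchy_smult)
next
  case (10 s t)
  have "add (cauchy_seqs V) s t \<in> carr (cauchy_seqs V)" by (rule cauchy_add) fact+
  note lim = nrm_cauchy_tendsto[OF this] tendsto_add[OF 10[THEN nrm_cauchy_tendsto]]
  show ?case
    by (rule tendsto_le[OF sequentially_bot lim(2,1)], rule always_eventually)
      (use 10 in \<open>auto simp: cauchy_iff\<close>, simp add: cauchy_seqs_def nrm_add)
next
  case (11 s c)
  have lim1: "(\<lambda>n. nrm V (smult (cauchy_seqs V) c s n)) \<longlonglongrightarrow> nrm (cauchy_seqs V) (smult (cauchy_seqs V) c s)"
    by (rule nrm_cauchy_tendsto[OF cauchy_smult]) fact
  have lim2: "(\<lambda>n. cmod c * nrm V (s n)) \<longlonglongrightarrow> cmod c * nrm (cauchy_seqs V) s"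
    by (intro tendsto_intros nrm_cauchy_tendsto 11)
  have "(\<lambda>n. nrm V (smult (cauchy_seqs V) c s n)) = (\<lambda>n. cmod c * nrm V (s n))"
    using 11 by (auto simp: cauchy_iff) (simp add: cauchy_seqs_def nrm_smult)
  then show ?case using lim1 lim2 LIMSEQ_unique by metis
qed (auto simp: cauchy_seqs_def assoc comm smult_add smult_smult smult_one add_cancel sub_self)

text \<open>
  The seminorm of a Cauchy sequence is a limit, which exists by the reverse triangle inequality;
  hence two Cauchy sequences are identified exactly if their differences tend to zero.
\<close>

lemma null_rel_cauchy:
  "(s, t) \<in> null_rel (cauchy_seqs V) \<longleftrightarrow> s \<in> carr (cauchy_seqs V) \<and> t \<in> carr (cauchy_seqs V) \<and>
     (\<lambda>n. nrm V (diff V (s n) (t n))) \<longlonglongrightarrow> 0"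
proof -
  have d: "diff (cauchy_seqs V) s t = (\<lambda>n. diff V (s n) (t n))" by (simp add: diff_def cauchy_seqs_def)
  show ?thesis
  proof (cases "s \<in> carr (cauchy_seqs V) \<and> t \<in> carr (cauchy_seqs V)")
    case True
    then have "(\<lambda>n. nrm V (diff V (s n) (t n))) \<longlonglongrightarrow> nrm (cauchy_seqs V) (diff (cauchy_seqs V) s t)"
      using nrm_cauchy_tendsto[of "diff (cauchy_seqs V) s t"] seminormed.diff_carr[OF seminormed_cauchy, of s t]
      by (simp add: d)
    then show ?thesis using True by (auto simp: null_rel_def dest: LIMSEQ_unique)
  qed (auto simp: null_rel_def)
qed

end

lemma seminormed_functions:
  fixes V :: "('a \<Rightarrow> complex^'n, 'b::topological_space) ip_space"
  assumes "add V = (\<lambda>f g x. f x + g x)" "smult V = (\<lambda>c f x. c *s f x)"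
    and "\<And>f g. f \<in> carr V \<Longrightarrow> g \<in> carr V \<Longrightarrow> (\<lambda>x. f x + g x) \<in> carr V"
    and "\<And>f c. f \<in> carr V \<Longrightarrow> (\<lambda>x. c *s f x) \<in> carr V"
    and "\<And>f g. f \<in> carr V \<Longrightarrow> g \<in> carr V \<Longrightarrow> nrm V (\<lambda>x. f x + g x) \<le> nrm V f + nrm V g"
    and "\<And>f c. f \<in> carr V \<Longrightarrow> nrm V (\<lambda>x. c *s f x) = cmod c * nrm V f"
  shows "seminormed V"
  by unfold_locales (simp_all add: assms, simp_all add: fun_eq_iff vec_eq_iff algebra_simps)

section \<open>Square integrable functions\<close>

lemma cip_self: "cip u u = of_real ((norm u)\<^sup>2)"
proof -
  have "(norm u)\<^sup>2 = (\<Sum>i\<in>UNIV. (cmod (u $ i))\<^sup>2)"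
    by (simp add: norm_vec_def L2_set_def sum_nonneg)
  then show ?thesis
    by (simp add: cip_def complex_norm_square mult.commute del: of_real_power)
qed

lemma norm_cip_le: "cmod (cip u v) \<le> norm u * norm v"
proof -
  have "cmod (cip u v) \<le> (\<Sum>i\<in>UNIV. \<bar>cmod (u $ i)\<bar> * \<bar>cmod (v $ i)\<bar>)"
    unfolding cip_def by (rule order_trans[OF norm_sum]) (simp add: norm_mult)
  also have "\<dots> \<le> norm u * norm v"
    unfolding norm_vec_def by (rule L2_set_mult_ineq)
  finally show ?thesis .
qed

lemma cip_add_left: "cip (u + v) w = cip u w + cip v w"
  and cip_add_right: "cip u (v + w) = cip u v + cip u w"
  and cip_smult_left: "cip (c *s u) v = cnj c * cip u v"
  and cip_smult_right: "cip u (c *s v) = c * cip u v"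
  and cip_cnj: "cnj (cip u v) = cip v u"
  by (simp_all add: cip_def sum.distrib sum_distrib_left algebra_simps)

lemma norm_smult_vec: "norm (c *s (u :: complex^'n)) = cmod c * norm u"
proof -
  have "norm (c *s u) = L2_set (\<lambda>i. cmod c * cmod (u $ i)) UNIV"
    by (simp add: norm_vec_def norm_mult)
  then show ?thesis by (simp add: norm_vec_def L2_set_right_distrib)
qed

lemma bounded_bilinear_smult_vec: "bounded_bilinear (\<lambda>c (u :: complex^'n). c *s u)"
  by (rule bounded_bilinear.intro)
    (auto simp: vec_eq_iff algebra_simps norm_smult_vec intro!: exI[of _ 1])

lemma scaleR_smult_vec: "r *\<^sub>R (u :: complex^'n) = of_real r *s u"
  by (simp only: vec_eq_iff vector_scaleR_component vector_smult_component)
    (simp add: scaleR_conv_of_real)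

lemma bounded_bilinear_cip: "bounded_bilinear (cip :: complex^'n \<Rightarrow> _)"
proof (rule bounded_bilinear.intro)
  show "\<exists>K. \<forall>a b. norm (cip (a :: complex^'n) b) \<le> norm a * norm b * K"
    by (intro exI[of _ 1]) (simp add: norm_cip_le)
qed (simp_all only: cip_add_left cip_add_right scaleR_smult_vec cip_smult_left cip_smult_right
      scaleR_conv_of_real complex_cnj_complex_of_real)

lemma borel_measurable_cip [measurable]:
  assumes "f \<in> borel_measurable M" "g \<in> borel_measurable M"
  shows "(\<lambda>x. cip (f x) (g x :: complex^'n)) \<in> borel_measurable M"
  by (rule borel_measurable_continuous_Pair[OF assms])
    (intro bounded_bilinear.continuous_on[OF bounded_bilinear_cip] continuous_intros)

lemma borel_measurable_smult_vec [measurable]: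
  assumes "c \<in> borel_measurable M" "g \<in> borel_measurable M"
  shows "(\<lambda>x. c x *s (g x :: complex^'n)) \<in> borel_measurable M"
  by (rule borel_measurable_continuous_Pair[OF assms])
    (intro bounded_bilinear.continuous_on[OF bounded_bilinear_smult_vec] continuous_intros)

lemma mem_sq_int: "f \<in> carr (sq_int M) \<longleftrightarrow> f \<in> borel_measurable M \<and> integrable M (\<lambda>x. (norm (f x))\<^sup>2)"
  by (simp add: sq_int_def)

lemma integrable_norm_mult:
  assumes "f \<in> carr (sq_int M)" "g \<in> carr (sq_int M)"
  shows "integrable M (\<lambda>x. norm (f x) * norm (g x))"
proof (rule Bochner_Integration.integrable_bound)
  have [measurable]: "f \<in> borel_measurable M" "g \<in> borel_measurable M"
    using assms by (auto simp: mem_sq_int)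
  show "integrable M (\<lambda>x. (norm (f x))\<^sup>2 + (norm (g x))\<^sup>2)"
    using assms by (auto simp: mem_sq_int)
  show "(\<lambda>x. norm (f x) * norm (g x)) \<in> borel_measurable M" by measurable
  have "a * b \<le> a\<^sup>2 + b\<^sup>2" if "0 \<le> a" "0 \<le> b" for a b :: real
    using sum_squares_bound[of a b] mult_nonneg_nonneg[OF that] by simp
  then show "AE x in M. norm (norm (f x) * norm (g x)) \<le> norm ((norm (f x))\<^sup>2 + (norm (g x))\<^sup>2)"
    by auto
qed

lemma integrable_cip:
  assumes "f \<in> carr (sq_int M)" "g \<in> carr (sq_int M)"
  shows "integrable M (\<lambda>x. cip (f x) (g x))"
proof (rule Bochner_Integration.integrable_bound[OF integrable_norm_mult[OF assms]])
  have [measurable]: "f \<in> borel_measurable M" "g \<in> borel_measurable M"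
    using assms by (auto simp: mem_sq_int)
  show "(\<lambda>x. cip (f x) (g x)) \<in> borel_measurable M" by measurable
  show "AE x in M. norm (cip (f x) (g x)) \<le> norm (norm (f x) * norm (g x))"
    using norm_cip_le by (auto simp: abs_mult)
qed

lemma sq_int_nrm_nonneg: "0 \<le> nrm (sq_int M) f"
  by (simp add: sq_int_def)

lemma sq_int_nrm2: "(nrm (sq_int M) f)\<^sup>2 = (LINT x|M. (norm (f x))\<^sup>2)"
  by (simp add: sq_int_def)

lemma sq_int_ip_self: "ip (sq_int M) f f = of_real ((nrm (sq_int M) f)\<^sup>2)"
  by (simp only: sq_int_nrm2) (simp add: sq_int_def cip_self del: of_real_power)

text \<open>
  The Cauchy--Schwarz inequality for the pointwise norms; it yields both the triangle inequality and
  the boundedness of the inner product.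
\<close>

lemma integral_norm_mult_le:
  fixes f g :: "'a \<Rightarrow> complex^'n"
  assumes "f \<in> carr (sq_int M)" "g \<in> carr (sq_int M)"
  shows "(LINT x|M. norm (f x) * norm (g x)) \<le> nrm (sq_int M) f * nrm (sq_int M) g"
proof -
  have [measurable]: "f \<in> borel_measurable M" "g \<in> borel_measurable M"
    using assms by (auto simp: mem_sq_int)
  let ?I = "LINT x|M. norm (f x) * norm (g x)"
  have e1: "(\<integral>\<^sup>+x. ennreal (norm (f x)) * ennreal (norm (g x)) \<partial>M) = ennreal ?I"
    using nn_integral_eq_integral[OF integrable_norm_mult[OF assms]] by (simp add: ennreal_mult)
  have e2: "(\<integral>\<^sup>+x. (ennreal (norm (h x)))\<^sup>2 \<partial>M) = ennreal ((nrm (sq_int M) h)\<^sup>2)"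
    if "h \<in> carr (sq_int M)" for h :: "'a \<Rightarrow> complex^'n"
  proof -
    have "integrable M (\<lambda>x. (norm (h x))\<^sup>2)" using that by (simp add: mem_sq_int)
    from nn_integral_eq_integral[OF this] show ?thesis
      by (simp add: sq_int_nrm2 ennreal_power)
  qed
  have "(ennreal ?I)\<^sup>2 \<le> ennreal ((nrm (sq_int M) f)\<^sup>2) * ennreal ((nrm (sq_int M) g)\<^sup>2)"
    using Cauchy_Schwarz_nn_integral[of "\<lambda>x. ennreal (norm (f x))" M "\<lambda>x. ennreal (norm (g x))"]
    by (simp only: e1 e2[OF assms(1)] e2[OF assms(2)]) simp
  then have "?I\<^sup>2 \<le> (nrm (sq_int M) f * nrm (sq_int M) g)\<^sup>2"
    by (simp add: ennreal_power ennreal_mult[symmetric] integral_nonneg_AE power_mult_distrib)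
  then show ?thesis
    by (rule power2_le_imp_le) (simp add: sq_int_nrm_nonneg)
qed

lemma sq_int_cauchy_schwarz:
  assumes "f \<in> carr (sq_int M)" "g \<in> carr (sq_int M)"
  shows "cmod (ip (sq_int M) f g) \<le> nrm (sq_int M) f * nrm (sq_int M) g"
proof -
  have "cmod (ip (sq_int M) f g) = cmod (LINT x|M. cip (f x) (g x))" by (simp add: sq_int_def)
  also have "\<dots> \<le> (LINT x|M. norm (cip (f x) (g x)))" by (rule integral_norm_bound)
  also have "\<dots> \<le> (LINT x|M. norm (f x) * norm (g x))"
    by (intro integral_mono integrable_norm integrable_cip integrable_norm_mult assms norm_cip_le)
  also have "\<dots> \<le> nrm (sq_int M) f * nrm (sq_int M) g" by (rule integral_norm_mult_le[OF assms])
  finally show ?thesis .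
qed

lemma sq_int_add_carr:
  assumes "f \<in> carr (sq_int M)" "g \<in> carr (sq_int M)"
  shows "(\<lambda>x. f x + g x) \<in> carr (sq_int M)"
proof -
  have [measurable]: "f \<in> borel_measurable M" "g \<in> borel_measurable M"
    using assms by (auto simp: mem_sq_int)
  have "integrable M (\<lambda>x. (norm (f x + g x))\<^sup>2)"
  proof (rule Bochner_Integration.integrable_bound)
    show "integrable M (\<lambda>x. (norm (f x))\<^sup>2 + 2 * (norm (f x) * norm (g x)) + (norm (g x))\<^sup>2)"
      using assms integrable_norm_mult[OF assms] by (auto simp: mem_sq_int)
    have "(norm (f x + g x))\<^sup>2 \<le> (norm (f x) + norm (g x))\<^sup>2" for x
      by (intro power_mono norm_triangle_ineq) simp
    then show "AE x in M. norm ((norm (f x + g x))\<^sup>2) \<le>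
        norm ((norm (f x))\<^sup>2 + 2 * (norm (f x) * norm (g x)) + (norm (g x))\<^sup>2)"
      by (auto simp: power2_sum algebra_simps)
  qed measurable
  then show ?thesis by (simp add: mem_sq_int)
qed

lemma sq_int_smult_carr:
  assumes "f \<in> carr (sq_int M)"
  shows "(\<lambda>x. c *s f x) \<in> carr (sq_int M)"
  using assms by (auto simp: mem_sq_int norm_smult_vec power_mult_distrib)

lemma sq_int_nrm_add:
  assumes "f \<in> carr (sq_int M)" "g \<in> carr (sq_int M)"
  shows "nrm (sq_int M) (\<lambda>x. f x + g x) \<le> nrm (sq_int M) f + nrm (sq_int M) g"
proof (rule power2_le_imp_le)
  have i: "integrable M (\<lambda>x. (norm (f x))\<^sup>2)" "integrable M (\<lambda>x. (norm (g x))\<^sup>2)"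
    "integrable M (\<lambda>x. (norm (f x + g x))\<^sup>2)"
    using assms sq_int_add_carr[OF assms] by (auto simp: mem_sq_int)
  have "(norm (f x + g x))\<^sup>2 \<le> (norm (f x) + norm (g x))\<^sup>2" for x
    by (intro power_mono norm_triangle_ineq) simp
  then have "(LINT x|M. (norm (f x + g x))\<^sup>2) \<le>
      (LINT x|M. (norm (f x))\<^sup>2 + 2 * (norm (f x) * norm (g x)) + (norm (g x))\<^sup>2)"
    by (intro integral_mono i Bochner_Integration.integrable_add integrable_mult_right integrable_norm_mult assms)
      (simp add: power2_sum algebra_simps)
  also have "\<dots> = (nrm (sq_int M) f)\<^sup>2 + 2 * (LINT x|M. norm (f x) * norm (g x)) + (nrm (sq_int M) g)\<^sup>2"
    using i integrable_norm_mult[OF assms] by (simp add: sq_int_nrm2)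
  also have "\<dots> \<le> (nrm (sq_int M) f + nrm (sq_int M) g)\<^sup>2"
    using integral_norm_mult_le[OF assms] by (simp add: power2_sum algebra_simps)
  finally show "(nrm (sq_int M) (\<lambda>x. f x + g x))\<^sup>2 \<le> (nrm (sq_int M) f + nrm (sq_int M) g)\<^sup>2"
    by (simp add: sq_int_nrm2)
qed (simp add: sq_int_nrm_nonneg)

lemma sq_int_nrm_smult: "nrm (sq_int M) (\<lambda>x. c *s f x) = cmod c * nrm (sq_int M) f"
  by (simp add: sq_int_def norm_smult_vec power_mult_distrib real_sqrt_mult)

lemma seminormed_sq_int: "seminormed (sq_int M)"
  by (rule seminormed_functions)
    (auto simp: sq_int_add_carr sq_int_smult_carr sq_int_nrm_add sq_int_nrm_smult,
     simp_all add: sq_int_def)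

interpretation sq: seminormed "sq_int M" for M by (rule seminormed_sq_int)

lemma sq_int_diff: "diff (sq_int M) f g = (\<lambda>x. f x - g x)"
  by (simp add: diff_def sq_int_def fun_eq_iff vec_eq_iff)

lemma sq_int_add_eq: "add (sq_int M) f g = (\<lambda>x. f x + g x)"
  and sq_int_smult_eq: "smult (sq_int M) c f = (\<lambda>x. c *s f x)"
  by (simp_all add: sq_int_def)

lemma null_rel_sq_int:
  "(f, g) \<in> null_rel (sq_int M) \<longleftrightarrow> f \<in> carr (sq_int M) \<and> g \<in> carr (sq_int M) \<and> (AE x in M. f x = g x)"
proof -
  have "nrm (sq_int M) (diff (sq_int M) f g) = 0 \<longleftrightarrow> (AE x in M. f x = g x)"
    if "f \<in> carr (sq_int M)" "g \<in> carr (sq_int M)"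
  proof -
    have "diff (sq_int M) f g \<in> carr (sq_int M)" by (rule sq.diff_carr) fact+
    then have "integrable M (\<lambda>x. (norm (f x - g x))\<^sup>2)" by (simp add: sq_int_diff mem_sq_int)
    from integral_nonneg_eq_0_iff_AE[OF this]
    show ?thesis by (simp add: sq_int_diff) (simp add: sq_int_def)
  qed
  then show ?thesis by (auto simp: null_rel_def)
qed

lemma sq_int_ip_cong:
  assumes "(f, f') \<in> null_rel (sq_int M)" "(g, g') \<in> null_rel (sq_int M)"
  shows "ip (sq_int M) f' g' = ip (sq_int M) f g"
proof -
  have [measurable]: "f \<in> borel_measurable M" "g \<in> borel_measurable M" "f' \<in> borel_measurable M" "g' \<in> borel_measurable M"
    using assms by (auto simp: mem_sq_int null_rel_sq_int)
  have "(LINT x|M. cip (f' x) (g' x)) = (LINT x|M. cip (f x) (g x))"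
    using assms by (intro integral_cong_AE) (auto simp: null_rel_sq_int)
  then show ?thesis by (simp add: sq_int_def)
qed

lemma ip_L2:
  assumes "f \<in> carr (sq_int M)" "g \<in> carr (sq_int M)"
  shows "ip (L2 M) (cls (sq_int M) f) (cls (sq_int M) g) = ip (sq_int M) f g"
  unfolding L2_def by (rule sq.ip_hausdorff[OF assms sq_int_ip_cong])

lemma cls_sq_int_eq_iff:
  assumes "f \<in> carr (sq_int M)" "g \<in> carr (sq_int M)"
  shows "cls (sq_int M) f = cls (sq_int M) g \<longleftrightarrow> (AE x in M. f x = g x)"
  using assms by (simp add: sq.cls_eq_iff null_rel_sq_int)

text \<open>
  Completeness.  A Cauchy sequence has a subsequence whose increments \<open>d\<^sub>k\<close> have norms at most
  \<open>2\<^sup>-\<^sup>k\<close>.  Then \<open>\<Sum>k. 2\<^sup>k |d\<^sub>k|\<^sup>2\<close> has a finite integral, so it is finite almost everywhere,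
  which forces \<open>|d\<^sub>k|\<close> to decay geometrically and the subsequence to converge almost
  everywhere.  Fatou's lemma turns this into convergence in norm.
\<close>

lemma sq_int_complete:
  fixes s :: "nat \<Rightarrow> 'a \<Rightarrow> complex^'n"
  assumes s: "s \<in> carr (cauchy_seqs (sq_int M))"
  obtains g where "g \<in> carr (sq_int M)" "(\<lambda>n. nrm (sq_int M) (diff (sq_int M) (s n) g)) \<longlonglongrightarrow> 0"
proof -
  let ?S = "sq_int M :: ('a \<Rightarrow> complex^'n, complex) ip_space"
  have c: "s n \<in> carr ?S" for n using s by (simp add: sq.cauchy_iff)
  have [measurable]: "s n \<in> borel_measurable M" for n using c by (simp add: mem_sq_int)
  have cau: "\<exists>N. \<forall>m\<ge>N. \<forall>n\<ge>N. nrm ?S (diff ?S (s m) (s n)) < e" if "e > 0" for e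
    using s that by (simp add: sq.cauchy_iff)
  have nn: "(\<integral>\<^sup>+x. ennreal ((norm (s m x - s n x))\<^sup>2) \<partial>M) = ennreal ((nrm ?S (diff ?S (s m) (s n)))\<^sup>2)" for m n
  proof -
    have "diff ?S (s m) (s n) \<in> carr ?S" by (rule sq.diff_carr[OF c c])
    then have "integrable M (\<lambda>x. (norm (s m x - s n x))\<^sup>2)" by (simp add: sq_int_diff mem_sq_int)
    from nn_integral_eq_integral[OF this] show ?thesis by (simp add: sq_int_diff sq_int_nrm2)
  qed
  have "\<exists>N. \<forall>k. (\<forall>m\<ge>N k. \<forall>n\<ge>N k. nrm ?S (diff ?S (s m) (s n)) < (1/2)^k)"
    by (rule choice) (use cau in auto)
  then obtain N where N: "\<And>k m n. m \<ge> N k \<Longrightarrow> n \<ge> N k \<Longrightarrow> nrm ?S (diff ?S (s m) (s n)) < (1/2)^k" by blast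
  \<comment> \<open>indices beyond all of \<open>N 0, \<dots>, N k\<close>\<close>
  define r where "r k = k + (\<Sum>j\<le>k. N j)" for k
  have rN: "r m \<ge> N k" if "m \<ge> k" for m k
  proof -
    have "N k \<le> (\<Sum>j\<le>m. N j)" using that by (intro member_le_sum) auto
    then show ?thesis by (simp add: r_def)
  qed
  have r_ge: "k \<le> r k" for k by (simp add: r_def)
  let ?d = "\<lambda>k x. s (r (Suc k)) x - s (r k) x"
  have "(\<integral>\<^sup>+x. suminf (\<lambda>k. ennreal (2^k * (norm (?d k x))\<^sup>2)) \<partial>M) =
      suminf (\<lambda>k. \<integral>\<^sup>+x. ennreal (2^k * (norm (?d k x))\<^sup>2) \<partial>M)"
    by (rule nn_integral_suminf) measurable
  also have "\<dots> \<le> suminf (\<lambda>k. ennreal ((1/2)^k))"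
  proof (rule suminf_le)
    fix k
    have "(\<integral>\<^sup>+x. ennreal (2^k * (norm (?d k x))\<^sup>2) \<partial>M) = ennreal (2^k) * ennreal ((nrm ?S (diff ?S (s (r (Suc k))) (s (r k))))\<^sup>2)"
      by (simp add: ennreal_mult nn_integral_cmult nn)
    also have "\<dots> \<le> ennreal (2^k) * ennreal (((1/2)^k)\<^sup>2)"
      using N[of k "r (Suc k)" "r k"] rN[of k "Suc k"] rN[of k k]
      by (intro mult_left_mono ennreal_leI power_mono) (auto simp: sq_int_nrm_nonneg)
    also have "\<dots> = ennreal ((1/2)^k)"
      by (simp add: ennreal_mult[symmetric] power2_eq_square power_divide)
    finally show "(\<integral>\<^sup>+x. ennreal (2^k * (norm (?d k x))\<^sup>2) \<partial>M) \<le> ennreal ((1/2)^k)" .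
  qed auto
  also have "\<dots> < \<infinity>"
    by (subst suminf_ennreal2) (auto simp: summable_geometric less_top)
  finally have "(\<integral>\<^sup>+x. suminf (\<lambda>k. ennreal (2^k * (norm (?d k x))\<^sup>2)) \<partial>M) \<noteq> \<infinity>" by simp
  then have "AE x in M. suminf (\<lambda>k. ennreal (2^k * (norm (?d k x))\<^sup>2)) \<noteq> \<infinity>"
    by (intro nn_integral_PInf_AE) measurable
  moreover have conv: "convergent (\<lambda>k. s (r k) x)" if fin: "suminf (\<lambda>k. ennreal (2^k * (norm (?d k x))\<^sup>2)) \<noteq> \<infinity>" for x
  proof -
    have "summable (\<lambda>k. 2^k * (norm (?d k x))\<^sup>2)"
      by (rule summable_suminf_not_top) (use fin in auto)
    then have "(\<lambda>k. 2^k * (norm (?d k x))\<^sup>2) \<longlonglongrightarrow> 0" by (rule summable_LIMSEQ_zero)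
    then have "Bseq (\<lambda>k. 2^k * (norm (?d k x))\<^sup>2)" using convergentI convergent_imp_Bseq by blast
    then obtain K where K: "K > 0" "\<And>k. 2^k * (norm (?d k x))\<^sup>2 \<le> K" unfolding Bseq_def by auto
    have le: "norm (?d k x) \<le> sqrt K * (1 / sqrt 2)^k" for k
    proof (rule power2_le_imp_le)
      have "(norm (?d k x))\<^sup>2 \<le> K / 2^k" using K(2)[of k] by (simp add: field_simps)
      also have "K / 2^k = (sqrt K * (1 / sqrt 2)^k)\<^sup>2"
        using K(1) by (simp add: power_mult_distrib power_divide power_mult[symmetric] mult.commute[of k 2])
          (simp add: power_mult)
      finally show "(norm (?d k x))\<^sup>2 \<le> (sqrt K * (1 / sqrt 2)^k)\<^sup>2" .
    qed (use K in auto)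
    have "summable (\<lambda>k. sqrt K * (1 / sqrt 2)^k)"
      by (intro summable_mult summable_geometric) auto
    then have "summable (\<lambda>k. norm (?d k x))"
      by (rule summable_comparison_test'[where N = 0]) (simp add: le)
    then have "summable (\<lambda>k. ?d k x)" by (rule summable_norm_cancel)
    then show ?thesis
      by (simp add: summable_iff_convergent sum_lessThan_telescope[of "\<lambda>k. s (r k) x"]
          convergent_diff_const_right_iff)
  qed
  ultimately have conv_AE: "AE x in M. convergent (\<lambda>k. s (r k) x)" by auto
  define g where "g x = lim (\<lambda>k. s (r k) x)" for x
  have [measurable]: "g \<in> borel_measurable M" unfolding g_def by measurable
  have fatou: "(\<integral>\<^sup>+x. ennreal ((norm (s n x - g x))\<^sup>2) \<partial>M) \<le> ennreal (((1/2)^k)\<^sup>2)" if "n \<ge> N k" for n k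
  proof -
    have "(\<integral>\<^sup>+x. ennreal ((norm (s n x - g x))\<^sup>2) \<partial>M)
        = (\<integral>\<^sup>+x. liminf (\<lambda>j. ennreal ((norm (s n x - s (r j) x))\<^sup>2)) \<partial>M)"
    proof (rule nn_integral_cong_AE, use conv_AE in eventually_elim)
      fix x assume "convergent (\<lambda>k. s (r k) x)"
      then have "(\<lambda>k. s (r k) x) \<longlonglongrightarrow> g x" by (simp add: g_def convergent_LIMSEQ_iff)
      then have "(\<lambda>j. ennreal ((norm (s n x - s (r j) x))\<^sup>2)) \<longlonglongrightarrow> ennreal ((norm (s n x - g x))\<^sup>2)"
        by (intro tendsto_intros)
      then show "ennreal ((norm (s n x - g x))\<^sup>2) = liminf (\<lambda>j. ennreal ((norm (s n x - s (r j) x))\<^sup>2))"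
        using lim_imp_Liminf[OF sequentially_bot] by metis
    qed
    also have "\<dots> \<le> liminf (\<lambda>j. \<integral>\<^sup>+x. ennreal ((norm (s n x - s (r j) x))\<^sup>2) \<partial>M)"
      by (rule nn_integral_liminf) measurable
    also have "\<dots> \<le> ennreal (((1/2)^k)\<^sup>2)"
    proof -
      have "eventually (\<lambda>j. (\<integral>\<^sup>+x. ennreal ((norm (s n x - s (r j) x))\<^sup>2) \<partial>M) \<le> ennreal (((1/2)^k)\<^sup>2)) sequentially"
        unfolding eventually_sequentially
      proof (intro exI[of _ k] allI impI)
        fix j assume "k \<le> j"
        then show "(\<integral>\<^sup>+x. ennreal ((norm (s n x - s (r j) x))\<^sup>2) \<partial>M) \<le> ennreal (((1/2)^k)\<^sup>2)"
          using N[of k n "r j"] that rN[of k j] unfolding nn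
          by (intro ennreal_leI power_mono) (auto simp: sq_int_nrm_nonneg)
      qed
      from Liminf_mono[OF this] show ?thesis by (simp add: Liminf_const)
    qed
    finally show ?thesis .
  qed
  have int: "integrable M (\<lambda>x. (norm (s n x - g x))\<^sup>2)" if "n \<ge> N 0" for n
    by (rule integrableI_bounded) (use fatou[OF that] in \<open>auto simp: order_le_less_trans\<close>)
  have d: "(\<lambda>x. s (N 0) x - g x) \<in> carr ?S" using int[of "N 0"] by (simp add: mem_sq_int)
  have "g = diff ?S (s (N 0)) (\<lambda>x. s (N 0) x - g x)" by (simp add: sq_int_diff)
  then have g: "g \<in> carr ?S" using sq.diff_carr[OF c d] by metis
  have le: "nrm ?S (diff ?S (s n) g) \<le> (1/2)^k" if "n \<ge> N k" for n k
  proof -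
    have "diff ?S (s n) g \<in> carr ?S" by (rule sq.diff_carr[OF c g])
    then have "integrable M (\<lambda>x. (norm (s n x - g x))\<^sup>2)" by (simp add: sq_int_diff mem_sq_int)
    from nn_integral_eq_integral[OF this] fatou[OF that]
    have "(nrm ?S (diff ?S (s n) g))\<^sup>2 \<le> ((1/2)^k)\<^sup>2"
      by (simp add: sq_int_diff sq_int_nrm2)
    then show ?thesis by (rule power2_le_imp_le) simp
  qed
  have "(\<lambda>n. nrm ?S (diff ?S (s n) g)) \<longlonglongrightarrow> 0"
  proof (rule LIMSEQ_I)
    fix e :: real assume "e > 0"
    then obtain k where k: "(1/2)^k < e" using real_arch_pow_inv[of e "1/2"] by auto
    show "\<exists>no. \<forall>n\<ge>no. norm (nrm ?S (diff ?S (s n) g) - 0) < e"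
      using le[of k] k by (auto simp: sq_int_nrm_nonneg intro!: exI[of _ "N k"] order_le_less_trans[OF _ k])
  qed
  then show ?thesis using that g by blast
qed

section \<open>Smooth functions on open sets\<close>

text \<open>
  On an open set the derivative at a point does not see the values outside, so that functions may be
  replaced by others which agree with them on the set.
\<close>

lemma Ck_on_cong:
  assumes "open U" "\<And>x. x \<in> U \<Longrightarrow> f x = g x"
  shows "Ck_on k U f \<longleftrightarrow> Ck_on k U g"
  using assms(2)
proof (induction k arbitrary: f g)
  case 0
  then show ?case by (simp cong: continuous_on_cong)
next
  case (Suc k)
  have d: "(f has_derivative D) (at x) \<longleftrightarrow> (g has_derivative D) (at x)" if "x \<in> U" for x D
    using Suc.prems has_derivative_transform_within_open[OF _ \<open>open U\<close> that] by metis
  then have e: "frechet_derivative f (at x) = frechet_derivative g (at x)" if "x \<in> U" for x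
    using that by (simp add: frechet_derivative_def)
  have "Ck_on k U (\<lambda>x. frechet_derivative f (at x) v) \<longleftrightarrow> Ck_on k U (\<lambda>x. frechet_derivative g (at x) v)" for v
    by (rule Suc.IH) (simp add: e)
  moreover have "f differentiable (at x) \<longleftrightarrow> g differentiable (at x)" if "x \<in> U" for x
    using d[OF that] by (simp add: differentiable_def)
  ultimately show ?case by simp
qed

lemma Ck_on_SucI:
  assumes "open U" "\<And>x. x \<in> U \<Longrightarrow> (f has_derivative f' x) (at x)" "\<And>v. Ck_on k U (\<lambda>x. f' x v)"
  shows "Ck_on (Suc k) U f"
proof -
  have "Ck_on k U (\<lambda>x. frechet_derivative f (at x) v)" for v
    using Ck_on_cong[OF assms(1), of "\<lambda>x. frechet_derivative f (at x) v" "\<lambda>x. f' x v" k]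
      frechet_derivative_at[OF assms(2), symmetric] assms(3)[of v] by simp
  then show ?thesis using assms(2) by (auto simp: differentiable_def)
qed

lemma Ck_on_Suc_has_derivative:
  "Ck_on (Suc k) U f \<Longrightarrow> x \<in> U \<Longrightarrow> (f has_derivative frechet_derivative f (at x)) (at x)"
  by (simp add: frechet_derivative_works)

lemma Ck_on_continuous: "Ck_on k U f \<Longrightarrow> continuous_on U f"
  by (cases k) (simp_all add: continuous_at_imp_continuous_on differentiable_imp_continuous_within)

lemma Ck_on_Suc_D: "Ck_on (Suc k) U f \<Longrightarrow> Ck_on k U f"
proof (induction k arbitrary: f)
  case 0
  show ?case using Ck_on_continuous[OF 0] by simp
next
  case (Suc k)
  then show ?case by (simp only: Ck_on.simps) blast
qed

lemma Ck_on_const: "open U \<Longrightarrow> Ck_on k U (\<lambda>_. c)"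
proof (induction k arbitrary: c)
  case (Suc k)
  then show ?case by (intro Ck_on_SucI[where f' = "\<lambda>_ _. 0"]) auto
qed simp

lemma Ck_on_add: "open U \<Longrightarrow> Ck_on k U f \<Longrightarrow> Ck_on k U g \<Longrightarrow> Ck_on k U (\<lambda>x. f x + g x)"
proof (induction k arbitrary: f g)
  case (Suc k)
  show ?case
    by (rule Ck_on_SucI[OF Suc.prems(1) has_derivative_add[OF
        Ck_on_Suc_has_derivative[OF Suc.prems(2)] Ck_on_Suc_has_derivative[OF Suc.prems(3)]]])
      (use Suc in auto)
qed (auto intro: continuous_intros)

lemma Ck_on_bounded_linear:
  assumes L: "bounded_linear L"
  shows "open U \<Longrightarrow> Ck_on k U f \<Longrightarrow> Ck_on k U (\<lambda>x. L (f x))"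
proof (induction k arbitrary: f)
  case 0
  then show ?case by (auto intro: bounded_linear.continuous_on[OF L])
next
  case (Suc k)
  show ?case
    by (rule Ck_on_SucI[OF Suc.prems(1) bounded_linear.has_derivative[OF L
        Ck_on_Suc_has_derivative[OF Suc.prems(2)]]]) (use Suc in auto)
qed

lemma Ck_on_bounded_linear_self:
  assumes L: "bounded_linear L" and U: "open U"
  shows "Ck_on k U L"
proof (cases k)
  case 0
  then show ?thesis by (auto intro: bounded_linear.continuous_on[OF L] continuous_intros)
next
  case (Suc j)
  show ?thesis unfolding Suc
    by (rule Ck_on_SucI[OF U bounded_linear_imp_has_derivative[OF L]]) (rule Ck_on_const[OF U])
qed

lemma Ck_on_bounded_bilinear:
  assumes B: "bounded_bilinear B"
  shows "open U \<Longrightarrow> Ck_on k U f \<Longrightarrow> Ck_on k U g \<Longrightarrow> Ck_on k U (\<lambda>x. B (f x) (g x))"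
proof (induction k arbitrary: f g)
  case 0
  then show ?case by (auto intro: bounded_bilinear.continuous_on[OF B])
next
  case (Suc k)
  have "Ck_on k U f" "Ck_on k U g" using Suc.prems Ck_on_Suc_D by blast+
  then show ?case
    by (intro Ck_on_SucI[OF Suc.prems(1) bounded_bilinear.FDERIV[OF B
        Ck_on_Suc_has_derivative[OF Suc.prems(2)] Ck_on_Suc_has_derivative[OF Suc.prems(3)]]])
      (use Suc in \<open>auto intro!: Ck_on_add\<close>)
qed

lemma Ck_on_compose_linear:
  assumes L: "bounded_linear L" and V: "open V" and VU: "\<And>x. x \<in> V \<Longrightarrow> L x \<in> U"
  shows "Ck_on k U f \<Longrightarrow> Ck_on k V (\<lambda>x. f (L x))"
proof (induction k arbitrary: f)
  case 0
  then show ?case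
    by (auto intro!: continuous_on_compose2[of U f] bounded_linear.continuous_on[OF L] continuous_intros VU)
next
  case (Suc k)
  have "((\<lambda>x. f (L x)) has_derivative (\<lambda>v. frechet_derivative f (at (L x)) (L v))) (at x)" if "x \<in> V" for x
    using diff_chain_at[OF bounded_linear_imp_has_derivative[OF L] Ck_on_Suc_has_derivative[OF Suc.prems VU[OF that]]]
    by (simp add: o_def)
  then show ?case
    by (rule Ck_on_SucI[OF V]) (use Suc in auto)
qed

text \<open>
  The chain rule for an outer function of one real variable, all of whose derivatives are given:
  the induction over the order of differentiability runs through the whole family.
\<close>

lemma Ck_on_compose_real:
  fixes g :: "nat \<Rightarrow> real \<Rightarrow> 'b::real_normed_vector"
  assumes g: "\<And>n t. (g n has_vector_derivative g (Suc n) t) (at t)"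
  shows "open U \<Longrightarrow> Ck_on k U u \<Longrightarrow> Ck_on k U (\<lambda>x. g n (u x))"
proof (induction k arbitrary: n)
  case 0
  have "continuous_on UNIV (g n)"
    using g by (intro continuous_at_imp_continuous_on ballI) (blast intro: has_vector_derivative_continuous)
  then show ?case using 0 by (auto intro: continuous_on_compose2)
next
  case (Suc k)
  have "((\<lambda>x. g n (u x)) has_derivative (\<lambda>v. frechet_derivative u (at x) v *\<^sub>R g (Suc n) (u x))) (at x)"
    if "x \<in> U" for x
    using diff_chain_at[OF Ck_on_Suc_has_derivative[OF Suc.prems(2) that] g[of n, unfolded has_vector_derivative_def]]
    by (simp add: o_def)
  then show ?case
    by (rule Ck_on_SucI[OF Suc.prems(1)])
      (use Suc Ck_on_Suc_D in \<open>auto intro!: Ck_on_bounded_bilinear[OF bounded_bilinear_scaleR] simp del: Ck_on.simps(1)\<close>)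
qed

text \<open>
  The derivative of \<open>1/u\<close> is again a product of \<open>1/u\<close> and derivatives of \<open>u\<close>, so that the regularity
  of \<open>1/u\<close> improves together with that of \<open>u\<close>.
\<close>

lemma Ck_on_inverse:
  fixes u :: "'a::real_normed_vector \<Rightarrow> real"
  assumes "\<And>x. x \<in> U \<Longrightarrow> u x \<noteq> 0"
  shows "open U \<Longrightarrow> Ck_on k U u \<Longrightarrow> Ck_on k U (\<lambda>x. inverse (u x))"
proof (induction k)
  case 0
  then show ?case using assms by (auto intro!: continuous_intros)
next
  case (Suc k)
  have "((\<lambda>x. inverse (u x)) has_derivative
      (\<lambda>v. - (inverse (u x) * frechet_derivative u (at x) v * inverse (u x)))) (at x)" if "x \<in> U" for x
    by (rule Deriv.has_derivative_inverse[OF assms[OF that] Ck_on_Suc_has_derivative[OF Suc.prems(2) that]])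
  moreover have "Ck_on k U (\<lambda>x. inverse (u x))" using Suc Ck_on_Suc_D by blast
  then have "Ck_on k U (\<lambda>x. - (inverse (u x) * frechet_derivative u (at x) v * inverse (u x)))" for v
    using Suc.prems
    by (intro Ck_on_bounded_linear[OF bounded_linear_minus[OF bounded_linear_ident]]
        Ck_on_bounded_bilinear[OF bounded_bilinear_mult]) auto
  ultimately show ?case by (rule Ck_on_SucI[OF Suc.prems(1)])
qed

subsection \<open>Smoothness\<close>

lemma smooth_on_cong: "open U \<Longrightarrow> (\<And>x. x \<in> U \<Longrightarrow> f x = g x) \<Longrightarrow> smooth_on U f \<longleftrightarrow> smooth_on U g"
  unfolding smooth_on_def using Ck_on_cong[of U f g] by simp

lemma smooth_on_has_derivative:
  "smooth_on U f \<Longrightarrow> x \<in> U \<Longrightarrow> (f has_derivative frechet_derivative f (at x)) (at x)"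
  unfolding smooth_on_def using Ck_on_Suc_has_derivative by blast

lemma smooth_on_frechet: "smooth_on U f \<Longrightarrow> smooth_on U (\<lambda>x. frechet_derivative f (at x) v)"
  unfolding smooth_on_def using Ck_on.simps(2) by blast

lemma smooth_on_continuous: "smooth_on U f \<Longrightarrow> continuous_on U f"
  unfolding smooth_on_def using Ck_on_continuous by blast

lemma smooth_on_const: "open U \<Longrightarrow> smooth_on U (\<lambda>_. c)"
  by (simp add: smooth_on_def Ck_on_const)

lemma smooth_on_add: "open U \<Longrightarrow> smooth_on U f \<Longrightarrow> smooth_on U g \<Longrightarrow> smooth_on U (\<lambda>x. f x + g x)"
  by (simp add: smooth_on_def Ck_on_add)

lemma smooth_on_linear: "bounded_linear L \<Longrightarrow> open U \<Longrightarrow> smooth_on U L"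
  by (simp add: smooth_on_def Ck_on_bounded_linear_self)

lemma smooth_on_bounded_linear:
  "bounded_linear L \<Longrightarrow> open U \<Longrightarrow> smooth_on U f \<Longrightarrow> smooth_on U (\<lambda>x. L (f x))"
  by (simp add: smooth_on_def Ck_on_bounded_linear)

lemma smooth_on_bounded_bilinear:
  "bounded_bilinear B \<Longrightarrow> open U \<Longrightarrow> smooth_on U f \<Longrightarrow> smooth_on U g \<Longrightarrow> smooth_on U (\<lambda>x. B (f x) (g x))"
  by (simp add: smooth_on_def Ck_on_bounded_bilinear)

lemma smooth_on_compose_linear:
  "bounded_linear L \<Longrightarrow> open V \<Longrightarrow> (\<And>x. x \<in> V \<Longrightarrow> L x \<in> U) \<Longrightarrow> smooth_on U f \<Longrightarrow> smooth_on V (\<lambda>x. f (L x))"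
  unfolding smooth_on_def using Ck_on_compose_linear by blast

lemma smooth_on_compose_real:
  "(\<And>n t. (g n has_vector_derivative g (Suc n) t) (at t)) \<Longrightarrow> open U \<Longrightarrow> smooth_on U u \<Longrightarrow>
     smooth_on U (\<lambda>x. g n (u x))"
  by (simp add: smooth_on_def Ck_on_compose_real)

lemma smooth_on_inverse:
  "(\<And>x. x \<in> U \<Longrightarrow> u x \<noteq> (0::real)) \<Longrightarrow> open U \<Longrightarrow> smooth_on U u \<Longrightarrow> smooth_on U (\<lambda>x. inverse (u x))"
  by (simp add: smooth_on_def Ck_on_inverse)

lemma smooth_on_mult:
  fixes f g :: "_ \<Rightarrow> 'a::real_normed_algebra"
  shows "open U \<Longrightarrow> smooth_on U f \<Longrightarrow> smooth_on U g \<Longrightarrow> smooth_on U (\<lambda>x. f x * g x)"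
  by (rule smooth_on_bounded_bilinear[OF bounded_bilinear_mult])

lemma smooth_on_of_real:
  "open U \<Longrightarrow> smooth_on U f \<Longrightarrow> smooth_on U (\<lambda>x. of_real (f x) :: complex)"
  by (rule smooth_on_bounded_linear[OF bounded_linear_of_real])

lemma smooth_on_minus: "open U \<Longrightarrow> smooth_on U f \<Longrightarrow> smooth_on U (\<lambda>x. - f x)"
  by (rule smooth_on_bounded_linear[OF bounded_linear_minus[OF bounded_linear_ident]])

lemma smooth_on_diff: "open U \<Longrightarrow> smooth_on U f \<Longrightarrow> smooth_on U g \<Longrightarrow> smooth_on U (\<lambda>x. f x - g x)"
  using smooth_on_add[of U f "\<lambda>x. - g x"] smooth_on_minus[of U g] by simp

lemma smooth_on_power:
  fixes f :: "_ \<Rightarrow> real"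
  shows "open U \<Longrightarrow> smooth_on U f \<Longrightarrow> smooth_on U (\<lambda>x. (f x) ^ n)"
  by (induction n) (auto intro: smooth_on_const smooth_on_mult)

lemma smooth_on_smult_vec:
  "open U \<Longrightarrow> smooth_on U c \<Longrightarrow> smooth_on U f \<Longrightarrow> smooth_on U (\<lambda>x. c x *s (f x :: complex^'n))"
  by (rule smooth_on_bounded_bilinear[OF bounded_bilinear_smult_vec])

text \<open>
  The derivatives of the sine are its translates by multiples of \<open>\<pi>/2\<close>; this family feeds the chain
  rule and covers the cosine as well.
\<close>

lemma smooth_on_sin_shift:
  assumes "open U" "smooth_on U u"
  shows "smooth_on U (\<lambda>x. sin (u x + real n * (pi / 2)))"
proof (rule smooth_on_compose_real[where g = "\<lambda>n t. sin (t + real n * (pi / 2))"])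
  fix n t
  have "sin (t + real (Suc n) * (pi / 2)) = sin ((t + real n * (pi / 2)) + pi / 2)"
    by (simp add: algebra_simps add_divide_distrib)
  also have "\<dots> = cos (t + real n * (pi / 2))"
    by (simp add: sin_add)
  finally show "((\<lambda>t. sin (t + real n * (pi / 2))) has_vector_derivative sin (t + real (Suc n) * (pi / 2))) (at t)"
    by (auto simp: has_real_derivative_iff_has_vector_derivative[symmetric] intro!: derivative_eq_intros)
qed (use assms in auto)

lemma smooth_on_sin:
  fixes u :: "_ \<Rightarrow> real"
  shows "open U \<Longrightarrow> smooth_on U u \<Longrightarrow> smooth_on U (\<lambda>x. sin (u x))"
  using smooth_on_sin_shift[of U u 0] by simp

lemma smooth_on_cos:
  fixes u :: "_ \<Rightarrow> real"
  shows "open U \<Longrightarrow> smooth_on U u \<Longrightarrow> smooth_on U (\<lambda>x. cos (u x))"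
  using smooth_on_sin_shift[of U u 1] by (simp add: sin_add)

subsection \<open>A smooth step\<close>

text \<open>
  The flat functions \<open>p(1/x) exp(-1/x)\<close>, extended by zero to \<open>x \<le> 0\<close>, are closed under
  differentiation; this is what makes \<open>exp(-1/x)\<close> smooth at the origin.
\<close>

definition flat :: "real poly \<Rightarrow> real \<Rightarrow> real" where
  "flat p x = (if x > 0 then poly p (1 / x) * exp (- 1 / x) else 0)"

definition flat_deriv_poly :: "real poly \<Rightarrow> real poly" where
  "flat_deriv_poly p = [:0, 0, 1:] * (p - pderiv p)"

lemma poly_exp_tendsto_0: "((\<lambda>y. poly p y * exp (- y)) \<longlongrightarrow> (0::real)) at_top"
proof -
  have "((\<lambda>y. \<Sum>i\<le>degree p. coeff p i * (y ^ i / exp y)) \<longlongrightarrow> (\<Sum>i\<le>degree p. coeff p i * 0)) at_top"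
    by (intro tendsto_sum tendsto_mult tendsto_const tendsto_power_div_exp_0)
  then show ?thesis
    by (simp add: poly_altdef sum_distrib_right exp_minus divide_inverse mult.assoc)
qed

lemma flat_derivative: "(flat p has_real_derivative flat (flat_deriv_poly p) x) (at x)"
proof -
  consider "x > 0" | "x < 0" | "x = 0" by linarith
  then show ?thesis
  proof cases
    case 1
    have "((\<lambda>x. poly p (1 / x) * exp (- 1 / x)) has_real_derivative flat (flat_deriv_poly p) x) (at x)"
      using 1 by (auto intro!: derivative_eq_intros
          simp: flat_def flat_deriv_poly_def field_simps power2_eq_square)
    then show ?thesis
      unfolding has_field_derivative_def
      by (rule has_derivative_transform_within_open[of _ _ _ _ "{0<..}"]) (use 1 in \<open>auto simp: flat_def\<close>)
  next
    case 2
    have "((\<lambda>x. 0) has_real_derivative flat (flat_deriv_poly p) x) (at x)"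
      using 2 by (simp add: flat_def)
    then show ?thesis
      unfolding has_field_derivative_def
      by (rule has_derivative_transform_within_open[of _ _ _ _ "{..<0}"]) (use 2 in \<open>auto simp: flat_def\<close>)
  next
    case 3
    \<comment> \<open>the difference quotient at the origin is the flat function of \<open>X p\<close>\<close>
    have "((\<lambda>h. poly (pCons 0 p) (inverse h) * exp (- inverse h)) \<longlongrightarrow> 0) (at_right 0)"
      by (rule filterlim_compose[OF poly_exp_tendsto_0 filterlim_inverse_at_top_right])
    moreover have "eventually (\<lambda>h. poly (pCons 0 p) (inverse h) * exp (- inverse h) = flat p h / h) (at_right 0)"
      by (auto simp: eventually_at_filter flat_def field_simps)
    ultimately have r: "((\<lambda>h. flat p h / h) \<longlongrightarrow> 0) (at_right 0)"
      by (rule Lim_transform_eventually)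
    have "eventually (\<lambda>h. 0 = flat p h / h) (at_left 0)"
      by (auto simp: eventually_at_filter flat_def)
    then have "((\<lambda>h. flat p h / h) \<longlongrightarrow> 0) (at_left 0)"
      by (rule Lim_transform_eventually[OF tendsto_const])
    with r have "((\<lambda>h. flat p h / h) \<longlongrightarrow> 0) (at 0)"
      by (simp add: filterlim_split_at_real)
    then show ?thesis using 3 by (simp add: DERIV_def flat_def)
  qed
qed

lemma smooth_on_flat:
  assumes "open U" "smooth_on U u"
  shows "smooth_on U (\<lambda>x. flat p (u x))"
proof -
  have "smooth_on U (\<lambda>x. (\<lambda>n. flat ((flat_deriv_poly ^^ n) p)) 0 (u x))"
    by (rule smooth_on_compose_real)
      (use assms flat_derivative in \<open>auto simp: has_real_derivative_iff_has_vector_derivative[symmetric]\<close>)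
  then show ?thesis by simp
qed

text \<open>
  A smooth function which is \<open>0\<close> for \<open>x \<le> 0\<close> and \<open>1\<close> for \<open>x \<ge> 1\<close>.
\<close>

definition smooth_step :: "real \<Rightarrow> real" where
  "smooth_step x = flat 1 x * inverse (flat 1 x + flat 1 (1 - x))"

lemma flat_one_nonneg: "0 \<le> flat 1 x" and flat_one_pos: "x > 0 \<Longrightarrow> 0 < flat 1 x"
  by (auto simp: flat_def)

lemma flat_denominator_pos: "flat 1 x + flat 1 (1 - x) > 0"
  using flat_one_pos[of x] flat_one_pos[of "1 - x"] flat_one_nonneg[of x] flat_one_nonneg[of "1 - x"]
  by (cases "x > 0") auto

lemma smooth_step_eq_0: "x \<le> 0 \<Longrightarrow> smooth_step x = 0"
  by (simp add: smooth_step_def flat_def)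

lemma smooth_step_eq_1: "x \<ge> 1 \<Longrightarrow> smooth_step x = 1"
  by (simp add: smooth_step_def flat_def)

lemma smooth_step_bounds: "0 \<le> smooth_step x" "smooth_step x \<le> 1"
  using flat_denominator_pos[of x] flat_one_nonneg[of x] flat_one_nonneg[of "1 - x"]
  by (auto simp: smooth_step_def divide_inverse[symmetric] divide_le_eq_1)

lemma smooth_on_smooth_step:
  assumes "open U" "smooth_on U u"
  shows "smooth_on U (\<lambda>x. smooth_step (u x))"
  unfolding smooth_step_def using assms flat_denominator_pos
  by (intro smooth_on_mult smooth_on_inverse smooth_on_add smooth_on_flat smooth_on_diff smooth_on_const)
    (auto simp: less_le)

section \<open>Coordinates and Riemannian measures\<close>

subsection \<open>Measures given in coordinates\<close>

text \<open>
  Both Riemannian measures are images of a density in coordinates.  Integrals and statements almost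
  everywhere are pulled back to Lebesgue measure here once for both.
\<close>

locale coordinate_measure =
  fixes D :: "'a::euclidean_space set" and w :: "'a \<Rightarrow> real" and F :: "'a \<Rightarrow> 'b::topological_space"
    and S :: "'b set" and M :: "'b measure"
  assumes D: "D \<in> sets borel" and w: "continuous_on UNIV w" and w_pos: "\<And>x. x \<in> D \<Longrightarrow> w x > 0"
    and F: "continuous_on D F" and F_S: "\<And>x. x \<in> D \<Longrightarrow> F x \<in> S"
    and M: "M = distr (density (restrict_space lborel D) (\<lambda>x. ennreal (w x))) (restrict_space borel S) F"
begin

lemma sets_M: "sets M = sets (restrict_space borel S)" and space_M: "space M = S"
  by (simp_all add: M space_restrict_space)

lemma measurable_M: "measurable M N = measurable (restrict_space borel S) N"
  by (rule measurable_cong_sets) (simp_all add: sets_M)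

lemma measurable_w [measurable]: "w \<in> borel_measurable borel"
  by (rule borel_measurable_continuous_onI[OF w])

lemma measurable_w_restrict: "w \<in> borel_measurable (restrict_space lborel D)"
  by (rule measurable_restrict_space1) measurable

lemma measurable_F: "F \<in> measurable (restrict_space borel D) (restrict_space borel S)"
  by (rule measurable_restrict_space2)
    (auto simp: space_restrict_space F_S intro: borel_measurable_continuous_on_restrict[OF F])

lemma measurable_F_lborel: "F \<in> measurable (restrict_space lborel D) (restrict_space borel S)"
  using measurable_F measurable_cong_sets[of "restrict_space lborel D" "restrict_space borel D"]
  by (simp add: sets_restrict_space)

lemma measurable_F_density:
  "F \<in> measurable (density (restrict_space lborel D) (\<lambda>x. ennreal (w x))) (restrict_space borel S)"
  using measurable_F_lborel by (simp add: measurable_density_eq1)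

lemma AE_w: "AE x in restrict_space lborel D. 0 \<le> w x"
  using w_pos by (intro AE_I2) (auto simp: space_restrict_space less_imp_le)

lemma integral_M:
  fixes g :: "'b \<Rightarrow> 'c::{banach, second_countable_topology}"
  assumes g: "g \<in> borel_measurable M"
  shows "integral\<^sup>L M g = (LINT x:D|lborel. w x *\<^sub>R g (F x))"
    and "integrable M g \<longleftrightarrow> set_integrable lborel D (\<lambda>x. w x *\<^sub>R g (F x))"
proof -
  have g': "g \<in> borel_measurable (restrict_space borel S)" using g by (simp add: measurable_M)
  have gF: "(\<lambda>x. g (F x)) \<in> borel_measurable (restrict_space lborel D)"
    by (rule measurable_compose[OF measurable_F_lborel g'])
  show "integral\<^sup>L M g = (LINT x:D|lborel. w x *\<^sub>R g (F x))"
    unfolding M integral_distr[OF measurable_F_density g'] integral_density[OF gF measurable_w_restrict AE_w]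
    by (simp add: Bochner_Integration.integral_restrict_space D set_lebesgue_integral_def)
  show "integrable M g \<longleftrightarrow> set_integrable lborel D (\<lambda>x. w x *\<^sub>R g (F x))"
    unfolding M integrable_distr_eq[OF measurable_F_density g'] integrable_density[OF gF measurable_w_restrict AE_w]
    by (simp add: integrable_restrict_space D set_integrable_def)
qed

lemma AE_M:
  assumes P: "{y \<in> S. P y} \<in> sets M"
  shows "(AE y in M. P y) \<longleftrightarrow> (AE x in lborel. x \<in> D \<longrightarrow> P (F x))"
proof -
  have "(AE y in M. P y) \<longleftrightarrow> (AE x in density (restrict_space lborel D) (\<lambda>x. ennreal (w x)). P (F x))"
    unfolding M using P
    by (intro AE_distr_iff[OF measurable_F_density]) (simp add: sets_M space_restrict_space)
  also have "\<dots> \<longleftrightarrow> (AE x in restrict_space lborel D. 0 < ennreal (w x) \<longrightarrow> P (F x))"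
    using measurable_w_restrict by (intro AE_density) simp
  also have "\<dots> \<longleftrightarrow> (AE x in lborel. x \<in> D \<longrightarrow> P (F x))"
    using w_pos by (simp add: AE_restrict_space_iff D)
  finally show ?thesis .
qed

lemma finite_measure_M:
  assumes "bounded D" "\<And>x. x \<in> D \<Longrightarrow> w x \<le> 1"
  shows "finite_measure M"
proof
  have "set_integrable lborel D (\<lambda>x. w x *\<^sub>R (1::real))"
    unfolding set_integrable_def
  proof (rule integrableI_bounded_set[where A = D and B = 1])
    show "emeasure lborel D < \<infinity>" by (rule emeasure_bounded_finite[OF assms(1)])
    show "AE x in lborel. x \<in> D \<longrightarrow> norm (indicator D x *\<^sub>R w x *\<^sub>R (1::real)) \<le> 1"
      using assms(2) w_pos by (auto simp: less_imp_le)
  qed (use D in auto)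
  then have "integrable M (\<lambda>_. 1 :: real)" by (simp add: integral_M(2))
  then have "(\<integral>\<^sup>+x. ennreal (norm (1::real)) \<partial>M) < \<infinity>" by (simp add: integrable_iff_bounded)
  then show "emeasure M (space M) \<noteq> \<infinity>" by simp
qed

lemma measurable_comp_F:
  assumes "g \<in> borel_measurable M"
  shows "(\<lambda>x. indicator D x *\<^sub>R (g (F x) :: 'c::{banach, second_countable_topology})) \<in> borel_measurable borel"
proof -
  have "(\<lambda>x. g (F x)) \<in> borel_measurable (restrict_space borel D)"
    by (rule measurable_compose[OF measurable_F]) (use assms in \<open>simp add: measurable_M\<close>)
  then show ?thesis by (simp add: borel_measurable_restrict_space_iff D)
qed

end

subsection \<open>Polar coordinates\<close>

definition angles :: "(real \<times> real) set" where
  "angles = {0..<2*pi} \<times> {0..<2*pi}"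

definition dom4 :: "(real \<times> real \<times> real \<times> real) set" where
  "dom4 = {0..<2*pi} \<times> {0..<2*pi} \<times> rect"

definition dens4 :: "real \<times> real \<times> real \<times> real \<Rightarrow> real" where
  "dens4 = (\<lambda>(t1, t2, ph, ps). (cos ph * cos ps) * (sin ph * cos ps) * cos ps)"

lemma open_rect: "open rect"
  by (simp add: rect_def open_Times)

lemma open_cover: "open ((UNIV :: real set) \<times> (UNIV :: real set) \<times> rect)"
  by (simp add: open_Times open_rect)

lemma rect_trig:
  assumes "(ph, ps) \<in> rect"
  shows "cos ph > 0" "sin ph > 0" "cos ps > 0"
  using assms by (auto simp: rect_def intro!: cos_gt_zero_pi sin_gt_zero)

lemma sphere_coordinates_le_1:
  fixes x y z :: real
  assumes "x\<^sup>2 + y\<^sup>2 + z\<^sup>2 = 1"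
  shows "\<bar>x\<bar> \<le> 1" "\<bar>y\<bar> \<le> 1" "\<bar>z\<bar> \<le> 1"
proof -
  have "x\<^sup>2 \<le> 1" "y\<^sup>2 \<le> 1" "z\<^sup>2 \<le> 1"
    using assms zero_le_power2[of x] zero_le_power2[of y] zero_le_power2[of z] by linarith+
  then show "\<bar>x\<bar> \<le> 1" "\<bar>y\<bar> \<le> 1" "\<bar>z\<bar> \<le> 1" by (simp_all add: abs_square_le_1)
qed

lemma sph4_eq: "sph4 (t1, t2, ph, ps) =
    (cis t1 * of_real (cos ph * cos ps), cis t2 * of_real (sin ph * cos ps), sin ps)"
  by (simp add: sph4_def)

lemma sph2_eq: "sph2 (ph, ps) = (cos ph * cos ps, sin ph * cos ps, sin ps)"
  by (simp add: sph2_def)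

lemma norm_cis_mult: "cmod (cis t * of_real r) = \<bar>r\<bar>"
  by (simp add: norm_mult)

lemma sphere_identity: "(cos ph * cos ps)\<^sup>2 + (sin ph * cos ps)\<^sup>2 + (sin ps)\<^sup>2 = (1::real)"
  by (simp add: power_mult_distrib distrib_right[symmetric])

lemma sph4_in: assumes "(ph, ps) \<in> rect" shows "sph4 (t1, t2, ph, ps) \<in> S4_0"
  using rect_trig[OF assms] sphere_identity[of ph ps]
  by (simp add: sph4_eq S4_0_def norm_mult power_mult_distrib)

lemma quot_sph4: assumes "(ph, ps) \<in> rect" shows "quot (sph4 (t1, t2, ph, ps)) = sph2 (ph, ps)"
  using rect_trig[OF assms] by (simp add: sph4_eq sph2_eq quot_def norm_mult)

text \<open>
  The latitude is read off from \<open>z\<close>, and rescaling by its cosine leaves a point on the unit circle in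
  the positive quadrant of the plane.
\<close>

lemma quadrant_polar:
  assumes "x\<^sup>2 + y\<^sup>2 + z\<^sup>2 = 1" "x > 0" "y > 0"
  obtains ph ps where "(ph, ps) \<in> rect" "x = cos ph * cos ps" "y = sin ph * cos ps" "z = sin ps"
proof -
  have z: "z\<^sup>2 < 1" using assms by (smt (verit) zero_less_power)
  then have z': "-1 < z" "z < 1" using abs_square_less_1[of z] by auto
  define ps where "ps = arcsin z"
  have ps: "-pi/2 < ps" "ps < pi/2" "sin ps = z"
    using arcsin_lt_bounded[of z] z' by (auto simp: ps_def)
  then have c: "cos ps > 0" by (intro cos_gt_zero_pi) auto
  have c2: "(cos ps)\<^sup>2 = x\<^sup>2 + y\<^sup>2" using ps(3) assms(1) by (simp add: cos_squared_eq)
  then have "(x / cos ps)\<^sup>2 + (y / cos ps)\<^sup>2 = 1"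
    using c by (simp add: power_divide add_divide_distrib[symmetric] c2[symmetric])
  then obtain ph where ph: "0 \<le> ph" "ph \<le> pi/2" "x / cos ps = cos ph" "y / cos ps = sin ph"
    using sincos_total_pi_half[of "x / cos ps" "y / cos ps"] c assms by auto
  have "ph \<noteq> 0" using ph(4) assms c by auto
  moreover have "ph \<noteq> pi/2"
  proof
    assume "ph = pi/2"
    then have "x / cos ps = 0" unfolding ph(3) by (simp only: cos_pi_half)
    then show False using c assms by simp
  qed
  ultimately have "(ph, ps) \<in> rect" using ph ps by (auto simp: rect_def)
  moreover have "x = cos ph * cos ps" "y = sin ph * cos ps" using ph c by (auto simp: field_simps)
  ultimately show ?thesis using ps(3) that by blast
qed

lemma angle_reduce: obtains k :: int where "t + 2 * pi * of_int k \<in> {0..<2*pi}"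
proof (rule that[of "- floor (t / (2*pi))"])
  define n where "n = floor (t / (2*pi))"
  have "of_int n \<le> t / (2*pi)" "t / (2*pi) < of_int n + 1" unfolding n_def by linarith+
  then have "of_int n * (2*pi) \<le> t" "t < (of_int n + 1) * (2*pi)"
    by (simp_all only: pos_le_divide_eq pos_divide_less_eq pi_gt_zero zero_less_mult_iff zero_less_numeral simp_thms)
  then show "t + 2 * pi * of_int (- floor (t / (2*pi))) \<in> {0..<2*pi}"
    unfolding n_def[symmetric] by (simp add: algebra_simps)
qed

lemma cis_periodic: "cis (t + 2 * pi * of_int k) = cis t"
  by (simp add: complex_eq_iff sin_add cos_add)

lemma sph4_periodic: "sph4 (t1 + 2 * pi * of_int k1, t2 + 2 * pi * of_int k2, r) = sph4 (t1, t2, r)"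
  by (cases r) (simp add: sph4_eq cis_periodic)

lemma S4_0_polar:
  assumes "p \<in> S4_0"
  obtains t1 t2 ph ps where "(t1, t2, ph, ps) \<in> dom4" "p = sph4 (t1, t2, ph, ps)"
proof -
  obtain a b x where p: "p = (a, b, x)" by (cases p)
  have ab: "a \<noteq> 0" "b \<noteq> 0" "(norm a)\<^sup>2 + (norm b)\<^sup>2 + x\<^sup>2 = 1" using assms by (auto simp: p S4_0_def)
  then obtain ph ps where r: "(ph, ps) \<in> rect" "norm a = cos ph * cos ps" "norm b = sin ph * cos ps" "x = sin ps"
    using quadrant_polar[of "norm a" "norm b" x] by auto
  obtain k1 where k1: "Arg a + 2 * pi * of_int k1 \<in> {0..<2*pi}" by (rule angle_reduce)
  obtain k2 where k2: "Arg b + 2 * pi * of_int k2 \<in> {0..<2*pi}" by (rule angle_reduce)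
  have "a = cis (Arg a) * of_real (norm a)" "b = cis (Arg b) * of_real (norm b)"
    using rcis_cmod_Arg[of a] rcis_cmod_Arg[of b] by (simp_all add: rcis_def mult.commute)
  then have "p = sph4 (Arg a + 2 * pi * of_int k1, Arg b + 2 * pi * of_int k2, ph, ps)"
    unfolding sph4_periodic using r by (simp add: p sph4_eq)
  then show ?thesis using k1 k2 r(1) by (intro that) (auto simp: dom4_def)
qed

lemma Arg2pi_cis:
  assumes "0 \<le> t" "t < 2*pi" "r > 0"
  shows "Arg2pi (cis t * of_real r) = t"
  using Arg2pi_unique[of r t] assms by (simp add: cis_conv_exp mult.commute)

text \<open>
  An explicit inverse of the coordinates.  It shows that the chart is a Borel map, although it is
  discontinuous where one of the angles vanishes.
\<close>

definition polar4 :: "pt4 \<Rightarrow> real \<times> real \<times> real \<times> real" where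
  "polar4 = (\<lambda>(a, b, x). (Arg2pi a, Arg2pi b, arctan (norm b / norm a), arcsin x))"

lemma polar4_sph4: assumes "z \<in> dom4" shows "polar4 (sph4 z) = z"
proof -
  obtain t1 t2 ph ps where z: "z = (t1, t2, ph, ps)" by (cases z)
  have t: "0 \<le> t1" "t1 < 2*pi" "0 \<le> t2" "t2 < 2*pi" and r: "(ph, ps) \<in> rect"
    using assms by (auto simp: z dom4_def)
  note pos = rect_trig[OF r]
  have "sin ph * cos ps / (cos ph * cos ps) = tan ph" using pos by (simp add: tan_def)
  moreover have "arctan (tan ph) = ph" "arcsin (sin ps) = ps"
    using r by (auto simp: rect_def intro!: arctan_tan arcsin_sin)
  moreover have "cmod (cis t1 * of_real (cos ph * cos ps)) = cos ph * cos ps"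
    "cmod (cis t2 * of_real (sin ph * cos ps)) = sin ph * cos ps"
    using pos by (simp_all only: norm_cis_mult) simp_all
  ultimately show ?thesis
    using Arg2pi_cis[of t1 "cos ph * cos ps"] Arg2pi_cis[of t2 "sin ph * cos ps"] t pos
    by (simp add: z sph4_eq polar4_def del: of_real_mult)
qed

lemma inj_on_sph4: "inj_on sph4 dom4"
  by (rule inj_on_inverseI[of _ polar4]) (rule polar4_sph4)

lemma chart4_sph4: "z \<in> dom4 \<Longrightarrow> chart4 (sph4 z) = z"
  unfolding chart4_def dom4_def[symmetric] by (rule the_inv_into_f_f[OF inj_on_sph4])

lemma sph4_chart4: "p \<in> S4_0 \<Longrightarrow> sph4 (chart4 p) = p" and chart4_in: "p \<in> S4_0 \<Longrightarrow> chart4 p \<in> dom4"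
  by (metis S4_0_polar chart4_sph4)+

lemma chart4_eq_polar4: "p \<in> S4_0 \<Longrightarrow> chart4 p = polar4 p"
  by (metis S4_0_polar chart4_sph4 polar4_sph4)

lemma chart4_sph4_shift:
  assumes "(ph, ps) \<in> rect"
  obtains k1 k2 :: int where
    "chart4 (sph4 (t1, t2, ph, ps)) = (t1 + 2 * pi * of_int k1, t2 + 2 * pi * of_int k2, ph, ps)"
proof -
  obtain k1 where k1: "t1 + 2 * pi * of_int k1 \<in> {0..<2*pi}" by (rule angle_reduce)
  obtain k2 where k2: "t2 + 2 * pi * of_int k2 \<in> {0..<2*pi}" by (rule angle_reduce)
  have "chart4 (sph4 (t1 + 2 * pi * of_int k1, t2 + 2 * pi * of_int k2, ph, ps)) =
      (t1 + 2 * pi * of_int k1, t2 + 2 * pi * of_int k2, ph, ps)"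
    by (rule chart4_sph4) (use k1 k2 assms in \<open>simp add: dom4_def\<close>)
  then show ?thesis using that by (simp add: sph4_periodic)
qed

text \<open>
  The argument is continuous off the closed positive half axis, on which it vanishes.
\<close>

lemma borel_measurable_Arg2pi [measurable]: "Arg2pi \<in> borel_measurable borel"
proof -
  have cl: "closed (\<real>\<^sub>\<ge>\<^sub>0 :: complex set)" by (rule closed_nonneg_Reals_complex)
  have "(\<lambda>z. if z \<in> \<real>\<^sub>\<ge>\<^sub>0 then 0 else Arg2pi z) \<in> borel_measurable borel"
  proof (rule measurable_If_restrict_space_iff[THEN iffD2], goal_cases)
    case 1 show ?case using cl by simp
  next
    case 2
    have "continuous_on {z. z \<notin> \<real>\<^sub>\<ge>\<^sub>0} Arg2pi"
      by (intro continuous_at_imp_continuous_on ballI continuous_at_Arg2pi) auto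
    then show ?case by (auto intro: borel_measurable_continuous_on_restrict)
  qed
  moreover have "(\<lambda>z. if z \<in> \<real>\<^sub>\<ge>\<^sub>0 then 0 else Arg2pi z) = Arg2pi"
    by (auto simp: fun_eq_iff Arg2pi_eq_0 complex_nonneg_Reals_iff complex_is_Real_iff)
  ultimately show ?thesis by simp
qed

lemma borel_measurable_arcsin_on:
  "(\<lambda>p :: pt4. arcsin (snd (snd p))) \<in> borel_measurable (restrict_space borel S4_0)"
proof (rule borel_measurable_continuous_on_restrict, rule continuous_on_arcsin)
  have "\<bar>x\<bar> \<le> 1" if "(a, b, x) \<in> S4_0" for a b x
    using that sphere_coordinates_le_1(3)[of "norm a" "norm b" x] by (simp add: S4_0_def)
  then show "\<forall>x\<in>S4_0. - 1 \<le> snd (snd x) \<and> snd (snd x) \<le> 1"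
    by (force simp: abs_le_iff)
qed (intro continuous_intros)

lemma measurable_chart4: "chart4 \<in> measurable (restrict_space borel S4_0) borel"
proof -
  have [measurable]: "(\<lambda>p :: pt4. arcsin (snd (snd p))) \<in> borel_measurable (restrict_space borel S4_0)"
    by (rule borel_measurable_arcsin_on)
  have f [measurable]: "fst \<in> measurable (restrict_space borel S4_0) (borel :: complex measure)"
    "(\<lambda>p. fst (snd p)) \<in> measurable (restrict_space borel S4_0) (borel :: complex measure)"
    by (auto intro!: measurable_restrict_space1 borel_measurable_continuous_onI continuous_intros)
  have "(\<lambda>p. (Arg2pi (fst p), Arg2pi (fst (snd p)), arctan (norm (fst (snd p)) / norm (fst p)), arcsin (snd (snd p))))
      \<in> measurable (restrict_space borel S4_0) borel"
    by (intro borel_measurable_Pair; measurable)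
  then have "polar4 \<in> measurable (restrict_space borel S4_0) borel"
    by (simp add: polar4_def case_prod_unfold)
  then show ?thesis
    by (subst measurable_cong[of _ _ polar4]) (auto simp: space_restrict_space chart4_eq_polar4)
qed

lemma Q2_0_eq: "Q2_0 = {(x, y, z). x\<^sup>2 + y\<^sup>2 + z\<^sup>2 = 1 \<and> x > 0 \<and> y > 0}"
proof (intro set_eqI iffI)
  fix p assume "p \<in> Q2_0"
  then obtain ph ps where r: "(ph, ps) \<in> rect" "p = sph2 (ph, ps)" by (auto simp: Q2_0_def)
  show "p \<in> {(x, y, z). x\<^sup>2 + y\<^sup>2 + z\<^sup>2 = 1 \<and> x > 0 \<and> y > 0}"
    using r rect_trig[OF r(1)] sphere_identity[of ph ps] by (simp add: sph2_eq)
next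
  fix p assume "p \<in> {(x, y, z). x\<^sup>2 + y\<^sup>2 + z\<^sup>2 = 1 \<and> x > (0::real) \<and> y > 0}"
  then obtain x y z where "p = (x, y, z)" "x\<^sup>2 + y\<^sup>2 + z\<^sup>2 = 1" "x > 0" "y > 0" by auto
  with quadrant_polar[of x y z] show "p \<in> Q2_0"
    by (metis Q2_0_def image_eqI sph2_eq)
qed

lemma sph2_in: "r \<in> rect \<Longrightarrow> sph2 r \<in> Q2_0"
  by (simp add: Q2_0_def)

definition polar2 :: "pt2 \<Rightarrow> real \<times> real" where
  "polar2 = (\<lambda>(x, y, z). (arctan (y / x), arcsin z))"

lemma polar2_sph2: assumes "r \<in> rect" shows "polar2 (sph2 r) = r"
proof -
  obtain ph ps where r: "r = (ph, ps)" by (cases r)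
  note pos = rect_trig[OF assms[unfolded r]]
  have "sin ph * cos ps / (cos ph * cos ps) = tan ph" using pos by (simp add: tan_def)
  moreover have "arctan (tan ph) = ph" "arcsin (sin ps) = ps"
    using assms by (auto simp: r rect_def intro!: arctan_tan arcsin_sin)
  ultimately show ?thesis by (simp add: r sph2_eq polar2_def)
qed

lemma chart2_sph2: "r \<in> rect \<Longrightarrow> chart2 (sph2 r) = r"
  unfolding chart2_def
  by (rule the_inv_into_f_f[OF inj_on_inverseI[of _ polar2]]) (auto simp: polar2_sph2)

lemma sph2_chart2: "y \<in> Q2_0 \<Longrightarrow> sph2 (chart2 y) = y" and chart2_in: "y \<in> Q2_0 \<Longrightarrow> chart2 y \<in> rect"
  and chart2_eq_polar2: "y \<in> Q2_0 \<Longrightarrow> chart2 y = polar2 y"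
  by (auto simp: Q2_0_def chart2_sph2 polar2_sph2)

lemma continuous_polar2: "continuous_on Q2_0 polar2"
  unfolding polar2_def case_prod_unfold
proof (intro continuous_intros)
  have "\<bar>z\<bar> \<le> 1" if "(x, y, z) \<in> Q2_0" for x y z
    using that sphere_coordinates_le_1(3)[of x y z] by (simp add: Q2_0_eq)
  then show "\<forall>x\<in>Q2_0. - 1 \<le> snd (snd x) \<and> snd (snd x) \<le> 1" by (force simp: abs_le_iff)
qed (auto simp: Q2_0_eq)

lemma measurable_chart2: "chart2 \<in> measurable (restrict_space borel Q2_0) borel"
  using borel_measurable_continuous_on_restrict[OF continuous_polar2]
  by (subst measurable_cong[of _ _ polar2]) (auto simp: space_restrict_space chart2_eq_polar2)

lemma quot_in: "p \<in> S4_0 \<Longrightarrow> quot p \<in> Q2_0"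
  by (auto simp: S4_0_def Q2_0_eq quot_def)

lemma continuous_quot: "continuous_on A quot"
  unfolding quot_def case_prod_unfold by (intro continuous_intros)

lemma measurable_quot: "quot \<in> measurable (restrict_space borel S4_0) (restrict_space borel Q2_0)"
  by (rule measurable_restrict_space2)
    (auto simp: space_restrict_space quot_in intro: borel_measurable_continuous_on_restrict[OF continuous_quot])

lemma continuous_sph4: "continuous_on A sph4"
  unfolding sph4_def case_prod_unfold by (intro continuous_intros)

lemma continuous_sph2: "continuous_on A sph2"
  unfolding sph2_def case_prod_unfold by (intro continuous_intros)

lemma dom4_borel: "dom4 \<in> sets borel"
  unfolding dom4_def by (intro borel_Times) (auto simp: open_rect)

interpretation vol4: coordinate_measure dom4 dens4 sph4 S4_0 vol4
proof
  show "continuous_on UNIV dens4" unfolding dens4_def case_prod_unfold by (intro continuous_intros)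
  show "vol4 = distr (density (restrict_space lborel dom4) (\<lambda>x. ennreal (dens4 x))) (restrict_space borel S4_0) sph4"
    unfolding vol4_def dom4_def dens4_def by (simp add: case_prod_unfold)
  show "dens4 z > 0" "sph4 z \<in> S4_0" if "z \<in> dom4" for z
    using that by (auto simp: dens4_def dom4_def rect_trig sph4_in)
qed (auto simp: dom4_borel continuous_sph4)

definition dens2 :: "real \<times> real \<Rightarrow> real" where
  "dens2 r = cos (snd r)"

interpretation vol2: coordinate_measure rect dens2 sph2 Q2_0 vol2
proof
  show "continuous_on UNIV dens2" unfolding dens2_def by (intro continuous_intros)
  show "vol2 = distr (density (restrict_space lborel rect) (\<lambda>x. ennreal (dens2 x))) (restrict_space borel Q2_0) sph2"
    unfolding vol2_def dens2_def by (simp add: case_prod_unfold)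
qed (auto simp: open_rect continuous_sph2 sph2_in dens2_def dest!: rect_trig)

lemma finite_measure_vol4: "finite_measure vol4"
proof (rule vol4.finite_measure_M)
  show "bounded dom4" by (auto simp: dom4_def rect_def intro!: bounded_Times)
  have "\<bar>dens4 x\<bar> \<le> 1" for x
    unfolding dens4_def by (auto simp: abs_mult case_prod_unfold intro!: mult_le_one)
  then show "dens4 x \<le> 1" for x by (simp add: abs_le_iff)
qed

lemma finite_measure_vol2: "finite_measure vol2"
  by (rule vol2.finite_measure_M) (auto simp: rect_def dens2_def intro!: bounded_Times)

subsection \<open>Integration along the torus orbits\<close>

lemma reorder_measurable:
  "(\<lambda>z :: (real \<times> real) \<times> (real \<times> real). (fst (snd z), snd (snd z), fst z)) \<in> borel_measurable (lborel \<Otimes>\<^sub>M lborel)"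
  unfolding lborel_prod measurable_lborel2 by (intro borel_measurable_continuous_onI continuous_intros)

text \<open>
  Puts the coordinates of the quadrant before the angles, so that Fubini's theorem integrates along the
  orbits first.
\<close>

lemma lborel_reorder:
  "distr (lborel \<Otimes>\<^sub>M lborel) lborel (\<lambda>z :: (real \<times> real) \<times> (real \<times> real). (fst (snd z), snd (snd z), fst z)) = lborel"
proof (rule measure_eqI)
  let ?h = "\<lambda>z :: (real \<times> real) \<times> (real \<times> real). (fst (snd z), snd (snd z), fst z)"
  note h [measurable] = reorder_measurable
  fix X assume "X \<in> sets (distr (lborel \<Otimes>\<^sub>M lborel) lborel ?h)"
  then have X [measurable]: "X \<in> sets borel" by simp
  have m [measurable]: "(\<lambda>z. indicator X z :: ennreal) \<in> borel_measurable (borel \<Otimes>\<^sub>M borel \<Otimes>\<^sub>M borel \<Otimes>\<^sub>M borel)"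
    "(\<lambda>z. indicator X z :: ennreal) \<in> borel_measurable (lborel \<Otimes>\<^sub>M (lborel \<Otimes>\<^sub>M lborel))"
    by (simp_all add: borel_prod lborel_prod)
  have "emeasure (distr (lborel \<Otimes>\<^sub>M lborel) lborel ?h) X = (\<integral>\<^sup>+z. indicator X (?h z) \<partial>(lborel \<Otimes>\<^sub>M lborel))"
    using h by (subst nn_integral_distr[symmetric, where f = "indicator X" and M' = lborel]) (auto simp: nn_integral_indicator)
  also have "\<dots> = (\<integral>\<^sup>+t. \<integral>\<^sup>+r. indicator X (fst t, snd t, r) \<partial>lborel \<partial>lborel)"
    by (subst lborel_pair.nn_integral_snd[symmetric]) (auto intro: measurable_compose[OF h])
  also have "\<dots> = (\<integral>\<^sup>+t. \<integral>\<^sup>+r. indicator X (fst t, snd t, r) \<partial>lborel \<partial>(lborel \<Otimes>\<^sub>M lborel))"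
    by (simp add: lborel_prod)
  also have "\<dots> = (\<integral>\<^sup>+t1. \<integral>\<^sup>+t2. \<integral>\<^sup>+r. indicator X (t1, t2, r) \<partial>lborel \<partial>lborel \<partial>lborel)"
  proof -
    have "(\<lambda>z :: (real \<times> real) \<times> (real \<times> real). (fst (fst z), snd (fst z), snd z)) \<in> borel_measurable (lborel \<Otimes>\<^sub>M lborel)"
      unfolding lborel_prod measurable_lborel2 by (intro borel_measurable_continuous_onI continuous_intros)
    from measurable_compose[OF this, of "\<lambda>z. indicator X z :: ennreal" borel]
    have "(\<lambda>t. \<integral>\<^sup>+r. indicator X (fst t, snd t, r) \<partial>lborel) \<in> borel_measurable (lborel :: (real \<times> real) measure)"
      by (intro lborel.borel_measurable_nn_integral) (simp add: case_prod_unfold)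
    then show ?thesis
      by (subst lborel.nn_integral_fst[symmetric]) (simp_all add: lborel_prod)
  qed
  also have "\<dots> = (\<integral>\<^sup>+t1. \<integral>\<^sup>+z. indicator X (t1, z) \<partial>(lborel \<Otimes>\<^sub>M lborel) \<partial>lborel)"
    by (subst lborel.nn_integral_fst[symmetric]) (simp_all add: lborel_prod)
  also have "\<dots> = (\<integral>\<^sup>+z. indicator X z \<partial>(lborel \<Otimes>\<^sub>M (lborel \<Otimes>\<^sub>M lborel)))"
    by (subst lborel_prod)+ (subst lborel.nn_integral_fst, simp_all add: lborel_prod)
  also have "\<dots> = emeasure lborel X" by (simp add: lborel_prod nn_integral_indicator)
  finally show "emeasure (distr (lborel \<Otimes>\<^sub>M lborel) lborel ?h) X = emeasure lborel X" .
qed simp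

definition fibre_integral :: "(pt4 \<Rightarrow> complex) \<Rightarrow> real \<times> real \<Rightarrow> complex" where
  "fibre_integral u r = (LINT t:angles|lborel. u (sph4 (fst t, snd t, r)))"

text \<open>
  The density, in the two angles, of the volume of an orbit.
\<close>

definition orbit_weight :: "real \<times> real \<Rightarrow> real" where
  "orbit_weight r = sin (fst r) * cos (fst r) * (cos (snd r))\<^sup>2"

lemma angles_borel: "angles \<in> sets borel"
  unfolding angles_def by (intro borel_Times) auto

lemma angles_finite: "emeasure lborel angles < \<infinity>"
  by (rule emeasure_bounded_finite) (auto simp: angles_def intro!: bounded_Times)

context
  fixes u :: "pt4 \<Rightarrow> complex" and C :: real
  assumes u: "u \<in> borel_measurable (restrict_space borel S4_0)"
    and bound: "\<And>p. p \<in> S4_0 \<Longrightarrow> cmod (u p) \<le> C"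
begin

text \<open>
  Extension by zero to all coordinates, for the use of Fubini's theorem on products of Lebesgue measures.
\<close>

definition fibre_integrand :: "(real \<times> real) \<times> (real \<times> real) \<Rightarrow> complex" where
  "fibre_integrand z = indicator dom4 (fst (snd z), snd (snd z), fst z) *\<^sub>R u (sph4 (fst (snd z), snd (snd z), fst z))"

lemma fibre_integrand_measurable: "fibre_integrand \<in> borel_measurable (lborel \<Otimes>\<^sub>M lborel)"
proof -
  have "(\<lambda>x. indicator dom4 x *\<^sub>R u (sph4 x)) \<in> borel_measurable borel"
    by (rule vol4.measurable_comp_F) (simp add: vol4.measurable_M u)
  from measurable_compose[OF reorder_measurable this] show ?thesis
    by (simp add: fibre_integrand_def[abs_def])
qed

lemma fibre_integrand_bound: "cmod (fibre_integrand (r, t)) \<le> \<bar>C\<bar> * indicator angles t"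
  using bound[of "sph4 (fst t, snd t, r)"] sph4_in[of "fst r" "snd r" "fst t" "snd t"]
  by (auto simp: fibre_integrand_def indicator_def dom4_def angles_def mem_Times_iff)

lemma fibre_integrand_integrable: "integrable lborel (\<lambda>t. fibre_integrand (r, t))"
proof (rule Bochner_Integration.integrable_bound)
  show "integrable lborel (\<lambda>t. \<bar>C\<bar> * indicator angles t :: real)"
    using angles_finite angles_borel by (intro integrable_mult_right integrable_real_indicator) auto
  show "(\<lambda>t. fibre_integrand (r, t)) \<in> borel_measurable lborel"
    using measurable_compose[OF measurable_Pair1'[of r lborel lborel] fibre_integrand_measurable] by simp
  show "AE t in lborel. norm (fibre_integrand (r, t)) \<le> norm (\<bar>C\<bar> * indicator angles t :: real)"
    using fibre_integrand_bound by (simp add: abs_mult)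
qed

lemma fibre_integrand_eq:
  assumes "r \<in> rect"
  shows "fibre_integrand (r, t) = indicator angles t *\<^sub>R u (sph4 (fst t, snd t, r))"
  using assms by (cases t) (simp add: fibre_integrand_def dom4_def angles_def indicator_def)

lemma integral_fibre_integrand:
  "(LINT t|lborel. fibre_integrand (r, t)) = indicator rect r *\<^sub>R fibre_integral u r"
proof (cases "r \<in> rect")
  case True
  then show ?thesis by (simp add: fibre_integrand_eq fibre_integral_def set_lebesgue_integral_def)
next
  case False
  then show ?thesis by (simp add: fibre_integrand_def dom4_def)
qed

lemma fibre_integral_bound:
  assumes "r \<in> rect"
  shows "cmod (fibre_integral u r) \<le> \<bar>C\<bar> * measure lborel angles"
proof -
  have "cmod (LINT t|lborel. fibre_integrand (r, t)) \<le> (LINT t|lborel. \<bar>C\<bar> * indicator angles t)"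
    by (rule Bochner_Integration.integral_norm_bound_integral[OF fibre_integrand_integrable])
      (use angles_finite angles_borel fibre_integrand_bound in \<open>auto intro!: integrable_mult_right integrable_real_indicator\<close>)
  then show ?thesis using assms by (simp add: integral_fibre_integrand)
qed

lemma fibre_integral_measurable: "(\<lambda>y. fibre_integral u (chart2 y)) \<in> borel_measurable vol2"
proof -
  have "(\<lambda>r. LINT t|lborel. fibre_integrand (r, t)) \<in> borel_measurable lborel"
    by (rule lborel.borel_measurable_lebesgue_integral)
      (use fibre_integrand_measurable in \<open>simp add: case_prod_eta\<close>)
  then have "(\<lambda>r. LINT t|lborel. fibre_integrand (r, t)) \<in> borel_measurable borel" by simp
  from measurable_compose[OF measurable_chart2 this] show ?thesis
    unfolding vol2.measurable_M
    by (subst measurable_cong[where g = "\<lambda>y. LINT t|lborel. fibre_integrand (chart2 y, t)"])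
      (auto simp: space_restrict_space integral_fibre_integrand chart2_in)
qed

text \<open>
  In coordinates the density of the sphere is the product of \<open>orbit_weight\<close> and the density of the
  quadrant.  As \<open>u\<close> is bounded and the angles range over a bounded set, the integrability of \<open>v\<close>
  suffices for Fubini's theorem.
\<close>

lemma vol4_disintegration:
  fixes v :: "pt2 \<Rightarrow> complex"
  assumes v: "integrable vol2 v"
  shows "integrable vol4 (\<lambda>p. u p * v (quot p))"
    and "(LINT p|vol4. u p * v (quot p)) =
      (LINT y|vol2. fibre_integral u (chart2 y) * of_real (orbit_weight (chart2 y)) * v y)"
proof -
  have vm: "v \<in> borel_measurable vol2" using v by auto
  let ?h = "\<lambda>z :: (real \<times> real) \<times> (real \<times> real). (fst (snd z), snd (snd z), fst z)"
  have h: "?h \<in> measurable (lborel \<Otimes>\<^sub>M lborel) lborel"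
    unfolding measurable_lborel1 by (rule reorder_measurable)
  have g: "(\<lambda>p. u p * v (quot p)) \<in> borel_measurable vol4"
    unfolding vol4.measurable_M
    using u measurable_compose[OF measurable_quot vm[unfolded vol2.measurable_M]] by measurable
  define V where "V r = indicator rect r *\<^sub>R (dens2 r *\<^sub>R v (sph2 r))" for r
  have Vi: "integrable lborel V"
    using v vol2.integral_M(2)[OF vm] by (simp add: V_def[abs_def] set_integrable_def)
  have Vm [measurable]: "V \<in> borel_measurable lborel" using Vi by auto
  let ?H = "\<lambda>z. indicator dom4 z *\<^sub>R (dens4 z *\<^sub>R (u (sph4 z) * v (quot (sph4 z))))"
  let ?G = "\<lambda>z. fibre_integrand z * (of_real (orbit_weight (fst z)) * V (fst z))"
  have HG: "?H (?h z) = ?G z" for z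
  proof (cases "?h z \<in> dom4")
    case True
    obtain ph ps where r: "fst z = (ph, ps)" by (cases "fst z")
    have "(ph, ps) \<in> rect" using True by (simp add: dom4_def r)
    then show ?thesis using True
      by (simp add: fibre_integrand_def V_def quot_sph4 r dens4_def dens2_def orbit_weight_def
          scaleR_conv_of_real power2_eq_square)
  qed (simp add: fibre_integrand_def)
  have ow [measurable]: "(\<lambda>r. of_real (orbit_weight r) :: complex) \<in> borel_measurable lborel"
    unfolding orbit_weight_def by (simp, intro borel_measurable_continuous_onI continuous_intros)
  have ow1: "\<bar>orbit_weight r\<bar> \<le> 1" for r
    by (auto simp: orbit_weight_def abs_mult abs_square_le_1 intro!: mult_le_one)
  have Gm [measurable]: "?G \<in> borel_measurable (lborel \<Otimes>\<^sub>M lborel)"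
    using fibre_integrand_measurable by measurable
  have Hm: "?H \<in> borel_measurable lborel"
  proof -
    have "(\<lambda>x. dens4 x *\<^sub>R (indicator dom4 x *\<^sub>R (u (sph4 x) * v (quot (sph4 x))))) \<in> borel_measurable borel"
      using vol4.measurable_comp_F[OF g] vol4.measurable_w by measurable
    then show ?thesis by (simp add: mult.commute)
  qed
  have "integrable (lborel \<Otimes>\<^sub>M lborel) ?G"
  proof (rule lborel_pair.Fubini_integrable[OF Gm])
    show "integrable lborel (\<lambda>r. LINT t|lborel. norm (?G (r, t)))"
    proof (rule Bochner_Integration.integrable_bound)
      show "integrable lborel (\<lambda>r. (\<bar>C\<bar> * measure lborel angles) * norm (V r))"
        using Vi by auto
      have "(\<lambda>z. norm (?G z)) \<in> borel_measurable (lborel \<Otimes>\<^sub>M lborel)" by measurable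
      then show "(\<lambda>r. LINT t|lborel. norm (?G (r, t))) \<in> borel_measurable lborel"
        by (intro lborel.borel_measurable_lebesgue_integral) (simp add: case_prod_unfold)
      have "(LINT t|lborel. norm (?G (r, t))) \<le> (LINT t|lborel. (\<bar>C\<bar> * norm (V r)) * indicator angles t)" for r
      proof (rule integral_mono)
        show "integrable lborel (\<lambda>t. norm (?G (r, t)))"
          using fibre_integrand_integrable[of r] by (auto intro!: integrable_norm)
        show "integrable lborel (\<lambda>t. (\<bar>C\<bar> * norm (V r)) * indicator angles t)"
          using angles_finite angles_borel by (intro integrable_mult_right integrable_real_indicator) auto
        fix t
        have "norm (?G (r, t)) = norm (fibre_integrand (r, t)) * (\<bar>orbit_weight r\<bar> * norm (V r))"
          by (simp add: norm_mult)
        also have "\<dots> \<le> (\<bar>C\<bar> * indicator angles t) * (1 * norm (V r))"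
          by (intro mult_mono fibre_integrand_bound ow1) auto
        finally show "norm (?G (r, t)) \<le> (\<bar>C\<bar> * norm (V r)) * indicator angles t" by (simp add: mult_ac)
      qed
      then show "AE r in lborel. norm (LINT t|lborel. norm (?G (r, t))) \<le> norm ((\<bar>C\<bar> * measure lborel angles) * norm (V r))"
        by (simp add: mult_ac abs_mult)
    qed
    show "AE r in lborel. integrable lborel (\<lambda>t. ?G (r, t))"
      using fibre_integrand_integrable by simp
  qed
  note Gi = this
  have "integrable (lborel \<Otimes>\<^sub>M lborel) (\<lambda>z. ?H (?h z))" using Gi by (simp only: HG)
  then have Hi: "integrable lborel ?H"
    using integrable_distr_eq[OF h, of ?H] Hm by (simp only: lborel_reorder)
  then show "integrable vol4 (\<lambda>p. u p * v (quot p))"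
    by (simp only: vol4.integral_M(2)[OF g] set_integrable_def)
  have "(LINT p|vol4. u p * v (quot p)) = integral\<^sup>L lborel ?H"
    by (simp only: vol4.integral_M(1)[OF g] set_lebesgue_integral_def)
  also have "\<dots> = (LINT z|(lborel \<Otimes>\<^sub>M lborel). ?G z)"
    using integral_distr[OF h, of ?H] Hm by (simp only: lborel_reorder HG)
  also have "\<dots> = (LINT r|lborel. LINT t|lborel. ?G (r, t))"
    by (rule lborel_pair.integral_fst'[symmetric, OF Gi])
  also have "\<dots> = (LINT r:rect|lborel. dens2 r *\<^sub>R
      (fibre_integral u (chart2 (sph2 r)) * of_real (orbit_weight (chart2 (sph2 r))) * v (sph2 r)))"
    unfolding set_lebesgue_integral_def
    by (rule Bochner_Integration.integral_cong)
      (auto simp: integral_fibre_integrand V_def chart2_sph2 indicator_def mult_ac)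
  also have "\<dots> = (LINT y|vol2. fibre_integral u (chart2 y) * of_real (orbit_weight (chart2 y)) * v y)"
  proof (rule vol2.integral_M(1)[symmetric])
    have "(\<lambda>y. of_real (orbit_weight (chart2 y)) :: complex) \<in> borel_measurable vol2"
      unfolding vol2.measurable_M by (rule measurable_compose[OF measurable_chart2 ow[unfolded measurable_lborel2]])
    then show "(\<lambda>y. fibre_integral u (chart2 y) * of_real (orbit_weight (chart2 y)) * v y) \<in> borel_measurable vol2"
      using fibre_integral_measurable vm by measurable
  qed
  finally show "(LINT p|vol4. u p * v (quot p)) =
      (LINT y|vol2. fibre_integral u (chart2 y) * of_real (orbit_weight (chart2 y)) * v y)" .
qed

end

lemma lborel_integral_reflect:
  fixes h :: "'a::euclidean_space \<Rightarrow> 'b::{banach, second_countable_topology}"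
  assumes [measurable]: "h \<in> borel_measurable borel"
  shows "(LINT t|lborel. h (c - t)) = (LINT t|lborel. h t)"
proof -
  have "lborel = distr lborel borel (\<lambda>t. c + (-1) *\<^sub>R t)"
    using lborel_affine[of "-1" c] by (simp add: density_1)
  then have "(LINT t|lborel. h t) = (LINT t|distr lborel borel (\<lambda>t. c + (-1) *\<^sub>R t). h t)" by simp
  also have "\<dots> = (LINT t|lborel. h (c - t))" by (subst integral_distr) auto
  finally show ?thesis ..
qed

text \<open>
  The module inner product averages over the points \<open>t\<^sup>-\<^sup>1 p\<close>.  By periodicity, inverting \<open>t\<close> amounts
  to a reflection of the square of angles, which preserves Lebesgue measure; its boundary is a null
  set.
\<close>

lemma fibre_integral_inverse:
  assumes u: "u \<in> borel_measurable (restrict_space borel S4_0)" and r: "r \<in> rect"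
  shows "(LINT t:{0..2*pi} \<times> {0..2*pi}|lborel. u (sph4 (- fst t, - snd t, r))) = fibre_integral u r"
proof -
  let ?Q = "{0..2*pi} \<times> {0..2*pi} :: (real \<times> real) set"
  define f where "f t = u (sph4 (fst t, snd t, r))" for t
  have fm: "f \<in> borel_measurable borel"
  proof -
    have "continuous_on UNIV (\<lambda>t. sph4 (fst t, snd t, r))"
      by (intro continuous_on_compose2[OF continuous_sph4[of UNIV]] continuous_intros) auto
    then have "(\<lambda>t. sph4 (fst t, snd t, r)) \<in> measurable borel (restrict_space borel S4_0)"
      using sph4_in[of "fst r" "snd r"] r
      by (intro measurable_restrict_space2 borel_measurable_continuous_onI) auto
    from measurable_compose[OF this u] show ?thesis by (simp add: f_def[abs_def])
  qed
  have Q [measurable]: "?Q \<in> sets borel" by (intro borel_Times) auto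
  have hm: "(\<lambda>t. indicator ?Q t *\<^sub>R f t) \<in> borel_measurable borel" using fm by measurable
  have per: "f (- t) = f ((2*pi, 2*pi) - t)" for t
    using sph4_periodic[of "- fst t" 1 "- snd t" 1 r] by (simp add: f_def algebra_simps)
  have "(LINT t:?Q|lborel. u (sph4 (- fst t, - snd t, r))) = (LINT t|lborel. indicator ?Q t *\<^sub>R f ((2*pi, 2*pi) - t))"
    unfolding per[symmetric] by (simp add: f_def set_lebesgue_integral_def)
  also have "\<dots> = (LINT t|lborel. indicator ?Q ((2*pi, 2*pi) - t) *\<^sub>R f ((2*pi, 2*pi) - t))"
    by (rule Bochner_Integration.integral_cong) (auto simp: indicator_def mem_Times_iff)
  also have "\<dots> = (LINT t|lborel. indicator ?Q t *\<^sub>R f t)"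
    by (rule lborel_integral_reflect[OF hm])
  also have "\<dots> = (LINT t|lborel. indicator angles t *\<^sub>R f t)"
  proof (rule integral_cong_AE)
    have "{2*pi} \<times> UNIV \<union> UNIV \<times> {2*pi} \<in> null_sets (lborel \<Otimes>\<^sub>M (lborel :: real measure))"
      by (intro null_sets.Un null_setsI) (auto simp: lborel.emeasure_pair_measure_Times)
    then have "AE t in lborel. t \<notin> {2*pi :: real} \<times> UNIV \<union> UNIV \<times> {2*pi :: real}"
      unfolding lborel_prod by (rule AE_not_in)
    then show "AE t in lborel. indicator ?Q t *\<^sub>R f t = indicator angles t *\<^sub>R f t"
      by eventually_elim (auto simp: indicator_def angles_def)
    show "(\<lambda>t. indicator angles t *\<^sub>R f t) \<in> borel_measurable lborel"
      using fm angles_borel by measurable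
  qed (use hm in simp)
  finally show ?thesis by (simp add: fibre_integral_def f_def set_lebesgue_integral_def)
qed

lemma X_ip_eq:
  assumes m: "(\<lambda>p. cip (\<xi> p) (\<eta> p)) \<in> borel_measurable (restrict_space borel S4_0)" and y: "y \<in> Q2_0"
  shows "X_ip \<xi> \<eta> y = fibre_integral (\<lambda>p. cip (\<xi> p) (\<eta> p)) (chart2 y) * of_real (orbit_weight (chart2 y))"
proof -
  obtain ph ps where r: "chart2 y = (ph, ps)" by (cases "chart2 y")
  have *: "(inverse (cis (fst t)) * of_real (cos ph * cos ps), inverse (cis (snd t)) * of_real (sin ph * cos ps), sin ps) =
      sph4 (- fst t, - snd t, (ph, ps))" for t :: "real \<times> real"
    by (simp add: sph4_eq)
  show ?thesis
    using y fibre_integral_inverse[OF m chart2_in[OF y]]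
    by (simp only: X_ip_def if_True r Let_def case_prod_conv *) (simp add: orbit_weight_def)
qed

section \<open>Compactly supported smooth functions\<close>

subsection \<open>Smooth functions seen through a covering\<close>

text \<open>
  \<open>F\<close> covers \<open>S\<close> by an open set of a Euclidean space, \<open>\<sigma>\<close> is a Borel section, and any point
  of the covering space differs from the chosen one in its fibre by a period of \<open>F\<close>.
\<close>

locale smooth_cover =
  fixes U :: "'a::euclidean_space set" and F :: "'a \<Rightarrow> 'b::t2_space" and S :: "'b set" and \<sigma> :: "'b \<Rightarrow> 'a"
  assumes open_U: "open U" and cont_F: "continuous_on U F" and F_in: "\<And>z. z \<in> U \<Longrightarrow> F z \<in> S"
    and \<sigma>_in: "\<And>p. p \<in> S \<Longrightarrow> \<sigma> p \<in> U" and F_\<sigma>: "\<And>p. p \<in> S \<Longrightarrow> F (\<sigma> p) = p"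
    and \<sigma>_measurable: "\<sigma> \<in> measurable (restrict_space borel S) borel"
    and lift_compact: "\<And>K. compact K \<Longrightarrow> K \<subseteq> S \<Longrightarrow> \<exists>L. compact L \<and> L \<subseteq> U \<and> K \<subseteq> F ` L"
    and deck: "\<And>z. z \<in> U \<Longrightarrow> \<exists>c. \<sigma> (F z) = z + c \<and> (\<forall>w. F (w + c) = F w)"
begin

definition Cc :: "('b \<Rightarrow> 'c::real_normed_vector) set" where
  "Cc = {f. smooth_on U (f \<circ> F) \<and> (\<exists>K. compact K \<and> K \<subseteq> S \<and> (\<forall>p. p \<notin> K \<longrightarrow> f p = 0))}"

definition deriv :: "'a \<Rightarrow> ('b \<Rightarrow> 'c::real_normed_vector) \<Rightarrow> 'b \<Rightarrow> 'c" where
  "deriv v f p = (if p \<in> S then frechet_derivative (\<lambda>z. f (F z)) (at (\<sigma> p)) v else 0)"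

lemma Cc_smooth: "f \<in> Cc \<Longrightarrow> smooth_on U (\<lambda>z. f (F z))"
  by (simp add: Cc_def o_def)

lemma Cc_support:
  assumes "f \<in> Cc"
  obtains K where "compact K" "K \<subseteq> S" "\<forall>p. p \<notin> K \<longrightarrow> f p = 0"
  using assms by (auto simp: Cc_def)

lemma CcI:
  "smooth_on U (\<lambda>z. f (F z)) \<Longrightarrow> compact K \<Longrightarrow> K \<subseteq> S \<Longrightarrow> (\<And>p. p \<notin> K \<Longrightarrow> f p = 0) \<Longrightarrow> f \<in> Cc"
  by (auto simp: Cc_def o_def)

lemma Cc_outside: "f \<in> Cc \<Longrightarrow> p \<notin> S \<Longrightarrow> f p = 0"
  by (auto simp: Cc_def)

lemma Cc_measurable:
  fixes f :: "'b \<Rightarrow> 'c::real_normed_vector"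
  assumes "f \<in> Cc"
  shows "f \<in> borel_measurable (restrict_space borel S)"
proof -
  have "continuous_on U (\<lambda>z. f (F z))" by (rule smooth_on_continuous[OF Cc_smooth[OF assms]])
  then have "(\<lambda>z. indicator U z *\<^sub>R f (F z)) \<in> borel_measurable borel"
    by (rule borel_measurable_continuous_on_indicator[OF borel_open[OF open_U]])
  from measurable_compose[OF \<sigma>_measurable this] show ?thesis
    by (subst measurable_cong[where g = "\<lambda>p. indicator U (\<sigma> p) *\<^sub>R f (F (\<sigma> p))"])
      (auto simp: space_restrict_space \<sigma>_in F_\<sigma>)
qed

text \<open>
  A compact support need not have a compact preimage in the covering space, but it is covered by a
  compact set there.
\<close>

lemma Cc_bounded:
  assumes "f \<in> Cc"
  obtains C where "C \<ge> 0" "\<forall>p. norm (f p) \<le> C"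
proof -
  obtain K where K: "compact K" "K \<subseteq> S" "\<forall>p. p \<notin> K \<longrightarrow> f p = 0" by (rule Cc_support[OF assms])
  obtain L where L: "compact L" "L \<subseteq> U" "K \<subseteq> F ` L" using lift_compact[OF K(1,2)] by blast
  have "continuous_on L (\<lambda>z. f (F z))"
    using smooth_on_continuous[OF Cc_smooth[OF assms]] L(2) continuous_on_subset by blast
  then have "bounded ((\<lambda>z. f (F z)) ` L)" by (intro compact_imp_bounded compact_continuous_image L)
  then obtain C where C: "\<And>z. z \<in> L \<Longrightarrow> norm (f (F z)) \<le> C" by (auto simp: bounded_iff)
  have "norm (f p) \<le> max C 0" for p
  proof (cases "p \<in> K")
    case True
    then obtain z where "z \<in> L" "p = F z" using L(3) by blast
    then show ?thesis using C[of z] by simp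
  qed (simp add: K)
  then show ?thesis using that[of "max C 0"] by simp
qed

lemma Cc_bilinear:
  assumes "bounded_bilinear B" "f \<in> Cc" "smooth_on U (\<lambda>z. g (F z))"
  shows "(\<lambda>p. B (f p) (g p)) \<in> Cc"
proof -
  obtain K where K: "compact K" "K \<subseteq> S" "\<forall>p. p \<notin> K \<longrightarrow> f p = 0" by (rule Cc_support[OF assms(2)])
  show ?thesis
  proof (rule CcI[OF _ K(1,2)])
    show "smooth_on U (\<lambda>z. B (f (F z)) (g (F z)))"
      by (rule smooth_on_bounded_bilinear[OF assms(1) open_U Cc_smooth[OF assms(2)] assms(3)])
  qed (simp add: K(3) bounded_bilinear.zero_left[OF assms(1)])
qed

lemma Cc_linear:
  assumes "bounded_linear L" "f \<in> Cc"
  shows "(\<lambda>p. L (f p)) \<in> Cc"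
proof -
  obtain K where K: "compact K" "K \<subseteq> S" "\<forall>p. p \<notin> K \<longrightarrow> f p = 0" by (rule Cc_support[OF assms(2)])
  show ?thesis
  proof (rule CcI[OF _ K(1,2)])
    show "smooth_on U (\<lambda>z. L (f (F z)))"
      by (rule smooth_on_bounded_linear[OF assms(1) open_U Cc_smooth[OF assms(2)]])
  qed (simp add: K(3) linear_0 bounded_linear.linear[OF assms(1)])
qed

lemma Cc_add:
  assumes "f \<in> Cc" "g \<in> Cc"
  shows "(\<lambda>p. f p + g p) \<in> Cc"
proof -
  obtain K where K: "compact K" "K \<subseteq> S" "\<forall>p. p \<notin> K \<longrightarrow> f p = 0" by (rule Cc_support[OF assms(1)])
  obtain K' where K': "compact K'" "K' \<subseteq> S" "\<forall>p. p \<notin> K' \<longrightarrow> g p = 0" by (rule Cc_support[OF assms(2)])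
  show ?thesis
    by (rule CcI[of _ "K \<union> K'"]) (use assms K K' in \<open>auto intro!: smooth_on_add open_U Cc_smooth[OF assms(1)] Cc_smooth[OF assms(2)]\<close>)
qed

lemma Cc_smult:
  assumes "smooth_on U (\<lambda>z. c (F z))" "f \<in> Cc"
  shows "(\<lambda>p. c p *s (f p :: complex^'n)) \<in> Cc"
  using Cc_bilinear[OF bounded_bilinear.flip[OF bounded_bilinear_smult_vec] assms(2,1)] by simp

lemma Cc_cmult: "f \<in> Cc \<Longrightarrow> (\<lambda>p. c *s (f p :: complex^'n)) \<in> Cc"
  by (rule Cc_smult[OF smooth_on_const[OF open_U]])

lemma Cc_diff: "f \<in> Cc \<Longrightarrow> g \<in> Cc \<Longrightarrow> (\<lambda>p. f p - g p) \<in> Cc"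
  using Cc_add[of f "\<lambda>p. - g p"] Cc_linear[OF bounded_linear_minus[OF bounded_linear_ident], of g] by simp

text \<open>
  Two points of a fibre differ by a period, and translation by a period does not change the function
  on the covering space.  So derivatives may be computed at any point of the fibre.
\<close>

lemma deriv_eq:
  assumes z: "z \<in> U" and D: "((\<lambda>z. f (F z)) has_derivative D) (at z)"
  shows "deriv v f (F z) = D v"
proof -
  obtain c where c: "\<sigma> (F z) = z + c" "\<And>w. F (w + c) = F w" using deck[OF z] by blast
  have c': "F (w - c) = F w" for w using c(2)[of "w - c"] by simp
  have t: "((\<lambda>w. w - c) has_derivative (\<lambda>h. h)) (at (z + c))"
    by (auto intro!: derivative_eq_intros)
  have "((\<lambda>z. f (F z)) has_derivative D) (at ((z + c) - c))" using D by simp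
  from diff_chain_at[OF t this] have "((\<lambda>w. f (F w)) has_derivative D) (at (\<sigma> (F z)))"
    by (simp add: o_def c' c(1))
  from frechet_derivative_at[OF this] show ?thesis
    using F_in[OF z] by (simp add: deriv_def)
qed

lemma deriv_frechet:
  assumes "f \<in> Cc" "z \<in> U"
  shows "deriv v f (F z) = frechet_derivative (\<lambda>z. f (F z)) (at z) v"
  by (rule deriv_eq[OF assms(2) smooth_on_has_derivative[OF Cc_smooth[OF assms(1)] assms(2)]])

text \<open>
  Supports do not grow: outside the support the function vanishes in a whole neighbourhood of each point
  of the covering space.
\<close>

lemma deriv_Cc:
  assumes f: "f \<in> Cc"
  shows "deriv v f \<in> Cc"
proof -
  obtain K where K: "compact K" "K \<subseteq> S" "\<forall>p. p \<notin> K \<longrightarrow> f p = 0" by (rule Cc_support[OF f])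
  have sm: "smooth_on U (\<lambda>z. deriv v f (F z))"
    by (subst smooth_on_cong[OF open_U deriv_frechet[OF f]])
      (auto intro: smooth_on_frechet[OF Cc_smooth[OF f]])
  have "deriv v f p = 0" if "p \<notin> K" for p
  proof (cases "p \<in> S")
    case True
    have "openin (top_of_set U) (U \<inter> F -` (- K))"
      by (rule continuous_openin_preimage_gen[OF cont_F]) (simp add: open_Compl compact_imp_closed K)
    then have op: "open (U \<inter> F -` (- K))" by (rule openin_open_trans[OF _ open_U])
    have "((\<lambda>z. 0) has_derivative (\<lambda>_. 0)) (at (\<sigma> p))" by simp
    then have "((\<lambda>z. f (F z)) has_derivative (\<lambda>_. 0)) (at (\<sigma> p))"
      by (rule has_derivative_transform_within_open[OF _ op]) (use True that K F_\<sigma> \<sigma>_in in auto)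
    from deriv_eq[OF \<sigma>_in[OF True] this] show ?thesis by (simp add: F_\<sigma> True)
  qed (simp add: deriv_def)
  then show ?thesis using sm K(1,2) by (intro CcI[of _ K]) auto
qed

lemma deriv_linear:
  assumes L: "bounded_linear L" and f: "f \<in> Cc"
  shows "deriv v (\<lambda>p. L (f p)) p = L (deriv v f p)"
proof (cases "p \<in> S")
  case True
  note z = \<sigma>_in[OF True]
  from deriv_eq[OF z bounded_linear.has_derivative[OF L smooth_on_has_derivative[OF Cc_smooth[OF f] z]], of v]
  show ?thesis using deriv_frechet[OF f z, of v] by (simp add: F_\<sigma> True)
qed (simp add: deriv_def linear_0 bounded_linear.linear[OF L])

lemma deriv_add:
  assumes f: "f \<in> Cc" and g: "g \<in> Cc"
  shows "deriv v (\<lambda>p. f p + g p) p = deriv v f p + deriv v g p"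
proof (cases "p \<in> S")
  case True
  note z = \<sigma>_in[OF True]
  from deriv_eq[OF z has_derivative_add[OF smooth_on_has_derivative[OF Cc_smooth[OF f] z]
        smooth_on_has_derivative[OF Cc_smooth[OF g] z]], of v]
  show ?thesis using deriv_frechet[OF f z, of v] deriv_frechet[OF g z, of v] by (simp add: F_\<sigma> True)
qed (simp add: deriv_def)

lemma Cc_sq_int:
  fixes f :: "'b \<Rightarrow> complex^'n"
  assumes M: "finite_measure M" "sets M = sets (restrict_space borel S)" and f: "f \<in> Cc"
  shows "f \<in> carr (sq_int M)"
proof -
  obtain C where C: "C \<ge> 0" "\<forall>p. norm (f p) \<le> C" by (rule Cc_bounded[OF f]) 
  have m [measurable]: "f \<in> borel_measurable M"
    using Cc_measurable[OF f] measurable_cong_sets[OF M(2) refl] by blast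
  have "integrable M (\<lambda>x. (norm (f x))\<^sup>2)"
    by (rule finite_measure.integrable_const_bound[OF M(1), where B = "C\<^sup>2"]) (use C in auto)
  then show ?thesis by (simp add: mem_sq_int m)
qed

end

subsection \<open>The two coverings\<close>

abbreviation cover4 :: "(real \<times> real \<times> real \<times> real) set" where
  "cover4 \<equiv> UNIV \<times> UNIV \<times> rect"

interpretation c4: smooth_cover cover4 sph4 S4_0 chart4
proof
  show "open cover4" by (rule open_cover)
  show "continuous_on cover4 sph4" by (rule continuous_sph4)
  show "sph4 z \<in> S4_0" if "z \<in> cover4" for z using that by (auto intro: sph4_in)
  show "chart4 p \<in> cover4" if "p \<in> S4_0" for p using chart4_in[OF that] by (auto simp: dom4_def)
  show "\<exists>c. chart4 (sph4 z) = z + c \<and> (\<forall>w. sph4 (w + c) = sph4 w)" if "z \<in> cover4" for z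
  proof -
    obtain t1 t2 ph ps where z: "z = (t1, t2, ph, ps)" by (cases z)
    with that have "(ph, ps) \<in> rect" by simp
    then obtain k1 k2 :: int where k: "chart4 (sph4 (t1, t2, ph, ps)) = (t1 + 2 * pi * of_int k1, t2 + 2 * pi * of_int k2, ph, ps)"
      by (rule chart4_sph4_shift)
    show ?thesis
    proof (intro exI[of _ "(2 * pi * of_int k1, 2 * pi * of_int k2, 0, 0)"] conjI allI)
      show "chart4 (sph4 z) = z + (2 * pi * of_int k1, 2 * pi * of_int k2, 0, 0)"
        by (simp add: z k)
      show "sph4 (w + (2 * pi * of_int k1, 2 * pi * of_int k2, 0, 0)) = sph4 w" for w
        using sph4_periodic[of "fst w" k1 "fst (snd w)" k2 "snd (snd w)"] by (cases w) simp
    qed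
  qed
  show "\<exists>L. compact L \<and> L \<subseteq> cover4 \<and> K \<subseteq> sph4 ` L" if K: "compact K" "K \<subseteq> S4_0" for K
  proof (intro exI conjI)
    let ?R = "(\<lambda>p. polar2 (quot p)) ` K"
    have "continuous_on K (\<lambda>p. polar2 (quot p))"
      by (rule continuous_on_compose2[OF continuous_polar2 continuous_quot]) (use K quot_in in auto)
    then show "compact ({0..2*pi} \<times> {0..2*pi} \<times> ?R)"
      by (intro compact_Times compact_continuous_image K) auto
    show "{0..2*pi} \<times> {0..2*pi} \<times> ?R \<subseteq> cover4"
      using K chart2_in[OF quot_in] by (auto simp: chart2_eq_polar2[OF quot_in, symmetric])
    show "K \<subseteq> sph4 ` ({0..2*pi} \<times> {0..2*pi} \<times> ?R)"
    proof
      fix p assume p: "p \<in> K"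
      then have pS: "p \<in> S4_0" using K by blast
      then obtain t1 t2 ph ps where z: "(t1, t2, ph, ps) \<in> dom4" "p = sph4 (t1, t2, ph, ps)" by (rule S4_0_polar)
      then have "(ph, ps) \<in> rect" by (simp add: dom4_def)
      then have "(ph, ps) = polar2 (quot p)" by (simp add: z quot_sph4 polar2_sph2)
      then have "(t1, t2, ph, ps) \<in> {0..2*pi} \<times> {0..2*pi} \<times> ?R"
        using z p by (auto simp: dom4_def)
      then show "p \<in> sph4 ` ({0..2*pi} \<times> {0..2*pi} \<times> ?R)" using z(2) by blast
    qed
  qed
qed (simp_all add: sph4_chart4 measurable_chart4)

interpretation c2: smooth_cover rect sph2 Q2_0 chart2
proof
  show "\<exists>L. compact L \<and> L \<subseteq> rect \<and> K \<subseteq> sph2 ` L" if K: "compact K" "K \<subseteq> Q2_0" for K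
  proof (intro exI conjI)
    show "compact (polar2 ` K)"
      using continuous_on_subset[OF continuous_polar2] K by (intro compact_continuous_image) auto
    show "polar2 ` K \<subseteq> rect" using K chart2_in by (auto simp: chart2_eq_polar2[symmetric] subset_eq)
    have "p \<in> sph2 ` polar2 ` K" if "p \<in> K" for p
      using that K sph2_chart2[of p] by (auto simp: chart2_eq_polar2 image_iff intro!: bexI[of _ p])
    then show "K \<subseteq> sph2 ` polar2 ` K" by blast
  qed
  show "\<exists>c. chart2 (sph2 z) = z + c \<and> (\<forall>w. sph2 (w + c) = sph2 w)" if "z \<in> rect" for z
    using that by (intro exI[of _ 0]) (simp add: chart2_sph2)
qed (simp_all add: open_rect continuous_sph2 sph2_in chart2_in sph2_chart2 measurable_chart2)

lemma Cc4_eq: "Cc4 = c4.Cc" and Cc2_eq: "Cc2 = c2.Cc"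
  by (simp_all add: Cc4_def Cc2_def c4.Cc_def c2.Cc_def)

lemma Cc4_sq_int: "f \<in> Cc4 \<Longrightarrow> f \<in> carr (sq_int vol4)"
  unfolding Cc4_eq by (rule c4.Cc_sq_int[OF finite_measure_vol4 vol4.sets_M])

lemma Cc2_sq_int: "h \<in> Cc2 \<Longrightarrow> h \<in> carr (sq_int vol2)"
  unfolding Cc2_eq by (rule c2.Cc_sq_int[OF finite_measure_vol2 vol2.sets_M])

lemma Cc2_quot_smooth:
  assumes "h \<in> Cc2"
  shows "smooth_on cover4 (\<lambda>z. h (quot (sph4 z)))"
proof -
  have "smooth_on cover4 (\<lambda>z. (\<lambda>r. h (sph2 r)) (snd (snd z)))"
    by (rule smooth_on_compose_linear[where U = rect])
      (use assms in \<open>auto simp: Cc2_eq open_cover intro!: bounded_linear_compose[OF bounded_linear_snd bounded_linear_snd] c2.Cc_smooth\<close>)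
  then show ?thesis
    by (subst smooth_on_cong[OF open_cover]) (auto simp: quot_sph4)
qed

lemma vector_derivative_line:
  assumes f: "(f has_derivative D) (at z)"
  shows "vector_derivative (\<lambda>s. f (z + (s - t) *\<^sub>R e)) (at t) = D e"
proof -
  have l: "((\<lambda>s. z + (s - t) *\<^sub>R e) has_derivative (\<lambda>h. h *\<^sub>R e)) (at t)"
    by (auto intro!: derivative_eq_intros)
  have "((\<lambda>s. f (z + (s - t) *\<^sub>R e)) has_derivative (\<lambda>h. D (h *\<^sub>R e))) (at t)"
    using diff_chain_at[OF l, of f D] f by (simp add: o_def)
  then have "((\<lambda>s. f (z + (s - t) *\<^sub>R e)) has_vector_derivative D e) (at t)"
    by (simp add: has_vector_derivative_def linear_scale[OF has_derivative_linear[OF f]])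
  then show ?thesis by (rule vector_derivative_at)
qed

lemma partial4:
  assumes f: "f \<in> Cc4"
  shows "d_t1 f = c4.deriv (1, 0, 0, 0) f" "d_t2 f = c4.deriv (0, 1, 0, 0) f"
    "d_ph f = c4.deriv (0, 0, 1, 0) f" "d_ps f = c4.deriv (0, 0, 0, 1) f"
proof -
  have *: "vector_derivative (\<lambda>s. f (sph4 (chart4 p + (s - t) *\<^sub>R e))) (at t) =
      frechet_derivative (\<lambda>z. f (sph4 z)) (at (chart4 p)) e" if "p \<in> S4_0" for p t e
    using vector_derivative_line[OF smooth_on_has_derivative[OF c4.Cc_smooth c4.\<sigma>_in[OF that]]] f
    by (simp add: Cc4_eq)
  show "d_t1 f = c4.deriv (1, 0, 0, 0) f"
  proof (rule ext)
    fix p show "d_t1 f p = c4.deriv (1, 0, 0, 0) f p"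
      using *[of p "fst (chart4 p)" "(1, 0, 0, 0)"]
      by (cases "chart4 p") (auto simp: d_t1_def c4.deriv_def)
  qed
  show "d_t2 f = c4.deriv (0, 1, 0, 0) f"
  proof (rule ext)
    fix p show "d_t2 f p = c4.deriv (0, 1, 0, 0) f p"
      using *[of p "fst (snd (chart4 p))" "(0, 1, 0, 0)"]
      by (cases "chart4 p") (auto simp: d_t2_def c4.deriv_def)
  qed
  show "d_ph f = c4.deriv (0, 0, 1, 0) f"
  proof (rule ext)
    fix p show "d_ph f p = c4.deriv (0, 0, 1, 0) f p"
      using *[of p "fst (snd (snd (chart4 p)))" "(0, 0, 1, 0)"]
      by (cases "chart4 p") (auto simp: d_ph_def c4.deriv_def)
  qed
  show "d_ps f = c4.deriv (0, 0, 0, 1) f"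
  proof (rule ext)
    fix p show "d_ps f p = c4.deriv (0, 0, 0, 1) f p"
      using *[of p "snd (snd (snd (chart4 p)))" "(0, 0, 0, 1)"]
      by (cases "chart4 p") (auto simp: d_ps_def c4.deriv_def)
  qed
qed

lemma partial2:
  assumes f: "f \<in> Cc2"
  shows "q_ph f = c2.deriv (1, 0) f" "q_ps f = c2.deriv (0, 1) f"
proof -
  have *: "vector_derivative (\<lambda>s. f (sph2 (chart2 p + (s - t) *\<^sub>R e))) (at t) =
      frechet_derivative (\<lambda>z. f (sph2 z)) (at (chart2 p)) e" if "p \<in> Q2_0" for p t e
    using vector_derivative_line[OF smooth_on_has_derivative[OF c2.Cc_smooth c2.\<sigma>_in[OF that]]] f
    by (simp add: Cc2_eq)
  show "q_ph f = c2.deriv (1, 0) f"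
  proof (rule ext)
    fix p show "q_ph f p = c2.deriv (1, 0) f p"
      using *[of p "fst (chart2 p)" "(1, 0)"]
      by (cases "chart2 p") (auto simp: q_ph_def c2.deriv_def)
  qed
  show "q_ps f = c2.deriv (0, 1) f"
  proof (rule ext)
    fix p show "q_ps f p = c2.deriv (0, 1) f p"
      using *[of p "snd (chart2 p)" "(0, 1)"]
      by (cases "chart2 p") (auto simp: q_ps_def c2.deriv_def)
  qed
qed

subsection \<open>Cutoff functions\<close>

text \<open>
  The points excluded from \<open>S4_0\<close> are those where one of the first two coordinates of the orbit
  vanishes, so it suffices to cut off in their squares, which are smooth functions of the coordinates.
  The function is \<open>1\<close> where both squares are at least \<open>d\<close>, and \<open>0\<close> where one of them is at most \<open>d/2\<close>.
\<close>

definition cutoff :: "real \<Rightarrow> pt2 \<Rightarrow> real" where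
  "cutoff d y = (if y \<in> Q2_0 then smooth_step (2 / d * (fst y)\<^sup>2 - 1) * smooth_step (2 / d * (fst (snd y))\<^sup>2 - 1) else 0)"

lemma cutoff_bounds: "0 \<le> cutoff d y" "cutoff d y \<le> 1"
  using smooth_step_bounds by (auto simp: cutoff_def intro!: mult_le_one)

lemma cutoff_eq_1: "d > 0 \<Longrightarrow> y \<in> Q2_0 \<Longrightarrow> d \<le> (fst y)\<^sup>2 \<Longrightarrow> d \<le> (fst (snd y))\<^sup>2 \<Longrightarrow> cutoff d y = 1"
proof -
  assume *: "d > 0" "y \<in> Q2_0" "d \<le> (fst y)\<^sup>2" "d \<le> (fst (snd y))\<^sup>2"
  have "1 \<le> 2 / d * s - 1" if "d \<le> s" for s using that *(1) by (simp add: field_simps)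
  then show ?thesis using * by (simp add: cutoff_def smooth_step_eq_1)
qed

lemma cutoff_Cc2:
  assumes d: "d > 0"
  shows "(\<lambda>y. complex_of_real (cutoff d y)) \<in> Cc2"
proof -
  let ?K = "{y :: pt2. (fst y)\<^sup>2 + (fst (snd y))\<^sup>2 + (snd (snd y))\<^sup>2 = 1 \<and> 0 \<le> fst y \<and> 0 \<le> fst (snd y) \<and>
      d / 2 \<le> (fst y)\<^sup>2 \<and> d / 2 \<le> (fst (snd y))\<^sup>2}"
  show ?thesis unfolding Cc2_eq
  proof (rule c2.CcI[of _ ?K])
    have "smooth_on rect (\<lambda>r. smooth_step (2 / d * (cos (fst r) * cos (snd r))\<^sup>2 - 1) *
        smooth_step (2 / d * (sin (fst r) * cos (snd r))\<^sup>2 - 1))"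
      by (intro smooth_on_mult smooth_on_smooth_step smooth_on_diff smooth_on_power smooth_on_const smooth_on_sin
          smooth_on_cos smooth_on_linear bounded_linear_fst bounded_linear_snd open_rect)
    then have "smooth_on rect (\<lambda>r. cutoff d (sph2 r))"
      by (subst smooth_on_cong[OF open_rect]) (auto simp: cutoff_def sph2_in sph2_eq)
    then show "smooth_on rect (\<lambda>r. complex_of_real (cutoff d (sph2 r)))" by (rule smooth_on_of_real[OF open_rect])
    have "bounded ?K"
    proof (rule bounded_subset[of "{-1..1} \<times> {-1..1} \<times> {-1..1}"])
      have "\<bar>x\<bar> \<le> 1 \<and> \<bar>y\<bar> \<le> 1 \<and> \<bar>z\<bar> \<le> 1" if "x\<^sup>2 + y\<^sup>2 + z\<^sup>2 = 1" for x y z :: real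
        using sphere_coordinates_le_1[OF that] by blast
      then show "?K \<subseteq> {-1..1} \<times> {-1..1} \<times> {-1..1}" by (force simp: abs_le_iff)
    qed (auto intro!: bounded_Times)
    moreover have "closed ?K"
      by (intro closed_Collect_conj closed_Collect_eq closed_Collect_le continuous_intros)
    ultimately show "compact ?K" by (simp add: compact_eq_bounded_closed)
    have "0 < x" if "0 \<le> x" "d / 2 \<le> x\<^sup>2" for x using that d by (cases "x = 0") auto
    then show "?K \<subseteq> Q2_0" by (auto simp: Q2_0_eq)
    fix y assume y: "y \<notin> ?K"
    show "complex_of_real (cutoff d y) = 0"
    proof (cases "y \<in> Q2_0")
      case True
      then have "(fst y)\<^sup>2 < d / 2 \<or> (fst (snd y))\<^sup>2 < d / 2" using y by (auto simp: Q2_0_eq)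
      then have "2 / d * (fst y)\<^sup>2 - 1 \<le> 0 \<or> 2 / d * (fst (snd y))\<^sup>2 - 1 \<le> 0" using d by (auto simp: field_simps)
      then show ?thesis by (auto simp: cutoff_def smooth_step_eq_0)
    qed (simp add: cutoff_def)
  qed
qed

text \<open>
  On a compact set \<open>|a|\<close> and \<open>|b|\<close> attain positive minima.
\<close>

lemma cutoff_on_compact:
  assumes "compact K" "K \<subseteq> S4_0"
  obtains d where "d > 0" "\<forall>p\<in>K. cutoff d (quot p) = 1"
proof (cases "K = {}")
  case True
  then show ?thesis using that[of 1] by simp
next
  case False
  obtain p1 where p1: "p1 \<in> K" "\<And>p. p \<in> K \<Longrightarrow> norm (fst p1) \<le> norm (fst p)"
    using continuous_attains_inf[OF assms(1) False, of "\<lambda>p. norm (fst p)"]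
      continuous_on_norm[OF continuous_on_fst[OF continuous_on_id]] by metis
  obtain p2 where p2: "p2 \<in> K" "\<And>p. p \<in> K \<Longrightarrow> norm (fst (snd p2)) \<le> norm (fst (snd p))"
    using continuous_attains_inf[OF assms(1) False, of "\<lambda>p. norm (fst (snd p))"]
      continuous_on_norm[OF continuous_on_fst[OF continuous_on_snd[OF continuous_on_id]]] by metis
  define d where "d = min ((norm (fst p1))\<^sup>2) ((norm (fst (snd p2)))\<^sup>2)"
  have "d > 0" using p1(1) p2(1) assms(2) by (auto simp: d_def S4_0_def)
  moreover have "cutoff d (quot p) = 1" if "p \<in> K" for p
  proof (rule cutoff_eq_1[OF \<open>d > 0\<close>])
    show "quot p \<in> Q2_0" using that assms(2) quot_in by blast
    have "(norm (fst p1))\<^sup>2 \<le> (norm (fst p))\<^sup>2" "(norm (fst (snd p2)))\<^sup>2 \<le> (norm (fst (snd p)))\<^sup>2"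
      using p1(2)[OF that] p2(2)[OF that] by (auto intro: power_mono)
    then show "d \<le> (fst (quot p))\<^sup>2" "d \<le> (fst (snd (quot p)))\<^sup>2"
      by (simp_all add: d_def quot_def case_prod_unfold min.coboundedI1 min.coboundedI2)
  qed
  ultimately show ?thesis using that by blast
qed

lemma Cc4_cutoff:
  assumes "f \<in> Cc4"
  obtains d where "d > 0" "\<forall>p. cutoff d (quot p) = 1 \<or> f p = 0"
proof -
  obtain K where K: "compact K" "K \<subseteq> S4_0" "\<forall>p. p \<notin> K \<longrightarrow> f p = 0"
    using assms c4.Cc_support unfolding Cc4_eq by blast
  obtain d where "d > 0" "\<forall>p\<in>K. cutoff d (quot p) = 1" by (rule cutoff_on_compact[OF K(1,2)])
  then show ?thesis using K(3) that by blast
qed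

section \<open>The differential operators on compactly supported smooth functions\<close>

subsection \<open>Tensor products of spinors\<close>

definition spinor_tensor :: "complex^2 \<Rightarrow> complex^2 \<Rightarrow> complex^4" where
  "spinor_tensor l m = vector [l$1 * m$1, l$2 * m$1, l$1 * m$2, l$2 * m$2]"

lemma vector_4_nth:
  "(vector [x, y, z, w] :: ('a::zero)^4) $ 1 = x"
  "(vector [x, y, z, w] :: ('a::zero)^4) $ 2 = y"
  "(vector [x, y, z, w] :: ('a::zero)^4) $ 3 = z"
  "(vector [x, y, z, w] :: ('a::zero)^4) $ 4 = w"
  unfolding vector_def by simp_all

lemma spinor_tensor_nth:
  "spinor_tensor l m $ 1 = l$1 * m$1" "spinor_tensor l m $ 2 = l$2 * m$1"
  "spinor_tensor l m $ 3 = l$1 * m$2" "spinor_tensor l m $ 4 = l$2 * m$2"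
  by (simp_all add: spinor_tensor_def vector_4_nth)

lemma cip_spinor_tensor: "cip (spinor_tensor l m) (spinor_tensor l' m') = cip l l' * cip m m'"
  by (simp add: cip_def sum_4 sum_2 spinor_tensor_nth algebra_simps)

lemma bounded_bilinear_spinor_tensor: "bounded_bilinear spinor_tensor"
  unfolding bilinear_conv_bounded_bilinear[symmetric]
  by (auto simp: bilinear_def linear_iff vec_eq_iff forall_4 spinor_tensor_nth algebra_simps)

lemma spinor_tensor_zero: "spinor_tensor 0 m = 0" "spinor_tensor l 0 = 0"
  and spinor_tensor_add_left: "spinor_tensor (l + l') m = spinor_tensor l m + spinor_tensor l' m"
  and spinor_tensor_add_right: "spinor_tensor l (m + m') = spinor_tensor l m + spinor_tensor l m'"
  and spinor_tensor_smult_left: "spinor_tensor (c *s l) m = c *s spinor_tensor l m"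
  and spinor_tensor_smult_right: "spinor_tensor l (c *s m) = c *s spinor_tensor l m"
  by (simp_all add: vec_eq_iff forall_4 spinor_tensor_nth algebra_simps)

lemma matrix_smult: "A *v (c *s v) = c *s (A *v (v :: complex^'n))"
  by (simp add: vec_eq_iff matrix_vector_mult_def sum_distrib_left mult.left_commute)

lemma bounded_linear_matrix: "bounded_linear (\<lambda>v. (A :: complex^'n^'m) *v v)"
  unfolding linear_conv_bounded_linear[symmetric]
  by (simp only: linear_iff matrix_vector_right_distrib scaleR_smult_vec matrix_smult simp_thms)

lemma matrix_add: "A *v (v + w) = A *v v + A *v (w :: complex^'n)"
  by (rule matrix_vector_right_distrib)

text \<open>Clifford multiplication by the vertical directions, acting on the left tensor factor.\<close>

definition vertical1 :: "complex^4^4" where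
  "vertical1 = vector [vector [0, 1, 0, 0], vector [1, 0, 0, 0], vector [0, 0, 0, 1], vector [0, 0, 1, 0]]"

definition vertical2 :: "complex^4^4" where
  "vertical2 = vector [vector [0, -\<i>, 0, 0], vector [\<i>, 0, 0, 0], vector [0, 0, 0, -\<i>], vector [0, 0, \<i>, 0]]"

text \<open>The gradings \<open>\<gamma>\<^sub>X \<otimes> 1\<close> and \<open>\<gamma>\<^sub>X \<otimes> \<gamma>\<^sub>Q\<close>, and the matrix of \<open>\<Gamma>\<close>.\<close>

definition grading_left :: "complex^4^4" where
  "grading_left = vector [vector [1, 0, 0, 0], vector [0, -1, 0, 0], vector [0, 0, 1, 0], vector [0, 0, 0, -1]]"

definition grading_both :: "complex^4^4" where
  "grading_both = vector [vector [1, 0, 0, 0], vector [0, -1, 0, 0], vector [0, 0, -1, 0], vector [0, 0, 0, 1]]"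

definition Gamma_matrix :: "complex^4^4" where
  "Gamma_matrix = vector [vector [1, 0, 0, 0], vector [0, 1, 0, 0], vector [0, 0, 1, 0], vector [0, 0, 0, -1]]"

lemmas matrix4_defs = vertical1_def vertical2_def grading_left_def grading_both_def Gamma_matrix_def
  gamma1_def gamma2_def gamma3_def gamma4_def
lemmas matrix2_defs = sigma1_def sigma2_def grading2_def

lemma matrix2_apply:
  "(sigma1 *v v) $ 1 = v $ 2" "(sigma1 *v v) $ 2 = v $ 1"
  "(sigma2 *v v) $ 1 = -\<i> * v $ 2" "(sigma2 *v v) $ 2 = \<i> * v $ 1"
  "(grading2 *v v) $ 1 = v $ 1" "(grading2 *v v) $ 2 = - v $ 2"
  by (simp_all add: matrix_vector_mult_def sum_2 matrix2_defs)

lemma matrix4_apply: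
  "(vertical1 *v w) $ 1 = w $ 2" "(vertical1 *v w) $ 2 = w $ 1" "(vertical1 *v w) $ 3 = w $ 4" "(vertical1 *v w) $ 4 = w $ 3"
  "(vertical2 *v w) $ 1 = -\<i> * w $ 2" "(vertical2 *v w) $ 2 = \<i> * w $ 1" "(vertical2 *v w) $ 3 = -\<i> * w $ 4" "(vertical2 *v w) $ 4 = \<i> * w $ 3"
  "(grading_left *v w) $ 1 = w $ 1" "(grading_left *v w) $ 2 = - w $ 2" "(grading_left *v w) $ 3 = w $ 3" "(grading_left *v w) $ 4 = - w $ 4"
  "(grading_both *v w) $ 1 = w $ 1" "(grading_both *v w) $ 2 = - w $ 2" "(grading_both *v w) $ 3 = - w $ 3" "(grading_both *v w) $ 4 = w $ 4"
  "(Gamma_matrix *v w) $ 1 = w $ 1" "(Gamma_matrix *v w) $ 2 = w $ 2" "(Gamma_matrix *v w) $ 3 = w $ 3" "(Gamma_matrix *v w) $ 4 = - w $ 4"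
  "(gamma1 *v w) $ 1 = w $ 2" "(gamma1 *v w) $ 2 = w $ 1" "(gamma1 *v w) $ 3 = - w $ 4" "(gamma1 *v w) $ 4 = - w $ 3"
  "(gamma2 *v w) $ 1 = -\<i> * w $ 2" "(gamma2 *v w) $ 2 = \<i> * w $ 1" "(gamma2 *v w) $ 3 = \<i> * w $ 4" "(gamma2 *v w) $ 4 = -\<i> * w $ 3"
  "(gamma3 *v w) $ 1 = w $ 3" "(gamma3 *v w) $ 2 = w $ 4" "(gamma3 *v w) $ 3 = w $ 1" "(gamma3 *v w) $ 4 = w $ 2"
  "(gamma4 *v w) $ 1 = -\<i> * w $ 3" "(gamma4 *v w) $ 2 = -\<i> * w $ 4" "(gamma4 *v w) $ 3 = \<i> * w $ 1" "(gamma4 *v w) $ 4 = \<i> * w $ 2"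
  by (simp_all add: matrix_vector_mult_def sum_4 matrix4_defs vector_4_nth)

lemma spinor_tensor_matrix:
  "spinor_tensor (sigma1 *v l) m = vertical1 *v spinor_tensor l m"
  "spinor_tensor (sigma2 *v l) m = vertical2 *v spinor_tensor l m"
  "spinor_tensor l (sigma1 *v m) = gamma3 *v spinor_tensor l m"
  "spinor_tensor l (sigma2 *v m) = gamma4 *v spinor_tensor l m"
  "spinor_tensor (grading2 *v l) m = grading_left *v spinor_tensor l m"
  "spinor_tensor (grading2 *v l) (grading2 *v m) = grading_both *v spinor_tensor l m"
  by (simp_all add: vec_eq_iff forall_4 spinor_tensor_nth matrix4_apply matrix2_apply)

subsection \<open>Smooth coefficients\<close>

lemma coefficient_smooth4:
  assumes "smooth_on rect c"
  shows "smooth_on cover4 (\<lambda>z. c (snd (snd (chart4 (sph4 z)))))"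
proof -
  have "smooth_on cover4 (\<lambda>z. c (snd (snd z)))"
    by (rule smooth_on_compose_linear[OF _ open_cover _ assms])
      (auto intro: bounded_linear_compose[OF bounded_linear_snd bounded_linear_snd])
  moreover have "snd (snd (chart4 (sph4 z))) = snd (snd z)" if "z \<in> cover4" for z
  proof -
    obtain t1 t2 ph ps where z: "z = (t1, t2, ph, ps)" by (cases z)
    with that have "(ph, ps) \<in> rect" by simp
    then show ?thesis using chart4_sph4_shift[of ph ps t1 t2] by (metis z snd_conv)
  qed
  ultimately show ?thesis by (subst smooth_on_cong[OF open_cover]) auto
qed

lemma coefficient_smooth2:
  assumes "smooth_on rect c"
  shows "smooth_on rect (\<lambda>r. c (chart2 (sph2 r)))"
  by (subst smooth_on_cong[OF open_rect]) (use assms chart2_sph2 in auto)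

lemma quot_chart: "p \<in> S4_0 \<Longrightarrow> chart2 (quot p) = snd (snd (chart4 p))"
  by (elim S4_0_polar) (simp add: chart4_sph4 quot_sph4 chart2_sph2 dom4_def)

definition coef_t1 :: "real \<times> real \<Rightarrow> complex" where
  "coef_t1 r = \<i> / of_real (cos (fst r) * cos (snd r))"
definition coef_t2 :: "real \<times> real \<Rightarrow> complex" where
  "coef_t2 r = \<i> / of_real (sin (fst r) * cos (snd r))"
definition coef_ph :: "real \<times> real \<Rightarrow> complex" where
  "coef_ph r = \<i> / of_real (cos (snd r))"
definition pot_ph :: "real \<times> real \<Rightarrow> complex" where
  "pot_ph r = of_real (cot (fst r) / 2 - tan (fst r) / 2)"
definition pot_ps :: "real \<times> real \<Rightarrow> complex" where
  "pot_ps r = of_real (tan (snd r))"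
definition sec_ps :: "real \<times> real \<Rightarrow> complex" where
  "sec_ps r = 1 / of_real (cos (snd r))"

lemma coefs_smooth:
  "smooth_on rect coef_t1" "smooth_on rect coef_t2" "smooth_on rect coef_ph" "smooth_on rect pot_ph"
  "smooth_on rect pot_ps" "smooth_on rect sec_ps"
proof -
  note trig = smooth_on_sin[OF open_rect smooth_on_linear[OF bounded_linear_fst open_rect]]
    smooth_on_sin[OF open_rect smooth_on_linear[OF bounded_linear_snd open_rect]]
    smooth_on_cos[OF open_rect smooth_on_linear[OF bounded_linear_fst open_rect]]
    smooth_on_cos[OF open_rect smooth_on_linear[OF bounded_linear_snd open_rect]]
  have nz: "cos (fst r) \<noteq> 0" "sin (fst r) \<noteq> 0" "cos (snd r) \<noteq> 0" if "r \<in> rect" for r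
    using rect_trig[of "fst r" "snd r"] that by auto
  have inv: "smooth_on rect (\<lambda>r. inverse (cos (fst r)))" "smooth_on rect (\<lambda>r. inverse (sin (fst r)))"
    "smooth_on rect (\<lambda>r. inverse (cos (snd r)))"
    by (intro smooth_on_inverse trig open_rect nz; assumption)+
  have "smooth_on rect (\<lambda>r. \<i> * of_real (inverse (cos (fst r)) * inverse (cos (snd r))))"
    by (intro smooth_on_mult smooth_on_of_real smooth_on_const open_rect inv)
  then show "smooth_on rect coef_t1" by (simp add: coef_t1_def[abs_def] divide_inverse mult_ac)
  have "smooth_on rect (\<lambda>r. \<i> * of_real (inverse (sin (fst r)) * inverse (cos (snd r))))"
    by (intro smooth_on_mult smooth_on_of_real smooth_on_const open_rect inv)
  then show "smooth_on rect coef_t2" by (simp add: coef_t2_def[abs_def] divide_inverse mult_ac)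
  have "smooth_on rect (\<lambda>r. \<i> * of_real (inverse (cos (snd r))))"
    by (intro smooth_on_mult smooth_on_of_real smooth_on_const open_rect inv)
  then show "smooth_on rect coef_ph" by (simp add: coef_ph_def[abs_def] divide_inverse)
  have "smooth_on rect (\<lambda>r. of_real (inverse (cos (snd r))) :: complex)"
    by (intro smooth_on_of_real open_rect inv)
  then show "smooth_on rect sec_ps" by (simp add: sec_ps_def[abs_def] divide_inverse)
  have "smooth_on rect (\<lambda>r. of_real (sin (snd r) * inverse (cos (snd r))) :: complex)"
    by (intro smooth_on_of_real smooth_on_mult open_rect inv trig)
  then show "smooth_on rect pot_ps" by (simp add: pot_ps_def[abs_def] tan_def divide_inverse)
  have "smooth_on rect (\<lambda>r. cot (fst r))" "smooth_on rect (\<lambda>r. tan (fst r))"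
    using smooth_on_mult[OF open_rect trig(3) inv(2)] smooth_on_mult[OF open_rect trig(1) inv(1)]
    by (simp_all add: cot_def tan_def divide_inverse)
  from smooth_on_diff[OF open_rect this]
  have "smooth_on rect (\<lambda>r. (1/2) *\<^sub>R (cot (fst r) - tan (fst r)))"
    by (rule smooth_on_bounded_linear[OF bounded_linear_scaleR_right open_rect])
  then have "smooth_on rect (\<lambda>r. cot (fst r) / 2 - tan (fst r) / 2)"
    by (simp add: diff_divide_distrib)
  then show "smooth_on rect pot_ph"
    unfolding pot_ph_def[abs_def] by (rule smooth_on_of_real[OF open_rect])
qed

subsection \<open>The operators\<close>

text \<open>
  What the two summands of the tensor sum turn out to be on \<open>\<complex>\<^sup>4\<close>-valued functions.  The matrices
  \<open>\<gamma>\<^sup>3\<close> and \<open>\<gamma>\<^sup>4\<close> are those of \<open>1 \<otimes> \<sigma>\<^sup>1\<close> and \<open>1 \<otimes> \<sigma>\<^sup>2\<close>.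
\<close>

definition vertical_symb :: "(pt4 \<Rightarrow> complex^4) \<Rightarrow> pt4 \<Rightarrow> complex^4" where
  "vertical_symb f p = (let r = snd (snd (chart4 p)) in
     coef_t1 r *s (vertical1 *v d_t1 f p) + coef_t2 r *s (vertical2 *v d_t2 f p))"

definition horizontal_symb :: "(pt4 \<Rightarrow> complex^4) \<Rightarrow> pt4 \<Rightarrow> complex^4" where
  "horizontal_symb f p = (let r = snd (snd (chart4 p)) in
     coef_ph r *s (gamma3 *v (d_ph f p + pot_ph r *s f p)) +
     \<i> *s (gamma4 *v (d_ps f p - ((3/2) * pot_ps r) *s f p)))"

lemma D_V0_eq: "D_V0 \<xi> p = (let r = snd (snd (chart4 p)) in
    coef_t1 r *s (sigma1 *v d_t1 \<xi> p) + coef_t2 r *s (sigma2 *v d_t2 \<xi> p))"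
  by (simp add: D_V0_def Let_def case_prod_unfold coef_t1_def coef_t2_def)

lemma nabla_ph_eq: "nabla_ph \<xi> p = d_ph \<xi> p + pot_ph (snd (snd (chart4 p))) *s \<xi> p"
  by (simp add: nabla_ph_def Let_def case_prod_unfold pot_ph_def)

lemma nabla_ps_eq: "nabla_ps \<xi> p = d_ps \<xi> p - pot_ps (snd (snd (chart4 p))) *s \<xi> p"
  by (simp add: nabla_ps_def Let_def case_prod_unfold pot_ps_def)

lemma D_Q0_eq: "D_Q0 h y = (let r = chart2 y in
    coef_ph r *s (sigma1 *v q_ph h y) + \<i> *s (sigma2 *v (q_ps h y - ((1/2) * pot_ps r) *s h y)))"
  by (simp add: D_Q0_def Let_def case_prod_unfold coef_ph_def pot_ps_def)

lemma Dirac4_symb_eq: "Dirac4_symb f p = (let r = snd (snd (chart4 p)) in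
    coef_t1 r *s (gamma1 *v d_t1 f p) + coef_t2 r *s (gamma2 *v d_t2 f p) +
    coef_ph r *s (gamma3 *v (d_ph f p + pot_ph r *s f p)) +
    \<i> *s (gamma4 *v (d_ps f p - ((3/2) * pot_ps r) *s f p)))"
  by (simp add: Dirac4_symb_def Let_def case_prod_unfold coef_t1_def coef_t2_def coef_ph_def pot_ph_def pot_ps_def)

lemma Cc4_coef: "f \<in> Cc4 \<Longrightarrow> smooth_on rect c \<Longrightarrow> (\<lambda>p. c (snd (snd (chart4 p))) *s (f p :: complex^'n)) \<in> Cc4"
  unfolding Cc4_eq by (rule c4.Cc_smult[OF coefficient_smooth4])

lemma Cc2_coef: "f \<in> Cc2 \<Longrightarrow> smooth_on rect c \<Longrightarrow> (\<lambda>y. c (chart2 y) *s (f y :: complex^'n)) \<in> Cc2"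
  unfolding Cc2_eq by (rule c2.Cc_smult[OF coefficient_smooth2])

lemma Cc4_matrix: "f \<in> Cc4 \<Longrightarrow> (\<lambda>p. (A :: complex^'n^'m) *v f p) \<in> Cc4"
  unfolding Cc4_eq by (rule c4.Cc_linear[OF bounded_linear_matrix])

lemma Cc2_matrix: "f \<in> Cc2 \<Longrightarrow> (\<lambda>p. (A :: complex^'n^'m) *v f p) \<in> Cc2"
  unfolding Cc2_eq by (rule c2.Cc_linear[OF bounded_linear_matrix])

lemmas Cc4_ops = c4.Cc_add[folded Cc4_eq] c4.Cc_diff[folded Cc4_eq] c4.Cc_cmult[folded Cc4_eq]
  Cc4_matrix Cc4_coef
lemmas Cc2_ops = c2.Cc_add[folded Cc2_eq] c2.Cc_diff[folded Cc2_eq] c2.Cc_cmult[folded Cc2_eq]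
  Cc2_matrix Cc2_coef

lemma partial4_Cc4: "f \<in> Cc4 \<Longrightarrow> d_t1 f \<in> Cc4" "f \<in> Cc4 \<Longrightarrow> d_t2 f \<in> Cc4"
  "f \<in> Cc4 \<Longrightarrow> d_ph f \<in> Cc4" "f \<in> Cc4 \<Longrightarrow> d_ps f \<in> Cc4"
  by (simp_all add: partial4) (simp_all add: Cc4_eq c4.deriv_Cc)

lemma partial2_Cc2: "f \<in> Cc2 \<Longrightarrow> q_ph f \<in> Cc2" "f \<in> Cc2 \<Longrightarrow> q_ps f \<in> Cc2"
  by (simp_all add: partial2) (simp_all add: Cc2_eq c2.deriv_Cc)

lemma smooth_on_cmult_rect: "smooth_on rect c \<Longrightarrow> smooth_on rect (\<lambda>r. (k::complex) * c r)"
  by (intro smooth_on_mult smooth_on_const open_rect)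

lemma D_V0_Cc4: "f \<in> Cc4 \<Longrightarrow> D_V0 f \<in> Cc4"
  unfolding D_V0_eq[abs_def] Let_def by (intro Cc4_ops partial4_Cc4 coefs_smooth)

lemma nabla_Cc4: "f \<in> Cc4 \<Longrightarrow> nabla_ph f \<in> Cc4" "f \<in> Cc4 \<Longrightarrow> nabla_ps f \<in> Cc4"
  unfolding nabla_ph_eq[abs_def] nabla_ps_eq[abs_def] by (intro Cc4_ops partial4_Cc4 coefs_smooth; assumption)+

lemma D_Q0_Cc2: "f \<in> Cc2 \<Longrightarrow> D_Q0 f \<in> Cc2"
  unfolding D_Q0_eq[abs_def] Let_def
  by (intro Cc2_ops partial2_Cc2 coefs_smooth Cc2_coef[where c = "\<lambda>r. (1/2) * pot_ps r"] smooth_on_cmult_rect)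

lemma vertical_symb_Cc4: "f \<in> Cc4 \<Longrightarrow> vertical_symb f \<in> Cc4"
  unfolding vertical_symb_def[abs_def] Let_def by (intro Cc4_ops partial4_Cc4 coefs_smooth)

lemma horizontal_symb_Cc4: "f \<in> Cc4 \<Longrightarrow> horizontal_symb f \<in> Cc4"
  unfolding horizontal_symb_def[abs_def] Let_def
  by (intro Cc4_ops partial4_Cc4 coefs_smooth Cc4_coef[where c = "\<lambda>r. (3/2) * pot_ps r"] smooth_on_cmult_rect)

lemma X_act_sec_Cc4:
  assumes "f \<in> Cc4"
  shows "X_act f (\<lambda>y. let (ph, ps) = chart2 y in 1 / of_real (cos ps)) \<in> Cc4"
    and "X_act f (\<lambda>y. let (ph, ps) = chart2 y in 1 / of_real (cos ps)) p = sec_ps (snd (snd (chart4 p))) *s f p"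
proof -
  show *: "X_act f (\<lambda>y. let (ph, ps) = chart2 y in 1 / of_real (cos ps)) p = sec_ps (snd (snd (chart4 p))) *s f p" for p
  proof (cases "p \<in> S4_0")
    case True
    then show ?thesis by (simp add: X_act_def quot_chart Let_def case_prod_unfold sec_ps_def)
  next
    case False
    then have "f p = 0" using assms c4.Cc_outside unfolding Cc4_eq by blast
    then show ?thesis by (simp add: X_act_def)
  qed
  show "X_act f (\<lambda>y. let (ph, ps) = chart2 y in 1 / of_real (cos ps)) \<in> Cc4"
    unfolding *[abs_def] by (intro Cc4_coef assms coefs_smooth)
qed

subsection \<open>The product rule\<close>

lemma spinor_tensor_Cc4:
  assumes "\<xi> \<in> Cc4" "\<eta> \<in> Cc2"
  shows "(\<lambda>p. spinor_tensor (\<xi> p) (\<eta> (quot p))) \<in> Cc4"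
  using c4.Cc_bilinear[OF bounded_bilinear_spinor_tensor _ Cc2_quot_smooth[OF assms(2)]] assms(1)
  by (simp add: Cc4_eq)

text \<open>
  In coordinates the second factor is a function of the last two variables only.
\<close>

lemma deriv_spinor_tensor:
  assumes \<xi>: "\<xi> \<in> Cc4" and \<eta>: "\<eta> \<in> Cc2"
  shows "c4.deriv v (\<lambda>p. spinor_tensor (\<xi> p) (\<eta> (quot p))) p =
    spinor_tensor (c4.deriv v \<xi> p) (\<eta> (quot p)) + spinor_tensor (\<xi> p) (c2.deriv (snd (snd v)) \<eta> (quot p))"
proof (cases "p \<in> S4_0")
  case True
  let ?z = "chart4 p"
  have z: "?z \<in> cover4" by (rule c4.\<sigma>_in[OF True])
  then have r: "snd (snd ?z) \<in> rect" by auto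
  have q: "quot p = sph2 (snd (snd ?z))"
    using sph2_chart2[OF quot_in[OF True]] by (simp add: quot_chart[OF True])
  have d1: "((\<lambda>z. \<xi> (sph4 z)) has_derivative (\<lambda>v. c4.deriv v \<xi> p)) (at ?z)"
    using smooth_on_has_derivative[OF c4.Cc_smooth[OF \<xi>[unfolded Cc4_eq]] z]
    by (simp add: c4.deriv_def True)
  have d2: "((\<lambda>r. \<eta> (sph2 r)) has_derivative (\<lambda>v. c2.deriv v \<eta> (quot p))) (at (snd (snd ?z)))"
    using smooth_on_has_derivative[OF c2.Cc_smooth[OF \<eta>[unfolded Cc2_eq]] r]
    by (simp add: c2.deriv_def q sph2_in[OF r] chart2_sph2[OF r])
  have d3: "((\<lambda>z. \<eta> (sph2 (snd (snd z)))) has_derivative (\<lambda>v. c2.deriv (snd (snd v)) \<eta> (quot p))) (at ?z)"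
    using diff_chain_at[OF bounded_linear_imp_has_derivative[OF bounded_linear_compose[OF bounded_linear_snd bounded_linear_snd]] d2]
    by (simp add: o_def)
  have d4: "((\<lambda>z. \<eta> (quot (sph4 z))) has_derivative (\<lambda>v. c2.deriv (snd (snd v)) \<eta> (quot p))) (at ?z)"
    by (rule has_derivative_transform_within_open[OF d3 open_cover z]) (auto simp: quot_sph4)
  from c4.deriv_eq[OF z bounded_bilinear.FDERIV[OF bounded_bilinear_spinor_tensor d1 d4], of v]
  show ?thesis by (simp add: c4.F_\<sigma>[OF True] add.commute)
next
  case False
  then have "\<xi> p = 0" using \<xi> c4.Cc_outside unfolding Cc4_eq by blast
  then show ?thesis using False by (simp add: c4.deriv_def spinor_tensor_zero)
qed

lemma c2_deriv_zero: "\<eta> \<in> Cc2 \<Longrightarrow> c2.deriv (0, 0) \<eta> y = 0"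
  using linear_0[OF has_derivative_linear[OF smooth_on_has_derivative[OF c2.Cc_smooth[of \<eta>] c2.\<sigma>_in[of y]]]]
  by (simp add: c2.deriv_def Cc2_eq zero_prod_def)

text \<open>
  Derivatives in the angles see the first factor only.  Along the quadrant the product rule applies,
  and the potentials \<open>tan \<psi>\<close> of the connection and \<open>(1/2) tan \<psi>\<close> of the quadrant add up to the
  \<open>(3/2) tan \<psi>\<close> of the sphere.
\<close>

lemma vertical_spinor_tensor:
  assumes \<xi>: "\<xi> \<in> Cc4" and \<eta>: "\<eta> \<in> Cc2"
  shows "vertical_symb (\<lambda>p. spinor_tensor (\<xi> p) (\<eta> (quot p))) = (\<lambda>p. spinor_tensor (D_V0 \<xi> p) (\<eta> (quot p)))"
  by (simp add: fun_eq_iff vertical_symb_def D_V0_eq Let_def partial4[OF spinor_tensor_Cc4[OF assms]] partial4[OF \<xi>]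
      deriv_spinor_tensor[OF assms] c2_deriv_zero[OF \<eta>] spinor_tensor_zero spinor_tensor_add_left
      spinor_tensor_smult_left spinor_tensor_matrix del: vector_smult_assoc)

lemma horizontal_spinor_tensor:
  assumes \<xi>: "\<xi> \<in> Cc4" and \<eta>: "\<eta> \<in> Cc2"
  shows "horizontal_symb (\<lambda>p. spinor_tensor (\<xi> p) (\<eta> (quot p))) p =
    spinor_tensor (\<xi> p) (D_Q0 \<eta> (quot p)) +
    (spinor_tensor (X_act (nabla_ph \<xi>) (\<lambda>y. let (ph, ps) = chart2 y in 1 / of_real (cos ps)) p) (\<i> *s (sigma1 *v \<eta> (quot p))) +
     spinor_tensor (nabla_ps \<xi> p) (\<i> *s (sigma2 *v \<eta> (quot p))))"
proof (cases "p \<in> S4_0")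
  case True
  let ?r = "snd (snd (chart4 p))"
  have c: "coef_ph ?r = \<i> * sec_ps ?r" by (simp add: coef_ph_def sec_ps_def)
  have l: "spinor_tensor (\<xi> p) (D_Q0 \<eta> (quot p)) =
      coef_ph ?r *s (gamma3 *v spinor_tensor (\<xi> p) (c2.deriv (1, 0) \<eta> (quot p))) +
      \<i> *s (gamma4 *v (spinor_tensor (\<xi> p) (c2.deriv (0, 1) \<eta> (quot p)) - ((1/2) * pot_ps ?r) *s spinor_tensor (\<xi> p) (\<eta> (quot p))))"
    unfolding D_Q0_eq Let_def quot_chart[OF True] partial2[OF \<eta>] spinor_tensor_add_right spinor_tensor_smult_right
      spinor_tensor_matrix
    by (simp add: vec_eq_iff forall_4 matrix4_apply spinor_tensor_nth algebra_simps)
  show ?thesis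
    unfolding X_act_sec_Cc4(2)[OF nabla_Cc4(1)[OF \<xi>]]
    unfolding l horizontal_symb_def Let_def partial4[OF spinor_tensor_Cc4[OF assms]] deriv_spinor_tensor[OF assms]
      nabla_ph_eq nabla_ps_eq partial4[OF \<xi>] c
    by (simp add: vec_eq_iff forall_4 matrix4_apply matrix2_apply spinor_tensor_nth algebra_simps)
next
  case False
  have z: "f p = 0" if "f \<in> Cc4" for f :: "pt4 \<Rightarrow> complex^'n"
    using that False c4.Cc_outside unfolding Cc4_eq by blast
  show ?thesis
    unfolding z[OF \<xi>] z[OF horizontal_symb_Cc4[OF spinor_tensor_Cc4[OF assms]]]
      z[OF X_act_sec_Cc4(1)[OF nabla_Cc4(1)[OF \<xi>]]] z[OF nabla_Cc4(2)[OF \<xi>]]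
    by (simp add: spinor_tensor_zero)
qed

lemma vertical_add: "f \<in> Cc4 \<Longrightarrow> g \<in> Cc4 \<Longrightarrow> vertical_symb (\<lambda>p. f p + g p) = (\<lambda>p. vertical_symb f p + vertical_symb g p)"
  and horizontal_add: "f \<in> Cc4 \<Longrightarrow> g \<in> Cc4 \<Longrightarrow> horizontal_symb (\<lambda>p. f p + g p) = (\<lambda>p. horizontal_symb f p + horizontal_symb g p)"
  and vertical_cmult: "f \<in> Cc4 \<Longrightarrow> vertical_symb (\<lambda>p. k *s f p) = (\<lambda>p. k *s vertical_symb f p)"
  and horizontal_cmult: "f \<in> Cc4 \<Longrightarrow> horizontal_symb (\<lambda>p. k *s f p) = (\<lambda>p. k *s horizontal_symb f p)"
proof -
  have bl: "bounded_linear (\<lambda>v :: complex^4. k *s v)"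
    by (rule bounded_bilinear.bounded_linear_right[OF bounded_bilinear_smult_vec])
  show "vertical_symb (\<lambda>p. f p + g p) = (\<lambda>p. vertical_symb f p + vertical_symb g p)"
    "horizontal_symb (\<lambda>p. f p + g p) = (\<lambda>p. horizontal_symb f p + horizontal_symb g p)" if "f \<in> Cc4" "g \<in> Cc4"
    using that Cc4_ops(1)[OF that]
    by (simp_all add: fun_eq_iff vertical_symb_def horizontal_symb_def Let_def partial4 Cc4_eq c4.deriv_add
        vec_eq_iff forall_4 matrix4_apply algebra_simps)
  show "vertical_symb (\<lambda>p. k *s f p) = (\<lambda>p. k *s vertical_symb f p)"
    "horizontal_symb (\<lambda>p. k *s f p) = (\<lambda>p. k *s horizontal_symb f p)" if "f \<in> Cc4"
    using that Cc4_ops(3)[OF that, of k] c4.deriv_linear[OF bl]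
    by (simp_all add: fun_eq_iff vertical_symb_def horizontal_symb_def Let_def partial4 Cc4_eq
        vec_eq_iff forall_4 matrix4_apply algebra_simps)
qed

text \<open>
  The matrix of \<open>\<Gamma>\<close> is constant in the chosen frame, so it commutes with the derivatives and only the
  Clifford matrices are conjugated.
\<close>

lemma Gamma_conjugates_to_Dirac:
  assumes f: "f \<in> Cc4"
  shows "Gamma_matrix *v (vertical_symb (\<lambda>p. Gamma_matrix *v f p) p + grading_left *v horizontal_symb (\<lambda>p. Gamma_matrix *v f p) p) =
    Dirac4_symb f p"
proof -
  have "c4.deriv v (\<lambda>p. Gamma_matrix *v f p) p = Gamma_matrix *v c4.deriv v f p" for v p
    using c4.deriv_linear[OF bounded_linear_matrix] f by (simp add: Cc4_eq)
  then show ?thesis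
    unfolding vertical_symb_def horizontal_symb_def Dirac4_symb_eq Let_def partial4[OF Cc4_matrix[OF f]] partial4[OF f]
    by (simp add: vec_eq_iff forall_4 matrix4_apply algebra_simps)
qed

lemma Gamma_matrix_involution: "Gamma_matrix *v (Gamma_matrix *v w) = w"
  by (simp add: vec_eq_iff forall_4 matrix4_apply)

section \<open>The Hilbert space of spinors\<close>

lemma sq_int_ip_add_left:
  assumes "f \<in> carr (sq_int M)" "g \<in> carr (sq_int M)" "h \<in> carr (sq_int M)"
  shows "ip (sq_int M) (\<lambda>x. f x + g x) h = ip (sq_int M) f h + ip (sq_int M) g h"
  using integrable_cip[OF assms(1,3)] integrable_cip[OF assms(2,3)]
  by (simp add: sq_int_def cip_add_left)

lemma sq_int_ip_smult_left: "ip (sq_int M) (\<lambda>x. c *s f x) h = cnj c * ip (sq_int M) f h"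
  by (simp add: sq_int_def cip_smult_left)

lemma sq_int_ip_cnj: "cnj (ip (sq_int M) f g) = ip (sq_int M) g f"
  by (simp add: sq_int_def Bochner_Integration.integral_cnj[symmetric] cip_cnj del: Bochner_Integration.integral_cnj)

lemma sq_int_zero: "(\<lambda>_. 0) \<in> carr (sq_int M)"
  by (simp add: mem_sq_int)

lemma sq_int_uminus_carr: "f \<in> carr (sq_int M) \<Longrightarrow> (\<lambda>x. - f x) \<in> carr (sq_int M)"
  by (simp add: mem_sq_int)

text \<open>
  The squared differences are dominated by \<open>4 B\<^sup>2\<close>.
\<close>

lemma sq_int_dominated_convergence:
  fixes s :: "nat \<Rightarrow> 'a \<Rightarrow> complex^'n"
  assumes s: "\<And>n. s n \<in> borel_measurable M" and g [measurable]: "g \<in> borel_measurable M"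
    and B: "integrable M (\<lambda>x. (B x)\<^sup>2)" and lim: "\<And>x. x \<in> space M \<Longrightarrow> (\<lambda>n. s n x) \<longlonglongrightarrow> g x"
    and bound: "\<And>n x. x \<in> space M \<Longrightarrow> norm (s n x) \<le> B x"
  shows "g \<in> carr (sq_int M)" "\<And>n. s n \<in> carr (sq_int M)"
    "(\<lambda>n. nrm (sq_int M) (diff (sq_int M) (s n) g)) \<longlonglongrightarrow> 0"
proof -
  note [measurable] = s
  have gB: "norm (g x) \<le> B x" if "x \<in> space M" for x
    using LIMSEQ_le_const2[OF tendsto_norm[OF lim[OF that]]] bound[OF that] by blast
  have carr: "f \<in> carr (sq_int M)" if [measurable]: "f \<in> borel_measurable M" and "\<And>x. x \<in> space M \<Longrightarrow> norm (f x) \<le> B x"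
    for f :: "'a \<Rightarrow> complex^'n"
  proof -
    have "integrable M (\<lambda>x. (norm (f x))\<^sup>2)"
      by (rule Bochner_Integration.integrable_bound[OF B]) (use that in \<open>auto intro!: power_mono\<close>)
    then show ?thesis by (simp add: mem_sq_int)
  qed
  show "g \<in> carr (sq_int M)" by (rule carr[OF g gB])
  show "s n \<in> carr (sq_int M)" for n by (rule carr[OF s bound])
  have "(\<lambda>n. LINT x|M. (norm (s n x - g x))\<^sup>2) \<longlonglongrightarrow> (LINT x|M. 0)"
  proof (rule integral_dominated_convergence[where w = "\<lambda>x. 4 * (B x)\<^sup>2"])
    show "AE x in M. (\<lambda>n. (norm (s n x - g x))\<^sup>2) \<longlonglongrightarrow> 0"
    proof (rule AE_I2)
      fix x assume x: "x \<in> space M"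
      have "(\<lambda>n. (norm (s n x - g x))\<^sup>2) \<longlonglongrightarrow> (norm (g x - g x))\<^sup>2" by (intro tendsto_intros lim x)
      then show "(\<lambda>n. (norm (s n x - g x))\<^sup>2) \<longlonglongrightarrow> 0" by simp
    qed
    show "AE x in M. norm ((norm (s n x - g x))\<^sup>2) \<le> 4 * (B x)\<^sup>2" for n
    proof (rule AE_I2)
      fix x assume x: "x \<in> space M"
      have "norm (s n x - g x) \<le> 2 * B x"
        using norm_triangle_ineq4[of "s n x" "g x"] bound[OF x, of n] gB[OF x] by simp
      then have "(norm (s n x - g x))\<^sup>2 \<le> (2 * B x)\<^sup>2" by (intro power_mono) auto
      then show "norm ((norm (s n x - g x))\<^sup>2) \<le> 4 * (B x)\<^sup>2" by (simp add: power_mult_distrib)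
    qed
  qed (use B in auto)
  then have "(\<lambda>n. sqrt (LINT x|M. (norm (s n x - g x))\<^sup>2)) \<longlonglongrightarrow> sqrt 0"
    by (intro tendsto_real_sqrt) simp
  then show "(\<lambda>n. nrm (sq_int M) (diff (sq_int M) (s n) g)) \<longlonglongrightarrow> 0"
    by (simp add: sq_int_diff) (simp add: sq_int_def)
qed

abbreviation SQ :: "(pt4 \<Rightarrow> complex^4, complex) ip_space" where
  "SQ \<equiv> sq_int vol4"

lemma carr_L2_S4: "carr L2_S4 = cls SQ ` carr SQ"
  by (simp add: L2_S4_def L2_def sq.carr_hausdorff)

text \<open>
  The Hilbert space \<open>L2_S4\<close> as a type, so that limits and closures in it are those of a real
  inner product space; \<open>spinor f\<close> is the class of the function \<open>f\<close>.
\<close>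

typedef spinor_L2 = "carr L2_S4"
  unfolding carr_L2_S4 using sq_int_zero by blast

definition spinor :: "(pt4 \<Rightarrow> complex^4) \<Rightarrow> spinor_L2" where
  "spinor f = Abs_spinor_L2 (cls SQ f)"

lemma Rep_spinor: "f \<in> carr SQ \<Longrightarrow> Rep_spinor_L2 (spinor f) = cls SQ f"
  unfolding spinor_def by (rule Abs_spinor_L2_inverse) (simp add: carr_L2_S4)

lemma spinor_cases:
  obtains f where "f \<in> carr SQ" "a = spinor f"
proof -
  have "Rep_spinor_L2 a \<in> cls SQ ` carr SQ" using Rep_spinor_L2[of a] by (simp add: carr_L2_S4)
  then obtain f where "f \<in> carr SQ" "Rep_spinor_L2 a = cls SQ f" by blast
  then show ?thesis using that by (metis Rep_spinor_L2_inverse spinor_def)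
qed

lemma spinor_eq_iff: "f \<in> carr SQ \<Longrightarrow> g \<in> carr SQ \<Longrightarrow> spinor f = spinor g \<longleftrightarrow> (AE p in vol4. f p = g p)"
  unfolding spinor_def by (subst Abs_spinor_L2_inject) (simp_all add: carr_L2_S4 cls_sq_int_eq_iff)

definition cscale :: "complex \<Rightarrow> spinor_L2 \<Rightarrow> spinor_L2" where
  "cscale c a = Abs_spinor_L2 (smult L2_S4 c (Rep_spinor_L2 a))"

definition cinner :: "spinor_L2 \<Rightarrow> spinor_L2 \<Rightarrow> complex" where
  "cinner a b = ip L2_S4 (Rep_spinor_L2 a) (Rep_spinor_L2 b)"

lemma cscale_spinor: "f \<in> carr SQ \<Longrightarrow> cscale c (spinor f) = spinor (\<lambda>p. c *s f p)"
  by (simp add: cscale_def Rep_spinor L2_S4_def L2_def sq.smult_hausdorff)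
    (simp add: spinor_def sq_int_smult_eq)

lemma cinner_spinor: "f \<in> carr SQ \<Longrightarrow> g \<in> carr SQ \<Longrightarrow> cinner (spinor f) (spinor g) = ip SQ f g"
  by (simp add: cinner_def Rep_spinor L2_S4_def ip_L2)

instantiation spinor_L2 :: real_inner
begin

definition zero_spinor_L2 :: spinor_L2 where "zero_spinor_L2 = spinor (\<lambda>_. 0)"
definition plus_spinor_L2 :: "spinor_L2 \<Rightarrow> spinor_L2 \<Rightarrow> spinor_L2" where
  "plus_spinor_L2 a b = Abs_spinor_L2 (add L2_S4 (Rep_spinor_L2 a) (Rep_spinor_L2 b))"
definition uminus_spinor_L2 :: "spinor_L2 \<Rightarrow> spinor_L2" where "uminus_spinor_L2 a = cscale (-1) a"
definition minus_spinor_L2 :: "spinor_L2 \<Rightarrow> spinor_L2 \<Rightarrow> spinor_L2" where "minus_spinor_L2 a b = a + (- b)"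
definition scaleR_spinor_L2 :: "real \<Rightarrow> spinor_L2 \<Rightarrow> spinor_L2" where "scaleR_spinor_L2 r a = cscale (of_real r) a"
definition inner_spinor_L2 :: "spinor_L2 \<Rightarrow> spinor_L2 \<Rightarrow> real" where "inner_spinor_L2 a b = Re (cinner a b)"
definition norm_spinor_L2 :: "spinor_L2 \<Rightarrow> real" where "norm_spinor_L2 a = sqrt (inner a a)"
definition sgn_spinor_L2 :: "spinor_L2 \<Rightarrow> spinor_L2" where "sgn_spinor_L2 a = inverse (norm a) *\<^sub>R a"
definition dist_spinor_L2 :: "spinor_L2 \<Rightarrow> spinor_L2 \<Rightarrow> real" where "dist_spinor_L2 a b = norm (a - b)"
definition uniformity_spinor_L2 :: "(spinor_L2 \<times> spinor_L2) filter" where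
  "uniformity_spinor_L2 = (INF e\<in>{0<..}. principal {(x, y). dist x y < e})"
definition open_spinor_L2 :: "spinor_L2 set \<Rightarrow> bool" where
  "open_spinor_L2 U = (\<forall>x\<in>U. eventually (\<lambda>(x', y). x' = x \<longrightarrow> y \<in> U) uniformity)"

lemma spinor_add: "f \<in> carr SQ \<Longrightarrow> g \<in> carr SQ \<Longrightarrow> spinor f + spinor g = spinor (\<lambda>p. f p + g p)"
  by (simp add: plus_spinor_L2_def Rep_spinor L2_S4_def L2_def sq.add_hausdorff)
    (simp add: spinor_def sq_int_add_eq)

lemma spinor_scaleR: "f \<in> carr SQ \<Longrightarrow> r *\<^sub>R spinor f = spinor (\<lambda>p. of_real r *s f p)"
  by (simp add: scaleR_spinor_L2_def cscale_spinor)

lemma spinor_minus: "f \<in> carr SQ \<Longrightarrow> - spinor f = spinor (\<lambda>p. (-1) *s f p)"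
  unfolding uminus_spinor_L2_def by (rule cscale_spinor)

instance
proof
  fix a b c :: spinor_L2 and r t :: real
  obtain f where f: "f \<in> carr SQ" "a = spinor f" by (rule spinor_cases)
  obtain g where g: "g \<in> carr SQ" "b = spinor g" by (rule spinor_cases)
  obtain h where h: "h \<in> carr SQ" "c = spinor h" by (rule spinor_cases)
  note rules = f g h spinor_add spinor_scaleR spinor_minus sq_int_add_carr sq_int_smult_carr
    zero_spinor_L2_def sq_int_zero minus_spinor_L2_def
  show "a + b + c = a + (b + c)" "a + b = b + a" "0 + a = a" "r *\<^sub>R (a + b) = r *\<^sub>R a + r *\<^sub>R b"
    "(r + t) *\<^sub>R a = r *\<^sub>R a + t *\<^sub>R a" "r *\<^sub>R t *\<^sub>R a = (r * t) *\<^sub>R a"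
    by (simp_all add: rules algebra_simps vector_add_ldistrib vector_sadd_rdistrib vector_smult_assoc)
  show "1 *\<^sub>R a = a" by (simp add: rules)
  show "- a + a = 0" by (simp add: rules sq_int_uminus_carr)
  show "a - b = a + - b" by (rule minus_spinor_L2_def)
  show "dist a b = norm (a - b)" by (rule dist_spinor_L2_def)
  show "sgn a = inverse (norm a) *\<^sub>R a" by (rule sgn_spinor_L2_def)
  show "(uniformity :: (spinor_L2 \<times> spinor_L2) filter) = (INF e\<in>{0<..}. principal {(x, y). dist x y < e})"
    by (rule uniformity_spinor_L2_def)
  show "open U = (\<forall>x\<in>U. eventually (\<lambda>(x', y). x' = x \<longrightarrow> y \<in> U) uniformity)" for U :: "spinor_L2 set"
    by (rule open_spinor_L2_def)
  show "inner a b = inner b a"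
    using sq_int_ip_cnj[of vol4 f g] by (simp add: inner_spinor_L2_def rules cinner_spinor) (metis complex_cnj(1) cnj.simps(1))
  show "inner (a + b) c = inner a c + inner b c"
    by (simp add: inner_spinor_L2_def rules cinner_spinor sq_int_ip_add_left)
  show "inner (r *\<^sub>R a) b = r * inner a b"
    by (simp add: inner_spinor_L2_def rules cinner_spinor sq_int_ip_smult_left)
  have aa: "inner a a = (nrm SQ f)\<^sup>2"
    by (simp add: inner_spinor_L2_def f cinner_spinor sq_int_ip_self)
  then show "0 \<le> inner a a" by simp
  have "nrm SQ f = 0 \<longleftrightarrow> (AE p in vol4. f p = 0)"
    using null_rel_sq_int[of f "\<lambda>_. 0" vol4] f by (simp add: null_rel_def sq_int_diff sq_int_zero)
  then show "inner a a = 0 \<longleftrightarrow> a = 0"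
    using aa spinor_eq_iff[OF f(1) sq_int_zero] by (simp add: f zero_spinor_L2_def)
  show "norm a = sqrt (inner a a)" by (rule norm_spinor_L2_def)
qed

end

lemma norm_spinor: "f \<in> carr SQ \<Longrightarrow> norm (spinor f) = nrm SQ f"
  by (simp add: norm_eq_sqrt_inner inner_spinor_L2_def cinner_spinor sq_int_ip_self sq_int_nrm_nonneg)

lemma spinor_diff: "f \<in> carr SQ \<Longrightarrow> g \<in> carr SQ \<Longrightarrow> spinor f - spinor g = spinor (\<lambda>p. f p - g p)"
  by (simp add: diff_conv_add_uminus spinor_minus spinor_add sq_int_uminus_carr del: add_uminus_conv_diff)

lemma norm_spinor_diff: "f \<in> carr SQ \<Longrightarrow> g \<in> carr SQ \<Longrightarrow> norm (spinor f - spinor g) = nrm SQ (diff SQ f g)"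
  using sq.diff_carr[of f vol4 g] by (simp add: spinor_diff norm_spinor sq_int_diff)

instance spinor_L2 :: complete_space
proof
  fix X :: "nat \<Rightarrow> spinor_L2" assume X: "Cauchy X"
  have "\<forall>n. \<exists>f. f \<in> carr SQ \<and> X n = spinor f" using spinor_cases by metis
  then obtain s where s: "\<And>n. s n \<in> carr SQ" "\<And>n. X n = spinor (s n)" by metis
  have "s \<in> carr (cauchy_seqs SQ)"
    using X unfolding sq.cauchy_iff Cauchy_def by (simp add: s dist_norm norm_spinor_diff)
  then obtain g where g: "g \<in> carr SQ" "(\<lambda>n. nrm SQ (diff SQ (s n) g)) \<longlonglongrightarrow> 0" by (rule sq_int_complete)
  then have "(\<lambda>n. norm (X n - spinor g)) \<longlonglongrightarrow> 0" by (simp add: s norm_spinor_diff)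
  then have "X \<longlonglongrightarrow> spinor g" using LIM_zero_iff tendsto_norm_zero_iff by blast
  then show "convergent X" by (auto simp: convergent_def)
qed

lemma cscale_simps:
  "cscale c (a + b) = cscale c a + cscale c b" "cscale c (cscale d a) = cscale (c * d) a"
  "cscale 1 a = a" "norm (cscale c a) = cmod c * norm a" "cscale (c + d) a = cscale c a + cscale d a"
  "cscale (-1) a = - a"
proof -
  obtain f where f: "f \<in> carr SQ" "a = spinor f" by (rule spinor_cases)
  obtain g where g: "g \<in> carr SQ" "b = spinor g" by (rule spinor_cases)
  show "cscale c (a + b) = cscale c a + cscale c b" "cscale c (cscale d a) = cscale (c * d) a"
    "cscale 1 a = a" "norm (cscale c a) = cmod c * norm a" "cscale (c + d) a = cscale c a + cscale d a"
    by (simp_all add: f g cscale_spinor spinor_add sq_int_add_carr sq_int_smult_carr norm_spinor sq_int_nrm_smult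
        vector_add_ldistrib vector_sadd_rdistrib vector_smult_assoc)
  show "cscale (-1) a = - a" by (simp add: uminus_spinor_L2_def)
qed

lemma cscale_zero: "cscale c 0 = 0" "cscale 0 a = 0"
  using cscale_simps(4)[of c 0] cscale_simps(4)[of 0 a] by simp_all

lemma scaleR_cscale: "r *\<^sub>R a = cscale (of_real r) a"
  by (simp add: scaleR_spinor_L2_def)

lemma bounded_linear_cscale: "bounded_linear (cscale c)"
  by (rule bounded_linear_intro[where K = "cmod c"])
    (simp_all add: cscale_simps scaleR_cscale mult.commute)

lemma cinner_simps:
  "cinner (a + b) c = cinner a c + cinner b c" "cinner (cscale k a) c = cnj k * cinner a c"
  "cnj (cinner a b) = cinner b a" "cinner a a = of_real ((norm a)\<^sup>2)" "cmod (cinner a b) \<le> norm a * norm b"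
proof -
  obtain f where f: "f \<in> carr SQ" "a = spinor f" by (rule spinor_cases)
  obtain g where g: "g \<in> carr SQ" "b = spinor g" by (rule spinor_cases)
  obtain h where h: "h \<in> carr SQ" "c = spinor h" by (rule spinor_cases)
  show "cinner (a + b) c = cinner a c + cinner b c" "cinner (cscale k a) c = cnj k * cinner a c"
    "cnj (cinner a b) = cinner b a" "cinner a a = of_real ((norm a)\<^sup>2)" "cmod (cinner a b) \<le> norm a * norm b"
    by (simp_all add: f g h cscale_spinor cinner_spinor spinor_add sq_int_add_carr sq_int_smult_carr norm_spinor
        sq_int_ip_add_left sq_int_ip_smult_left sq_int_ip_cnj sq_int_ip_self sq_int_cauchy_schwarz)
qed

lemma cinner_right_simps:
  "cinner c (a + b) = cinner c a + cinner c b" "cinner c (cscale k a) = k * cinner c a"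
proof -
  have "cnj (cinner (a + b) c) = cnj (cinner a c) + cnj (cinner b c)" by (simp add: cinner_simps(1))
  then show "cinner c (a + b) = cinner c a + cinner c b" by (simp add: cinner_simps(3))
  have "cnj (cinner (cscale k a) c) = k * cnj (cinner a c)" by (simp add: cinner_simps(2))
  then show "cinner c (cscale k a) = k * cinner c a" by (simp add: cinner_simps(3))
qed

lemma bounded_bilinear_cinner: "bounded_bilinear cinner"
  by (rule bounded_bilinear.intro)
    (auto simp: cinner_simps(1,2) cinner_right_simps scaleR_cscale scaleR_conv_of_real
      intro!: exI[of _ 1] cinner_simps(5))

lemmas tendsto_cinner = bounded_bilinear.tendsto[OF bounded_bilinear_cinner]

section \<open>Density of the smooth spinors\<close>

lemma vol4_dominated_convergence:
  assumes s: "\<And>n. s n \<in> borel_measurable vol4" and g: "g \<in> borel_measurable vol4"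
    and lim: "\<And>p. p \<in> S4_0 \<Longrightarrow> (\<lambda>n. s n p) \<longlonglongrightarrow> g p"
    and bound: "\<And>n p. p \<in> S4_0 \<Longrightarrow> norm (s n p) \<le> B p" and B: "integrable vol4 (\<lambda>p. (B p)\<^sup>2)"
  shows "g \<in> carr SQ" "\<And>n. s n \<in> carr SQ" "(\<lambda>n. spinor (s n)) \<longlonglongrightarrow> spinor g"
proof -
  note * = sq_int_dominated_convergence[OF s g B, unfolded vol4.space_M, OF lim bound]
  show c: "g \<in> carr SQ" by (rule *(1))
  show c': "s n \<in> carr SQ" for n by (rule *(2))
  have "(\<lambda>n. norm (spinor (s n) - spinor g)) \<longlonglongrightarrow> 0" using *(3) by (simp add: norm_spinor_diff c c')
  then show "(\<lambda>n. spinor (s n)) \<longlonglongrightarrow> spinor g" using LIM_zero_iff tendsto_norm_zero_iff by blast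
qed

lemma vol4_integrable_const: "integrable vol4 (\<lambda>p. (C :: real)\<^sup>2)"
  by (rule finite_measure.integrable_const[OF finite_measure_vol4])

lemma in_closure_sequentially:
  fixes l :: "'a::metric_space"
  shows "(\<And>n. x n \<in> A) \<Longrightarrow> x \<longlonglongrightarrow> l \<Longrightarrow> l \<in> closure A"
  by (auto simp: closure_sequential)

definition smooth_spinors :: "spinor_L2 set" where
  "smooth_spinors = spinor ` Cc4"

lemma closure_smooth_spinors_add:
  assumes "a \<in> closure smooth_spinors" "b \<in> closure smooth_spinors"
  shows "a + b \<in> closure smooth_spinors"
proof -
  obtain x where x: "\<And>n. x n \<in> smooth_spinors" "x \<longlonglongrightarrow> a" using assms(1) unfolding closure_sequential by blast
  obtain y where y: "\<And>n. y n \<in> smooth_spinors" "y \<longlonglongrightarrow> b" using assms(2) unfolding closure_sequential by blast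
  have "x n + y n \<in> smooth_spinors" for n
  proof -
    obtain f g where "f \<in> Cc4" "g \<in> Cc4" "x n = spinor f" "y n = spinor g"
      using x(1)[of n] y(1)[of n] by (auto simp: smooth_spinors_def)
    then show ?thesis by (simp add: smooth_spinors_def spinor_add Cc4_sq_int Cc4_ops(1))
  qed
  then show ?thesis by (rule in_closure_sequentially[OF _ tendsto_add[OF x(2) y(2)]])
qed

lemma closure_smooth_spinors_minus:
  assumes "a \<in> closure smooth_spinors"
  shows "- a \<in> closure smooth_spinors"
proof -
  obtain x where x: "\<And>n. x n \<in> smooth_spinors" "x \<longlonglongrightarrow> a" using assms unfolding closure_sequential by blast
  have "- x n \<in> smooth_spinors" for n
  proof -
    obtain f where "f \<in> Cc4" "x n = spinor f" using x(1)[of n] by (auto simp: smooth_spinors_def)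
    then show ?thesis using Cc4_ops(3)[of f "-1"] by (auto simp: smooth_spinors_def spinor_minus Cc4_sq_int)
  qed
  then show ?thesis by (rule in_closure_sequentially[OF _ tendsto_minus[OF x(2)]])
qed

lemma Cc2_quot_Cc4:
  assumes "h \<in> Cc2"
  shows "(\<lambda>p. h (quot p)) \<in> Cc4"
proof -
  obtain K where K: "compact K" "K \<subseteq> Q2_0" "\<forall>p. p \<notin> K \<longrightarrow> h p = 0"
    using assms c2.Cc_support unfolding Cc2_eq by blast
  have sub: "quot -` K \<subseteq> S4_0"
  proof
    fix p assume "p \<in> quot -` K"
    then have "quot p \<in> Q2_0" using K(2) by auto
    then show "p \<in> S4_0" by (cases p) (auto simp: quot_def Q2_0_eq S4_0_def)
  qed
  have "bounded S4_0"
  proof (rule bounded_subset[of "cball 0 1 \<times> cball 0 1 \<times> {-1..1}"])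
    have "cmod a \<le> 1 \<and> cmod b \<le> 1 \<and> \<bar>x\<bar> \<le> 1" if "(cmod a)\<^sup>2 + (cmod b)\<^sup>2 + x\<^sup>2 = 1" for a b x
      using sphere_coordinates_le_1[OF that] by simp
    then show "S4_0 \<subseteq> cball 0 1 \<times> cball 0 1 \<times> {-1..1}" by (force simp: abs_le_iff S4_0_def)
  qed (auto intro!: bounded_Times)
  then have "bounded (quot -` K)" using sub bounded_subset by blast
  moreover have "closed (quot -` K)"
    by (rule closed_vimage[OF compact_imp_closed[OF K(1)] continuous_quot])
  ultimately have "compact (quot -` K)" by (simp add: compact_eq_bounded_closed)
  then show ?thesis
    unfolding Cc4_eq by (rule c4.CcI[OF Cc2_quot_smooth[OF assms] _ sub]) (use K(3) in blast)
qed

lemma smooth_on_sph4: "smooth_on cover4 (\<lambda>z. sph4 z \<bullet> b)"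
proof -
  note t = smooth_on_linear[OF bounded_linear_fst open_cover]
    smooth_on_linear[OF bounded_linear_compose[OF bounded_linear_fst bounded_linear_snd] open_cover]
    smooth_on_linear[OF bounded_linear_compose[OF bounded_linear_fst bounded_linear_compose[OF bounded_linear_snd bounded_linear_snd]] open_cover]
    smooth_on_linear[OF bounded_linear_compose[OF bounded_linear_snd bounded_linear_compose[OF bounded_linear_snd bounded_linear_snd]] open_cover]
  note sc = t[THEN smooth_on_sin[OF open_cover]] t[THEN smooth_on_cos[OF open_cover]]
  obtain b1 b2 b3 where b: "b = (b1, b2, b3)" by (cases b)
  have "smooth_on cover4 (\<lambda>z :: real \<times> real \<times> real \<times> real.
     (cos (fst z) * (cos (fst (snd (snd z))) * cos (snd (snd (snd z))))) * Re b1 +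
     (sin (fst z) * (cos (fst (snd (snd z))) * cos (snd (snd (snd z))))) * Im b1 +
     ((cos (fst (snd z)) * (sin (fst (snd (snd z))) * cos (snd (snd (snd z))))) * Re b2 +
     (sin (fst (snd z)) * (sin (fst (snd (snd z))) * cos (snd (snd (snd z))))) * Im b2 +
      sin (snd (snd (snd z))) * b3))"
    by (intro smooth_on_add[OF open_cover] smooth_on_mult[OF open_cover] smooth_on_const[OF open_cover] sc)
  then show ?thesis
    by (simp add: sph4_def b case_prod_unfold inner_complex_def algebra_simps)
qed

lemma smooth_on_prod:
  assumes "finite I" "open U" "\<And>i. i \<in> I \<Longrightarrow> smooth_on U (f i)"
  shows "smooth_on U (\<lambda>x. \<Prod>i\<in>I. (f i x :: real))"
  using assms(1,3) by (induction I rule: finite_induct) (auto intro: smooth_on_mult smooth_on_const assms(2))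

definition box_approx :: "pt4 \<Rightarrow> pt4 \<Rightarrow> nat \<Rightarrow> pt4 \<Rightarrow> real" where
  "box_approx l u n p = (\<Prod>b\<in>Basis. smooth_step (real n * ((p - l) \<bullet> b)) * smooth_step (real n * ((u - p) \<bullet> b)))"

lemma box_approx_bounds: "0 \<le> box_approx l u n p" "box_approx l u n p \<le> 1"
  unfolding box_approx_def
  by (auto intro!: prod_nonneg prod_le_1 mult_le_one simp: smooth_step_bounds)

lemma smooth_step_scaled_tendsto: "(\<lambda>n. smooth_step (real n * t)) \<longlonglongrightarrow> of_bool (t > 0)"
proof (cases "t > 0")
  case True
  obtain N :: nat where N: "1 / t < real N" using reals_Archimedean2 by blast
  have "smooth_step (real n * t) = 1" if "n \<ge> N" for n
  proof (rule smooth_step_eq_1)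
    have "1 < real N * t" using N True by (simp add: divide_less_eq)
    also have "\<dots> \<le> real n * t" using that True by simp
    finally show "1 \<le> real n * t" by simp
  qed
  then show ?thesis using True by (auto intro!: tendsto_eventually eventually_sequentiallyI)
next
  case False
  then show ?thesis by (simp add: smooth_step_eq_0 mult_nonneg_nonpos)
qed

lemma box_approx_tendsto: "(\<lambda>n. box_approx l u n p) \<longlonglongrightarrow> indicator (box l u) p"
proof -
  have "(\<lambda>n. box_approx l u n p) \<longlonglongrightarrow> (\<Prod>b\<in>Basis. of_bool ((p - l) \<bullet> b > 0) * of_bool ((u - p) \<bullet> b > 0))"
    unfolding box_approx_def by (intro tendsto_prod tendsto_mult smooth_step_scaled_tendsto)
  moreover have "(\<Prod>b\<in>Basis. of_bool ((p - l) \<bullet> b > 0) * of_bool ((u - p) \<bullet> b > 0)) = (indicator (box l u) p :: real)"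
  proof (cases "p \<in> box l u")
    case True
    then show ?thesis by (auto simp: mem_box inner_diff_left intro!: prod.neutral)
  next
    case False
    then obtain b where b: "b \<in> Basis" "\<not> (l \<bullet> b < p \<bullet> b \<and> p \<bullet> b < u \<bullet> b)" by (auto simp: mem_box)
    then have "(\<Prod>b\<in>Basis. of_bool ((p - l) \<bullet> b > 0) * of_bool ((u - p) \<bullet> b > 0)) = (0::real)"
      by (intro prod_zero) (auto simp: inner_diff_left)
    then show ?thesis using False by simp
  qed
  ultimately show ?thesis by simp
qed

text \<open>
  Products of smooth steps of the ambient coordinates, which are smooth on the covering, converge
  pointwise and boundedly to the indicator of a box.  The cutoff near the excluded orbits makes their
  supports compact and tends to one.
\<close>

lemma indicator_box_in_closure:
  "spinor (\<lambda>p. of_real (indicator (box l u) p) *s v) \<in> closure smooth_spinors"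
    "(\<lambda>p. of_real (indicator (box l u) p) *s v) \<in> carr SQ"
proof -
  define F where "F n p = complex_of_real (cutoff (1 / real (Suc n)) (quot p)) *s (of_real (box_approx l u n p) *s v)" for n p
  have FC: "F n \<in> Cc4" for n
  proof -
    have "smooth_on cover4 (\<lambda>z. box_approx l u n (sph4 z))"
      unfolding box_approx_def inner_diff_left
      by (intro smooth_on_prod smooth_on_mult smooth_on_smooth_step smooth_on_diff smooth_on_const smooth_on_sph4 open_cover)
        auto
    then have "smooth_on cover4 (\<lambda>z. of_real (box_approx l u n (sph4 z)) *s v)"
      by (intro smooth_on_smult_vec smooth_on_of_real smooth_on_const open_cover)
    from c4.Cc_bilinear[OF bounded_bilinear_smult_vec Cc2_quot_Cc4[OF cutoff_Cc2, unfolded Cc4_eq] this]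
    show ?thesis by (simp add: F_def[abs_def] Cc4_eq)
  qed
  have cut: "(\<lambda>n. cutoff (1 / real (Suc n)) y) \<longlonglongrightarrow> 1" if y: "y \<in> Q2_0" for y
  proof -
    define m where "m = min ((fst y)\<^sup>2) ((fst (snd y))\<^sup>2)"
    have "m > 0" using y by (auto simp: m_def Q2_0_eq)
    then obtain N where N: "1 / real (Suc N) < m" using nat_approx_posE by blast
    have "cutoff (1 / real (Suc n)) y = 1" if "n \<ge> N" for n
    proof (rule cutoff_eq_1[OF _ y])
      have "1 / real (Suc n) \<le> 1 / real (Suc N)" using that by (simp add: frac_le)
      then show "1 / real (Suc n) \<le> (fst y)\<^sup>2" "1 / real (Suc n) \<le> (fst (snd y))\<^sup>2" using N by (auto simp: m_def)
    qed simp
    then show ?thesis by (auto intro!: tendsto_eventually eventually_sequentiallyI)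
  qed
  have [measurable]: "(\<lambda>p. of_real (indicator (box l u) p) *s v) \<in> borel_measurable vol4"
    unfolding vol4.measurable_M by (intro measurable_restrict_space1) measurable
  have lim: "(\<lambda>n. F n p) \<longlonglongrightarrow> of_real (indicator (box l u) p) *s v" if "p \<in> S4_0" for p
  proof -
    have "(\<lambda>n. F n p) \<longlonglongrightarrow> complex_of_real 1 *s (of_real (indicator (box l u) p) *s v)"
      unfolding F_def
      by (intro bounded_bilinear.tendsto[OF bounded_bilinear_smult_vec] tendsto_of_real box_approx_tendsto tendsto_const
          cut quot_in that)
    then show ?thesis by simp
  qed
  have bd: "norm (F n p) \<le> norm v" for n p
  proof -
    have "norm (F n p) = cutoff (1 / real (Suc n)) (quot p) * box_approx l u n p * norm v"
      using cutoff_bounds box_approx_bounds by (simp add: F_def norm_smult_vec norm_mult)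
    also have "\<dots> \<le> 1 * norm v"
      using cutoff_bounds box_approx_bounds by (intro mult_right_mono mult_le_one) auto
    finally show ?thesis by simp
  qed
  have m: "F n \<in> borel_measurable vol4" for n using Cc4_sq_int[OF FC[of n]] by (simp add: mem_sq_int)
  note dom = vol4_dominated_convergence[of F "\<lambda>p. of_real (indicator (box l u) p) *s v" "\<lambda>_. norm v",
      OF m _ lim bd vol4_integrable_const]
  show "(\<lambda>p. of_real (indicator (box l u) p) *s v) \<in> carr SQ" by (rule dom(1)) measurable
  have "(\<lambda>n. spinor (F n)) \<longlonglongrightarrow> spinor (\<lambda>p. of_real (indicator (box l u) p) *s v)"
    by (rule dom(3)) measurable
  then show "spinor (\<lambda>p. of_real (indicator (box l u) p) *s v) \<in> closure smooth_spinors"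
    by (rule in_closure_sequentially[rotated]) (use FC in \<open>auto simp: smooth_spinors_def\<close>)
qed

lemma indicator_sq_int:
  assumes "A \<in> sets borel"
  shows "(\<lambda>p. complex_of_real (indicator A p) *s v) \<in> carr SQ"
proof -
  note [measurable] = assms
  have m [measurable]: "(\<lambda>p. complex_of_real (indicator A p) *s v) \<in> borel_measurable vol4"
    unfolding vol4.measurable_M by (intro measurable_restrict_space1) measurable
  have "integrable vol4 (\<lambda>p. (norm (complex_of_real (indicator A p) *s v))\<^sup>2)"
  proof (rule finite_measure.integrable_const_bound[OF finite_measure_vol4, where B = "(norm v)\<^sup>2"])
    show "AE p in vol4. norm ((norm (complex_of_real (indicator A p) *s v))\<^sup>2) \<le> (norm v)\<^sup>2"
      by (auto simp: norm_smult_vec indicator_def)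
  qed measurable
  then show ?thesis by (simp add: mem_sq_int)
qed

text \<open>
  Open boxes are stable under intersections and generate the Borel sets, so it remains to pass to
  complements and disjoint unions.
\<close>

lemma indicator_in_closure:
  fixes A :: "pt4 set"
  assumes "A \<in> sets borel"
  shows "spinor (\<lambda>p. complex_of_real (indicator A p) *s v) \<in> closure smooth_spinors"
proof -
  let ?E = "range (\<lambda>(a, b). box a b :: pt4 set)"
  have borel: "sets borel = sigma_sets UNIV ?E" by (simp add: borel_eq_box)
  have "Int_stable ?E" by (auto simp: Int_stable_def box_Int_box)
  moreover have "?E \<subseteq> Pow UNIV" by simp
  moreover have "A \<in> sigma_sets UNIV ?E" using assms by (simp add: borel)
  ultimately show ?thesis
  proof (induction rule: sigma_sets_induct_disjoint)
    case (basic A)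
    then show ?case using indicator_box_in_closure(1) by auto
  next
    case empty
    show ?case using indicator_box_in_closure(1)[of 0 0 v] by simp
  next
    case (compl A)
    then have A: "A \<in> sets borel" by (simp add: borel)
    \<comment> \<open>The complement within the sphere is taken in a box containing the sphere, whose indicator is
      already known to be a limit.\<close>
    define c where "c = (Complex 2 2, Complex 2 2, 2 :: real)"
    have sub: "S4_0 \<subseteq> box (- c) c"
    proof
      fix p assume "p \<in> S4_0"
      then obtain a b x where p: "p = (a, b, x)" "(cmod a)\<^sup>2 + (cmod b)\<^sup>2 + x\<^sup>2 = 1" by (auto simp: S4_0_def)
      have "cmod a \<le> 1" "cmod b \<le> 1" "\<bar>x\<bar> \<le> 1" using sphere_coordinates_le_1[OF p(2)] by simp_all
      then have "\<bar>Re a\<bar> \<le> 1" "\<bar>Im a\<bar> \<le> 1" "\<bar>Re b\<bar> \<le> 1" "\<bar>Im b\<bar> \<le> 1" "\<bar>x\<bar> \<le> 1"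
        using abs_Re_le_cmod[of a] abs_Im_le_cmod[of a] abs_Re_le_cmod[of b] abs_Im_le_cmod[of b] by linarith+
      then show "p \<in> box (- c) c"
        by (auto simp: p(1) c_def mem_box Basis_prod_def Basis_complex_def)
    qed
    let ?f = "\<lambda>B p. complex_of_real (indicator B p) *s v"
    have "spinor (?f (UNIV - A)) = spinor (?f (box (- c) c)) + - spinor (?f A)"
    proof -
      have "spinor (?f (box (- c) c)) + - spinor (?f A) = spinor (\<lambda>p. ?f (box (- c) c) p - ?f A p)"
        by (simp add: spinor_diff indicator_sq_int[OF A] indicator_box_in_closure(2))
      also have "\<dots> = spinor (?f (UNIV - A))"
      proof (subst spinor_eq_iff)
        show "AE p in vol4. ?f (box (- c) c) p - ?f A p = ?f (UNIV - A) p"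
          using sub by (intro AE_I2) (auto simp: vol4.space_M indicator_def vec_eq_iff)
        have "diff SQ (?f (box (- c) c)) (?f A) \<in> carr SQ"
          by (rule sq.diff_carr[OF indicator_box_in_closure(2) indicator_sq_int[OF A]])
        then show "(\<lambda>p. ?f (box (- c) c) p - ?f A p) \<in> carr SQ" by (simp add: sq_int_diff)
        show "?f (UNIV - A) \<in> carr SQ" using A by (intro indicator_sq_int) auto
      qed
      finally show ?thesis ..
    qed
    then show ?case
      using closure_smooth_spinors_add[OF indicator_box_in_closure(1) closure_smooth_spinors_minus[OF compl(2)]] by metis
  next
    case (union A)
    have A: "A i \<in> sets borel" for i using union(2) by (auto simp: borel)
    let ?f = "\<lambda>B p. complex_of_real (indicator B p) *s v"
    have P: "(\<Union>i<n. A i) \<in> sets borel" for n using A by auto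
    have in_cl: "spinor (?f (\<Union>i<n. A i)) \<in> closure smooth_spinors" for n
    proof (induction n)
      case 0
      show ?case using indicator_box_in_closure(1)[of 0 0 v] by simp
    next
      case (Suc n)
      have "A i \<inter> A n = {}" if "i < n" for i
        using disjoint_family_onD[OF union(1), of i n] that by simp
      then have "(\<Union>i<n. A i) \<inter> A n = {}" by blast
      then have "?f (\<Union>i<Suc n. A i) = (\<lambda>p. ?f (\<Union>i<n. A i) p + ?f (A n) p)"
        by (auto simp: fun_eq_iff lessThan_Suc indicator_def vec_eq_iff)
      then have "spinor (?f (\<Union>i<Suc n. A i)) = spinor (?f (\<Union>i<n. A i)) + spinor (?f (A n))"
        by (simp add: spinor_add indicator_sq_int[OF P] indicator_sq_int[OF A])
      then show ?case using closure_smooth_spinors_add[OF Suc union(3)[of n]] by simp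
    qed
    have "(\<lambda>n. spinor (?f (\<Union>i<n. A i))) \<longlonglongrightarrow> spinor (?f (\<Union>i. A i))"
    proof (rule vol4_dominated_convergence(3)[where B = "\<lambda>_. norm v"])
      show "?f (\<Union>i<n. A i) \<in> borel_measurable vol4" for n using indicator_sq_int[OF P] by (simp add: mem_sq_int)
      have "(\<Union>i. A i) \<in> sets borel" using A by auto
      from indicator_sq_int[OF this] show "?f (\<Union>i. A i) \<in> borel_measurable vol4" by (simp add: mem_sq_int)
      show "(\<lambda>n. ?f (\<Union>i<n. A i) p) \<longlonglongrightarrow> ?f (\<Union>i. A i) p" for p
        by (intro bounded_bilinear.tendsto[OF bounded_bilinear_smult_vec] tendsto_of_real tendsto_const LIMSEQ_indicator_UN)
      show "norm (?f (\<Union>i<n. A i) p) \<le> norm v" for n p by (simp add: norm_smult_vec indicator_def)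
      show "integrable vol4 (\<lambda>_. (norm v)\<^sup>2)" by (rule vol4_integrable_const)
    qed
    then show ?case by (rule closed_sequentially[OF closed_closure in_cl])
  qed
qed

lemma simple_function_in_closure:
  assumes "simple_function vol4 F"
  shows "spinor F \<in> closure smooth_spinors" "F \<in> carr SQ"
proof -
  have *: "spinor (\<lambda>p. \<Sum>y\<in>I. complex_of_real (indicator (A y) p) *s y) \<in> closure smooth_spinors \<and>
      (\<lambda>p. \<Sum>y\<in>I. complex_of_real (indicator (A y) p) *s y) \<in> carr SQ"
    if "finite I" "\<And>y. A y \<in> sets borel" for I :: "(complex^4) set" and A
    using that(1)
  proof (induction rule: finite_induct)
    case empty
    have "spinor (\<lambda>_. 0) \<in> closure smooth_spinors" using indicator_box_in_closure(1)[of 0 0 0] by simp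
    then show ?case by (simp add: sq_int_zero)
  next
    case (insert y I)
    let ?g = "\<lambda>p. \<Sum>y\<in>I. complex_of_real (indicator (A y) p) *s y" and ?f = "\<lambda>p. complex_of_real (indicator (A y) p) *s y"
    have "?f \<in> carr SQ" "spinor ?f \<in> closure smooth_spinors"
      using indicator_sq_int indicator_in_closure that(2) by blast+
    moreover have "spinor (\<lambda>p. ?f p + ?g p) = spinor ?f + spinor ?g"
      using insert.IH \<open>?f \<in> carr SQ\<close> by (simp add: spinor_add)
    ultimately show ?case
      using insert by (auto simp: closure_smooth_spinors_add sq_int_add_carr)
  qed
  have fin: "finite (F ` S4_0)" using simple_functionD(1)[OF assms] by (simp add: vol4.space_M)
  have "\<exists>B\<in>sets borel. F -` {y} \<inter> S4_0 = S4_0 \<inter> B" for y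
  proof -
    have "F -` {y} \<inter> S4_0 \<in> sets vol4" using simple_functionD(2)[OF assms, of "{y}"] by (simp add: vol4.space_M)
    then show ?thesis by (auto simp: vol4.sets_M sets_restrict_space image_iff)
  qed
  then obtain A where A: "\<And>y. A y \<in> sets borel" "\<And>y. F -` {y} \<inter> S4_0 = S4_0 \<inter> A y" by metis
  define G where "G p = (\<Sum>y\<in>F ` S4_0. complex_of_real (indicator (A y) p) *s y)" for p
  have FG: "G p = F p" if "p \<in> S4_0" for p
  proof -
    have "p \<in> F -` {y} \<inter> S4_0 \<longleftrightarrow> p \<in> S4_0 \<inter> A y" for y by (simp only: A(2))
    then have "p \<in> A y \<longleftrightarrow> F p = y" for y using that by auto
    then have "G p = (\<Sum>y\<in>F ` S4_0. if F p = y then y else 0)"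
      unfolding G_def by (intro sum.cong refl) (simp add: indicator_def)
    then show ?thesis using that fin by simp
  qed
  have G: "spinor G \<in> closure smooth_spinors" "G \<in> carr SQ"
    using *[OF fin A(1)] unfolding G_def[abs_def] by auto
  have Fm: "F \<in> borel_measurable vol4" by (rule borel_measurable_simple_function[OF assms])
  have "integrable vol4 (\<lambda>p. (norm (G p))\<^sup>2) = integrable vol4 (\<lambda>p. (norm (F p))\<^sup>2)"
    by (rule Bochner_Integration.integrable_cong) (simp_all add: vol4.space_M FG)
  then have "integrable vol4 (\<lambda>p. (norm (F p))\<^sup>2)" using G(2) by (simp add: mem_sq_int)
  then show c: "F \<in> carr SQ" using Fm by (simp add: mem_sq_int)
  have "spinor F = spinor G"
    by (subst spinor_eq_iff[OF c G(2)]) (rule AE_I2, simp add: vol4.space_M FG)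
  then show "spinor F \<in> closure smooth_spinors" using G(1) by simp
qed

text \<open>
  A square integrable function is the dominated limit of simple functions, and these are combinations of
  indicators.
\<close>

theorem smooth_spinors_dense: "closure smooth_spinors = UNIV"
proof -
  have "a \<in> closure smooth_spinors" for a
  proof -
    obtain f where f: "f \<in> carr SQ" "a = spinor f" by (rule spinor_cases)
    have fm: "f \<in> borel_measurable vol4" using f by (simp add: mem_sq_int)
    obtain F where F: "\<forall>i. simple_function vol4 (F i)" "\<forall>p\<in>S4_0. (\<lambda>i. F i p) \<longlonglongrightarrow> f p"
      "\<forall>i. \<forall>p\<in>S4_0. dist (F i p) 0 \<le> 2 * dist (f p) 0"
      using borel_measurable_implies_sequence_metric[OF fm, of 0] unfolding vol4.space_M by blast
    have "(\<lambda>i. spinor (F i)) \<longlonglongrightarrow> spinor f"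
    proof (rule vol4_dominated_convergence(3)[where B = "\<lambda>p. 2 * norm (f p)"])
      show "F i \<in> borel_measurable vol4" for i by (rule borel_measurable_simple_function[OF F(1)[rule_format]])
      show "integrable vol4 (\<lambda>p. (2 * norm (f p))\<^sup>2)"
        using f(1) by (auto simp: power_mult_distrib mem_sq_int)
    qed (use fm F in auto)
    then show ?thesis unfolding f(2)
      by (rule closed_sequentially[OF closed_closure simple_function_in_closure(1)[OF F(1)[rule_format]]])
  qed
  then show ?thesis by blast
qed

section \<open>The vertical Hilbert module\<close>

text \<open>
  Over a fixed point of the quadrant the module inner product is, up to \<open>orbit_weight\<close>, the inner
  product of square integrable functions on the torus.  This gives the Cauchy--Schwarz inequality
  pointwise; the module norm is the supremum of the resulting seminorms.
\<close>

definition orbit_measure :: "(real \<times> real) measure" where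
  "orbit_measure = restrict_space lborel angles"

definition on_orbit :: "real \<times> real \<Rightarrow> (pt4 \<Rightarrow> complex^2) \<Rightarrow> real \<times> real \<Rightarrow> complex^2" where
  "on_orbit r f t = f (sph4 (fst t, snd t, r))"

lemma on_orbit_carr:
  assumes f: "f \<in> Cc4" and r: "r \<in> rect"
  shows "on_orbit r f \<in> carr (sq_int orbit_measure)"
proof -
  have "continuous_on UNIV (\<lambda>t. sph4 (fst t, snd t, r))"
    by (intro continuous_on_compose2[OF continuous_sph4[of UNIV]] continuous_intros) auto
  then have "(\<lambda>t. sph4 (fst t, snd t, r)) \<in> measurable borel (restrict_space borel S4_0)"
    using sph4_in[of "fst r" "snd r"] r
    by (intro measurable_restrict_space2 borel_measurable_continuous_onI) auto
  from measurable_compose[OF this c4.Cc_measurable[OF f[unfolded Cc4_eq]]]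
  have "on_orbit r f \<in> borel_measurable borel" by (simp add: on_orbit_def[abs_def])
  then have m: "on_orbit r f \<in> borel_measurable orbit_measure"
    unfolding orbit_measure_def by (intro measurable_restrict_space1) simp
  obtain C where C: "C \<ge> 0" "\<forall>p. norm (f p) \<le> C"
    by (rule c4.Cc_bounded[OF f[unfolded Cc4_eq]])
  have "finite_measure orbit_measure"
    by (rule finite_measureI) (use angles_finite angles_borel in \<open>auto simp: orbit_measure_def emeasure_restrict_space space_restrict_space\<close>)
  then have "integrable orbit_measure (\<lambda>t. (norm (on_orbit r f t))\<^sup>2)"
  proof (rule finite_measure.integrable_const_bound[where B = "C\<^sup>2"])
    show "AE t in orbit_measure. norm ((norm (on_orbit r f t))\<^sup>2) \<le> C\<^sup>2"
      by (rule AE_I2) (simp add: on_orbit_def power_mono C(2)[rule_format])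
  qed (use m in measurable)
  then show ?thesis by (simp add: mem_sq_int m)
qed

lemma cip_Cc4_measurable:
  assumes "f \<in> Cc4" "g \<in> Cc4"
  shows "(\<lambda>p. cip (f p) (g p :: complex^'n)) \<in> borel_measurable (restrict_space borel S4_0)"
  using c4.Cc_measurable[OF assms(1)[unfolded Cc4_eq]] c4.Cc_measurable[OF assms(2)[unfolded Cc4_eq]]
  by (rule borel_measurable_cip)

lemma X_ip_on_orbit:
  assumes f: "f \<in> Cc4" and g: "g \<in> Cc4" and y: "y \<in> Q2_0"
  shows "X_ip f g y = ip (sq_int orbit_measure) (on_orbit (chart2 y) f) (on_orbit (chart2 y) g) * of_real (orbit_weight (chart2 y))"
  unfolding X_ip_eq[OF cip_Cc4_measurable[OF f g] y]
  using angles_borel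
  by (simp add: fibre_integral_def sq_int_def orbit_measure_def on_orbit_def Bochner_Integration.integral_restrict_space
      set_lebesgue_integral_def)

lemma X_ip_outside: "y \<notin> Q2_0 \<Longrightarrow> X_ip f g y = 0"
  by (simp add: X_ip_def)

lemma orbit_weight_bounds: "r \<in> rect \<Longrightarrow> 0 \<le> orbit_weight r" "\<bar>orbit_weight r\<bar> \<le> 1"
  using rect_trig[of "fst r" "snd r"]
  by (auto simp: orbit_weight_def abs_mult abs_square_le_1 intro!: mult_le_one)

definition orbit_norm :: "pt2 \<Rightarrow> (pt4 \<Rightarrow> complex^2) \<Rightarrow> real" where
  "orbit_norm y f = sqrt (cmod (X_ip f f y))"

lemma orbit_norm_eq:
  assumes "f \<in> Cc4" "y \<in> Q2_0"
  shows "orbit_norm y f = nrm (sq_int orbit_measure) (on_orbit (chart2 y) f) * sqrt (orbit_weight (chart2 y))"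
  using orbit_weight_bounds(1)[OF chart2_in[OF assms(2)]]
  by (simp add: orbit_norm_def X_ip_on_orbit[OF assms(1,1,2)] sq_int_ip_self norm_mult norm_power
      real_sqrt_mult sq_int_nrm_nonneg)

lemma on_orbit_add: "on_orbit r (\<lambda>p. f p + g p) = (\<lambda>t. on_orbit r f t + on_orbit r g t)"
  and on_orbit_smult: "on_orbit r (\<lambda>p. c *s f p) = (\<lambda>t. c *s on_orbit r f t)"
  by (simp_all add: on_orbit_def[abs_def])

lemma orbit_norm_nonneg: "0 \<le> orbit_norm y f"
  by (simp add: orbit_norm_def)

lemma orbit_norm_add:
  assumes "f \<in> Cc4" "g \<in> Cc4"
  shows "orbit_norm y (\<lambda>p. f p + g p) \<le> orbit_norm y f + orbit_norm y g"
proof (cases "y \<in> Q2_0")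
  case True
  note r = chart2_in[OF True]
  show ?thesis
    using sq_int_nrm_add[OF on_orbit_carr[OF assms(1) r] on_orbit_carr[OF assms(2) r]] orbit_weight_bounds(1)[OF r]
    by (simp add: orbit_norm_eq assms Cc4_ops(1) True on_orbit_add distrib_right[symmetric] mult_right_mono)
qed (simp add: orbit_norm_def X_ip_outside)

lemma orbit_norm_smult:
  assumes "f \<in> Cc4"
  shows "orbit_norm y (\<lambda>p. c *s f p) = cmod c * orbit_norm y f"
proof (cases "y \<in> Q2_0")
  case True
  then show ?thesis by (simp add: orbit_norm_eq assms Cc4_ops(3) on_orbit_smult sq_int_nrm_smult)
qed (simp add: orbit_norm_def X_ip_outside)

lemma X_ip_cauchy_schwarz:
  assumes "f \<in> Cc4" "g \<in> Cc4"
  shows "cmod (X_ip f g y) \<le> orbit_norm y f * orbit_norm y g"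
proof (cases "y \<in> Q2_0")
  case True
  note r = chart2_in[OF True]
  let ?w = "orbit_weight (chart2 y)"
  have w: "?w = sqrt ?w * sqrt ?w" "0 \<le> ?w" using orbit_weight_bounds(1)[OF r] by auto
  have "cmod (X_ip f g y) = cmod (ip (sq_int orbit_measure) (on_orbit (chart2 y) f) (on_orbit (chart2 y) g)) * ?w"
    using w(2) by (simp add: X_ip_on_orbit[OF assms True] norm_mult)
  also have "\<dots> \<le> (nrm (sq_int orbit_measure) (on_orbit (chart2 y) f) * nrm (sq_int orbit_measure) (on_orbit (chart2 y) g)) * ?w"
    by (intro mult_right_mono sq_int_cauchy_schwarz on_orbit_carr assms r w(2))
  also have "\<dots> = orbit_norm y f * orbit_norm y g"
    by (subst w(1)) (simp add: orbit_norm_eq assms True)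
  finally show ?thesis .
qed (simp add: orbit_norm_def X_ip_outside)

lemma X_ip_add_left:
  assumes "f \<in> Cc4" "g \<in> Cc4" "h \<in> Cc4"
  shows "X_ip (\<lambda>p. f p + g p) h y = X_ip f h y + X_ip g h y"
  using sq_int_ip_add_left[OF assms[THEN on_orbit_carr[OF _ chart2_in[of y]]]]
  by (cases "y \<in> Q2_0") (simp_all add: X_ip_on_orbit assms Cc4_ops(1) on_orbit_add X_ip_outside distrib_right)

lemma X_ip_cnj:
  assumes "f \<in> Cc4" "h \<in> Cc4"
  shows "cnj (X_ip f h y) = X_ip h f y"
  by (cases "y \<in> Q2_0") (simp_all add: X_ip_on_orbit assms X_ip_outside sq_int_ip_cnj)

lemma X_ip_bounded:
  assumes f: "f \<in> Cc4"
  obtains B where "\<forall>y. cmod (X_ip f f y) \<le> B"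
proof -
  obtain C where C: "C \<ge> 0" "\<forall>p. norm (f p) \<le> C" by (rule c4.Cc_bounded[OF f[unfolded Cc4_eq]])
  have c: "cmod (cip (f p) (f p)) \<le> C\<^sup>2" for p
  proof -
    have "cmod (cip (f p) (f p)) = (norm (f p))\<^sup>2" by (simp add: cip_self norm_power)
    then show ?thesis using power_mono[OF C(2)[rule_format] norm_ge_zero, of p 2] by simp
  qed
  have "cmod (X_ip f f y) \<le> \<bar>C\<^sup>2\<bar> * measure lborel angles" for y
  proof (cases "y \<in> Q2_0")
    case True
    have "cmod (X_ip f f y) \<le> (\<bar>C\<^sup>2\<bar> * measure lborel angles) * 1"
      unfolding X_ip_eq[OF cip_Cc4_measurable[OF f f] True] norm_mult
      using orbit_weight_bounds(2)
      by (intro mult_mono fibre_integral_bound cip_Cc4_measurable f c chart2_in True) auto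
    then show ?thesis by simp
  qed (simp add: X_ip_outside)
  then show ?thesis using that by blast
qed

lemma carr_X_pre: "carr X_pre = Cc4"
  and add_X_pre: "add X_pre = (\<lambda>f g p. f p + g p)"
  and smult_X_pre: "smult X_pre = (\<lambda>c f p. c *s f p)"
  and ip_X_pre: "ip X_pre = X_ip"
  by (simp_all add: X_pre_def)

lemma diff_X_pre: "diff X_pre f g = (\<lambda>p. f p - g p)"
  by (simp add: diff_def add_X_pre smult_X_pre fun_eq_iff)

lemma Q2_0_nonempty: "Q2_0 \<noteq> {}"
proof -
  have "(pi/4, 0) \<in> rect" by (simp add: rect_def)
  then show ?thesis by (auto simp: Q2_0_def)
qed

lemma orbit_norm_le:
  assumes "f \<in> Cc4"
  shows "orbit_norm y f \<le> nrm X_pre f"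
proof (cases "y \<in> Q2_0")
  case True
  obtain B where "\<forall>y. cmod (X_ip f f y) \<le> B" by (rule X_ip_bounded[OF assms])
  then have "cmod (X_ip f f y) \<le> (SUP y\<in>Q2_0. cmod (X_ip f f y))"
    by (intro cSUP_upper True bdd_aboveI2) auto
  then show ?thesis by (simp add: orbit_norm_def X_pre_def)
next
  case False
  obtain z where z: "z \<in> Q2_0" using Q2_0_nonempty by blast
  obtain B where "\<forall>y. cmod (X_ip f f y) \<le> B" by (rule X_ip_bounded[OF assms])
  then have "cmod (X_ip f f z) \<le> (SUP y\<in>Q2_0. cmod (X_ip f f y))"
    by (intro cSUP_upper z bdd_aboveI2) auto
  then have "0 \<le> (SUP y\<in>Q2_0. cmod (X_ip f f y))" using norm_ge_zero order_trans by blast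
  then show ?thesis using False by (simp add: orbit_norm_def X_pre_def X_ip_outside)
qed

lemma nrm_X_pre_le:
  assumes "\<And>y. orbit_norm y f \<le> B"
  shows "nrm X_pre f \<le> B"
proof -
  have B: "0 \<le> B" using assms[of undefined] orbit_norm_nonneg[of undefined f] by simp
  have "cmod (X_ip f f y) \<le> B\<^sup>2" for y
    using power_mono[OF assms[of y] orbit_norm_nonneg, of 2] by (simp add: orbit_norm_def)
  then have "(SUP y\<in>Q2_0. cmod (X_ip f f y)) \<le> B\<^sup>2" by (intro cSUP_least Q2_0_nonempty) auto
  then show ?thesis using B by (simp add: X_pre_def real_le_lsqrt)
qed

lemma seminormed_X_pre: "seminormed X_pre"
proof (rule seminormed_functions)
  show "nrm X_pre (\<lambda>p. f p + g p) \<le> nrm X_pre f + nrm X_pre g" if "f \<in> carr X_pre" "g \<in> carr X_pre" for f g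
    using that unfolding carr_X_pre
    by (intro nrm_X_pre_le order_trans[OF orbit_norm_add add_mono[OF orbit_norm_le orbit_norm_le]])
  have le: "nrm X_pre (\<lambda>p. c *s f p) \<le> cmod c * nrm X_pre f" if "f \<in> Cc4" for f c
    using that orbit_norm_le[OF that] by (intro nrm_X_pre_le) (simp add: orbit_norm_smult mult_left_mono)
  show "nrm X_pre (\<lambda>p. c *s f p) = cmod c * nrm X_pre f" if "f \<in> carr X_pre" for f c
  proof (cases "c = 0")
    case True
    have "0 \<le> nrm X_pre (\<lambda>p. c *s f p)"
      using that unfolding carr_X_pre by (intro order_trans[OF orbit_norm_nonneg orbit_norm_le[OF Cc4_ops(3)]])
    then show ?thesis using le[of f c] that True by (simp add: carr_X_pre)
  next
    case False
    have "nrm X_pre (\<lambda>p. inverse c *s (c *s f p)) \<le> cmod (inverse c) * nrm X_pre (\<lambda>p. c *s f p)"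
      using that by (intro le Cc4_ops(3)) (simp add: carr_X_pre)
    then have "nrm X_pre f \<le> inverse (cmod c) * nrm X_pre (\<lambda>p. c *s f p)"
      using False by (simp add: vector_smult_assoc norm_inverse)
    then have "cmod c * nrm X_pre f \<le> nrm X_pre (\<lambda>p. c *s f p)"
      using False by (simp add: field_simps)
    then show ?thesis using le[of f c] that by (simp add: carr_X_pre)
  qed
qed (simp_all add: add_X_pre smult_X_pre carr_X_pre Cc4_ops)

interpretation xp: seminormed X_pre by (rule seminormed_X_pre)
interpretation xc: seminormed "cauchy_seqs X_pre" by (rule xp.seminormed_cauchy)

text \<open>
  The bound is uniform in the point of the quadrant.  It makes inner products of Cauchy sequences
  converge and depend on the classes only.
\<close>

lemma X_ip_diff_bound:
  assumes "f \<in> Cc4" "g \<in> Cc4" "f' \<in> Cc4" "g' \<in> Cc4"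
  shows "cmod (X_ip f g y - X_ip f' g' y) \<le>
    nrm X_pre (diff X_pre f f') * nrm X_pre g + nrm X_pre f' * nrm X_pre (diff X_pre g g')"
proof -
  have d: "(\<lambda>p. f p - f' p) \<in> Cc4" "(\<lambda>p. g p - g' p) \<in> Cc4" by (intro Cc4_ops assms)+
  have 1: "X_ip f g y = X_ip (\<lambda>p. f p - f' p) g y + X_ip f' g y"
    using X_ip_add_left[OF d(1) assms(3,2)] by simp
  have "cnj (X_ip g f' y) = cnj (X_ip (\<lambda>p. g p - g' p) f' y + X_ip g' f' y)"
    using X_ip_add_left[OF d(2) assms(4,3)] by simp
  then have 2: "X_ip f' g y = X_ip f' (\<lambda>p. g p - g' p) y + X_ip f' g' y"
    by (simp add: X_ip_cnj assms d)
  have "X_ip f g y - X_ip f' g' y = X_ip (\<lambda>p. f p - f' p) g y + X_ip f' (\<lambda>p. g p - g' p) y"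
    by (simp add: 1 2)
  also have "cmod \<dots> \<le> orbit_norm y (\<lambda>p. f p - f' p) * orbit_norm y g + orbit_norm y f' * orbit_norm y (\<lambda>p. g p - g' p)"
    by (rule norm_triangle_le[OF add_mono]) (intro X_ip_cauchy_schwarz assms d)+
  also have "\<dots> \<le> nrm X_pre (\<lambda>p. f p - f' p) * nrm X_pre g + nrm X_pre f' * nrm X_pre (\<lambda>p. g p - g' p)"
    by (intro add_mono mult_mono orbit_norm_le orbit_norm_nonneg assms d xp.nrm_nonneg) (simp_all add: carr_X_pre assms d)
  finally show ?thesis by (simp add: diff_X_pre)
qed

lemma cauchy_bounded:
  assumes "s \<in> carr (cauchy_seqs X_pre)"
  obtains B where "B > 0" "\<forall>n. nrm X_pre (s n) \<le> B"
proof -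
  have "Bseq (\<lambda>n. nrm X_pre (s n))" by (rule convergent_imp_Bseq[OF xp.cauchy_nrm_convergent[OF assms]])
  then obtain K where "K > 0" "\<forall>n. norm (nrm X_pre (s n)) \<le> K" by (auto simp: Bseq_def)
  then have "nrm X_pre (s n) \<le> K" for n by (simp add: abs_le_iff)
  then show ?thesis using that \<open>K > 0\<close> by blast
qed

definition limit_ip :: "(nat \<Rightarrow> pt4 \<Rightarrow> complex^2) \<Rightarrow> (nat \<Rightarrow> pt4 \<Rightarrow> complex^2) \<Rightarrow> pt2 \<Rightarrow> complex" where
  "limit_ip s t y = lim (\<lambda>n. X_ip (s n) (t n) y)"

lemma limit_ip_tendsto:
  assumes s: "s \<in> carr (cauchy_seqs X_pre)" and t: "t \<in> carr (cauchy_seqs X_pre)"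
  shows "(\<lambda>n. X_ip (s n) (t n) y) \<longlonglongrightarrow> limit_ip s t y"
proof -
  obtain B where B: "B > 0" "\<forall>n. nrm X_pre (s n) \<le> B" by (rule cauchy_bounded[OF s])
  obtain B' where B': "B' > 0" "\<forall>n. nrm X_pre (t n) \<le> B'" by (rule cauchy_bounded[OF t])
  have c: "s n \<in> Cc4" "t n \<in> Cc4" for n using s t by (simp_all add: xp.cauchy_iff carr_X_pre)
  have "Cauchy (\<lambda>n. X_ip (s n) (t n) y)"
  proof (rule metric_CauchyI)
    fix e :: real assume e: "e > 0"
    obtain N1 where N1: "\<And>m n. m \<ge> N1 \<Longrightarrow> n \<ge> N1 \<Longrightarrow> nrm X_pre (diff X_pre (s m) (s n)) < e / (2 * B')"
      using s e B'(1) unfolding xp.cauchy_iff by (meson divide_pos_pos mult_pos_pos zero_less_numeral)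
    obtain N2 where N2: "\<And>m n. m \<ge> N2 \<Longrightarrow> n \<ge> N2 \<Longrightarrow> nrm X_pre (diff X_pre (t m) (t n)) < e / (2 * B)"
      using t e B(1) unfolding xp.cauchy_iff by (meson divide_pos_pos mult_pos_pos zero_less_numeral)
    have "dist (X_ip (s m) (t m) y) (X_ip (s n) (t n) y) < e" if mn: "m \<ge> max N1 N2" "n \<ge> max N1 N2" for m n
    proof -
      have "dist (X_ip (s m) (t m) y) (X_ip (s n) (t n) y) \<le>
          nrm X_pre (diff X_pre (s m) (s n)) * nrm X_pre (t m) + nrm X_pre (s n) * nrm X_pre (diff X_pre (t m) (t n))"
        unfolding dist_norm by (rule X_ip_diff_bound[OF c(1) c(2) c(1) c(2)])
      also have "\<dots> \<le> nrm X_pre (diff X_pre (s m) (s n)) * B' + B * nrm X_pre (diff X_pre (t m) (t n))"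
        using B B' c by (intro add_mono mult_left_mono mult_right_mono xp.nrm_nonneg xp.diff_carr) (auto simp: carr_X_pre)
      also have "\<dots> < (e / (2 * B')) * B' + B * (e / (2 * B))"
        using N1[of m n] N2[of m n] mn B B' by (intro add_strict_mono mult_strict_left_mono mult_strict_right_mono) auto
      also have "\<dots> = e" using B B' by simp
      finally show ?thesis .
    qed
    then show "\<exists>M. \<forall>m\<ge>M. \<forall>n\<ge>M. dist (X_ip (s m) (t m) y) (X_ip (s n) (t n) y) < e" by blast
  qed
  then show ?thesis by (simp add: Cauchy_convergent_iff convergent_LIMSEQ_iff limit_ip_def)
qed

lemma tendsto_fun_iff:
  fixes f :: "nat \<Rightarrow> 'a \<Rightarrow> 'b::topological_space"
  shows "f \<longlonglongrightarrow> l \<longleftrightarrow> (\<forall>x. (\<lambda>n. f n x) \<longlonglongrightarrow> l x)"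
proof -
  have "f \<longlonglongrightarrow> l \<longleftrightarrow> limitin (product_topology (\<lambda>_. euclidean) UNIV) f l sequentially"
    by (simp add: euclidean_product_topology limitin_canonical_iff)
  also have "\<dots> \<longleftrightarrow> (\<forall>x. (\<lambda>n. f n x) \<longlonglongrightarrow> l x)"
    by (simp add: limitin_componentwise limitin_canonical_iff)
  finally show ?thesis .
qed

lemma ip_cauchy_X_pre:
  assumes "s \<in> carr (cauchy_seqs X_pre)" "t \<in> carr (cauchy_seqs X_pre)"
  shows "ip (cauchy_seqs X_pre) s t = limit_ip s t"
proof -
  have "(THE z. (\<lambda>n. X_ip (s n) (t n)) \<longlonglongrightarrow> z) = limit_ip s t"
  proof (rule the_equality)
    show "(\<lambda>n. X_ip (s n) (t n)) \<longlonglongrightarrow> limit_ip s t"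
      unfolding tendsto_fun_iff using limit_ip_tendsto[OF assms] by blast
    show "z = limit_ip s t" if "(\<lambda>n. X_ip (s n) (t n)) \<longlonglongrightarrow> z" for z
      using that limit_ip_tendsto[OF assms] unfolding tendsto_fun_iff by (blast intro: LIMSEQ_unique)
  qed
  then show ?thesis by (simp add: cauchy_seqs_def ip_X_pre)
qed

lemma ip_X_mod:
  assumes s: "s \<in> carr (cauchy_seqs X_pre)" and t: "t \<in> carr (cauchy_seqs X_pre)"
  shows "ip X_mod (cls (cauchy_seqs X_pre) s) (cls (cauchy_seqs X_pre) t) = limit_ip s t"
proof -
  have "limit_ip s' t' = limit_ip s t"
    if s': "(s, s') \<in> null_rel (cauchy_seqs X_pre)" and t': "(t, t') \<in> null_rel (cauchy_seqs X_pre)" for s' t'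
  proof
    fix y
    have c': "s' \<in> carr (cauchy_seqs X_pre)" "t' \<in> carr (cauchy_seqs X_pre)"
      using s' t' by (auto simp: null_rel_def)
    have c: "s n \<in> Cc4" "t n \<in> Cc4" "s' n \<in> Cc4" "t' n \<in> Cc4" for n
      using s t c' by (simp_all add: xp.cauchy_iff carr_X_pre)
    let ?e = "\<lambda>n. nrm X_pre (diff X_pre (s n) (s' n)) * nrm X_pre (t n) + nrm X_pre (s' n) * nrm X_pre (diff X_pre (t n) (t' n))"
    have "?e \<longlonglongrightarrow> 0 * nrm (cauchy_seqs X_pre) t + nrm (cauchy_seqs X_pre) s' * 0"
      using s' t' unfolding xp.null_rel_cauchy
      by (intro tendsto_add tendsto_mult xp.nrm_cauchy_tendsto t c') auto
    then have e0: "?e \<longlonglongrightarrow> 0" by simp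
    have "\<forall>n. norm (X_ip (s n) (t n) y - X_ip (s' n) (t' n) y) \<le> ?e n"
      using X_ip_diff_bound[OF c(1) c(2) c(3) c(4)] by blast
    from Lim_null_comparison[OF always_eventually[OF this] e0]
    have "(\<lambda>n. X_ip (s n) (t n) y - X_ip (s' n) (t' n) y) \<longlonglongrightarrow> 0" .
    moreover have "(\<lambda>n. X_ip (s n) (t n) y - X_ip (s' n) (t' n) y) \<longlonglongrightarrow> limit_ip s t y - limit_ip s' t' y"
      by (rule tendsto_diff[OF limit_ip_tendsto[OF s t] limit_ip_tendsto[OF c'(1) c'(2)]])
    ultimately have "limit_ip s t y - limit_ip s' t' y = 0" using LIMSEQ_unique by blast
    then show "limit_ip s' t' y = limit_ip s t y" by simp
  qed
  then show ?thesis
    unfolding X_mod_def completion_def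
    by (subst xc.ip_hausdorff[OF s t]) (auto simp: ip_cauchy_X_pre s t null_rel_def)
qed

lemma limit_ip_bound:
  assumes s: "s \<in> carr (cauchy_seqs X_pre)" and t: "t \<in> carr (cauchy_seqs X_pre)"
  obtains B where "\<forall>n y. cmod (X_ip (s n) (t n) y) \<le> B" "\<forall>y. cmod (limit_ip s t y) \<le> B"
proof -
  obtain B where B: "B > 0" "\<forall>n. nrm X_pre (s n) \<le> B" by (rule cauchy_bounded[OF s])
  obtain B' where B': "B' > 0" "\<forall>n. nrm X_pre (t n) \<le> B'" by (rule cauchy_bounded[OF t])
  have c: "s n \<in> Cc4" "t n \<in> Cc4" for n using s t by (simp_all add: xp.cauchy_iff carr_X_pre)
  have le: "cmod (X_ip (s n) (t n) y) \<le> B * B'" for n y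
  proof -
    have "cmod (X_ip (s n) (t n) y) \<le> orbit_norm y (s n) * orbit_norm y (t n)" by (rule X_ip_cauchy_schwarz[OF c])
    also have "\<dots> \<le> B * B'"
      using B B' orbit_norm_le[OF c(1)] orbit_norm_le[OF c(2)] order_trans
      by (intro mult_mono orbit_norm_nonneg) (blast, blast, simp)
    finally show ?thesis .
  qed
  have "cmod (limit_ip s t y) \<le> B * B'" for y
    by (rule LIMSEQ_le_const2[OF tendsto_norm[OF limit_ip_tendsto[OF s t]]]) (use le in blast)
  then show ?thesis using that le by blast
qed

lemma X_ip_measurable:
  assumes f: "f \<in> Cc4" and g: "g \<in> Cc4"
  shows "X_ip f g \<in> borel_measurable vol2"
proof -
  obtain C where C: "C \<ge> 0" "\<forall>p. norm (f p) \<le> C" by (rule c4.Cc_bounded[OF f[unfolded Cc4_eq]])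
  obtain C' where C': "C' \<ge> 0" "\<forall>p. norm (g p) \<le> C'" by (rule c4.Cc_bounded[OF g[unfolded Cc4_eq]])
  have b: "cmod (cip (f p) (g p)) \<le> C * C'" for p
    using norm_cip_le[of "f p" "g p"] C C' mult_mono[of "norm (f p)" C "norm (g p)" C'] by (meson norm_ge_zero order_trans)
  have "(\<lambda>r. orbit_weight r) \<in> borel_measurable borel"
    unfolding orbit_weight_def by (intro borel_measurable_continuous_onI continuous_intros)
  from measurable_compose[OF measurable_chart2 this]
  have [measurable]: "(\<lambda>y. orbit_weight (chart2 y)) \<in> borel_measurable vol2" by (simp add: vol2.measurable_M)
  note [measurable] = fibre_integral_measurable[OF cip_Cc4_measurable[OF f g] b]
  have "(\<lambda>y. fibre_integral (\<lambda>p. cip (f p) (g p)) (chart2 y) * of_real (orbit_weight (chart2 y))) \<in> borel_measurable vol2"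
    by measurable
  then show ?thesis
    by (subst measurable_cong[where g = "\<lambda>y. fibre_integral (\<lambda>p. cip (f p) (g p)) (chart2 y) * of_real (orbit_weight (chart2 y))"])
      (auto simp: vol2.space_M X_ip_eq[OF cip_Cc4_measurable[OF f g]])
qed

lemma limit_ip_measurable:
  assumes "s \<in> carr (cauchy_seqs X_pre)" "t \<in> carr (cauchy_seqs X_pre)"
  shows "limit_ip s t \<in> borel_measurable vol2"
  by (rule borel_measurable_LIMSEQ_metric[OF X_ip_measurable limit_ip_tendsto[OF assms]])
    (use assms in \<open>simp_all add: xp.cauchy_iff carr_X_pre\<close>)

section \<open>Tensoring with functions on the quadrant\<close>

abbreviation HQ :: "(pt2 \<Rightarrow> complex^2, complex) ip_space" where
  "HQ \<equiv> sq_int vol2"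

definition tensor_fun :: "(pt4 \<Rightarrow> complex^2) \<Rightarrow> (pt2 \<Rightarrow> complex^2) \<Rightarrow> pt4 \<Rightarrow> complex^4" where
  "tensor_fun \<xi> \<eta> p = spinor_tensor (\<xi> p) (\<eta> (quot p))"

text \<open>
  Disintegration of the volume: the pointwise inner product of two tensors is the product of the inner
  products of the factors, and the left one integrates to the module inner product.
\<close>

lemma tensor_fun_integral:
  assumes \<xi>: "\<xi> \<in> Cc4" "\<xi>' \<in> Cc4" and \<eta>: "\<eta> \<in> carr HQ" "\<eta>' \<in> carr HQ"
  shows "integrable vol4 (\<lambda>p. cip (tensor_fun \<xi> \<eta> p) (tensor_fun \<xi>' \<eta>' p))"
    "(LINT p|vol4. cip (tensor_fun \<xi> \<eta> p) (tensor_fun \<xi>' \<eta>' p)) = (LINT y|vol2. X_ip \<xi> \<xi>' y * cip (\<eta> y) (\<eta>' y))"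
proof -
  obtain C where C: "C \<ge> 0" "\<forall>p. norm (\<xi> p) \<le> C" by (rule c4.Cc_bounded[OF \<xi>(1)[unfolded Cc4_eq]])
  obtain C' where C': "C' \<ge> 0" "\<forall>p. norm (\<xi>' p) \<le> C'" by (rule c4.Cc_bounded[OF \<xi>(2)[unfolded Cc4_eq]])
  have b: "cmod (cip (\<xi> p) (\<xi>' p)) \<le> C * C'" for p
    using norm_cip_le[of "\<xi> p" "\<xi>' p"] C C' mult_mono[of "norm (\<xi> p)" C "norm (\<xi>' p)" C'] by (meson norm_ge_zero order_trans)
  note dis = vol4_disintegration[OF cip_Cc4_measurable[OF \<xi>] b integrable_cip[OF \<eta>]]
  show "integrable vol4 (\<lambda>p. cip (tensor_fun \<xi> \<eta> p) (tensor_fun \<xi>' \<eta>' p))"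
    using dis(1) by (simp add: tensor_fun_def cip_spinor_tensor)
  have "(LINT p|vol4. cip (tensor_fun \<xi> \<eta> p) (tensor_fun \<xi>' \<eta>' p)) =
      (LINT y|vol2. fibre_integral (\<lambda>p. cip (\<xi> p) (\<xi>' p)) (chart2 y) * of_real (orbit_weight (chart2 y)) * cip (\<eta> y) (\<eta>' y))"
    using dis(2) by (simp add: tensor_fun_def cip_spinor_tensor)
  also have "\<dots> = (LINT y|vol2. X_ip \<xi> \<xi>' y * cip (\<eta> y) (\<eta>' y))"
    by (rule Bochner_Integration.integral_cong) (auto simp: vol2.space_M X_ip_eq[OF cip_Cc4_measurable[OF \<xi>]])
  finally show "(LINT p|vol4. cip (tensor_fun \<xi> \<eta> p) (tensor_fun \<xi>' \<eta>' p)) = (LINT y|vol2. X_ip \<xi> \<xi>' y * cip (\<eta> y) (\<eta>' y))" .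
qed

lemma tensor_fun_carr:
  assumes \<xi>: "\<xi> \<in> Cc4" and \<eta>: "\<eta> \<in> carr HQ"
  shows "tensor_fun \<xi> \<eta> \<in> carr SQ"
proof -
  have [measurable]: "\<xi> \<in> borel_measurable vol4"
    using c4.Cc_measurable[OF \<xi>[unfolded Cc4_eq]] by (simp add: vol4.measurable_M)
  have "\<eta> \<in> borel_measurable vol2" using \<eta> by (simp add: mem_sq_int)
  then have [measurable]: "(\<lambda>p. \<eta> (quot p)) \<in> borel_measurable vol4"
    using measurable_compose[OF measurable_quot, of \<eta> borel] by (simp add: vol4.measurable_M vol2.measurable_M)
  have m: "tensor_fun \<xi> \<eta> \<in> borel_measurable vol4"
    unfolding tensor_fun_def[abs_def]
    by (rule borel_measurable_continuous_Pair)
      (auto intro!: bounded_bilinear.continuous_on[OF bounded_bilinear_spinor_tensor] continuous_intros)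
  have "integrable vol4 (\<lambda>p. Re (cip (tensor_fun \<xi> \<eta> p) (tensor_fun \<xi> \<eta> p)))"
    by (rule integrable_Re[OF tensor_fun_integral(1)[OF \<xi> \<xi> \<eta> \<eta>]])
  then show ?thesis using m by (simp add: mem_sq_int cip_self)
qed

lemma ip_tensor_fun:
  assumes "\<xi> \<in> Cc4" "\<xi>' \<in> Cc4" "\<eta> \<in> carr HQ" "\<eta>' \<in> carr HQ"
  shows "cinner (spinor (tensor_fun \<xi> \<eta>)) (spinor (tensor_fun \<xi>' \<eta>')) = (LINT y|vol2. X_ip \<xi> \<xi>' y * cip (\<eta> y) (\<eta>' y))"
  using tensor_fun_integral(2)[OF assms] tensor_fun_carr assms by (simp add: cinner_spinor) (simp add: sq_int_def)

lemma norm_tensor_fun: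
  assumes \<xi>: "\<xi> \<in> Cc4" and \<eta>: "\<eta> \<in> carr HQ"
  shows "norm (spinor (tensor_fun \<xi> \<eta>)) \<le> nrm X_pre \<xi> * nrm HQ \<eta>"
proof (rule power2_le_imp_le)
  have "complex_of_real ((norm (spinor (tensor_fun \<xi> \<eta>)))\<^sup>2) = (LINT y|vol2. X_ip \<xi> \<xi> y * of_real ((norm (\<eta> y))\<^sup>2))"
    using ip_tensor_fun[OF \<xi> \<xi> \<eta> \<eta>] by (simp only: cinner_simps(4) cip_self)
  then have "(norm (spinor (tensor_fun \<xi> \<eta>)))\<^sup>2 = cmod (LINT y|vol2. X_ip \<xi> \<xi> y * of_real ((norm (\<eta> y))\<^sup>2))"
    by (metis abs_power2 norm_of_real)
  also have "\<dots> \<le> (LINT y|vol2. (nrm X_pre \<xi>)\<^sup>2 * (norm (\<eta> y))\<^sup>2)"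
  proof (rule Bochner_Integration.integral_norm_bound_integral)
    have i: "integrable vol2 (\<lambda>y. (norm (\<eta> y))\<^sup>2)" using \<eta> by (simp add: mem_sq_int)
    then show i': "integrable vol2 (\<lambda>y. (nrm X_pre \<xi>)\<^sup>2 * (norm (\<eta> y))\<^sup>2)" by simp
    have le: "cmod (X_ip \<xi> \<xi> y) \<le> (nrm X_pre \<xi>)\<^sup>2" for y
      using power_mono[OF orbit_norm_le[OF \<xi>, of y] orbit_norm_nonneg, of 2] by (simp add: orbit_norm_def)
    then show *: "norm (X_ip \<xi> \<xi> y * of_real ((norm (\<eta> y))\<^sup>2)) \<le> (nrm X_pre \<xi>)\<^sup>2 * (norm (\<eta> y))\<^sup>2" for y
      by (simp add: norm_mult norm_power mult_right_mono)
    note [measurable] = X_ip_measurable[OF \<xi> \<xi>] borel_measurable_integrable[OF i]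
    have m: "(\<lambda>y. X_ip \<xi> \<xi> y * of_real ((norm (\<eta> y))\<^sup>2)) \<in> borel_measurable vol2" by measurable
    show "integrable vol2 (\<lambda>y. X_ip \<xi> \<xi> y * of_real ((norm (\<eta> y))\<^sup>2))"
      by (rule Bochner_Integration.integrable_bound[OF i' m]) (use * in \<open>auto simp: abs_mult\<close>)
  qed
  also have "\<dots> = (nrm X_pre \<xi> * nrm HQ \<eta>)\<^sup>2" by (simp add: sq_int_nrm2 power_mult_distrib)
  finally show "(norm (spinor (tensor_fun \<xi> \<eta>)))\<^sup>2 \<le> (nrm X_pre \<xi> * nrm HQ \<eta>)\<^sup>2" .
qed (use \<xi> in \<open>simp add: sq_int_nrm_nonneg xp.nrm_nonneg carr_X_pre\<close>)

section \<open>The unitary from the interior tensor product to the spinors\<close>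

subsection \<open>Elementary tensors\<close>

lemma tensor_fun_diff_left: "tensor_fun (\<lambda>p. f p - g p) \<eta> = (\<lambda>p. tensor_fun f \<eta> p - tensor_fun g \<eta> p)"
  and tensor_fun_diff_right: "tensor_fun f (\<lambda>y. \<eta> y - \<theta> y) = (\<lambda>p. tensor_fun f \<eta> p - tensor_fun f \<theta> p)"
  using bounded_bilinear.diff_left[OF bounded_bilinear_spinor_tensor]
    bounded_bilinear.diff_right[OF bounded_bilinear_spinor_tensor]
  by (simp_all add: tensor_fun_def[abs_def])

lemma spinor_tensor_fun_diff:
  assumes "f \<in> Cc4" "g \<in> Cc4" "\<eta> \<in> carr HQ"
  shows "norm (spinor (tensor_fun f \<eta>) - spinor (tensor_fun g \<eta>)) \<le> nrm X_pre (diff X_pre f g) * nrm HQ \<eta>"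
  using norm_tensor_fun[OF Cc4_ops(2)[OF assms(1,2)] assms(3)]
  by (simp add: spinor_diff tensor_fun_carr assms diff_X_pre tensor_fun_diff_left)

lemma spinor_tensor_fun_cong:
  assumes f: "f \<in> Cc4" and \<eta>: "(\<eta>, \<theta>) \<in> null_rel HQ"
  shows "spinor (tensor_fun f \<eta>) = spinor (tensor_fun f \<theta>)"
proof -
  have c: "\<eta> \<in> carr HQ" "\<theta> \<in> carr HQ" "nrm HQ (diff HQ \<eta> \<theta>) = 0" using \<eta> by (auto simp: null_rel_def)
  have "norm (spinor (tensor_fun f \<eta>) - spinor (tensor_fun f \<theta>)) \<le> nrm X_pre f * nrm HQ (diff HQ \<eta> \<theta>)"
    using norm_tensor_fun[OF f sq.diff_carr[OF c(1,2)]]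
    by (simp add: spinor_diff tensor_fun_carr f c sq_int_diff tensor_fun_diff_right)
  then show ?thesis using c(3) by simp
qed

text \<open>
  The value of \<open>W\<close> on an elementary tensor of an element of the completed module, represented by a
  Cauchy sequence, and a class of functions; \<open>norm_tensor_fun\<close> makes the limit exist.
\<close>

definition W_pair :: "(nat \<Rightarrow> pt4 \<Rightarrow> complex^2) \<Rightarrow> (pt2 \<Rightarrow> complex^2) \<Rightarrow> spinor_L2" where
  "W_pair s \<eta> = lim (\<lambda>n. spinor (tensor_fun (s n) \<eta>))"

lemma W_pair_tendsto:
  assumes s: "s \<in> carr (cauchy_seqs X_pre)" and \<eta>: "\<eta> \<in> carr HQ"
  shows "(\<lambda>n. spinor (tensor_fun (s n) \<eta>)) \<longlonglongrightarrow> W_pair s \<eta>"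
proof -
  have c: "s n \<in> Cc4" for n using s by (simp add: xp.cauchy_iff carr_X_pre)
  have "Cauchy (\<lambda>n. spinor (tensor_fun (s n) \<eta>))"
  proof (rule CauchyI)
    fix e :: real assume e: "e > 0"
    have pos: "nrm HQ \<eta> + 1 > 0" using sq_int_nrm_nonneg[of vol2 \<eta>] by linarith
    obtain N where N: "\<And>m n. m \<ge> N \<Longrightarrow> n \<ge> N \<Longrightarrow> nrm X_pre (diff X_pre (s m) (s n)) < e / (nrm HQ \<eta> + 1)"
      using s e pos unfolding xp.cauchy_iff by (meson divide_pos_pos)
    have "norm (spinor (tensor_fun (s m) \<eta>) - spinor (tensor_fun (s n) \<eta>)) < e" if mn: "m \<ge> N" "n \<ge> N" for m n
    proof -
      have d: "0 \<le> nrm X_pre (diff X_pre (s m) (s n))"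
        by (intro xp.nrm_nonneg xp.diff_carr) (simp_all add: carr_X_pre c)
      have "norm (spinor (tensor_fun (s m) \<eta>) - spinor (tensor_fun (s n) \<eta>)) \<le> nrm X_pre (diff X_pre (s m) (s n)) * nrm HQ \<eta>"
        by (rule spinor_tensor_fun_diff[OF c c \<eta>])
      also have "\<dots> \<le> nrm X_pre (diff X_pre (s m) (s n)) * (nrm HQ \<eta> + 1)"
        using d by (intro mult_left_mono) auto
      also have "\<dots> < e" using N[OF mn] pos by (simp add: pos_less_divide_eq)
      finally show ?thesis .
    qed
    then show "\<exists>M. \<forall>m\<ge>M. \<forall>n\<ge>M. norm (spinor (tensor_fun (s m) \<eta>) - spinor (tensor_fun (s n) \<eta>)) < e" by blast
  qed
  then show ?thesis by (simp add: Cauchy_convergent_iff convergent_LIMSEQ_iff W_pair_def)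
qed

lemma W_pair_cong:
  assumes s: "(s, t) \<in> null_rel (cauchy_seqs X_pre)" and \<eta>: "(\<eta>, \<theta>) \<in> null_rel HQ"
  shows "W_pair s \<eta> = W_pair t \<theta>"
proof -
  have c: "s \<in> carr (cauchy_seqs X_pre)" "t \<in> carr (cauchy_seqs X_pre)" "\<eta> \<in> carr HQ" "\<theta> \<in> carr HQ"
    using s \<eta> by (auto simp: null_rel_def)
  have cn: "s n \<in> Cc4" "t n \<in> Cc4" for n using c by (simp_all add: xp.cauchy_iff carr_X_pre)
  have "(\<lambda>n. nrm X_pre (diff X_pre (s n) (t n)) * nrm HQ \<eta>) \<longlonglongrightarrow> 0 * nrm HQ \<eta>"
    using s unfolding xp.null_rel_cauchy by (intro tendsto_mult tendsto_const) auto
  then have e0: "(\<lambda>n. nrm X_pre (diff X_pre (s n) (t n)) * nrm HQ \<eta>) \<longlonglongrightarrow> 0" by simp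
  have "\<forall>n. norm (spinor (tensor_fun (s n) \<eta>) - spinor (tensor_fun (t n) \<eta>)) \<le> nrm X_pre (diff X_pre (s n) (t n)) * nrm HQ \<eta>"
    using spinor_tensor_fun_diff[OF cn c(3)] by blast
  from Lim_null_comparison[OF always_eventually[OF this] e0]
  have "(\<lambda>n. spinor (tensor_fun (s n) \<eta>) - spinor (tensor_fun (t n) \<eta>)) \<longlonglongrightarrow> 0" .
  moreover have "(\<lambda>n. spinor (tensor_fun (s n) \<eta>) - spinor (tensor_fun (t n) \<eta>)) \<longlonglongrightarrow> W_pair s \<eta> - W_pair t \<eta>"
    by (rule tendsto_diff[OF W_pair_tendsto[OF c(1,3)] W_pair_tendsto[OF c(2,3)]])
  ultimately have "W_pair s \<eta> = W_pair t \<eta>" using LIMSEQ_unique by fastforce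
  also have "\<dots> = W_pair t \<theta>"
    by (simp add: W_pair_def spinor_tensor_fun_cong[OF cn(2) \<eta>])
  finally show ?thesis .
qed

text \<open>
  The inner products of a Cauchy sequence converge pointwise and boundedly, so that the limit may be
  taken under the integral over the quadrant.
\<close>

lemma cinner_W_pair:
  assumes s: "s \<in> carr (cauchy_seqs X_pre)" and t: "t \<in> carr (cauchy_seqs X_pre)"
    and \<eta>: "\<eta> \<in> carr HQ" and \<theta>: "\<theta> \<in> carr HQ"
  shows "cinner (W_pair s \<eta>) (W_pair t \<theta>) = (LINT y|vol2. limit_ip s t y * cip (\<eta> y) (\<theta> y))"
proof (rule LIMSEQ_unique)
  have c: "s n \<in> Cc4" "t n \<in> Cc4" for n using s t by (simp_all add: xp.cauchy_iff carr_X_pre)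
  show "(\<lambda>n. cinner (spinor (tensor_fun (s n) \<eta>)) (spinor (tensor_fun (t n) \<theta>))) \<longlonglongrightarrow> cinner (W_pair s \<eta>) (W_pair t \<theta>)"
    by (rule tendsto_cinner[OF W_pair_tendsto[OF s \<eta>] W_pair_tendsto[OF t \<theta>]])
  obtain B where B: "\<forall>n y. cmod (X_ip (s n) (t n) y) \<le> B" "\<forall>y. cmod (limit_ip s t y) \<le> B"
    by (rule limit_ip_bound[OF s t])
  have i: "integrable vol2 (\<lambda>y. cip (\<eta> y) (\<theta> y))" by (rule integrable_cip[OF \<eta> \<theta>])
  note [measurable] = borel_measurable_integrable[OF i] X_ip_measurable[OF c] limit_ip_measurable[OF s t]
  have "(\<lambda>n. LINT y|vol2. X_ip (s n) (t n) y * cip (\<eta> y) (\<theta> y)) \<longlonglongrightarrow> (LINT y|vol2. limit_ip s t y * cip (\<eta> y) (\<theta> y))"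
  proof (rule integral_dominated_convergence[where w = "\<lambda>y. B * cmod (cip (\<eta> y) (\<theta> y))"])
    show "integrable vol2 (\<lambda>y. B * cmod (cip (\<eta> y) (\<theta> y)))" using i by auto
    show "AE y in vol2. (\<lambda>n. X_ip (s n) (t n) y * cip (\<eta> y) (\<theta> y)) \<longlonglongrightarrow> limit_ip s t y * cip (\<eta> y) (\<theta> y)"
      by (rule AE_I2) (rule tendsto_mult[OF limit_ip_tendsto[OF s t] tendsto_const])
    show "AE y in vol2. norm (X_ip (s n) (t n) y * cip (\<eta> y) (\<theta> y)) \<le> B * cmod (cip (\<eta> y) (\<theta> y))" for n
      by (rule AE_I2) (simp add: norm_mult mult_right_mono B(1)[rule_format])
  qed measurable
  then show "(\<lambda>n. cinner (spinor (tensor_fun (s n) \<eta>)) (spinor (tensor_fun (t n) \<theta>))) \<longlonglongrightarrow> (LINT y|vol2. limit_ip s t y * cip (\<eta> y) (\<theta> y))"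
    by (simp add: ip_tensor_fun[OF c \<eta> \<theta>])
qed

lemma carr_X_mod: "carr X_mod = cls (cauchy_seqs X_pre) ` carr (cauchy_seqs X_pre)"
  by (simp add: X_mod_def completion_def xc.carr_hausdorff)

lemma carr_H_Q: "carr H_Q = cls HQ ` carr HQ"
  by (simp add: H_Q_def L2_def sq.carr_hausdorff)

definition W_elem :: "X_elem \<Rightarrow> H_elem \<Rightarrow> spinor_L2" where
  "W_elem x h = W_pair (SOME s. s \<in> x) (SOME \<eta>. \<eta> \<in> h)"

lemma W_elem_cls:
  assumes s: "s \<in> carr (cauchy_seqs X_pre)" and \<eta>: "\<eta> \<in> carr HQ"
  shows "W_elem (cls (cauchy_seqs X_pre) s) (cls HQ \<eta>) = W_pair s \<eta>"
proof -
  have "(SOME t. t \<in> cls (cauchy_seqs X_pre) s) \<in> cls (cauchy_seqs X_pre) s"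
    by (rule someI[of "\<lambda>t. t \<in> cls (cauchy_seqs X_pre) s", OF xc.cls_self[OF s]])
  moreover have "(SOME t. t \<in> cls HQ \<eta>) \<in> cls HQ \<eta>"
    by (rule someI[of "\<lambda>t. t \<in> cls HQ \<eta>", OF sq.cls_self[OF \<eta>]])
  ultimately show ?thesis
    unfolding W_elem_def by (intro W_pair_cong[symmetric]) (simp_all add: xc.mem_cls sq.mem_cls)
qed

lemma L2_mult_cls:
  assumes a: "a \<in> borel_measurable vol2" "\<And>y. cmod (a y) \<le> B" and \<eta>: "\<eta> \<in> carr HQ"
  shows "L2_mult vol2 a (cls HQ \<eta>) = cls HQ (\<lambda>y. a y *s \<eta> y)" "(\<lambda>y. a y *s \<eta> y) \<in> carr HQ"
proof -
  note [measurable] = a(1)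
  have B: "0 \<le> B" using a(2)[of undefined] norm_ge_zero order_trans by blast
  have c: "(\<lambda>y. a y *s \<theta> y) \<in> carr HQ" if "\<theta> \<in> carr HQ" for \<theta>
  proof -
    have [measurable]: "\<theta> \<in> borel_measurable vol2" using that by (simp add: mem_sq_int)
    have "integrable vol2 (\<lambda>y. (norm (a y *s \<theta> y))\<^sup>2)"
    proof (rule Bochner_Integration.integrable_bound)
      show "integrable vol2 (\<lambda>y. B\<^sup>2 * (norm (\<theta> y))\<^sup>2)" using that by (simp add: mem_sq_int)
      show "AE y in vol2. norm ((norm (a y *s \<theta> y))\<^sup>2) \<le> norm (B\<^sup>2 * (norm (\<theta> y))\<^sup>2)"
        by (rule AE_I2) (simp add: norm_smult_vec power_mult_distrib abs_mult mult_right_mono power_mono a(2))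
    qed measurable
    then show ?thesis by (simp add: mem_sq_int)
  qed
  show "(\<lambda>y. a y *s \<eta> y) \<in> carr HQ" by (rule c[OF \<eta>])
  show "L2_mult vol2 a (cls HQ \<eta>) = cls HQ (\<lambda>y. a y *s \<eta> y)"
    unfolding L2_mult_def
  proof (rule sq.lift_map_cls[OF \<eta>])
    show "(\<lambda>x. a x *s f x) \<in> carr HQ" if "f \<in> carr HQ" for f by (rule c[OF that])
    fix f g assume fg: "f \<in> carr HQ" "g \<in> carr HQ" "nrm HQ (diff HQ f g) = 0"
    then have "(f, g) \<in> null_rel HQ" by (simp add: null_rel_def)
    then have "AE y in vol2. f y = g y" by (simp add: null_rel_sq_int)
    then have "AE y in vol2. a y *s f y = a y *s g y" by eventually_elim simp
    then have "((\<lambda>y. a y *s f y), (\<lambda>y. a y *s g y)) \<in> null_rel HQ" by (simp add: null_rel_sq_int c fg)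
    then show "nrm HQ (diff HQ (\<lambda>x. a x *s f x) (\<lambda>x. a x *s g x)) = 0" by (simp add: null_rel_def)
  qed
qed

lemma cinner_W_elem:
  assumes x: "x \<in> carr X_mod" "x' \<in> carr X_mod" and h: "h \<in> carr H_Q" "h' \<in> carr H_Q"
  shows "cinner (W_elem x h) (W_elem x' h') = ip H_Q h (L2_mult vol2 (ip X_mod x x') h')"
proof -
  obtain s t where s: "s \<in> carr (cauchy_seqs X_pre)" "x = cls (cauchy_seqs X_pre) s"
    and t: "t \<in> carr (cauchy_seqs X_pre)" "x' = cls (cauchy_seqs X_pre) t" using x by (auto simp: carr_X_mod)
  obtain \<eta> \<theta> where \<eta>: "\<eta> \<in> carr HQ" "h = cls HQ \<eta>" and \<theta>: "\<theta> \<in> carr HQ" "h' = cls HQ \<theta>"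
    using h by (auto simp: carr_H_Q)
  obtain B where B: "\<forall>n y. cmod (X_ip (s n) (t n) y) \<le> B" "\<forall>y. cmod (limit_ip s t y) \<le> B"
    by (rule limit_ip_bound[OF s(1) t(1)])
  note m = L2_mult_cls[OF limit_ip_measurable[OF s(1) t(1)] B(2)[rule_format] \<theta>(1)]
  have "ip H_Q h (L2_mult vol2 (ip X_mod x x') h') = ip HQ \<eta> (\<lambda>y. limit_ip s t y *s \<theta> y)"
    by (simp add: s(2) t(2) ip_X_mod[OF s(1) t(1)] \<eta>(2) \<theta>(2) m(1) H_Q_def ip_L2 \<eta>(1) m(2))
  also have "\<dots> = cinner (W_elem x h) (W_elem x' h')"
    by (simp add: s t \<eta> \<theta> W_elem_cls cinner_W_pair) (simp add: sq_int_def cip_smult_right)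
  finally show ?thesis ..
qed

subsection \<open>Finite sums of elementary tensors\<close>

abbreviation FT :: "((X_elem \<times> H_elem) \<Rightarrow>\<^sub>0 complex, complex) ip_space" where
  "FT \<equiv> free_tensor X_mod H_Q (L2_mult vol2)"

text \<open>
  The form on formal sums of pairs is pulled back from the spinors along \<open>W_free\<close>.  Hence it is
  positive semidefinite, and the relations among elementary tensors become null vectors.
\<close>

definition W_free :: "((X_elem \<times> H_elem) \<Rightarrow>\<^sub>0 complex) \<Rightarrow> spinor_L2" where
  "W_free z = (\<Sum>k\<in>Poly_Mapping.keys z. cscale (Poly_Mapping.lookup z k) (W_elem (fst k) (snd k)))"

lemma W_free_superset:
  assumes "finite A" "Poly_Mapping.keys z \<subseteq> A"
  shows "W_free z = (\<Sum>k\<in>A. cscale (Poly_Mapping.lookup z k) (W_elem (fst k) (snd k)))"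
  unfolding W_free_def
  by (rule sum.mono_neutral_left[OF assms]) (simp add: in_keys_iff cscale_zero)

lemma W_free_add: "W_free (z + w) = W_free z + W_free w"
proof -
  let ?A = "Poly_Mapping.keys z \<union> Poly_Mapping.keys w"
  have f: "finite ?A" by simp
  have "Poly_Mapping.keys (z + w) \<subseteq> ?A" by (rule keys_add)
  from W_free_superset[OF f this] show ?thesis
    by (simp add: W_free_superset[OF f, of z] W_free_superset[OF f, of w] lookup_add cscale_simps(5) sum.distrib)
qed

lemma lookup_cmult: "Poly_Mapping.lookup (Poly_Mapping.map ((*) c) z) k = c * Poly_Mapping.lookup z k"
  for c :: complex
  by (simp add: map.rep_eq when_def)

lemma keys_cmult: "Poly_Mapping.keys (Poly_Mapping.map ((*) (c :: complex)) z) \<subseteq> Poly_Mapping.keys z"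
  by (auto simp: in_keys_iff lookup_cmult)

lemma W_free_cmult: "W_free (Poly_Mapping.map ((*) c) z) = cscale c (W_free z)"
proof -
  have "W_free (Poly_Mapping.map ((*) c) z) = (\<Sum>k\<in>Poly_Mapping.keys z. cscale (c * Poly_Mapping.lookup z k) (W_elem (fst k) (snd k)))"
    by (simp add: W_free_superset[OF finite_keys keys_cmult] lookup_cmult)
  also have "\<dots> = cscale c (W_free z)"
    by (simp add: W_free_def linear_sum[OF bounded_linear.linear[OF bounded_linear_cscale]] cscale_simps)
  finally show ?thesis .
qed

lemma W_free_single: "W_free (Poly_Mapping.single k c) = cscale c (W_elem (fst k) (snd k))"
  by (simp add: W_free_def cscale_zero)

lemma carr_FT: "carr FT = {z. Poly_Mapping.keys z \<subseteq> carr X_mod \<times> carr H_Q}"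
  and add_FT: "add FT = (+)" and smult_FT: "smult FT = (\<lambda>c. Poly_Mapping.map ((*) c))"
  by (simp_all add: free_tensor_def Let_def)

lemma ip_FT:
  assumes z: "z \<in> carr FT" and w: "w \<in> carr FT"
  shows "ip FT z w = cinner (W_free z) (W_free w)"
proof -
  have "cinner (W_free z) (W_free w) = (\<Sum>k\<in>Poly_Mapping.keys z. \<Sum>l\<in>Poly_Mapping.keys w.
      cnj (Poly_Mapping.lookup z k) * (Poly_Mapping.lookup w l * cinner (W_elem (fst k) (snd k)) (W_elem (fst l) (snd l))))"
    by (simp add: W_free_def bounded_bilinear.sum_left[OF bounded_bilinear_cinner]
        bounded_bilinear.sum_right[OF bounded_bilinear_cinner] cinner_simps(2) cinner_right_simps(2) sum_distrib_left)
      (subst sum.swap, simp add: mult.left_commute)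
  also have "\<dots> = (\<Sum>k\<in>Poly_Mapping.keys z. \<Sum>l\<in>Poly_Mapping.keys w.
      cnj (Poly_Mapping.lookup z k) * Poly_Mapping.lookup w l *
        ip H_Q (snd k) (L2_mult vol2 (ip X_mod (fst k) (fst l)) (snd l)))"
  proof (intro sum.cong refl)
    fix k l assume kl: "k \<in> Poly_Mapping.keys z" "l \<in> Poly_Mapping.keys w"
    have "fst k \<in> carr X_mod" "fst l \<in> carr X_mod" "snd k \<in> carr H_Q" "snd l \<in> carr H_Q"
      using kl z w by (auto simp: carr_FT)
    from cinner_W_elem[OF this]
    show "cnj (Poly_Mapping.lookup z k) * (Poly_Mapping.lookup w l * cinner (W_elem (fst k) (snd k)) (W_elem (fst l) (snd l))) =
      cnj (Poly_Mapping.lookup z k) * Poly_Mapping.lookup w l *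
        ip H_Q (snd k) (L2_mult vol2 (ip X_mod (fst k) (fst l)) (snd l))" by simp
  qed
  also have "\<dots> = ip FT z w"
    by (simp add: free_tensor_def Let_def case_prod_unfold)
  finally show ?thesis ..
qed

lemma nrm_FT: "z \<in> carr FT \<Longrightarrow> nrm FT z = norm (W_free z)"
proof -
  assume z: "z \<in> carr FT"
  have "nrm FT z = sqrt (Re (ip FT z z))" by (simp add: free_tensor_def Let_def)
  then show ?thesis by (simp add: ip_FT[OF z z] cinner_simps(4) Re_power2)
qed

lemma seminormed_FT: "seminormed FT"
proof
  fix x y z :: "(X_elem \<times> H_elem) \<Rightarrow>\<^sub>0 complex" and c d
  assume x: "x \<in> carr FT"
  show s: "smult FT c x \<in> carr FT" using x keys_cmult[of c x] by (auto simp: carr_FT smult_FT)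
  show "smult FT c (smult FT d x) = smult FT (c * d) x" "smult FT 1 x = x"
    "add FT x (smult FT (-1) x) = smult FT 0 x"
    by (simp_all add: poly_mapping_eq_iff fun_eq_iff smult_FT add_FT lookup_add lookup_cmult)
  show "nrm FT (smult FT c x) = cmod c * nrm FT x"
    using nrm_FT[OF s] nrm_FT[OF x] by (simp add: smult_FT W_free_cmult cscale_simps)
  assume y: "y \<in> carr FT"
  show a: "add FT x y \<in> carr FT" using x y keys_add[of x y] by (auto simp: carr_FT add_FT)
  show "nrm FT (add FT x y) \<le> nrm FT x + nrm FT y"
    using nrm_FT[OF a] nrm_FT[OF x] nrm_FT[OF y] by (simp add: add_FT W_free_add norm_triangle_ineq)
  show "add FT x y = add FT y x" by (simp add: add_FT add.commute)
  show "smult FT c (add FT x y) = add FT (smult FT c x) (smult FT c y)"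
    "add FT (add FT x y) (smult FT (-1) y) = x"
    by (simp_all add: poly_mapping_eq_iff fun_eq_iff smult_FT add_FT lookup_add lookup_cmult distrib_left)
  show "add FT (add FT x y) z = add FT x (add FT y z)" by (simp add: add_FT add.assoc)
qed

interpretation ft: seminormed FT by (rule seminormed_FT)
interpretation fc: seminormed "cauchy_seqs FT" by (rule ft.seminormed_cauchy)

lemma W_free_diff:
  shows "W_free (diff FT z w) = W_free z - W_free w"
  by (simp add: diff_def add_FT smult_FT W_free_add W_free_cmult cscale_simps(6))

lemma nrm_diff_FT: "z \<in> carr FT \<Longrightarrow> w \<in> carr FT \<Longrightarrow> nrm FT (diff FT z w) = norm (W_free z - W_free w)"
  using nrm_FT[OF ft.diff_carr] by (simp add: W_free_diff)

subsection \<open>The completion\<close>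

lemma cauchy_FT_iff:
  "s \<in> carr (cauchy_seqs FT) \<longleftrightarrow> (\<forall>n. s n \<in> carr FT) \<and> Cauchy (\<lambda>n. W_free (s n))"
proof -
  have "Cauchy (\<lambda>n. W_free (s n)) \<longleftrightarrow> (\<forall>e>0. \<exists>N. \<forall>m\<ge>N. \<forall>n\<ge>N. nrm FT (diff FT (s m) (s n)) < e)"
    if "\<forall>n. s n \<in> carr FT"
    using that by (simp add: nrm_diff_FT Cauchy_iff)
  then show ?thesis unfolding ft.cauchy_iff by blast
qed

definition W_map :: "T_elem \<Rightarrow> spinor_L2" where
  "W_map A = lim (\<lambda>n. W_free ((SOME s. s \<in> A) n))"

lemma W_free_tendsto:
  assumes "s \<in> carr (cauchy_seqs FT)"
  shows "(\<lambda>n. W_free (s n)) \<longlonglongrightarrow> lim (\<lambda>n. W_free (s n))"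
  using assms by (simp add: cauchy_FT_iff Cauchy_convergent_iff convergent_LIMSEQ_iff)

text \<open>
  As \<open>W_free\<close> preserves the seminorm, Cauchy sequences are identified exactly if their images have the
  same limit.
\<close>

lemma null_rel_FT:
  assumes s: "s \<in> carr (cauchy_seqs FT)" and t: "t \<in> carr (cauchy_seqs FT)"
  shows "(s, t) \<in> null_rel (cauchy_seqs FT) \<longleftrightarrow> lim (\<lambda>n. W_free (s n)) = lim (\<lambda>n. W_free (t n))"
proof -
  have c: "s n \<in> carr FT" "t n \<in> carr FT" for n using s t by (simp_all add: cauchy_FT_iff)
  have l: "(\<lambda>n. norm (W_free (s n) - W_free (t n))) \<longlonglongrightarrow> norm (lim (\<lambda>n. W_free (s n)) - lim (\<lambda>n. W_free (t n)))"
    by (intro tendsto_norm tendsto_diff W_free_tendsto s t)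
  have "(s, t) \<in> null_rel (cauchy_seqs FT) \<longleftrightarrow> (\<lambda>n. norm (W_free (s n) - W_free (t n))) \<longlonglongrightarrow> 0"
    by (simp add: ft.null_rel_cauchy s t nrm_diff_FT c)
  also have "\<dots> \<longleftrightarrow> norm (lim (\<lambda>n. W_free (s n)) - lim (\<lambda>n. W_free (t n))) = 0"
  proof
    assume "(\<lambda>n. norm (W_free (s n) - W_free (t n))) \<longlonglongrightarrow> 0"
    from LIMSEQ_unique[OF l this] show "norm (lim (\<lambda>n. W_free (s n)) - lim (\<lambda>n. W_free (t n))) = 0" .
  qed (use l in simp)
  finally show ?thesis by simp
qed

lemma W_map_cls:
  assumes s: "s \<in> carr (cauchy_seqs FT)"
  shows "W_map (cls (cauchy_seqs FT) s) = lim (\<lambda>n. W_free (s n))"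
proof -
  have "(SOME t. t \<in> cls (cauchy_seqs FT) s) \<in> cls (cauchy_seqs FT) s"
    by (rule someI[of "\<lambda>t. t \<in> cls (cauchy_seqs FT) s", OF fc.cls_self[OF s]])
  then have *: "(s, SOME t. t \<in> cls (cauchy_seqs FT) s) \<in> null_rel (cauchy_seqs FT)" by (simp add: fc.mem_cls)
  then have "(SOME t. t \<in> cls (cauchy_seqs FT) s) \<in> carr (cauchy_seqs FT)" by (simp add: null_rel_def)
  from null_rel_FT[OF s this] * show ?thesis by (simp add: W_map_def)
qed

lemma XH_eq: "XH = hausdorff (cauchy_seqs FT)"
  by (simp add: XH_def interior_tensor_def completion_def)

lemma carr_XH: "carr XH = cls (cauchy_seqs FT) ` carr (cauchy_seqs FT)"
  by (simp add: XH_eq fc.carr_hausdorff)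

lemma W_map_inj:
  assumes "A \<in> carr XH" "B \<in> carr XH" "W_map A = W_map B"
  shows "A = B"
proof -
  obtain s t where s: "s \<in> carr (cauchy_seqs FT)" "A = cls (cauchy_seqs FT) s"
    and t: "t \<in> carr (cauchy_seqs FT)" "B = cls (cauchy_seqs FT) t" using assms by (auto simp: carr_XH)
  show ?thesis using assms(3) null_rel_FT[OF s(1) t(1)] by (simp add: s t W_map_cls fc.cls_eq_iff)
qed

lemma W_map_add:
  assumes "A \<in> carr XH" "B \<in> carr XH"
  shows "W_map (add XH A B) = W_map A + W_map B" "add XH A B \<in> carr XH"
proof -
  obtain s t where s: "s \<in> carr (cauchy_seqs FT)" "A = cls (cauchy_seqs FT) s"
    and t: "t \<in> carr (cauchy_seqs FT)" "B = cls (cauchy_seqs FT) t" using assms by (auto simp: carr_XH)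
  have st: "add (cauchy_seqs FT) s t \<in> carr (cauchy_seqs FT)" by (rule fc.add_carr[OF s(1) t(1)])
  have e: "add XH A B = cls (cauchy_seqs FT) (add (cauchy_seqs FT) s t)"
    by (simp add: XH_eq s t fc.add_hausdorff)
  show "add XH A B \<in> carr XH" using st by (simp add: e carr_XH)
  have "add (cauchy_seqs FT) s t n = s n + t n" for n by (simp add: cauchy_seqs_def add_FT)
  then have "lim (\<lambda>n. W_free (add (cauchy_seqs FT) s t n)) = lim (\<lambda>n. W_free (s n) + W_free (t n))"
    by (simp add: W_free_add)
  also have "\<dots> = lim (\<lambda>n. W_free (s n)) + lim (\<lambda>n. W_free (t n))"
    by (rule limI) (intro tendsto_add W_free_tendsto s t)
  finally show "W_map (add XH A B) = W_map A + W_map B"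
    unfolding e W_map_cls[OF st] by (simp add: s(2) t(2) W_map_cls s(1) t(1))
qed

lemma W_map_smult:
  assumes "A \<in> carr XH"
  shows "W_map (smult XH c A) = cscale c (W_map A)" "smult XH c A \<in> carr XH"
proof -
  obtain s where s: "s \<in> carr (cauchy_seqs FT)" "A = cls (cauchy_seqs FT) s" using assms by (auto simp: carr_XH)
  have st: "smult (cauchy_seqs FT) c s \<in> carr (cauchy_seqs FT)" by (rule fc.smult_carr[OF s(1)])
  have e: "smult XH c A = cls (cauchy_seqs FT) (smult (cauchy_seqs FT) c s)"
    by (simp add: XH_eq s fc.smult_hausdorff)
  show "smult XH c A \<in> carr XH" using st by (simp add: e carr_XH)
  have "smult (cauchy_seqs FT) c s n = Poly_Mapping.map ((*) c) (s n)" for n by (simp add: cauchy_seqs_def smult_FT)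
  then have "lim (\<lambda>n. W_free (smult (cauchy_seqs FT) c s n)) = lim (\<lambda>n. cscale c (W_free (s n)))"
    by (simp add: W_free_cmult)
  also have "\<dots> = cscale c (lim (\<lambda>n. W_free (s n)))"
    by (rule limI) (intro bounded_linear.tendsto[OF bounded_linear_cscale] W_free_tendsto s)
  finally show "W_map (smult XH c A) = cscale c (W_map A)"
    unfolding e W_map_cls[OF st] by (simp add: s(2) W_map_cls s(1))
qed

lemma W_map_nrm:
  assumes "A \<in> carr XH"
  shows "nrm XH A = norm (W_map A)"
proof -
  obtain s where s: "s \<in> carr (cauchy_seqs FT)" "A = cls (cauchy_seqs FT) s" using assms by (auto simp: carr_XH)
  have c: "s n \<in> carr FT" for n using s by (simp add: cauchy_FT_iff)
  have "nrm XH A = nrm (cauchy_seqs FT) s" by (simp add: XH_eq s fc.nrm_hausdorff)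
  also have "\<dots> = norm (lim (\<lambda>n. W_free (s n)))"
    using LIMSEQ_unique[OF ft.nrm_cauchy_tendsto[OF s(1)]] tendsto_norm[OF W_free_tendsto[OF s(1)]]
    by (simp add: nrm_FT c)
  finally show ?thesis by (simp add: s W_map_cls)
qed

lemma ip_cauchy_FT:
  assumes s: "s \<in> carr (cauchy_seqs FT)" and t: "t \<in> carr (cauchy_seqs FT)"
  shows "ip (cauchy_seqs FT) s t = cinner (lim (\<lambda>n. W_free (s n))) (lim (\<lambda>n. W_free (t n)))"
proof -
  have c: "s n \<in> carr FT" "t n \<in> carr FT" for n using s t by (simp_all add: cauchy_FT_iff)
  have "(\<lambda>n. ip FT (s n) (t n)) \<longlonglongrightarrow> cinner (lim (\<lambda>n. W_free (s n))) (lim (\<lambda>n. W_free (t n)))"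
    by (simp add: ip_FT c) (rule tendsto_cinner[OF W_free_tendsto[OF s] W_free_tendsto[OF t]])
  then have "(THE z. (\<lambda>n. ip FT (s n) (t n)) \<longlonglongrightarrow> z) = cinner (lim (\<lambda>n. W_free (s n))) (lim (\<lambda>n. W_free (t n)))"
    by (intro the_equality) (auto intro: LIMSEQ_unique)
  then show ?thesis by (simp add: cauchy_seqs_def)
qed

lemma W_map_ip:
  assumes "A \<in> carr XH" "B \<in> carr XH"
  shows "ip XH A B = cinner (W_map A) (W_map B)"
proof -
  obtain s t where s: "s \<in> carr (cauchy_seqs FT)" "A = cls (cauchy_seqs FT) s"
    and t: "t \<in> carr (cauchy_seqs FT)" "B = cls (cauchy_seqs FT) t" using assms by (auto simp: carr_XH)
  have "ip XH A B = ip (cauchy_seqs FT) s t"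
    unfolding XH_eq s(2) t(2)
  proof (rule fc.ip_hausdorff[OF s(1) t(1)])
    fix s' t' assume st: "(s, s') \<in> null_rel (cauchy_seqs FT)" "(t, t') \<in> null_rel (cauchy_seqs FT)"
    then have c: "s' \<in> carr (cauchy_seqs FT)" "t' \<in> carr (cauchy_seqs FT)" by (auto simp: null_rel_def)
    show "ip (cauchy_seqs FT) s' t' = ip (cauchy_seqs FT) s t"
      using st null_rel_FT[OF s(1) c(1)] null_rel_FT[OF t(1) c(2)] by (simp add: ip_cauchy_FT s t c)
  qed
  then show ?thesis by (simp add: ip_cauchy_FT s t W_map_cls)
qed

lemma W_map_diff:
  assumes "A \<in> carr XH" "B \<in> carr XH"
  shows "W_map (diff XH A B) = W_map A - W_map B" "diff XH A B \<in> carr XH"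
  using W_map_add W_map_smult assms by (simp_all add: diff_def cscale_simps(6))

lemma elem_tensor_XH:
  assumes "x \<in> carr X_mod" "h \<in> carr H_Q"
  shows "elem_tensor X_mod H_Q (L2_mult vol2) x h \<in> carr XH"
    "W_map (elem_tensor X_mod H_Q (L2_mult vol2) x h) = W_elem x h"
proof -
  have "Poly_Mapping.single (x, h) 1 \<in> carr FT" using assms by (simp add: carr_FT)
  then have c: "(\<lambda>_. Poly_Mapping.single (x, h) 1) \<in> carr (cauchy_seqs FT)" by (rule ft.cauchy_const)
  show "elem_tensor X_mod H_Q (L2_mult vol2) x h \<in> carr XH"
    using c by (simp add: elem_tensor_def embed_def carr_XH)
  have "lim (\<lambda>n::nat. W_elem x h) = W_elem x h" by (rule limI) simp
  then show "W_map (elem_tensor X_mod H_Q (L2_mult vol2) x h) = W_elem x h"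
    by (simp add: elem_tensor_def embed_def W_map_cls[OF c] W_free_single cscale_simps)
qed

lemma embed_X_mod: "\<xi> \<in> Cc4 \<Longrightarrow> embed X_pre \<xi> \<in> carr X_mod"
  by (simp add: embed_def carr_X_mod xp.cauchy_const carr_X_pre)

lemma tens_XH:
  assumes "\<xi> \<in> Cc4" "\<eta> \<in> carr HQ"
  shows "tens \<xi> \<eta> \<in> carr XH" "W_map (tens \<xi> \<eta>) = spinor (tensor_fun \<xi> \<eta>)"
proof -
  have h: "cls HQ \<eta> \<in> carr H_Q" using assms by (simp add: carr_H_Q)
  note e = elem_tensor_XH[OF embed_X_mod[OF assms(1)] h]
  show "tens \<xi> \<eta> \<in> carr XH" using e by (simp add: tens_def)
  have "W_map (tens \<xi> \<eta>) = W_pair (\<lambda>_. \<xi>) \<eta>"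
    using e W_elem_cls[OF xp.cauchy_const assms(2)] assms(1) by (simp add: tens_def embed_def carr_X_pre)
  also have "\<dots> = spinor (tensor_fun \<xi> \<eta>)" unfolding W_pair_def by (rule limI) simp
  finally show "W_map (tens \<xi> \<eta>) = spinor (tensor_fun \<xi> \<eta>)" .
qed

text \<open>
  A cutoff function of the quadrant which is one on the support of \<open>f\<close>, times the two basis vectors,
  supplies the right factors; the two halves of \<open>f\<close> are the left ones.
\<close>

lemma smooth_spinor_split:
  assumes f: "f \<in> Cc4"
  obtains \<xi>1 \<xi>2 \<eta>1 \<eta>2 where "\<xi>1 \<in> Cc4" "\<xi>2 \<in> Cc4" "\<eta>1 \<in> Cc2" "\<eta>2 \<in> Cc2"
    "f = (\<lambda>p. tensor_fun \<xi>1 \<eta>1 p + tensor_fun \<xi>2 \<eta>2 p)"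
proof -
  obtain d where d: "d > 0" "\<forall>p. cutoff d (quot p) = 1 \<or> f p = 0" by (rule Cc4_cutoff[OF f])
  define left right where "left w = (vector [w $ 1, w $ 2] :: complex^2)"
    and "right w = (vector [w $ 3, w $ 4] :: complex^2)" for w :: "complex^4"
  have bl: "bounded_linear left" "bounded_linear right"
    unfolding linear_conv_bounded_linear[symmetric]
    by (auto simp: linear_iff left_def right_def vec_eq_iff forall_2)
  let ?h = "\<lambda>y. complex_of_real (cutoff d y)"
  have C: "(\<lambda>p. left (f p)) \<in> Cc4" "(\<lambda>p. right (f p)) \<in> Cc4"
    using c4.Cc_linear[OF bl(1)] c4.Cc_linear[OF bl(2)] f by (simp_all add: Cc4_eq)
  have bs: "bounded_linear (\<lambda>c. c *s m)" for m :: "complex^2"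
    by (rule bounded_bilinear.bounded_linear_left[OF bounded_bilinear_smult_vec])
  have E: "(\<lambda>y. ?h y *s (m :: complex^2)) \<in> Cc2" for m
    using c2.Cc_linear[OF bs] cutoff_Cc2[OF d(1)] by (simp add: Cc2_eq)
  have "f p = tensor_fun (\<lambda>p. left (f p)) (\<lambda>y. ?h y *s vector [1, 0]) p
      + tensor_fun (\<lambda>p. right (f p)) (\<lambda>y. ?h y *s vector [0, 1]) p" for p
    using d(2)[rule_format, of p]
    by (auto simp: tensor_fun_def vec_eq_iff forall_4 spinor_tensor_nth left_def right_def)
  then show ?thesis using C E that by (metis (no_types, lifting) ext)
qed

text \<open>
  A sequence of smooth spinors converging to a given one lifts to formal sums, and the lift is Cauchy
  because \<open>W_free\<close> preserves the seminorm.
\<close>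

lemma W_map_surj: "W_map ` carr XH = UNIV"
proof -
  have smooth: "\<exists>z\<in>carr FT. W_free z = spinor f" if f: "f \<in> Cc4" for f
  proof -
    obtain \<xi>1 \<xi>2 \<eta>1 \<eta>2 where s: "\<xi>1 \<in> Cc4" "\<xi>2 \<in> Cc4" "\<eta>1 \<in> Cc2" "\<eta>2 \<in> Cc2"
      "f = (\<lambda>p. tensor_fun \<xi>1 \<eta>1 p + tensor_fun \<xi>2 \<eta>2 p)" by (rule smooth_spinor_split[OF f])
    note h = s(3)[THEN Cc2_sq_int] s(4)[THEN Cc2_sq_int]
    define k1 k2 where "k1 = (embed X_pre \<xi>1, cls HQ \<eta>1)" and "k2 = (embed X_pre \<xi>2, cls HQ \<eta>2)"
    let ?z = "Poly_Mapping.single k1 1 + Poly_Mapping.single k2 (1 :: complex)"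
    have k: "k1 \<in> carr X_mod \<times> carr H_Q" "k2 \<in> carr X_mod \<times> carr H_Q"
      using s h by (auto simp: k1_def k2_def embed_X_mod carr_H_Q)
    have "W_elem (fst k1) (snd k1) = spinor (tensor_fun \<xi>1 \<eta>1)" "W_elem (fst k2) (snd k2) = spinor (tensor_fun \<xi>2 \<eta>2)"
      using tens_XH(2)[OF s(1) h(1)] tens_XH(2)[OF s(2) h(2)] elem_tensor_XH(2) k
      by (auto simp: k1_def k2_def tens_def)
    then have "W_free ?z = spinor (tensor_fun \<xi>1 \<eta>1) + spinor (tensor_fun \<xi>2 \<eta>2)"
      by (simp add: W_free_add W_free_single cscale_simps)
    then have "W_free ?z = spinor f"
      unfolding s(5) using s h by (simp add: spinor_add tensor_fun_carr)
    moreover have "?z \<in> carr FT"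
      using k keys_add[of "Poly_Mapping.single k1 1" "Poly_Mapping.single k2 (1::complex)"] by (auto simp: carr_FT)
    ultimately show ?thesis by blast
  qed
  have "a \<in> W_map ` carr XH" for a
  proof -
    have "a \<in> closure smooth_spinors" by (simp add: smooth_spinors_dense)
    then obtain x where x: "\<And>n. x n \<in> smooth_spinors" "x \<longlonglongrightarrow> a" unfolding closure_sequential by blast
    have "\<exists>z. z \<in> carr FT \<and> W_free z = x n" for n
    proof -
      obtain f where "f \<in> Cc4" "x n = spinor f" using x(1)[of n] by (auto simp: smooth_spinors_def)
      then show ?thesis using smooth by metis
    qed
    then obtain s where s: "\<And>n. s n \<in> carr FT" "\<And>n. W_free (s n) = x n" by metis
    have c: "s \<in> carr (cauchy_seqs FT)"
      using s LIMSEQ_imp_Cauchy[OF x(2)] by (simp add: cauchy_FT_iff)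
    have "W_map (cls (cauchy_seqs FT) s) = a" using limI[OF x(2)] by (simp add: W_map_cls[OF c] s)
    then show ?thesis using c by (auto simp: carr_XH)
  qed
  then show ?thesis by blast
qed

section \<open>Transport of operators along the unitary\<close>

lemma Rep_add: "add L2_S4 (Rep_spinor_L2 a) (Rep_spinor_L2 b) = Rep_spinor_L2 (a + b)"
proof -
  obtain f where f: "f \<in> carr SQ" "a = spinor f" by (rule spinor_cases)
  obtain g where g: "g \<in> carr SQ" "b = spinor g" by (rule spinor_cases)
  show ?thesis
    by (simp add: f g spinor_add Rep_spinor sq_int_add_carr L2_S4_def L2_def sq.add_hausdorff) (simp add: sq_int_add_eq)
qed

lemma Rep_smult: "smult L2_S4 c (Rep_spinor_L2 a) = Rep_spinor_L2 (cscale c a)"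
proof -
  obtain f where f: "f \<in> carr SQ" "a = spinor f" by (rule spinor_cases)
  show ?thesis
    by (simp add: f cscale_spinor Rep_spinor sq_int_smult_carr L2_S4_def L2_def sq.smult_hausdorff) (simp add: sq_int_smult_eq)
qed

lemma Rep_nrm_diff: "nrm L2_S4 (diff L2_S4 (Rep_spinor_L2 a) (Rep_spinor_L2 b)) = norm (a - b)"
proof -
  obtain f where f: "f \<in> carr SQ" "a = spinor f" by (rule spinor_cases)
  obtain g where g: "g \<in> carr SQ" "b = spinor g" by (rule spinor_cases)
  show ?thesis
    by (simp add: f g norm_spinor_diff Rep_spinor L2_S4_def L2_def sq.diff_hausdorff sq.nrm_hausdorff sq.diff_carr)
qed

lemma W_map_cases:
  obtains A where "A \<in> carr XH" "a = W_map A"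
proof -
  have "a \<in> W_map ` carr XH" by (simp only: W_map_surj UNIV_I)
  then show ?thesis using that by blast
qed

definition W_graph :: "(T_elem \<times> (pt4 \<Rightarrow> complex^4) set) set" where
  "W_graph = {(A, Rep_spinor_L2 (W_map A)) | A. A \<in> carr XH}"

lemma W_graph_unitary: "is_unitary XH L2_S4 W_graph"
  unfolding is_unitary_def
proof (intro conjI)
  show "single_valued W_graph" by (auto simp: single_valued_def W_graph_def)
  show "Domain W_graph = carr XH" by (auto simp: W_graph_def)
  have "B \<in> Range W_graph" if "B \<in> carr L2_S4" for B
  proof -
    obtain A where A: "A \<in> carr XH" "Abs_spinor_L2 B = W_map A" by (rule W_map_cases)
    then have "Rep_spinor_L2 (W_map A) = B" using Abs_spinor_L2_inverse[OF that] by simp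
    then show ?thesis using A(1) by (auto simp: W_graph_def Range_iff)
  qed
  then show "Range W_graph = carr L2_S4" using Rep_spinor_L2 by (auto simp: W_graph_def)
  have "(x, y) \<in> W_graph" if "(x, y) \<in> lin_span XH L2_S4 W_graph" for x y
    using that
  proof (induction rule: lin_span.induct)
    case (base p)
    then show ?case .
  next
    case (add x y x' y')
    then show ?case by (auto simp: W_graph_def W_map_add Rep_add)
  next
    case (smult x y c)
    then show ?case by (auto simp: W_graph_def W_map_smult Rep_smult)
  qed
  then show "lin_span XH L2_S4 W_graph = W_graph" by (auto intro: lin_span.base)
  show "\<forall>(x, y)\<in>W_graph. \<forall>(x', y')\<in>W_graph. ip L2_S4 y y' = ip XH x x'"
    by (auto simp: W_graph_def W_map_ip cinner_def)
qed

lemma scalar_times_vector_Cc4: "f \<in> Cc4 \<Longrightarrow> (\<lambda>p. f p *s (l :: complex^'n)) \<in> Cc4"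
  and scalar_times_vector_Cc2: "h \<in> Cc2 \<Longrightarrow> (\<lambda>y. h y *s (l :: complex^'n)) \<in> Cc2"
  using c4.Cc_linear[OF bounded_bilinear.bounded_linear_left[OF bounded_bilinear_smult_vec]]
    c2.Cc_linear[OF bounded_bilinear.bounded_linear_left[OF bounded_bilinear_smult_vec]]
  by (auto simp: Cc4_eq Cc2_eq)

lemma W_graph_tens:
  assumes "f \<in> Cc4" "h \<in> Cc2"
  shows "(tens (\<lambda>p. f p *s l) (\<lambda>y. h y *s m),
     cls (sq_int vol4) (\<lambda>p. (f p * h (quot p)) *s vector [l$1 * m$1, l$2 * m$1, l$1 * m$2, l$2 * m$2])) \<in> W_graph"
proof -
  note C = scalar_times_vector_Cc4[OF assms(1), of l] Cc2_sq_int[OF scalar_times_vector_Cc2[OF assms(2), of m]]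
  have "tensor_fun (\<lambda>p. f p *s l) (\<lambda>y. h y *s m) =
      (\<lambda>p. (f p * h (quot p)) *s vector [l$1 * m$1, l$2 * m$1, l$1 * m$2, l$2 * m$2])"
    unfolding spinor_tensor_def[symmetric] tensor_fun_def[abs_def]
    by (simp add: spinor_tensor_smult_left spinor_tensor_smult_right vector_smult_assoc mult.commute)
  then have "Rep_spinor_L2 (W_map (tens (\<lambda>p. f p *s l) (\<lambda>y. h y *s m))) =
      cls SQ (\<lambda>p. (f p * h (quot p)) *s vector [l$1 * m$1, l$2 * m$1, l$1 * m$2, l$2 * m$2])"
    using tens_XH(2)[OF C] Rep_spinor[OF tensor_fun_carr[OF C]] by simp
  then show ?thesis using tens_XH(1)[OF C] unfolding W_graph_def by force
qed

text \<open>
  A unitary with the prescribed values on elementary tensors agrees with \<open>W_graph\<close> on a subspace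
  which \<open>W_graph\<close> maps onto the smooth spinors; as these are dense, the two coincide.
\<close>

lemma W_prop_unique:
  assumes U: "W_prop U"
  shows "U = W_graph"
proof -
  have un: "single_valued U" "Domain U = carr XH" "Range U = carr L2_S4" "lin_span XH L2_S4 U = U"
    and ip: "\<And>x y x' y'. (x, y) \<in> U \<Longrightarrow> (x', y') \<in> U \<Longrightarrow> ip L2_S4 y y' = ip XH x x'"
    using U unfolding W_prop_def is_unitary_def by blast+
  have U_tens: "(tens (\<lambda>p. f p *s l) (\<lambda>y. h y *s m),
     cls SQ (\<lambda>p. (f p * h (quot p)) *s vector [l$1 * m$1, l$2 * m$1, l$1 * m$2, l$2 * m$2])) \<in> U"
    if "f \<in> Cc4" "h \<in> Cc2" for f h l m using U that unfolding W_prop_def by blast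
  have smooth: "\<exists>A\<in>carr XH. W_map A = spinor f \<and> (A, Rep_spinor_L2 (spinor f)) \<in> U" if f: "f \<in> Cc4" for f
  proof -
    obtain d where d: "d > 0" "\<forall>p. cutoff d (quot p) = 1 \<or> f p = 0" by (rule Cc4_cutoff[OF f])
    let ?h = "\<lambda>y. complex_of_real (cutoff d y)"
    define G where "G g l m = (\<lambda>p. (g p * ?h (quot p)) *s (vector [l$1 * m$1, l$2 * m$1, l$1 * m$2, l$2 * m$2] :: complex^4))"
      for g :: "pt4 \<Rightarrow> complex" and l m :: "complex^2"
    have G: "\<exists>A\<in>carr XH. W_map A = spinor (G g l m) \<and> (A, Rep_spinor_L2 (spinor (G g l m))) \<in> U \<and> G g l m \<in> carr SQ"
      if g: "g \<in> Cc4" for g l m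
    proof -
      let ?A = "tens (\<lambda>p. g p *s l) (\<lambda>y. ?h y *s m)"
      note C = scalar_times_vector_Cc4[OF g, of l] Cc2_sq_int[OF scalar_times_vector_Cc2[OF cutoff_Cc2[OF d(1)], of m]]
      have e: "tensor_fun (\<lambda>p. g p *s l) (\<lambda>y. ?h y *s m) = G g l m"
        unfolding G_def spinor_tensor_def[symmetric] tensor_fun_def[abs_def]
        by (simp add: spinor_tensor_smult_left spinor_tensor_smult_right vector_smult_assoc mult.commute)
      have Gc: "G g l m \<in> carr SQ" using tensor_fun_carr[OF C] by (simp add: e)
      have "(?A, Rep_spinor_L2 (spinor (G g l m))) \<in> U"
        using U_tens[OF g cutoff_Cc2[OF d(1)], of l m] by (simp add: Rep_spinor[OF Gc]) (simp add: G_def)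
      then show ?thesis using tens_XH[OF C] Gc by (auto simp: e)
    qed
    have add: "\<exists>A\<in>carr XH. W_map A = spinor (\<lambda>p. u p + v p) \<and> (A, Rep_spinor_L2 (spinor (\<lambda>p. u p + v p))) \<in> U \<and> (\<lambda>p. u p + v p) \<in> carr SQ"
      if u: "\<exists>A\<in>carr XH. W_map A = spinor u \<and> (A, Rep_spinor_L2 (spinor u)) \<in> U \<and> u \<in> carr SQ"
        and v: "\<exists>A\<in>carr XH. W_map A = spinor v \<and> (A, Rep_spinor_L2 (spinor v)) \<in> U \<and> v \<in> carr SQ" for u v
    proof -
      obtain A where A: "A \<in> carr XH" "W_map A = spinor u" "(A, Rep_spinor_L2 (spinor u)) \<in> U" "u \<in> carr SQ"
        using u by blast
      obtain B where B: "B \<in> carr XH" "W_map B = spinor v" "(B, Rep_spinor_L2 (spinor v)) \<in> U" "v \<in> carr SQ"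
        using v by blast
      have "(add XH A B, add L2_S4 (Rep_spinor_L2 (spinor u)) (Rep_spinor_L2 (spinor v))) \<in> U"
        using lin_span.add[OF lin_span.base[OF A(3)] lin_span.base[OF B(3)], of XH L2_S4] un(4) by simp
      then show ?thesis
        using A B W_map_add[OF A(1) B(1)] sq_int_add_carr[OF A(4) B(4)] by (auto simp: Rep_add spinor_add)
    qed
    have comp: "(\<lambda>p. f p $ i) \<in> Cc4" for i
      using c4.Cc_linear[OF bounded_linear_vec_nth] f by (simp add: Cc4_eq)
    let ?e1 = "vector [1, 0] :: complex^2" and ?e2 = "vector [0, 1] :: complex^2"
    let ?F = "\<lambda>p. (G (\<lambda>p. f p $ 1) ?e1 ?e1 p + G (\<lambda>p. f p $ 2) ?e2 ?e1 p) +
        (G (\<lambda>p. f p $ 3) ?e1 ?e2 p + G (\<lambda>p. f p $ 4) ?e2 ?e2 p)"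
    have F: "?F = f"
    proof
      fix p
      show "?F p = f p"
        using d(2)[rule_format, of p] by (auto simp: G_def vec_eq_iff forall_4 vector_4_nth)
    qed
    have "\<exists>A\<in>carr XH. W_map A = spinor ?F \<and> (A, Rep_spinor_L2 (spinor ?F)) \<in> U \<and> ?F \<in> carr SQ"
      by (rule add[OF add[OF G[OF comp] G[OF comp]] add[OF G[OF comp] G[OF comp]]])
    then show ?thesis unfolding F by blast
  qed
  have U_sub: "(x, y) \<in> W_graph" if xy: "(x, y) \<in> U" for x y
  proof -
    have x: "x \<in> carr XH" using un(2) xy by blast
    have "y \<in> carr L2_S4" using un(3) xy by blast
    then obtain b where b: "y = Rep_spinor_L2 b" by (metis Abs_spinor_L2_inverse)
    let ?c = "b - W_map x"
    have bs: "cinner a (u - v) = cinner a u - cinner a v" for a u v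
      using bounded_bilinear.diff_right[OF bounded_bilinear_cinner] .
    have "smooth_spinors \<subseteq> {a. cinner a ?c = 0}"
    proof
      fix a assume "a \<in> smooth_spinors"
      then obtain f where f: "f \<in> Cc4" "a = spinor f" by (auto simp: smooth_spinors_def)
      then obtain A where A: "A \<in> carr XH" "W_map A = a" "(A, Rep_spinor_L2 a) \<in> U" using smooth by blast
      have "cinner a b = ip XH A x" using ip[OF A(3) xy] by (simp add: cinner_def b)
      also have "\<dots> = cinner a (W_map x)" using W_map_ip[OF A(1) x] A(2) by simp
      finally show "a \<in> {a. cinner a ?c = 0}" by (simp add: bs)
    qed
    moreover have "closed {a. cinner a ?c = 0}"
      using bounded_bilinear.continuous_on[OF bounded_bilinear_cinner continuous_on_id continuous_on_const, of UNIV ?c]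
      by (intro closed_Collect_eq continuous_on_const) auto
    ultimately have "closure smooth_spinors \<subseteq> {a. cinner a ?c = 0}" by (rule closure_minimal)
    then have "cinner ?c ?c = 0" by (simp add: smooth_spinors_dense subset_iff)
    then have "b = W_map x" by (simp add: cinner_simps(4))
    then show ?thesis using x b by (auto simp: W_graph_def)
  qed
  show ?thesis
  proof
    show "U \<subseteq> W_graph" using U_sub by auto
    show "W_graph \<subseteq> U"
    proof
      fix q assume "q \<in> W_graph"
      then obtain x where x: "q = (x, Rep_spinor_L2 (W_map x))" "x \<in> carr XH" by (auto simp: W_graph_def)
      then obtain y where "(x, y) \<in> U" using un(2) by blast
      then have "(x, y) \<in> U" "y = Rep_spinor_L2 (W_map x)" using U_sub by (auto simp: W_graph_def)
      then show "q \<in> U" using x by simp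
    qed
  qed
qed

lemma W_unitary_eq: "W_unitary = W_graph"
  unfolding W_unitary_def
proof (rule the_equality)
  show "W_prop W_graph"
    unfolding W_prop_def using W_graph_unitary W_graph_tens by blast
qed (rule W_prop_unique)

text \<open>
  A unitary is inverse to its adjoint: if \<open>(y, x)\<close> is in the adjoint, then the vector \<open>y - W x\<close> is
  orthogonal to the range of \<open>W\<close>, hence to itself.
\<close>

lemma adjoint_W_graph: "op_adjoint XH L2_S4 W_graph = {(Rep_spinor_L2 (W_map A), A) | A. A \<in> carr XH}"
proof (intro set_eqI iffI)
  fix q assume "q \<in> op_adjoint XH L2_S4 W_graph"
  then obtain y x where q: "q = (y, x)" "y \<in> carr L2_S4" "x \<in> carr XH"
    "\<And>u. u \<in> carr XH \<Longrightarrow> ip L2_S4 (Rep_spinor_L2 (W_map u)) y = ip XH u x"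
    by (auto simp: op_adjoint_def W_graph_def)
  obtain b where b: "y = Rep_spinor_L2 b" using q(2) by (metis Abs_spinor_L2_inverse)
  \<comment> \<open>surjectivity: the difference is itself in the range\<close>
  obtain u where u: "u \<in> carr XH" "b - W_map x = W_map u" by (rule W_map_cases)
  have "cinner (W_map u) b = cinner (W_map u) (W_map x)"
    using q(4)[OF u(1)] W_map_ip[OF u(1) q(3)] by (simp add: b cinner_def)
  then have "cinner (W_map u) (b - W_map x) = 0"
    by (simp add: bounded_bilinear.diff_right[OF bounded_bilinear_cinner])
  then have "cinner (W_map u) (W_map u) = 0" by (simp only: u(2))
  then have "b - W_map x = 0" unfolding u(2) by (simp add: cinner_simps(4))
  then have "b = W_map x" by simp
  then show "q \<in> {(Rep_spinor_L2 (W_map A), A) | A. A \<in> carr XH}" using q b by auto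
next
  fix q assume "q \<in> {(Rep_spinor_L2 (W_map A), A) | A. A \<in> carr XH}"
  then show "q \<in> op_adjoint XH L2_S4 W_graph"
    using Rep_spinor_L2 by (auto simp: op_adjoint_def W_graph_def W_map_ip cinner_def)
qed

text \<open>
  The graph, in the square of the space of spinors, of the operator conjugate to \<open>S\<close>.
\<close>

definition transport :: "(T_elem \<times> T_elem) set \<Rightarrow> (spinor_L2 \<times> spinor_L2) set" where
  "transport S = (\<lambda>(x, y). (W_map x, W_map y)) ` S"

lemma mem_transport:
  assumes "S \<subseteq> carr XH \<times> carr XH" "x \<in> carr XH" "y \<in> carr XH"
  shows "(W_map x, W_map y) \<in> transport S \<longleftrightarrow> (x, y) \<in> S"
proof
  assume "(W_map x, W_map y) \<in> transport S"
  then obtain u v where uv: "(u, v) \<in> S" "W_map x = W_map u" "W_map y = W_map v" by (auto simp: transport_def)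
  then have "u \<in> carr XH" "v \<in> carr XH" using assms(1) by auto
  then have "x = u" "y = v" using uv W_map_inj assms(2,3) by blast+
  then show "(x, y) \<in> S" using uv by simp
qed (auto simp: transport_def intro!: image_eqI)

lemma transport_eqI:
  assumes "S \<subseteq> carr XH \<times> carr XH"
    "\<And>x y. x \<in> carr XH \<Longrightarrow> y \<in> carr XH \<Longrightarrow> (x, y) \<in> S \<longleftrightarrow> (W_map x, W_map y) \<in> T"
  shows "transport S = T"
proof (intro set_eqI iffI)
  fix q assume "q \<in> transport S"
  then show "q \<in> T" using assms by (auto simp: transport_def)
next
  fix q assume q: "q \<in> T"
  obtain x where x: "x \<in> carr XH" "fst q = W_map x" by (rule W_map_cases)
  obtain y where y: "y \<in> carr XH" "snd q = W_map y" by (rule W_map_cases)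
  have qe: "q = (W_map x, W_map y)" using x(2) y(2) by (simp add: prod_eq_iff)
  then have "(x, y) \<in> S" using assms(2)[OF x(1) y(1)] q by simp
  then show "q \<in> transport S" unfolding transport_def qe by (rule rev_image_eqI) simp
qed

text \<open>
  For an isometric \<open>\<phi>\<close>, operator closure is topological closure of the transported graph in the product space.
\<close>

lemma op_closure_transport:
  assumes iso: "\<And>x y. x \<in> carr V \<Longrightarrow> y \<in> carr V \<Longrightarrow> nrm V (diff V x y) = norm (\<phi> x - (\<phi> y :: 'a::real_normed_vector))"
    and S: "S \<subseteq> carr V \<times> carr V" and x: "x \<in> carr V" and y: "y \<in> carr V"
  shows "(x, y) \<in> op_closure V V S \<longleftrightarrow> (\<phi> x, \<phi> y) \<in> closure ((\<lambda>(x, y). (\<phi> x, \<phi> y)) ` S)"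
proof
  assume "(x, y) \<in> op_closure V V S"
  then obtain u v where uv: "\<And>n. (u n, v n) \<in> S" "(\<lambda>n. nrm V (diff V (u n) x)) \<longlonglongrightarrow> 0" "(\<lambda>n. nrm V (diff V (v n) y)) \<longlonglongrightarrow> 0"
    by (auto simp: op_closure_def)
  have c: "u n \<in> carr V" "v n \<in> carr V" for n using uv(1)[of n] S by auto
  have "(\<lambda>n. \<phi> (u n)) \<longlonglongrightarrow> \<phi> x" "(\<lambda>n. \<phi> (v n)) \<longlonglongrightarrow> \<phi> y"
    using uv(2,3) by (simp_all add: iso c x y LIM_zero_iff tendsto_norm_zero_iff)
  then have "(\<lambda>n. (\<phi> (u n), \<phi> (v n))) \<longlonglongrightarrow> (\<phi> x, \<phi> y)" by (rule tendsto_Pair)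
  then show "(\<phi> x, \<phi> y) \<in> closure ((\<lambda>(x, y). (\<phi> x, \<phi> y)) ` S)"
    by (rule in_closure_sequentially[rotated]) (use uv(1) in force)
next
  assume "(\<phi> x, \<phi> y) \<in> closure ((\<lambda>(x, y). (\<phi> x, \<phi> y)) ` S)"
  then obtain q where q: "\<And>n. q n \<in> (\<lambda>(x, y). (\<phi> x, \<phi> y)) ` S" "q \<longlonglongrightarrow> (\<phi> x, \<phi> y)"
    unfolding closure_sequential by blast
  have "\<exists>z. z \<in> S \<and> q n = (\<phi> (fst z), \<phi> (snd z))" for n using q(1)[of n] by force
  then obtain z where z: "\<And>n. z n \<in> S" "\<And>n. q n = (\<phi> (fst (z n)), \<phi> (snd (z n)))" by metis
  have c: "fst (z n) \<in> carr V" "snd (z n) \<in> carr V" for n using z(1)[of n] S by auto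
  have "(\<lambda>n. \<phi> (fst (z n))) \<longlonglongrightarrow> \<phi> x" "(\<lambda>n. \<phi> (snd (z n))) \<longlonglongrightarrow> \<phi> y"
    using tendsto_fst[OF q(2)] tendsto_snd[OF q(2)] by (simp_all add: z(2))
  then have "(\<lambda>n. nrm V (diff V (fst (z n)) x)) \<longlonglongrightarrow> 0" "(\<lambda>n. nrm V (diff V (snd (z n)) y)) \<longlonglongrightarrow> 0"
    by (simp_all add: iso c x y LIM_zero_iff tendsto_norm_zero_iff)
  moreover have "(fst (z n), snd (z n)) \<in> S" for n using z(1) by simp
  ultimately show "(x, y) \<in> op_closure V V S"
    unfolding op_closure_def mem_Collect_eq case_prod_conv using x y
    by (intro conjI exI[of _ "\<lambda>n. fst (z n)"] exI[of _ "\<lambda>n. snd (z n)"]) auto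
qed

lemma transport_closure:
  assumes "S \<subseteq> carr XH \<times> carr XH"
  shows "transport (op_closure XH XH S) = closure (transport S)" "op_closure XH XH S \<subseteq> carr XH \<times> carr XH"
proof -
  show s: "op_closure XH XH S \<subseteq> carr XH \<times> carr XH" by (auto simp: op_closure_def)
  have iso: "nrm XH (diff XH x y) = norm (W_map x - W_map y)" if "x \<in> carr XH" "y \<in> carr XH" for x y
    using that by (simp add: W_map_nrm W_map_diff)
  show "transport (op_closure XH XH S) = closure (transport S)"
    by (rule transport_eqI[OF s]) (simp add: op_closure_transport[OF iso assms] transport_def)
qed

text \<open>
  Sums and compositions are transported because \<open>W_map\<close> is injective on the carrier: the vectors at which
  the two operators are to be joined coincide as soon as their images do.
\<close>

lemma transport_add:
  assumes S: "S \<subseteq> carr XH \<times> carr XH" and T: "T \<subseteq> carr XH \<times> carr XH"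
  shows "transport (op_add XH S T) = {(a, b + c) | a b c. (a, b) \<in> transport S \<and> (a, c) \<in> transport T}"
    "op_add XH S T \<subseteq> carr XH \<times> carr XH"
proof -
  show s: "op_add XH S T \<subseteq> carr XH \<times> carr XH" using S T W_map_add(2) by (auto simp: op_add_def)
  have "(x, y) \<in> op_add XH S T \<longleftrightarrow> (W_map x, W_map y) \<in> {(a, b + c) | a b c. (a, b) \<in> transport S \<and> (a, c) \<in> transport T}"
    if x: "x \<in> carr XH" and y: "y \<in> carr XH" for x y
  proof
    assume "(x, y) \<in> op_add XH S T"
    then obtain u v where uv: "(x, u) \<in> S" "(x, v) \<in> T" "y = add XH u v" by (auto simp: op_add_def)
    then have "u \<in> carr XH" "v \<in> carr XH" using S T by auto
    then show "(W_map x, W_map y) \<in> {(a, b + c) | a b c. (a, b) \<in> transport S \<and> (a, c) \<in> transport T}"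
      using uv mem_transport[OF S x] mem_transport[OF T x] by (auto simp: W_map_add)
  next
    assume "(W_map x, W_map y) \<in> {(a, b + c) | a b c. (a, b) \<in> transport S \<and> (a, c) \<in> transport T}"
    then obtain b c where bc: "W_map y = b + c" "(W_map x, b) \<in> transport S" "(W_map x, c) \<in> transport T" by auto
    obtain u where u: "u \<in> carr XH" "b = W_map u" by (rule W_map_cases)
    obtain v where v: "v \<in> carr XH" "c = W_map v" by (rule W_map_cases)
    note uv = u v
    have "y = add XH u v" by (rule W_map_inj) (simp_all add: y uv W_map_add bc)
    moreover have "(x, u) \<in> S" "(x, v) \<in> T"
      using bc uv mem_transport[OF S x uv(1)] mem_transport[OF T x uv(3)] by auto
    ultimately show "(x, y) \<in> op_add XH S T" by (auto simp: op_add_def)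
  qed
  then show "transport (op_add XH S T) = {(a, b + c) | a b c. (a, b) \<in> transport S \<and> (a, c) \<in> transport T}"
    by (rule transport_eqI[OF s])
qed

lemma transport_scale:
  assumes S: "S \<subseteq> carr XH \<times> carr XH"
  shows "transport (op_scale XH c S) = {(a, cscale c b) | a b. (a, b) \<in> transport S}"
    "op_scale XH c S \<subseteq> carr XH \<times> carr XH"
proof -
  show "op_scale XH c S \<subseteq> carr XH \<times> carr XH" using S W_map_smult(2) by (auto simp: op_scale_def)
  have "W_map (smult XH c y) = cscale c (W_map y)" if "(x, y) \<in> S" for x y
    using S that W_map_smult(1) by blast
  then show "transport (op_scale XH c S) = {(a, cscale c b) | a b. (a, b) \<in> transport S}"
    unfolding transport_def op_scale_def by (fastforce simp: image_iff)
qed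

lemma transport_comp:
  assumes S: "S \<subseteq> carr XH \<times> carr XH" and T: "T \<subseteq> carr XH \<times> carr XH"
  shows "transport (S \<circ>\<^sub>g T) = transport T O transport S" "S \<circ>\<^sub>g T \<subseteq> carr XH \<times> carr XH"
proof -
  show s: "S \<circ>\<^sub>g T \<subseteq> carr XH \<times> carr XH" using S T by (auto simp: op_comp_def)
  have "(x, y) \<in> S \<circ>\<^sub>g T \<longleftrightarrow> (W_map x, W_map y) \<in> transport T O transport S"
    if x: "x \<in> carr XH" and y: "y \<in> carr XH" for x y
  proof
    assume "(x, y) \<in> S \<circ>\<^sub>g T"
    then obtain u where "(x, u) \<in> T" "(u, y) \<in> S" by (auto simp: op_comp_def)
    then show "(W_map x, W_map y) \<in> transport T O transport S" by (force simp: transport_def)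
  next
    assume "(W_map x, W_map y) \<in> transport T O transport S"
    then obtain b where b: "(W_map x, b) \<in> transport T" "(b, W_map y) \<in> transport S" by auto
    obtain u where u: "u \<in> carr XH" "b = W_map u" by (rule W_map_cases)
    then have "(x, u) \<in> T" "(u, y) \<in> S" using b mem_transport[OF T x u(1)] mem_transport[OF S u(1) y] by auto
    then show "(x, y) \<in> S \<circ>\<^sub>g T" by (auto simp: op_comp_def)
  qed
  then show "transport (S \<circ>\<^sub>g T) = transport T O transport S" by (rule transport_eqI[OF s])
qed

lemma transport_Id: "transport (Id_on (carr XH)) = Id" "Id_on (carr XH) \<subseteq> carr XH \<times> carr XH"
proof -
  show s: "Id_on (carr XH) \<subseteq> carr XH \<times> carr XH" by auto
  show "transport (Id_on (carr XH)) = Id"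
    by (rule transport_eqI[OF s]) (use W_map_inj in \<open>auto simp: Id_on_iff\<close>)
qed

lemma transport_span_subset:
  assumes G: "\<And>x y. (x, y) \<in> G \<Longrightarrow> x \<in> carr XH \<and> y \<in> carr XH \<and> (W_map x, W_map y) \<in> T"
    and add: "\<And>a b a' b'. (a, b) \<in> T \<Longrightarrow> (a', b') \<in> T \<Longrightarrow> (a + a', b + b') \<in> T"
    and scale: "\<And>a b c. (a, b) \<in> T \<Longrightarrow> (cscale c a, cscale c b) \<in> T"
  shows "lin_span XH XH G \<subseteq> carr XH \<times> carr XH" "transport (lin_span XH XH G) \<subseteq> T"
proof -
  have "fst q \<in> carr XH \<and> snd q \<in> carr XH \<and> (W_map (fst q), W_map (snd q)) \<in> T" if "q \<in> lin_span XH XH G" for q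
    using that
  proof (induction rule: lin_span.induct)
    case (base p)
    then show ?case using G by (cases p) auto
  next
    case (add x y x' y')
    then show ?case using assms(2) by (auto simp: W_map_add)
  next
    case (smult x y c)
    then show ?case using scale by (auto simp: W_map_smult)
  qed
  then show "lin_span XH XH G \<subseteq> carr XH \<times> carr XH" "transport (lin_span XH XH G) \<subseteq> T"
    by (force simp: transport_def)+
qed

lemma transport_span_add:
  assumes "(x, y) \<in> G" "(x', y') \<in> G" "x \<in> carr XH" "y \<in> carr XH" "x' \<in> carr XH" "y' \<in> carr XH"
  shows "(W_map x + W_map x', W_map y + W_map y') \<in> transport (lin_span XH XH G)"
proof -
  have "(add XH x x', add XH y y') \<in> lin_span XH XH G"
    by (intro lin_span.add lin_span.base assms)
  then have "(W_map (add XH x x'), W_map (add XH y y')) \<in> transport (lin_span XH XH G)" by (force simp: transport_def)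
  then show ?thesis by (simp add: W_map_add assms)
qed

section \<open>The gradings\<close>

definition pointwise :: "complex^4^4 \<Rightarrow> spinor_L2 \<Rightarrow> spinor_L2" where
  "pointwise A a = spinor (\<lambda>p. A *v (SOME f. f \<in> carr SQ \<and> a = spinor f) p)"

lemma matrix_carr:
  obtains K where "K > 0" "\<And>f. f \<in> carr SQ \<Longrightarrow> (\<lambda>p. (A :: complex^4^4) *v f p) \<in> carr SQ"
    "\<And>f. f \<in> carr SQ \<Longrightarrow> nrm SQ (\<lambda>p. A *v f p) \<le> nrm SQ f * K"
proof -
  obtain K where K: "K > 0" "\<And>v. norm (A *v v) \<le> norm v * K"
    using bounded_linear.pos_bounded[OF bounded_linear_matrix[of A]] by blast
  have sq: "(norm (A *v v))\<^sup>2 \<le> K\<^sup>2 * (norm v)\<^sup>2" for v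
    using power_mono[OF K(2)[of v] norm_ge_zero, of 2] by (simp add: power_mult_distrib mult.commute)
  have c: "(\<lambda>p. A *v f p) \<in> carr SQ" if f: "f \<in> carr SQ" for f
  proof -
    have "f \<in> borel_measurable vol4" using f by (simp add: mem_sq_int)
    then have m: "(\<lambda>p. A *v f p) \<in> borel_measurable vol4"
      by (rule measurable_compose) (intro borel_measurable_continuous_onI linear_continuous_on bounded_linear_matrix)
    have "integrable vol4 (\<lambda>p. (norm (A *v f p))\<^sup>2)"
    proof (rule Bochner_Integration.integrable_bound)
      show "integrable vol4 (\<lambda>p. K\<^sup>2 * (norm (f p))\<^sup>2)" using f by (simp add: mem_sq_int)
      show "(\<lambda>p. (norm (A *v f p))\<^sup>2) \<in> borel_measurable vol4" using m by measurable
      show "AE p in vol4. norm ((norm (A *v f p))\<^sup>2) \<le> norm (K\<^sup>2 * (norm (f p))\<^sup>2)"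
        by (rule AE_I2) (simp add: sq)
    qed
    then show ?thesis using m by (simp add: mem_sq_int)
  qed
  have "nrm SQ (\<lambda>p. A *v f p) \<le> nrm SQ f * K" if f: "f \<in> carr SQ" for f
  proof (rule power2_le_imp_le)
    have "(nrm SQ (\<lambda>p. A *v f p))\<^sup>2 \<le> (LINT p|vol4. K\<^sup>2 * (norm (f p))\<^sup>2)"
      unfolding sq_int_nrm2 using f c[OF f] by (intro integral_mono sq) (auto simp: mem_sq_int)
    then show "(nrm SQ (\<lambda>p. A *v f p))\<^sup>2 \<le> (nrm SQ f * K)\<^sup>2" by (simp add: sq_int_nrm2 power_mult_distrib mult.commute)
  qed (use K in \<open>simp add: sq_int_nrm_nonneg\<close>)
  then show ?thesis using K(1) c that by blast
qed

lemma pointwise_spinor: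
  assumes f: "f \<in> carr SQ"
  shows "pointwise A (spinor f) = spinor (\<lambda>p. A *v f p)" "(\<lambda>p. A *v f p) \<in> carr SQ"
proof -
  obtain K where c: "\<And>f. f \<in> carr SQ \<Longrightarrow> (\<lambda>p. A *v f p) \<in> carr SQ" by (rule matrix_carr[of A]) blast
  then show "(\<lambda>p. A *v f p) \<in> carr SQ" using f by blast
  define g where "g = (SOME g. g \<in> carr SQ \<and> spinor f = spinor g)"
  have g: "g \<in> carr SQ" "spinor f = spinor g"
    unfolding g_def using someI[of "\<lambda>g. g \<in> carr SQ \<and> spinor f = spinor g" f] f by auto
  then have "AE p in vol4. f p = g p" using spinor_eq_iff[OF f g(1)] by simp
  then have "AE p in vol4. A *v g p = A *v f p" by eventually_elim simp
  then show "pointwise A (spinor f) = spinor (\<lambda>p. A *v f p)"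
    using spinor_eq_iff[OF c[OF g(1)] c[OF f]] by (simp add: pointwise_def g_def)
qed

lemma bounded_linear_pointwise: "bounded_linear (pointwise A)"
proof -
  obtain K where K: "\<And>f. f \<in> carr SQ \<Longrightarrow> nrm SQ (\<lambda>p. A *v f p) \<le> nrm SQ f * K"
    by (rule matrix_carr[of A]) blast
  show ?thesis
  proof (rule bounded_linear_intro[where K = K])
    fix a b r
    obtain f where f: "f \<in> carr SQ" "a = spinor f" by (rule spinor_cases)
    obtain g where g: "g \<in> carr SQ" "b = spinor g" by (rule spinor_cases)
    show "pointwise A (a + b) = pointwise A a + pointwise A b"
      by (simp add: f g spinor_add sq_int_add_carr pointwise_spinor matrix_add)
    show "pointwise A (r *\<^sub>R a) = r *\<^sub>R pointwise A a"
      by (simp add: f spinor_scaleR sq_int_smult_carr pointwise_spinor matrix_smult)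
    show "norm (pointwise A a) \<le> norm a * K"
      using K[OF f(1)] by (simp add: f pointwise_spinor norm_spinor)
  qed
qed

lemma pointwise_cscale: "pointwise A (cscale c a) = cscale c (pointwise A a)"
proof -
  obtain f where f: "f \<in> carr SQ" "a = spinor f" by (rule spinor_cases)
  show ?thesis by (simp add: f cscale_spinor sq_int_smult_carr pointwise_spinor matrix_smult)
qed

text \<open>
  The graph of a bounded operator is closed and is the closure of its restriction to a dense subspace.
\<close>

lemma closure_graph_pointwise:
  "closure {(a, pointwise A a) | a. a \<in> smooth_spinors} = {(a, pointwise A a) | a. True}"
proof
  have cont: "continuous_on UNIV (pointwise A)" by (rule linear_continuous_on[OF bounded_linear_pointwise])
  have "closed {q :: spinor_L2 \<times> spinor_L2. snd q = pointwise A (fst q)}"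
    by (intro closed_Collect_eq continuous_intros continuous_on_compose2[OF cont]) auto
  moreover have "{q. snd q = pointwise A (fst q)} = {(a, pointwise A a) | a. True}" by auto
  ultimately have cl: "closed {(a, pointwise A a) | a. True}" by simp
  show "closure {(a, pointwise A a) | a. a \<in> smooth_spinors} \<subseteq> {(a, pointwise A a) | a. True}"
    by (rule closure_minimal[OF _ cl]) auto
  show "{(a, pointwise A a) | a. True} \<subseteq> closure {(a, pointwise A a) | a. a \<in> smooth_spinors}"
  proof clarify
    fix a
    have "a \<in> closure smooth_spinors" by (simp add: smooth_spinors_dense)
    then obtain x where x: "\<And>n. x n \<in> smooth_spinors" "x \<longlonglongrightarrow> a" unfolding closure_sequential by blast
    have "(\<lambda>n. (x n, pointwise A (x n))) \<longlonglongrightarrow> (a, pointwise A a)"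
      by (intro tendsto_Pair x bounded_linear.tendsto[OF bounded_linear_pointwise])
    then show "(a, pointwise A a) \<in> closure {(a, pointwise A a) | a. a \<in> smooth_spinors}"
      by (rule in_closure_sequentially[rotated]) (use x(1) in auto)
  qed
qed

lemma cip_grading: "cip (grading2 *v u) (grading2 *v v) = cip u v"
  by (simp add: cip_def sum_2 matrix2_apply)

lemma norm_grading: "norm (grading2 *v u) = norm u"
proof -
  have "complex_of_real ((norm (grading2 *v u))\<^sup>2) = complex_of_real ((norm u)\<^sup>2)"
    using cip_grading[of u u] by (simp only: cip_self)
  then have "(norm (grading2 *v u))\<^sup>2 = (norm u)\<^sup>2" by (simp only: of_real_eq_iff)
  then show ?thesis by simp
qed

lemma matrix_diff: "A *v (u - v) = A *v u - A *v (v :: complex^'n)"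
  by (rule linear_diff[OF bounded_linear.linear[OF bounded_linear_matrix]])

lemma X_grading_cls:
  assumes s: "s \<in> carr (cauchy_seqs X_pre)"
  shows "X_grading (cls (cauchy_seqs X_pre) s) = cls (cauchy_seqs X_pre) (\<lambda>n p. grading2 *v s n p)"
    "(\<lambda>n p. grading2 *v s n p) \<in> carr (cauchy_seqs X_pre)"
proof -
  have iso: "nrm X_pre (\<lambda>p. grading2 *v f p) = nrm X_pre f" for f
    by (simp add: X_pre_def X_ip_def cip_grading)
  have d: "nrm X_pre (diff X_pre (\<lambda>p. grading2 *v f p) (\<lambda>p. grading2 *v g p)) = nrm X_pre (diff X_pre f g)" for f g
    using iso[of "\<lambda>p. f p - g p"] by (simp add: diff_X_pre matrix_diff)
  have c: "(\<lambda>n p. grading2 *v t n p) \<in> carr (cauchy_seqs X_pre)" if "t \<in> carr (cauchy_seqs X_pre)" for t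
    using that by (simp add: xp.cauchy_iff d) (simp add: carr_X_pre Cc4_matrix)
  show "(\<lambda>n p. grading2 *v s n p) \<in> carr (cauchy_seqs X_pre)" by (rule c[OF s])
  show "X_grading (cls (cauchy_seqs X_pre) s) = cls (cauchy_seqs X_pre) (\<lambda>n p. grading2 *v s n p)"
    unfolding X_grading_def
  proof (rule xc.lift_map_cls[OF s c])
    fix t u assume tu: "t \<in> carr (cauchy_seqs X_pre)" "u \<in> carr (cauchy_seqs X_pre)"
      "nrm (cauchy_seqs X_pre) (diff (cauchy_seqs X_pre) t u) = 0"
    then have "(t, u) \<in> null_rel (cauchy_seqs X_pre)" by (simp add: null_rel_def)
    then have "((\<lambda>n p. grading2 *v t n p), (\<lambda>n p. grading2 *v u n p)) \<in> null_rel (cauchy_seqs X_pre)"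
      by (simp add: xp.null_rel_cauchy c d)
    then show "nrm (cauchy_seqs X_pre) (diff (cauchy_seqs X_pre) (\<lambda>n p. grading2 *v t n p) (\<lambda>n p. grading2 *v u n p)) = 0"
      by (simp add: null_rel_def)
  qed
qed

lemma H_grading_cls:
  assumes \<eta>: "\<eta> \<in> carr HQ"
  shows "H_grading (cls HQ \<eta>) = cls HQ (\<lambda>y. grading2 *v \<eta> y)" "(\<lambda>y. grading2 *v \<eta> y) \<in> carr HQ"
proof -
  have c: "(\<lambda>y. grading2 *v \<theta> y) \<in> carr HQ" if "\<theta> \<in> carr HQ" for \<theta>
  proof -
    have "\<theta> \<in> borel_measurable vol2" using that by (simp add: mem_sq_int)
    then have "(\<lambda>p. grading2 *v \<theta> p) \<in> borel_measurable vol2"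
      by (rule measurable_compose) (intro borel_measurable_continuous_onI linear_continuous_on bounded_linear_matrix)
    then show ?thesis using that by (simp add: mem_sq_int norm_grading)
  qed
  show "(\<lambda>y. grading2 *v \<eta> y) \<in> carr HQ" by (rule c[OF \<eta>])
  show "H_grading (cls HQ \<eta>) = cls HQ (\<lambda>y. grading2 *v \<eta> y)"
    unfolding H_grading_def
  proof (rule sq.lift_map_cls[OF \<eta> c])
    fix f g assume "nrm HQ (diff HQ f g) = 0"
    then show "nrm HQ (diff HQ (\<lambda>y. grading2 *v f y) (\<lambda>y. grading2 *v g y)) = 0"
      by (simp add: sq_int_diff matrix_diff[symmetric]) (simp add: sq_int_def norm_grading)
  qed
qed

lemma X_grading_carr: "x \<in> carr X_mod \<Longrightarrow> X_grading x \<in> carr X_mod"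
  using X_grading_cls by (auto simp: carr_X_mod)

lemma H_grading_carr: "h \<in> carr H_Q \<Longrightarrow> H_grading h \<in> carr H_Q"
  using H_grading_cls by (auto simp: carr_H_Q)

lemma W_elem_grading:
  assumes "x \<in> carr X_mod" "h \<in> carr H_Q"
  shows "W_elem (X_grading x) h = pointwise grading_left (W_elem x h)"
    "W_elem (X_grading x) (H_grading h) = pointwise grading_both (W_elem x h)"
proof -
  obtain s where s: "s \<in> carr (cauchy_seqs X_pre)" "x = cls (cauchy_seqs X_pre) s" using assms by (auto simp: carr_X_mod)
  obtain \<eta> where \<eta>: "\<eta> \<in> carr HQ" "h = cls HQ \<eta>" using assms by (auto simp: carr_H_Q)
  have c: "s n \<in> Cc4" for n using s by (simp add: xp.cauchy_iff carr_X_pre)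
  have lim: "(\<lambda>n. pointwise A (spinor (tensor_fun (s n) \<eta>))) \<longlonglongrightarrow> pointwise A (W_pair s \<eta>)" for A
    by (rule bounded_linear.tendsto[OF bounded_linear_pointwise W_pair_tendsto[OF s(1) \<eta>(1)]])
  have "W_pair (\<lambda>n p. grading2 *v s n p) \<eta> = pointwise grading_left (W_pair s \<eta>)"
  proof (rule LIMSEQ_unique[OF W_pair_tendsto[OF X_grading_cls(2)[OF s(1)] \<eta>(1)]])
    show "(\<lambda>n. spinor (tensor_fun (\<lambda>p. grading2 *v s n p) \<eta>)) \<longlonglongrightarrow> pointwise grading_left (W_pair s \<eta>)"
      using lim[of grading_left]
      by (simp add: pointwise_spinor tensor_fun_carr c \<eta>) (simp add: tensor_fun_def[abs_def] spinor_tensor_matrix)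
  qed
  then show "W_elem (X_grading x) h = pointwise grading_left (W_elem x h)"
    by (simp add: s(2) \<eta>(2) X_grading_cls[OF s(1)] W_elem_cls s(1) \<eta>(1))
  have "W_pair (\<lambda>n p. grading2 *v s n p) (\<lambda>y. grading2 *v \<eta> y) = pointwise grading_both (W_pair s \<eta>)"
  proof (rule LIMSEQ_unique[OF W_pair_tendsto[OF X_grading_cls(2)[OF s(1)] H_grading_cls(2)[OF \<eta>(1)]]])
    show "(\<lambda>n. spinor (tensor_fun (\<lambda>p. grading2 *v s n p) (\<lambda>y. grading2 *v \<eta> y))) \<longlonglongrightarrow> pointwise grading_both (W_pair s \<eta>)"
      using lim[of grading_both]
      by (simp add: pointwise_spinor tensor_fun_carr c \<eta>) (simp add: tensor_fun_def[abs_def] spinor_tensor_matrix(6))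
  qed
  then show "W_elem (X_grading x) (H_grading h) = pointwise grading_both (W_elem x h)"
    by (simp add: s(2) \<eta>(2) X_grading_cls[OF s(1)] H_grading_cls[OF \<eta>(1)] W_elem_cls s(1) \<eta>(1))
qed

text \<open>
  On elementary tensors, hence on the smooth spinors, the tensor product of the two maps is
  multiplication by \<open>C\<close>.  As this is bounded, the closure is the full graph.
\<close>

lemma transport_tensor_op:
  assumes A: "\<And>x. x \<in> carr X_mod \<Longrightarrow> A x \<in> carr X_mod" and B: "\<And>h. h \<in> carr H_Q \<Longrightarrow> B h \<in> carr H_Q"
    and AB: "\<And>x h. x \<in> carr X_mod \<Longrightarrow> h \<in> carr H_Q \<Longrightarrow> W_elem (A x) (B h) = pointwise C (W_elem x h)"
  shows "transport (tensor_op X_mod H_Q (L2_mult vol2) A B) = {(a, pointwise C a) | a. True}"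
    "tensor_op X_mod H_Q (L2_mult vol2) A B \<subseteq> carr XH \<times> carr XH"
proof -
  let ?t = "elem_tensor X_mod H_Q (L2_mult vol2)"
  let ?G = "{(?t x h, ?t (A x) (B h)) | x h. x \<in> carr X_mod \<and> h \<in> carr H_Q}"
  have op: "tensor_op X_mod H_Q (L2_mult vol2) A B = op_closure XH XH (lin_span XH XH ?G)"
    by (simp add: tensor_op_def Let_def XH_def)
  have sub: "lin_span XH XH ?G \<subseteq> carr XH \<times> carr XH" "transport (lin_span XH XH ?G) \<subseteq> {(a, pointwise C a) | a. True}"
    by (rule transport_span_subset[where T = "{(a, pointwise C a) | a. True}"];
        auto simp: elem_tensor_XH A B AB pointwise_cscale linear_add[OF bounded_linear.linear[OF bounded_linear_pointwise]])+
  have sup: "{(a, pointwise C a) | a. a \<in> smooth_spinors} \<subseteq> transport (lin_span XH XH ?G)"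
  proof clarify
    fix a assume "a \<in> smooth_spinors"
    then obtain f where f: "f \<in> Cc4" "a = spinor f" by (auto simp: smooth_spinors_def)
    obtain \<xi>1 \<xi>2 \<eta>1 \<eta>2 where s: "\<xi>1 \<in> Cc4" "\<xi>2 \<in> Cc4" "\<eta>1 \<in> Cc2" "\<eta>2 \<in> Cc2"
      "f = (\<lambda>p. tensor_fun \<xi>1 \<eta>1 p + tensor_fun \<xi>2 \<eta>2 p)" by (rule smooth_spinor_split[OF f(1)])
    note h = s(3)[THEN Cc2_sq_int] s(4)[THEN Cc2_sq_int]
    have m: "embed X_pre \<xi>1 \<in> carr X_mod" "embed X_pre \<xi>2 \<in> carr X_mod" "cls HQ \<eta>1 \<in> carr H_Q" "cls HQ \<eta>2 \<in> carr H_Q"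
      using s h by (auto simp: embed_X_mod carr_H_Q)
    let ?x1 = "?t (embed X_pre \<xi>1) (cls HQ \<eta>1)" and ?x2 = "?t (embed X_pre \<xi>2) (cls HQ \<eta>2)"
    let ?y1 = "?t (A (embed X_pre \<xi>1)) (B (cls HQ \<eta>1))" and ?y2 = "?t (A (embed X_pre \<xi>2)) (B (cls HQ \<eta>2))"
    have "(W_map ?x1 + W_map ?x2, W_map ?y1 + W_map ?y2) \<in> transport (lin_span XH XH ?G)"
      using m by (intro transport_span_add) (auto simp: elem_tensor_XH A B)
    moreover have "W_map ?x1 = spinor (tensor_fun \<xi>1 \<eta>1)" "W_map ?x2 = spinor (tensor_fun \<xi>2 \<eta>2)"
      using tens_XH(2)[OF s(1) h(1)] tens_XH(2)[OF s(2) h(2)] by (simp_all add: tens_def)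
    moreover have "W_map ?y1 = pointwise C (W_map ?x1)" "W_map ?y2 = pointwise C (W_map ?x2)"
      using m by (simp_all add: elem_tensor_XH A B AB)
    moreover have "a = spinor (tensor_fun \<xi>1 \<eta>1) + spinor (tensor_fun \<xi>2 \<eta>2)"
      unfolding f(2) s(5) using s h by (simp add: spinor_add tensor_fun_carr)
    ultimately show "(a, pointwise C a) \<in> transport (lin_span XH XH ?G)"
      by (simp add: linear_add[OF bounded_linear.linear[OF bounded_linear_pointwise]])
  qed
  show "tensor_op X_mod H_Q (L2_mult vol2) A B \<subseteq> carr XH \<times> carr XH"
    unfolding op by (rule transport_closure(2)[OF sub(1)])
  have "transport (tensor_op X_mod H_Q (L2_mult vol2) A B) = closure (transport (lin_span XH XH ?G))"
    unfolding op by (rule transport_closure(1)[OF sub(1)])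
  also have "\<dots> = {(a, pointwise C a) | a. True}"
  proof
    have "closed {(a, pointwise C a) | a. True}"
      using closed_closure[of "{(a, pointwise C a) | a. a \<in> smooth_spinors}"] unfolding closure_graph_pointwise .
    then show "closure (transport (lin_span XH XH ?G)) \<subseteq> {(a, pointwise C a) | a. True}"
      by (rule closure_minimal[OF sub(2)])
    show "{(a, pointwise C a) | a. True} \<subseteq> closure (transport (lin_span XH XH ?G))"
      unfolding closure_graph_pointwise[symmetric] by (rule closure_mono[OF sup])
  qed
  finally show "transport (tensor_op X_mod H_Q (L2_mult vol2) A B) = {(a, pointwise C a) | a. True}" .
qed

lemma transport_gamma_X: "transport gamma_X_tensor_1 = {(a, pointwise grading_left a) | a. True}"
  "gamma_X_tensor_1 \<subseteq> carr XH \<times> carr XH"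
  unfolding gamma_X_tensor_1_def
  by (rule transport_tensor_op, simp_all add: X_grading_carr W_elem_grading)+

lemma transport_gamma_XH: "transport gamma_XH = {(a, pointwise grading_both a) | a. True}"
  "gamma_XH \<subseteq> carr XH \<times> carr XH"
  unfolding gamma_XH_def
  by (rule transport_tensor_op, simp_all add: X_grading_carr H_grading_carr W_elem_grading(2))+

section \<open>The tensor sum and the Dirac operator\<close>

text \<open>
  The differential operators act on functions, the operators of the statement on classes: a smooth
  function is determined by its class because every nonempty open set has positive measure.
\<close>

lemma Cc4_AE_eq:
  fixes f g :: "pt4 \<Rightarrow> complex^4"
  assumes f: "f \<in> Cc4" and g: "g \<in> Cc4" and ae: "AE p in vol4. f p = g p"
  shows "f = g"
proof -
  define h where "h p = f p - g p" for p
  have h: "h \<in> Cc4" unfolding h_def by (rule Cc4_ops(2)[OF f g])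
  have hm: "h \<in> borel_measurable vol4"
    using c4.Cc_measurable[OF h[unfolded Cc4_eq]] by (simp add: vol4.measurable_M)
  have "{p \<in> S4_0. h p = 0} \<in> sets vol4"
    using hm by (simp add: vol4.space_M[symmetric])
  moreover have "AE p in vol4. h p = 0" using ae by (simp add: h_def)
  ultimately have ae0: "AE z in lborel. z \<in> dom4 \<longrightarrow> h (sph4 z) = 0" by (simp add: vol4.AE_M)
  have cont: "continuous_on cover4 (\<lambda>z. h (sph4 z))"
    by (rule smooth_on_continuous[OF c4.Cc_smooth[OF h[unfolded Cc4_eq]]])
  have "openin (top_of_set cover4) (cover4 \<inter> (\<lambda>z. h (sph4 z)) -` (- {0}))"
    by (rule continuous_openin_preimage_gen[OF cont open_Compl[OF closed_singleton]])
  then have N: "open (cover4 \<inter> (\<lambda>z. h (sph4 z)) -` (- {0}))" by (rule openin_open_trans[OF _ open_cover])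
  let ?N = "cover4 \<inter> (\<lambda>z. h (sph4 z)) -` (- {0})" and ?I = "{0<..<2*pi} \<times> {0<..<2*pi} \<times> rect"
  have I: "open ?I" by (simp add: open_Times open_rect)
  have "AE z in lborel. z \<notin> ?N \<inter> ?I"
    using ae0 by eventually_elim (auto simp: dom4_def)
  then have "?N \<inter> ?I \<in> null_sets lborel" using N I by (subst AE_iff_null_sets) auto
  then have "negligible (?N \<inter> ?I)" by (simp add: negligible_iff_null_sets null_sets_completionI)
  then have empty: "?N \<inter> ?I = {}" using open_not_negligible N I by blast
  have "h p = 0" for p
  proof (rule ccontr)
    assume "h p \<noteq> 0"
    then have "p \<in> S4_0" using c4.Cc_outside[OF h[unfolded Cc4_eq]] by blast
    then obtain t1 t2 ph ps where z: "(t1, t2, ph, ps) \<in> dom4" "p = sph4 (t1, t2, ph, ps)" by (rule S4_0_polar)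
    then have "(t1, t2, ph, ps) \<in> ?N" using \<open>h p \<noteq> 0\<close> by (auto simp: dom4_def)
    then obtain e where e: "e > 0" "ball (t1, t2, ph, ps) e \<subseteq> ?N" using N open_contains_ball by blast
    have t: "0 \<le> t1" "t1 < 2*pi" "0 \<le> t2" "t2 < 2*pi" "(ph, ps) \<in> rect" using z(1) by (auto simp: dom4_def)
    \<comment> \<open>A point with a vanishing angle lies on the boundary of the open square of angles, so it is moved
      inside.\<close>
    define \<delta> where "\<delta> = min (e / 3) (min ((2*pi - t1) / 2) ((2*pi - t2) / 2))"
    have "\<delta> \<le> (2*pi - t1) / 2" "\<delta> \<le> (2*pi - t2) / 2" unfolding \<delta>_def by linarith+
    then have \<delta>: "\<delta> > 0" "\<delta> \<le> e / 3" "t1 + \<delta> < 2*pi" "t2 + \<delta> < 2*pi"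
      using e t by (simp_all add: \<delta>_def)
    have "dist (t1, t2, ph, ps) (t1 + \<delta>, t2 + \<delta>, ph, ps) \<le> \<delta> + \<delta>"
      using \<delta>(1) sqrt_sum_squares_le_sum[of \<delta> \<delta>] by (simp add: dist_Pair_Pair dist_real_def)
    then have "(t1 + \<delta>, t2 + \<delta>, ph, ps) \<in> ball (t1, t2, ph, ps) e" using \<delta> e(1) by simp
    then have "(t1 + \<delta>, t2 + \<delta>, ph, ps) \<in> ?N \<inter> ?I" using e(2) \<delta> t by auto
    then show False using empty by blast
  qed
  then show ?thesis by (simp add: h_def fun_eq_iff)
qed

lemma spinor_smooth_eq_iff: "f \<in> Cc4 \<Longrightarrow> g \<in> Cc4 \<Longrightarrow> spinor f = spinor g \<longleftrightarrow> f = g"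
  using Cc4_AE_eq spinor_eq_iff[OF Cc4_sq_int Cc4_sq_int] by blast

text \<open>
  Linearity of \<open>P\<close> gives one inclusion.  For the other one, every smooth spinor is a sum of elementary
  tensors.
\<close>

lemma transport_differential:
  fixes P :: "(pt4 \<Rightarrow> complex^4) \<Rightarrow> pt4 \<Rightarrow> complex^4"
  assumes P: "\<And>f. f \<in> Cc4 \<Longrightarrow> P f \<in> Cc4"
    and add: "\<And>f g. f \<in> Cc4 \<Longrightarrow> g \<in> Cc4 \<Longrightarrow> P (\<lambda>p. f p + g p) = (\<lambda>p. P f p + P g p)"
    and scale: "\<And>f c. f \<in> Cc4 \<Longrightarrow> P (\<lambda>p. c *s f p) = (\<lambda>p. c *s P f p)"
    and Y: "\<And>\<xi> \<eta>. \<xi> \<in> Cc4 \<Longrightarrow> \<eta> \<in> Cc2 \<Longrightarrow> Y \<xi> \<eta> \<in> carr XH \<and> W_map (Y \<xi> \<eta>) = spinor (P (tensor_fun \<xi> \<eta>))"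
  shows "transport (lin_span XH XH {(tens \<xi> \<eta>, Y \<xi> \<eta>) | \<xi> \<eta>. \<xi> \<in> Cc4 \<and> \<eta> \<in> Cc2}) = {(spinor f, spinor (P f)) | f. f \<in> Cc4}"
    "lin_span XH XH {(tens \<xi> \<eta>, Y \<xi> \<eta>) | \<xi> \<eta>. \<xi> \<in> Cc4 \<and> \<eta> \<in> Cc2} \<subseteq> carr XH \<times> carr XH"
proof -
  let ?G = "{(tens \<xi> \<eta>, Y \<xi> \<eta>) | \<xi> \<eta>. \<xi> \<in> Cc4 \<and> \<eta> \<in> Cc2}" and ?T = "{(spinor f, spinor (P f)) | f. f \<in> Cc4}"
  have tf: "tensor_fun \<xi> \<eta> \<in> Cc4" if "\<xi> \<in> Cc4" "\<eta> \<in> Cc2" for \<xi> \<eta>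
    using spinor_tensor_Cc4[OF that] by (simp add: tensor_fun_def[abs_def])
  have G: "x \<in> carr XH \<and> y \<in> carr XH \<and> (W_map x, W_map y) \<in> ?T" if "(x, y) \<in> ?G" for x y
  proof -
    obtain \<xi> \<eta> where "\<xi> \<in> Cc4" "\<eta> \<in> Cc2" "x = tens \<xi> \<eta>" "y = Y \<xi> \<eta>" using \<open>(x, y) \<in> ?G\<close> by blast
    then show ?thesis using tens_XH[of \<xi> \<eta>] Y[of \<xi> \<eta>] tf[of \<xi> \<eta>] Cc2_sq_int[of \<eta>] by auto
  qed
  have T_add: "(a + a', b + b') \<in> ?T" if ab: "(a, b) \<in> ?T" "(a', b') \<in> ?T" for a b a' b'
  proof -
    obtain f where f: "f \<in> Cc4" "a = spinor f" "b = spinor (P f)" using ab(1) by blast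
    obtain g where g: "g \<in> Cc4" "a' = spinor g" "b' = spinor (P g)" using ab(2) by blast
    have "a + a' = spinor (\<lambda>p. f p + g p)" "b + b' = spinor (P (\<lambda>p. f p + g p))"
      using f g P by (simp_all add: spinor_add Cc4_sq_int add)
    then show ?thesis using Cc4_ops(1)[OF f(1) g(1)] by blast
  qed
  have T_scale: "(cscale c a, cscale c b) \<in> ?T" if ab: "(a, b) \<in> ?T" for a b c
  proof -
    obtain f where f: "f \<in> Cc4" "a = spinor f" "b = spinor (P f)" using ab by blast
    have "cscale c a = spinor (\<lambda>p. c *s f p)" "cscale c b = spinor (P (\<lambda>p. c *s f p))"
      using f P by (simp_all add: cscale_spinor Cc4_sq_int scale)
    then show ?thesis using Cc4_ops(3)[OF f(1)] by blast
  qed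
  note sub = transport_span_subset[OF G T_add T_scale]
  show "lin_span XH XH ?G \<subseteq> carr XH \<times> carr XH" by (rule sub(1))
  show "transport (lin_span XH XH ?G) = ?T"
  proof
    show "transport (lin_span XH XH ?G) \<subseteq> ?T" by (rule sub(2))
    show "?T \<subseteq> transport (lin_span XH XH ?G)"
    proof clarify
      fix f :: "pt4 \<Rightarrow> complex^4" assume f: "f \<in> Cc4"
      obtain \<xi>1 \<xi>2 \<eta>1 \<eta>2 where s: "\<xi>1 \<in> Cc4" "\<xi>2 \<in> Cc4" "\<eta>1 \<in> Cc2" "\<eta>2 \<in> Cc2"
        "f = (\<lambda>p. tensor_fun \<xi>1 \<eta>1 p + tensor_fun \<xi>2 \<eta>2 p)" by (rule smooth_spinor_split[OF f])
      note h = s(3)[THEN Cc2_sq_int] s(4)[THEN Cc2_sq_int]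
      note t1 = tf[OF s(1,3)] and t2 = tf[OF s(2,4)]
      have "(W_map (tens \<xi>1 \<eta>1) + W_map (tens \<xi>2 \<eta>2), W_map (Y \<xi>1 \<eta>1) + W_map (Y \<xi>2 \<eta>2)) \<in> transport (lin_span XH XH ?G)"
        by (rule transport_span_add)
          (use s tens_XH(1)[OF s(1) h(1)] tens_XH(1)[OF s(2) h(2)] Y[OF s(1,3)] Y[OF s(2,4)] in auto)
      moreover have "W_map (tens \<xi>1 \<eta>1) + W_map (tens \<xi>2 \<eta>2) = spinor f"
        unfolding s(5) tens_XH(2)[OF s(1) h(1)] tens_XH(2)[OF s(2) h(2)]
        by (rule spinor_add[OF Cc4_sq_int[OF t1] Cc4_sq_int[OF t2]])
      moreover have "W_map (Y \<xi>1 \<eta>1) + W_map (Y \<xi>2 \<eta>2) = spinor (P f)"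
        unfolding s(5) add[OF t1 t2] using Y[OF s(1,3)] Y[OF s(2,4)] spinor_add[OF Cc4_sq_int[OF P[OF t1]] Cc4_sq_int[OF P[OF t2]]]
        by simp
      ultimately show "(spinor f, spinor (P f)) \<in> transport (lin_span XH XH ?G)" by simp
    qed
  qed
qed

lemma transport_D_V: "transport D_V_tensor_1 = {(spinor f, spinor (vertical_symb f)) | f. f \<in> Cc4}"
  "D_V_tensor_1 \<subseteq> carr XH \<times> carr XH"
proof -
  have Y: "tens (D_V0 \<xi>) \<eta> \<in> carr XH \<and> W_map (tens (D_V0 \<xi>) \<eta>) = spinor (vertical_symb (tensor_fun \<xi> \<eta>))"
    if "\<xi> \<in> Cc4" "\<eta> \<in> Cc2" for \<xi> \<eta>
    using tens_XH[OF D_V0_Cc4[OF that(1)] Cc2_sq_int[OF that(2)]] vertical_spinor_tensor[OF that]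
    by (simp add: tensor_fun_def[abs_def])
  note * = transport_differential[of vertical_symb "\<lambda>\<xi> \<eta>. tens (D_V0 \<xi>) \<eta>",
      OF vertical_symb_Cc4 vertical_add vertical_cmult Y]
  show "transport D_V_tensor_1 = {(spinor f, spinor (vertical_symb f)) | f. f \<in> Cc4}"
    unfolding D_V_tensor_1_def by (rule *(1))
  show "D_V_tensor_1 \<subseteq> carr XH \<times> carr XH"
    unfolding D_V_tensor_1_def by (rule *(2))
qed

lemma transport_one_tensor: "transport one_tensor_nabla_D_Q = {(spinor f, spinor (horizontal_symb f)) | f. f \<in> Cc4}"
  "one_tensor_nabla_D_Q \<subseteq> carr XH \<times> carr XH"
proof -
  let ?c = "\<lambda>y. let (ph, ps) = chart2 y in 1 / of_real (cos ps)"
  let ?Y = "\<lambda>\<xi> \<eta>. add XH (tens \<xi> (D_Q0 \<eta>))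
         (add XH (tens (X_act (nabla_ph \<xi>) ?c) (\<lambda>y. \<i> *s (sigma1 *v \<eta> y)))
           (tens (nabla_ps \<xi>) (\<lambda>y. \<i> *s (sigma2 *v \<eta> y))))"
  have Y: "?Y \<xi> \<eta> \<in> carr XH \<and> W_map (?Y \<xi> \<eta>) = spinor (horizontal_symb (tensor_fun \<xi> \<eta>))"
    if \<xi>: "\<xi> \<in> Cc4" and \<eta>: "\<eta> \<in> Cc2" for \<xi> \<eta>
  proof -
    have s: "(\<lambda>y. \<i> *s (sigma1 *v \<eta> y)) \<in> carr HQ" "(\<lambda>y. \<i> *s (sigma2 *v \<eta> y)) \<in> carr HQ" "D_Q0 \<eta> \<in> carr HQ"
      by (intro Cc2_sq_int Cc2_ops D_Q0_Cc2 \<eta>)+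
    note C = \<xi> X_act_sec_Cc4(1)[OF nabla_Cc4(1)[OF \<xi>]] nabla_Cc4(2)[OF \<xi>]
    note t = tens_XH[OF C(1) s(3)] tens_XH[OF C(2) s(1)] tens_XH[OF C(3) s(2)]
    note tc = tensor_fun_carr[OF C(1) s(3)] tensor_fun_carr[OF C(2) s(1)] tensor_fun_carr[OF C(3) s(2)]
    have "?Y \<xi> \<eta> \<in> carr XH" by (intro W_map_add(2) t)
    have "W_map (?Y \<xi> \<eta>) = spinor (tensor_fun \<xi> (D_Q0 \<eta>)) +
        (spinor (tensor_fun (X_act (nabla_ph \<xi>) ?c) (\<lambda>y. \<i> *s (sigma1 *v \<eta> y))) +
         spinor (tensor_fun (nabla_ps \<xi>) (\<lambda>y. \<i> *s (sigma2 *v \<eta> y))))"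
      by (simp only: W_map_add t)
    also have "\<dots> = spinor (\<lambda>p. tensor_fun \<xi> (D_Q0 \<eta>) p +
        (tensor_fun (X_act (nabla_ph \<xi>) ?c) (\<lambda>y. \<i> *s (sigma1 *v \<eta> y)) p +
         tensor_fun (nabla_ps \<xi>) (\<lambda>y. \<i> *s (sigma2 *v \<eta> y)) p))"
      by (simp only: spinor_add[OF tc(2,3)] spinor_add[OF tc(1) sq_int_add_carr[OF tc(2,3)]])
    also have "\<dots> = spinor (horizontal_symb (tensor_fun \<xi> \<eta>))"
      unfolding tensor_fun_def[abs_def] horizontal_spinor_tensor[OF \<xi> \<eta>, abs_def] ..
    finally show ?thesis using \<open>?Y \<xi> \<eta> \<in> carr XH\<close> by blast
  qed
  note * = transport_differential[of horizontal_symb ?Y, OF horizontal_symb_Cc4 horizontal_add horizontal_cmult Y]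
  show "transport one_tensor_nabla_D_Q = {(spinor f, spinor (horizontal_symb f)) | f. f \<in> Cc4}"
    unfolding one_tensor_nabla_D_Q_def by (rule *(1))
  show "one_tensor_nabla_D_Q \<subseteq> carr XH \<times> carr XH"
    unfolding one_tensor_nabla_D_Q_def by (rule *(2))
qed

definition tensor_sum_symb :: "(pt4 \<Rightarrow> complex^4) \<Rightarrow> pt4 \<Rightarrow> complex^4" where
  "tensor_sum_symb f p = vertical_symb f p + grading_left *v horizontal_symb f p"

lemma tensor_sum_symb_Cc4: "f \<in> Cc4 \<Longrightarrow> tensor_sum_symb f \<in> Cc4"
  unfolding tensor_sum_symb_def[abs_def] by (intro Cc4_ops vertical_symb_Cc4 horizontal_symb_Cc4)

text \<open>
  Classes determine smooth functions, so the two summands are added only at a common function, and the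
  sum is the differential operator with the added symbols.
\<close>

lemma transport_tensor_sum:
  "transport D_V_times_D_Q = closure {(spinor f, spinor (tensor_sum_symb f)) | f. f \<in> Cc4}"
  "D_V_times_D_Q \<subseteq> carr XH \<times> carr XH"
proof -
  note c = transport_comp[OF transport_gamma_X(2) transport_one_tensor(2)]
  note a = transport_add[OF transport_D_V(2) c(2)]
  show "D_V_times_D_Q \<subseteq> carr XH \<times> carr XH"
    unfolding D_V_times_D_Q_def by (rule transport_closure(2)[OF a(2)])
  have co: "transport (gamma_X_tensor_1 \<circ>\<^sub>g one_tensor_nabla_D_Q) =
      {(spinor f, spinor (\<lambda>p. grading_left *v horizontal_symb f p)) | f. f \<in> Cc4}"
    unfolding c(1) transport_gamma_X(1) transport_one_tensor(1)
    using pointwise_spinor(1)[OF Cc4_sq_int[OF horizontal_symb_Cc4]] by fastforce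
  have sum: "spinor (vertical_symb f) + spinor (\<lambda>p. grading_left *v horizontal_symb f p) = spinor (tensor_sum_symb f)"
    if "f \<in> Cc4" for f
    using that unfolding tensor_sum_symb_def[abs_def]
    by (intro spinor_add Cc4_sq_int Cc4_matrix vertical_symb_Cc4 horizontal_symb_Cc4)
  have "transport (op_add XH D_V_tensor_1 (gamma_X_tensor_1 \<circ>\<^sub>g one_tensor_nabla_D_Q)) =
      {(spinor f, spinor (tensor_sum_symb f)) | f. f \<in> Cc4}" (is "?L = ?R")
  proof
    show "?L \<subseteq> ?R"
    proof
      fix q assume "q \<in> ?L"
      then obtain a b e where q: "q = (a, b + e)" "(a, b) \<in> transport D_V_tensor_1"
        "(a, e) \<in> transport (gamma_X_tensor_1 \<circ>\<^sub>g one_tensor_nabla_D_Q)" unfolding a(1) by blast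
      obtain f where f: "f \<in> Cc4" "a = spinor f" "b = spinor (vertical_symb f)" using q(2) by (auto simp: transport_D_V)
      obtain g where g: "g \<in> Cc4" "a = spinor g" "e = spinor (\<lambda>p. grading_left *v horizontal_symb g p)"
        using q(3) by (auto simp: co)
      have "g = f" using f g spinor_smooth_eq_iff by metis
      then show "q \<in> ?R" using f g sum[OF f(1)] by (auto simp: q(1))
    qed
    show "?R \<subseteq> ?L"
    proof
      fix q assume "q \<in> ?R"
      then obtain f where f: "f \<in> Cc4" "q = (spinor f, spinor (tensor_sum_symb f))" by blast
      have "(spinor f, spinor (vertical_symb f)) \<in> transport D_V_tensor_1"
        "(spinor f, spinor (\<lambda>p. grading_left *v horizontal_symb f p)) \<in> transport (gamma_X_tensor_1 \<circ>\<^sub>g one_tensor_nabla_D_Q)"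
        using f(1) by (auto simp: transport_D_V co)
      then show "q \<in> ?L" unfolding a(1) f(2) sum[OF f(1), symmetric] by blast
    qed
  qed
  then show "transport D_V_times_D_Q = closure {(spinor f, spinor (tensor_sum_symb f)) | f. f \<in> Cc4}"
    unfolding D_V_times_D_Q_def transport_closure(1)[OF a(2)] by simp
qed

lemma sq_int_diff_carr: "f \<in> carr (sq_int M) \<Longrightarrow> g \<in> carr (sq_int M) \<Longrightarrow> (\<lambda>x. f x - g x) \<in> carr (sq_int M)"
  using sq.diff_carr[of f M g] by (simp add: sq_int_diff)

lemma transport_Gamma: "transport Gamma_XH = {(a, pointwise Gamma_matrix a) | a. True}"
  "Gamma_XH \<subseteq> carr XH \<times> carr XH"
proof -
  note p = transport_add[OF transport_Id(2) transport_gamma_XH(2)]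
  note hp = transport_scale[OF p(2), of "1/2"]
  note g = transport_comp[OF transport_gamma_X(2) hp(2)]
  note n = transport_scale[OF transport_gamma_XH(2), of "-1"]
  note m = transport_add[OF transport_Id(2) n(2)]
  note hm = transport_scale[OF m(2), of "1/2"]
  note all = transport_add[OF g(2) hm(2)]
  show "Gamma_XH \<subseteq> carr XH \<times> carr XH" unfolding Gamma_XH_def by (rule all(2))
  have e: "pointwise grading_left (cscale (1/2) (a + pointwise grading_both a)) +
      cscale (1/2) (a + cscale (-1) (pointwise grading_both a)) = pointwise Gamma_matrix a" for a
  proof -
    obtain f where f: "f \<in> carr SQ" "a = spinor f" by (rule spinor_cases)
    show ?thesis
      by (simp add: f pointwise_spinor cscale_spinor spinor_add sq_int_add_carr sq_int_smult_carr
          sq_int_uminus_carr sq_int_diff_carr)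
        (rule arg_cong[where f = spinor], simp add: fun_eq_iff vec_eq_iff forall_4 matrix4_apply)
  qed
  have "transport Gamma_XH = {(a, pointwise grading_left (cscale (1/2) (a + pointwise grading_both a)) +
      cscale (1/2) (a + cscale (-1) (pointwise grading_both a))) | a. True}"
    unfolding Gamma_XH_def all(1) g(1) hp(1) p(1) hm(1) m(1) n(1) transport_Id(1) transport_gamma_X(1) transport_gamma_XH(1)
    by fastforce
  then show "transport Gamma_XH = {(a, pointwise Gamma_matrix a) | a. True}" by (simp only: e)
qed

lemma pointwise_Gamma_involution: "pointwise Gamma_matrix (pointwise Gamma_matrix a) = a"
proof -
  obtain f where f: "f \<in> carr SQ" "a = spinor f" by (rule spinor_cases)
  show ?thesis by (simp add: f pointwise_spinor Gamma_matrix_involution)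
qed

lemma closure_involution_image:
  assumes "continuous_on UNIV \<phi>" "\<And>x. \<phi> (\<phi> x) = x"
  shows "\<phi> ` closure S = closure (\<phi> ` S)"
proof
  have sub: "\<phi> ` closure A \<subseteq> closure (\<phi> ` A)" for A
    by (rule image_closure_subset) (auto intro: continuous_on_subset[OF assms(1)] closure_subset[THEN subsetD])
  show "\<phi> ` closure S \<subseteq> closure (\<phi> ` S)" by (rule sub)
  have "\<phi> ` closure (\<phi> ` S) \<subseteq> closure S" using sub[of "\<phi> ` S"] by (simp add: image_image assms(2))
  then have "\<phi> ` \<phi> ` closure (\<phi> ` S) \<subseteq> \<phi> ` closure S" by (rule image_mono)
  then show "closure (\<phi> ` S) \<subseteq> \<phi> ` closure S" by (simp add: image_image assms(2))
qed

text \<open>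
  Multiplication by the matrix of \<open>\<Gamma>\<close> is a continuous involution, so conjugation by it can be carried out
  before the closure is taken.
\<close>

lemma transport_conjugate:
  "transport (Gamma_XH \<circ>\<^sub>g D_V_times_D_Q \<circ>\<^sub>g Gamma_XH) = closure {(spinor f, spinor (Dirac4_symb f)) | f. f \<in> Cc4}"
  "Gamma_XH \<circ>\<^sub>g D_V_times_D_Q \<circ>\<^sub>g Gamma_XH \<subseteq> carr XH \<times> carr XH"
proof -
  note i = transport_comp[OF transport_tensor_sum(2) transport_Gamma(2)]
  note o = transport_comp[OF transport_Gamma(2) i(2)]
  show "Gamma_XH \<circ>\<^sub>g D_V_times_D_Q \<circ>\<^sub>g Gamma_XH \<subseteq> carr XH \<times> carr XH" by (rule o(2))
  let ?\<phi> = "\<lambda>q. (pointwise Gamma_matrix (fst q), pointwise Gamma_matrix (snd q))"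
  let ?S = "{(spinor f, spinor (tensor_sum_symb f)) | f. f \<in> Cc4}"
  have cont: "continuous_on UNIV (pointwise Gamma_matrix)" by (rule linear_continuous_on[OF bounded_linear_pointwise])
  have "transport (Gamma_XH \<circ>\<^sub>g D_V_times_D_Q \<circ>\<^sub>g Gamma_XH) = ?\<phi> ` closure ?S"
  proof (intro set_eqI iffI)
    fix q assume "q \<in> transport (Gamma_XH \<circ>\<^sub>g D_V_times_D_Q \<circ>\<^sub>g Gamma_XH)"
    then obtain a b where "(pointwise Gamma_matrix a, b) \<in> closure ?S" "q = (a, pointwise Gamma_matrix b)"
      unfolding o(1) i(1) transport_Gamma(1) transport_tensor_sum(1) by blast
    then show "q \<in> ?\<phi> ` closure ?S"
      by (intro image_eqI[of _ _ "(pointwise Gamma_matrix a, b)"]) (simp_all add: pointwise_Gamma_involution)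
  next
    fix q assume "q \<in> ?\<phi> ` closure ?S"
    then obtain a b where ab: "(a, b) \<in> closure ?S" "q = (pointwise Gamma_matrix a, pointwise Gamma_matrix b)" by force
    have "(pointwise Gamma_matrix a, a) \<in> {(a, pointwise Gamma_matrix a) | a. True}"
      using pointwise_Gamma_involution[of a] by auto
    moreover have "(b, pointwise Gamma_matrix b) \<in> {(a, pointwise Gamma_matrix a) | a. True}" by blast
    ultimately show "q \<in> transport (Gamma_XH \<circ>\<^sub>g D_V_times_D_Q \<circ>\<^sub>g Gamma_XH)"
      unfolding o(1) i(1) transport_Gamma(1) transport_tensor_sum(1) ab(2) using ab(1) by blast
  qed
  also have "\<dots> = closure (?\<phi> ` ?S)"
    by (rule closure_involution_image)
      (auto intro!: continuous_intros continuous_on_compose2[OF cont] simp: pointwise_Gamma_involution)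
  also have "?\<phi> ` ?S = {(spinor f, spinor (Dirac4_symb f)) | f. f \<in> Cc4}"
  proof -
    have e: "?\<phi> (spinor (\<lambda>p. Gamma_matrix *v f p), spinor (tensor_sum_symb (\<lambda>p. Gamma_matrix *v f p))) = (spinor f, spinor (Dirac4_symb f))"
      if f: "f \<in> Cc4" for f
    proof -
      have gf: "(\<lambda>p. Gamma_matrix *v f p) \<in> Cc4" by (rule Cc4_matrix[OF f])
      have "(\<lambda>p. Gamma_matrix *v tensor_sum_symb (\<lambda>p. Gamma_matrix *v f p) p) = Dirac4_symb f"
        unfolding tensor_sum_symb_def using Gamma_conjugates_to_Dirac[OF f] by (simp add: fun_eq_iff)
      then show ?thesis
        by (simp add: pointwise_spinor Cc4_sq_int gf tensor_sum_symb_Cc4 Gamma_matrix_involution)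
    qed
    show ?thesis
    proof (intro set_eqI iffI)
      fix q assume "q \<in> ?\<phi> ` ?S"
      then obtain f where f: "f \<in> Cc4" "q = ?\<phi> (spinor f, spinor (tensor_sum_symb f))" by blast
      have "q = (spinor (\<lambda>p. Gamma_matrix *v f p), spinor (Dirac4_symb (\<lambda>p. Gamma_matrix *v f p)))"
        using e[OF Cc4_matrix[OF f(1), of Gamma_matrix]] unfolding f(2) by (simp add: Gamma_matrix_involution)
      then show "q \<in> {(spinor f, spinor (Dirac4_symb f)) | f. f \<in> Cc4}" using Cc4_matrix[OF f(1), of Gamma_matrix] by blast
    next
      fix q assume "q \<in> {(spinor f, spinor (Dirac4_symb f)) | f. f \<in> Cc4}"
      then obtain f where f: "f \<in> Cc4" "q = (spinor f, spinor (Dirac4_symb f))" by blast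
      show "q \<in> ?\<phi> ` ?S"
        unfolding f(2) e[OF f(1), symmetric] using Cc4_matrix[OF f(1), of Gamma_matrix] by blast
    qed
  qed
  finally show "transport (Gamma_XH \<circ>\<^sub>g D_V_times_D_Q \<circ>\<^sub>g Gamma_XH) = closure {(spinor f, spinor (Dirac4_symb f)) | f. f \<in> Cc4}" .
qed

lemma Dirac4_symb_Cc4: "f \<in> Cc4 \<Longrightarrow> Dirac4_symb f \<in> Cc4"
proof -
  assume f: "f \<in> Cc4"
  have "Dirac4_symb f = (\<lambda>p. Gamma_matrix *v tensor_sum_symb (\<lambda>p. Gamma_matrix *v f p) p)"
    unfolding tensor_sum_symb_def using Gamma_conjugates_to_Dirac[OF f] by (simp add: fun_eq_iff)
  then show ?thesis using f by (auto intro!: Cc4_matrix tensor_sum_symb_Cc4)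
qed

lemma Dirac_S4_eq:
  "Dirac_S4 = {(Rep_spinor_L2 a, Rep_spinor_L2 b) | a b. (a, b) \<in> closure {(spinor f, spinor (Dirac4_symb f)) | f. f \<in> Cc4}}"
proof -
  let ?S = "{(cls SQ f, cls SQ (Dirac4_symb f)) | f. f \<in> Cc4}"
  have iso: "nrm L2_S4 (diff L2_S4 x y) = norm (Abs_spinor_L2 x - Abs_spinor_L2 y)"
    if "x \<in> carr L2_S4" "y \<in> carr L2_S4" for x y
    using Rep_nrm_diff[of "Abs_spinor_L2 x" "Abs_spinor_L2 y"] that by (simp add: Abs_spinor_L2_inverse)
  have S: "?S \<subseteq> carr L2_S4 \<times> carr L2_S4"
    by (auto simp: carr_L2_S4 intro!: imageI Cc4_sq_int Dirac4_symb_Cc4)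
  have im: "(\<lambda>(x, y). (Abs_spinor_L2 x, Abs_spinor_L2 y)) ` ?S = {(spinor f, spinor (Dirac4_symb f)) | f. f \<in> Cc4}"
    by (force simp: spinor_def)
  have *: "(Rep_spinor_L2 a, Rep_spinor_L2 b) \<in> Dirac_S4 \<longleftrightarrow> (a, b) \<in> closure {(spinor f, spinor (Dirac4_symb f)) | f. f \<in> Cc4}" for a b
    using op_closure_transport[OF iso S Rep_spinor_L2 Rep_spinor_L2, of a b]
    by (simp add: Dirac_S4_def im Rep_spinor_L2_inverse)
  show ?thesis
  proof (intro set_eqI iffI)
    fix q assume q: "q \<in> Dirac_S4"
    then obtain x y where xy: "q = (x, y)" "x \<in> carr L2_S4" "y \<in> carr L2_S4" by (auto simp: Dirac_S4_def op_closure_def)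
    then obtain a b where "x = Rep_spinor_L2 a" "y = Rep_spinor_L2 b" by (metis Abs_spinor_L2_inverse)
    then show "q \<in> {(Rep_spinor_L2 a, Rep_spinor_L2 b) | a b. (a, b) \<in> closure {(spinor f, spinor (Dirac4_symb f)) | f. f \<in> Cc4}}"
      using q * xy(1) by blast
  next
    fix q assume "q \<in> {(Rep_spinor_L2 a, Rep_spinor_L2 b) | a b. (a, b) \<in> closure {(spinor f, spinor (Dirac4_symb f)) | f. f \<in> Cc4}}"
    then show "q \<in> Dirac_S4" using * by blast
  qed
qed

theorem theorem6:
  shows "W_unitary \<circ>\<^sub>g Gamma_XH \<circ>\<^sub>g D_V_times_D_Q \<circ>\<^sub>g Gamma_XH \<circ>\<^sub>g op_adjoint XH L2_S4 W_unitary = Dirac_S4"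
proof -
  let ?D = "Gamma_XH \<circ>\<^sub>g D_V_times_D_Q \<circ>\<^sub>g Gamma_XH"
  have "W_unitary \<circ>\<^sub>g Gamma_XH \<circ>\<^sub>g D_V_times_D_Q \<circ>\<^sub>g Gamma_XH \<circ>\<^sub>g op_adjoint XH L2_S4 W_unitary =
      W_graph \<circ>\<^sub>g ?D \<circ>\<^sub>g op_adjoint XH L2_S4 W_graph"
    by (simp add: W_unitary_eq op_comp_def O_assoc)
  also have "\<dots> = {(Rep_spinor_L2 a, Rep_spinor_L2 b) | a b. (a, b) \<in> transport ?D}"
  proof (intro set_eqI iffI)
    fix q assume "q \<in> W_graph \<circ>\<^sub>g ?D \<circ>\<^sub>g op_adjoint XH L2_S4 W_graph"
    then obtain x y where xy: "(x, y) \<in> ?D" "q = (Rep_spinor_L2 (W_map x), Rep_spinor_L2 (W_map y))"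
      unfolding op_comp_def[of W_graph] op_comp_def[of "W_graph \<circ>\<^sub>g ?D"] op_comp_def[of ?D] adjoint_W_graph
      by (auto simp: W_graph_def)
    then have "(W_map x, W_map y) \<in> transport ?D" unfolding transport_def by force
    then show "q \<in> {(Rep_spinor_L2 a, Rep_spinor_L2 b) | a b. (a, b) \<in> transport ?D}" using xy(2) by blast
  next
    fix q assume "q \<in> {(Rep_spinor_L2 a, Rep_spinor_L2 b) | a b. (a, b) \<in> transport ?D}"
    then obtain x y where xy: "(x, y) \<in> ?D" "q = (Rep_spinor_L2 (W_map x), Rep_spinor_L2 (W_map y))"
      unfolding transport_def by force
    then have "x \<in> carr XH" "y \<in> carr XH" using transport_conjugate(2) by auto
    then have "(Rep_spinor_L2 (W_map x), x) \<in> op_adjoint XH L2_S4 W_graph" "(y, Rep_spinor_L2 (W_map y)) \<in> W_graph"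
      unfolding adjoint_W_graph by (auto simp: W_graph_def)
    then show "q \<in> W_graph \<circ>\<^sub>g ?D \<circ>\<^sub>g op_adjoint XH L2_S4 W_graph"
      unfolding xy(2) op_comp_def[of W_graph] op_comp_def[of ?D] using xy(1) by blast
  qed
  also have "\<dots> = Dirac_S4" unfolding transport_conjugate(1) Dirac_S4_eq ..
  finally show ?thesis .
qed

end
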